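(* Let $(X,\tau,\mathsf d,\mathfrak m)$ be an extended metric measure space and $T>0$. For all $(\rho_t)_{t\in[0,T]}\in\mathsf{CE}^2(X,\mathrm{Ch},\mathfrak m)$ one has $\mu_t=\rho_t\mathfrak m\in AC^2([0,T];(\mathcal P(X),W_{\mathsf d}))$ and $$|\dot\mu_t|\le\|\rho_t'\|\qquad\text{for a.e. }t\in(0,T).$$ Conversely, if $(X,\mathsf d)$ is complete, $\mu_t=\rho_t\mathfrak m\in AC^2([0,T];(\mathcal P(X),W_{\mathsf d}))$ and $\sup_{t\in[0,T]}\|\rho_t\|_{L^\infty(X,\mathfrak m)}<\infty$, then $(\rho_t)\in\mathsf{CE}^2(X,\mathrm{Ch},\mathfrak m)$ and $$\|\rho_t'\|\le|\dot\mu_t|\qquad\text{for a.e. }t\in(0,T).$$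
   Context: An extended metric space $(X,\mathsf d)$ is a set with a symmetric $\mathsf d:X\times X\to[0,\infty]$ satisfying the triangle inequality and $\mathsf d(x,y)=0$ iff $x=y$; for a semidistance the last condition is weakened to $\mathsf d(x,x)=0$. For a Hausdorff topology $\tau$ on $X$, $\mathrm{Lip}_b(X,\tau,\mathsf d)$ is the set of bounded, $\mathsf d$-Lipschitz, $\tau$-continuous functions $f:X\to\mathbb R$. $(X,\tau,\mathsf d)$ is an extended metric-topological space if (a) there are $(\tau\times\tau)$-continuous bounded semidistances $\mathsf d_i:X\times X\to[0,\infty)$, $i\in I$, with $\mathsf d=\sup_i\mathsf d_i$; (b) $\tau$ is generated by $\mathrm{Lip}_b(X,\tau,\mathsf d)$. $\mathcal P(X)$ is the set of Radon probability measures on the Borel sets of $\tau$. $(X,\tau,\mathsf d,\mathfrak m)$ is an extended metric measure space if moreover $\mathfrak m\in\mathcal P(X)$. $W_{\mathsf d}^2(\mu,\nu)=\inf\int\mathsf d^2\,d\boldsymbol\pi$ over Radon probability measures $\boldsymbol\pi$ on $X\times X$ with marginals $\mu,\nu$. $AC^2([0,T];(Y,\delta))$ is the set of curves $y:[0,T]\to Y$ for which there is $g\in L^2(0,T)$ with $\delta(y_s,y_t)\le\int_s^tg\,dr$ for $s\le t$; metric derivative $|\dot y_t|=\limsup_{s\to t}\delta(y_s,y_t)/|s-t|$ (w.r.t. $W_{\mathsf d}$ for $\mu_t$). Cheeger energy: for $f\in\mathrm{Lip}_b(X,\tau,\mathsf d)$, $\mathrm{Lip}_a(f,x)=\lim_{r\downarrow0}\sup\{|f(y)-f(z)|/\mathsf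 d(y,z):\ \mathsf d(y,x)\vee\mathsf d(z,x)<r,\ \mathsf d(y,z)>0\}$ ($=0$ at $\mathsf d$-isolated points), and $\mathrm{Lip}_a^*(f,\cdot)$ is the $\mathfrak m$-essentially smallest $\mathfrak m$-measurable function which is $\ge\mathrm{Lip}_a(f,\cdot)$ $\mathfrak m$-a.e. For $f\in L^2(X,\mathfrak m)$, $\mathrm{Ch}(f)=\inf\liminf_n\int(\mathrm{Lip}_a^*(f_n,\cdot))^2\,d\mathfrak m$ over sequences $f_n\in\mathrm{Lip}_b(X,\tau,\mathsf d)$ with $f_n\to f$ in $L^2(X,\mathfrak m)$; $D(\mathrm{Ch})=\{\mathrm{Ch}<\infty\}$. A relaxed slope of $f$ is any $G\ge g$ with $g$ a weak $L^2(X,\mathfrak m)$ limit point of $\mathrm{Lip}_a^*(f_n,\cdot)$ for some $f_n\in\mathrm{Lip}_b(X,\tau,\mathsf d)$, $f_n\to f$ in $L^2(X,\mathfrak m)$; $|\mathrm Df|_w$ (minimal relaxed slope) is the relaxed slope of smallest $L^2$ norm, and $\mathrm{Ch}(f)=\int|\mathrm Df|_w^2\,d\mathfrak m$ for $f\in D(\mathrm{Ch})$. $\mathcal A_{\mathrm{Ch}}=\{f\in D(\mathrm{Ch}):\ f,|\mathrm Df|_w\in L^\infty(X,\mathfrak m)\}$. A family of probability densities $(\rho_t)_{t\in[0,T]}$ (w.r.t. $\mathfrak m$) belongs to $\mathsf{CE}^2(X,\mathrm{Ch},\mathfrak m)$ if there is $c\in L^2(0,T)$ with $$\Big|\int f\rho_t\,d\mathfrak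 m-\int f\rho_s\,d\mathfrak m\Big|\le\int_s^tc(r)\Big(\int|\mathrm Df|_w^2\rho_r\,d\mathfrak m\Big)^{1/2}dr\quad\forall f\in\mathcal A_{\mathrm{Ch}},\ 0\le s\le t\le T;$$ the least such $c$ is denoted $\|\rho_t'\|$. *)

theory Defs
  imports "HOL-Probability.Probability"
begin

text \<open>The set X is a whole type of class \<^class>\<open>t2_space\<close>; its Hausdorff topology is the
  type class topology and its Borel sets are those of \<^const>\<open>borel\<close>.  The product topology on
  pairs is the type class one; its Borel sets may be strictly more than the product
  sigma-algebra, so plans are measures on \<^const>\<open>borel\<close> over the product type.\<close>

section \<open>Extended metric measure spaces\<close>

definition semidistance :: "('a \<Rightarrow> 'a \<Rightarrow> 'b::{linorder, comm_monoid_add}) \<Rightarrow> bool" where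
  "semidistance \<delta> \<longleftrightarrow>
     (\<forall>x y. 0 \<le> \<delta> x y) \<and> (\<forall>x. \<delta> x x = 0) \<and> (\<forall>x y. \<delta> x y = \<delta> y x) \<and>
     (\<forall>x y z. \<delta> x z \<le> \<delta> x y + \<delta> y z)"

definition extended_metric :: "('a \<Rightarrow> 'a \<Rightarrow> ennreal) \<Rightarrow> bool" where
  "extended_metric d \<longleftrightarrow> semidistance d \<and> (\<forall>x y. d x y = 0 \<longrightarrow> x = y)"

definition ext_complete :: "('a \<Rightarrow> 'a \<Rightarrow> ennreal) \<Rightarrow> bool" where
  "ext_complete d \<longleftrightarrow>
     (\<forall>x :: nat \<Rightarrow> 'a.
        (\<forall>e>0. \<exists>N. \<forall>j\<ge>N. \<forall>k\<ge>N. d (x j) (x k) < ennreal e) \<longrightarrow>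
        (\<exists>l. (\<lambda>n. d (x n) l) \<longlonglongrightarrow> 0))"

definition Lip_b :: "('a::topological_space \<Rightarrow> 'a \<Rightarrow> ennreal) \<Rightarrow> ('a \<Rightarrow> real) set" where
  "Lip_b d = {f. bounded (range f) \<and> continuous_on UNIV f \<and>
     (\<exists>L::real. 0 \<le> L \<and> (\<forall>x y. ennreal \<bar>f x - f y\<bar> \<le> ennreal L * d x y))}"

definition ext_metric_top_space :: "('a::t2_space \<Rightarrow> 'a \<Rightarrow> ennreal) \<Rightarrow> bool" where
  "ext_metric_top_space d \<longleftrightarrow>
     extended_metric d \<and>
     (\<exists>\<D> :: ('a \<Rightarrow> 'a \<Rightarrow> real) set.
        (\<forall>\<delta>\<in>\<D>. semidistance \<delta> \<and> bounded (range (\<lambda>(x, y). \<delta> x y)) \<and>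
               continuous_on UNIV (\<lambda>(x, y). \<delta> x y)) \<and>
        (\<forall>x y. d x y = (SUP \<delta>\<in>\<D>. ennreal (\<delta> x y)))) \<and>
     (open :: 'a set \<Rightarrow> bool) = generate_topology {f -` V |f V. f \<in> Lip_b d \<and> open V}"

definition radon_prob :: "'a::t2_space measure set" where
  "radon_prob = {\<mu>. prob_space \<mu> \<and> sets \<mu> = sets borel \<and>
     (\<forall>B\<in>sets \<mu>. emeasure \<mu> B = (SUP K\<in>{K. compact K \<and> K \<subseteq> B}. emeasure \<mu> K))}"

definition ext_metric_measure_space ::
    "('a::t2_space \<Rightarrow> 'a \<Rightarrow> ennreal) \<Rightarrow> 'a measure \<Rightarrow> bool" where
  "ext_metric_measure_space d m \<longleftrightarrow> ext_metric_top_space d \<and> m \<in> radon_prob"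

section \<open>Kantorovich-Wasserstein distance and absolutely continuous curves\<close>

definition esqrt :: "ennreal \<Rightarrow> ennreal" where
  "esqrt a = (if a = \<top> then \<top> else ennreal (sqrt (enn2real a)))"

definition plans :: "'a::t2_space measure \<Rightarrow> 'a measure \<Rightarrow> ('a \<times> 'a) measure set" where
  "plans \<mu> \<nu> = {\<pi> \<in> radon_prob. distr \<pi> borel fst = \<mu> \<and> distr \<pi> borel snd = \<nu>}"

definition W2 ::
    "('a::t2_space \<Rightarrow> 'a \<Rightarrow> ennreal) \<Rightarrow> 'a measure \<Rightarrow> 'a measure \<Rightarrow> ennreal" where
  "W2 d \<mu> \<nu> = esqrt (INF \<pi>\<in>plans \<mu> \<nu>. \<integral>\<^sup>+ (x, y). (d x y)\<^sup>2 \<partial>\<pi>)"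

text \<open>Elements of \<open>L\<^sup>2\<close> and \<open>L\<^sup>\<infinity>\<close> are represented by functions, not by equivalence classes.\<close>

definition L2 :: "'a measure \<Rightarrow> ('a \<Rightarrow> real) set" where
  "L2 M = {f \<in> borel_measurable M. integrable M (\<lambda>x. (f x)\<^sup>2)}"

definition Linf_norm :: "'a measure \<Rightarrow> ('a \<Rightarrow> real) \<Rightarrow> ennreal" where
  "Linf_norm M f = esssup M (\<lambda>x. ennreal \<bar>f x\<bar>)"

definition Linf :: "'a measure \<Rightarrow> ('a \<Rightarrow> real) set" where
  "Linf M = {f \<in> borel_measurable M. Linf_norm M f < \<top>}"

abbreviation leb_Ioo :: "real \<Rightarrow> real measure" where
  "leb_Ioo T \<equiv> restrict_space lborel {0<..<T}"

definition AC2 :: "real \<Rightarrow> 'b set \<Rightarrow> ('b \<Rightarrow> 'b \<Rightarrow> ennreal) \<Rightarrow> (real \<Rightarrow> 'b) set" where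
  "AC2 T Y \<delta> = {y. (\<forall>t\<in>{0..T}. y t \<in> Y) \<and>
     (\<exists>g\<in>L2 (leb_Ioo T). \<forall>s t. 0 \<le> s \<longrightarrow> s \<le> t \<longrightarrow> t \<le> T \<longrightarrow>
        \<delta> (y s) (y t) \<le> ennreal (LBINT r=s..t. g r))}"

definition metric_speed ::
    "real \<Rightarrow> ('b \<Rightarrow> 'b \<Rightarrow> ennreal) \<Rightarrow> (real \<Rightarrow> 'b) \<Rightarrow> real \<Rightarrow> ennreal" where
  "metric_speed T \<delta> y t =
     Limsup (at t within {0..T}) (\<lambda>s. \<delta> (y s) (y t) / ennreal \<bar>s - t\<bar>)"

section \<open>Cheeger energy and minimal relaxed slope\<close>

text \<open>The supremum is taken in \<^typ>\<open>ennreal\<close>, so it is 0 over the empty set, i.e. at isolated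
  points; for Lipschitz functions it is finite.\<close>

definition Lip_a :: "('a \<Rightarrow> 'a \<Rightarrow> ennreal) \<Rightarrow> ('a \<Rightarrow> real) \<Rightarrow> 'a \<Rightarrow> real" where
  "Lip_a d f x = enn2real (Lim (at_right (0::real)) (\<lambda>r.
     SUP (y, z)\<in>{(y, z). max (d y x) (d z x) < ennreal r \<and> 0 < d y z}.
       ennreal \<bar>f y - f z\<bar> / d y z))"

definition is_ess_envelope :: "'a measure \<Rightarrow> ('a \<Rightarrow> real) \<Rightarrow> ('a \<Rightarrow> real) \<Rightarrow> bool" where
  "is_ess_envelope M F G \<longleftrightarrow>
     G \<in> borel_measurable M \<and> (AE x in M. F x \<le> G x) \<and>
     (\<forall>H\<in>borel_measurable M. (AE x in M. F x \<le> H x) \<longrightarrow> (AE x in M. G x \<le> H x))"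

text \<open>A representative of a class that is unique up to null sets; the same applies to the other
  choices below.\<close>

definition Lip_a_star ::
    "('a \<Rightarrow> 'a \<Rightarrow> ennreal) \<Rightarrow> 'a measure \<Rightarrow> ('a \<Rightarrow> real) \<Rightarrow> 'a \<Rightarrow> real" where
  "Lip_a_star d m f = (SOME G. is_ess_envelope m (Lip_a d f) G)"

definition tends_L2 :: "'a measure \<Rightarrow> (nat \<Rightarrow> 'a \<Rightarrow> real) \<Rightarrow> ('a \<Rightarrow> real) \<Rightarrow> bool" where
  "tends_L2 M fs f \<longleftrightarrow> (\<lambda>n. LINT x|M. (fs n x - f x)\<^sup>2) \<longlonglongrightarrow> 0"

definition tends_weakly_L2 :: "'a measure \<Rightarrow> (nat \<Rightarrow> 'a \<Rightarrow> real) \<Rightarrow> ('a \<Rightarrow> real) \<Rightarrow> bool" where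
  "tends_weakly_L2 M gs g \<longleftrightarrow>
     (\<forall>h\<in>L2 M. (\<lambda>n. LINT x|M. gs n x * h x) \<longlonglongrightarrow> (LINT x|M. g x * h x))"

definition Lip_approx ::
    "('a::topological_space \<Rightarrow> 'a \<Rightarrow> ennreal) \<Rightarrow> 'a measure \<Rightarrow> ('a \<Rightarrow> real) \<Rightarrow>
     (nat \<Rightarrow> 'a \<Rightarrow> real) set" where
  "Lip_approx d m f = {fs. (\<forall>n. fs n \<in> Lip_b d) \<and> tends_L2 m fs f}"

definition Ch ::
    "('a::topological_space \<Rightarrow> 'a \<Rightarrow> ennreal) \<Rightarrow> 'a measure \<Rightarrow> ('a \<Rightarrow> real) \<Rightarrow> ennreal" where
  "Ch d m f = (INF fs\<in>Lip_approx d m f.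
     liminf (\<lambda>n. \<integral>\<^sup>+ x. ennreal ((Lip_a_star d m (fs n) x)\<^sup>2) \<partial>m))"

definition D_Ch ::
    "('a::topological_space \<Rightarrow> 'a \<Rightarrow> ennreal) \<Rightarrow> 'a measure \<Rightarrow> ('a \<Rightarrow> real) set" where
  "D_Ch d m = {f \<in> L2 m. Ch d m f < \<top>}"

text \<open>Weak limit points are limits of weakly convergent subsequences.  Reading them as cluster
  points in the weak topology gives the same relaxed slopes, by Mazur's lemma.\<close>

definition relaxed_slope ::
    "('a::topological_space \<Rightarrow> 'a \<Rightarrow> ennreal) \<Rightarrow> 'a measure \<Rightarrow> ('a \<Rightarrow> real) \<Rightarrow>
     ('a \<Rightarrow> real) \<Rightarrow> bool" where
  "relaxed_slope d m f G \<longleftrightarrow> G \<in> L2 m \<and>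
     (\<exists>fs\<in>Lip_approx d m f. \<exists>g\<in>L2 m.
        (\<exists>k :: nat \<Rightarrow> nat. strict_mono k \<and>
           tends_weakly_L2 m (\<lambda>n. Lip_a_star d m (fs (k n))) g) \<and>
        (AE x in m. g x \<le> G x))"

definition min_relaxed_slope ::
    "('a::topological_space \<Rightarrow> 'a \<Rightarrow> ennreal) \<Rightarrow> 'a measure \<Rightarrow> ('a \<Rightarrow> real) \<Rightarrow> 'a \<Rightarrow> real" where
  "min_relaxed_slope d m f = (SOME G. relaxed_slope d m f G \<and>
     (\<forall>H. relaxed_slope d m f H \<longrightarrow> (LINT x|m. (G x)\<^sup>2) \<le> (LINT x|m. (H x)\<^sup>2)))"

definition A_Ch ::
    "('a::topological_space \<Rightarrow> 'a \<Rightarrow> ennreal) \<Rightarrow> 'a measure \<Rightarrow> ('a \<Rightarrow> real) set" where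
  "A_Ch d m = {f \<in> D_Ch d m. f \<in> Linf m \<and> min_relaxed_slope d m f \<in> Linf m}"

section \<open>Continuity inequality\<close>

definition prob_density :: "'a measure \<Rightarrow> ('a \<Rightarrow> real) \<Rightarrow> bool" where
  "prob_density m \<rho> \<longleftrightarrow>
     \<rho> \<in> borel_measurable m \<and> (AE x in m. 0 \<le> \<rho> x) \<and> integrable m \<rho> \<and> (LINT x|m. \<rho> x) = 1"

text \<open>Nonnegativity is part of the definition: without it there is no least bound when, for
  instance, the Cheeger energy vanishes identically.\<close>

definition CE2_bound ::
    "real \<Rightarrow> ('a::topological_space \<Rightarrow> 'a \<Rightarrow> ennreal) \<Rightarrow> 'a measure \<Rightarrow> (real \<Rightarrow> 'a \<Rightarrow> real) \<Rightarrow>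
     (real \<Rightarrow> real) \<Rightarrow> bool" where
  "CE2_bound T d m \<rho> c \<longleftrightarrow>
     c \<in> L2 (leb_Ioo T) \<and> (AE r in leb_Ioo T. 0 \<le> c r) \<and>
     (\<forall>f\<in>A_Ch d m. \<forall>s t. 0 \<le> s \<longrightarrow> s \<le> t \<longrightarrow> t \<le> T \<longrightarrow>
        \<bar>(LINT x|m. f x * \<rho> t x) - (LINT x|m. f x * \<rho> s x)\<bar>
          \<le> (LBINT r=s..t. c r * sqrt (LINT x|m. (min_relaxed_slope d m f x)\<^sup>2 * \<rho> r x)))"

definition CE2 ::
    "real \<Rightarrow> ('a::topological_space \<Rightarrow> 'a \<Rightarrow> ennreal) \<Rightarrow> 'a measure \<Rightarrow> (real \<Rightarrow> 'a \<Rightarrow> real) set" where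
  "CE2 T d m = {\<rho>. (\<forall>t\<in>{0..T}. prob_density m (\<rho> t)) \<and> (\<exists>c. CE2_bound T d m \<rho> c)}"

definition CE2_speed ::
    "real \<Rightarrow> ('a::topological_space \<Rightarrow> 'a \<Rightarrow> ennreal) \<Rightarrow> 'a measure \<Rightarrow> (real \<Rightarrow> 'a \<Rightarrow> real) \<Rightarrow>
     real \<Rightarrow> real" where
  "CE2_speed T d m \<rho> = (SOME c. CE2_bound T d m \<rho> c \<and>
     (\<forall>c'. CE2_bound T d m \<rho> c' \<longrightarrow> (AE r in leb_Ioo T. c r \<le> c' r)))"

definition density_curve :: "'a measure \<Rightarrow> (real \<Rightarrow> 'a \<Rightarrow> real) \<Rightarrow> real \<Rightarrow> 'a measure" where
  "density_curve m \<rho> t = density m (\<lambda>x. ennreal (\<rho> t x))"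

end

(* Notation: mu_t = rho_t m.
   Continuity inequality => absolute continuity.  For f in Lip_b and a bounded continuous
   semidistance delta <= d, the Hopf-Lax functions Q_sigma f satisfy
   Lip_a (Q_sigma f)^2 <= -2 (d/dsigma) Q_sigma f in a finite-difference form.  Since
   |D u|_w <= Lip_a^* u for Lipschitz u, inserting Q_sigma f in the continuity inequality and moving
   diagonally in (sigma, t) yields int Q_1 f dmu_t - int f dmu_s <= (1/2) (int_s^t c)^2.  By duality
   this bounds W_2.  Duality is obtained by extending the functional
   h |-> inf {int phi dmu + int psi dnu + a C : h <= phi + psi + a delta^2} by Hahn-Banach to a
   finitely additive measure on X x X and radonizing it; tightness of the marginals makes the result
   a plan of cost at most C.
   Converse.  No superposition principle is needed: integrating |f x - f y| against plans between
   mu_s and mu_t as s increases to t bounds the density of t |-> int f dmu_t by the metric speed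
   times the L^2(mu_t) norm of Lip_a^* f, for f in Lip_b; the bound rho_t <= C carries this over to
   the minimal relaxed slope by strong approximation.
   A least bound c exists because c is a bound iff it dominates pointwise a.e. the densities of all
   the functions t |-> int f dmu_t, divided by the norms of |D f|_w; such c are stable under minima. *)
theory Submission
  imports Defs
begin

section \<open>Lipschitz functions and the generating semidistances\<close>

text \<open>The topology need not be metrizable, and \<open>d\<close> may be infinite and is only
  lower semicontinuous. A Hopf-Lax infimum with \<open>d\<close> itself could leave the continuous
  functions; taken with a bounded continuous \<open>\<delta>\<close> below \<open>d\<close> it stays
  in \<open>Lip_b d\<close>. The passage from \<open>\<delta>\<close> to \<open>d\<close> is
  postponed to the cost of the plan, where compactness reduces a supremum of semidistances to a
  single one. In the direct half each \<open>f\<close> has its own null set of times at which the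
  continuity inequality can be differentiated, and the functions \<open>Q \<sigma>\<close> form an
  uncountable family. Hence the evolution is used in integrated difference form, after a change of
  time that makes the bound \<open>c\<close> constant. In the converse half the asymptotic slope is
  not known to be measurable. Its envelope \<open>Lip_a_star\<close> serves in the statements, and
  measurable slopes at a fixed scale serve when plans are integrated. The slope is always read at
  the endpoint distributed by \<open>\<mu> t\<close>, with \<open>t\<close> fixed, so that the
  weight does not move while \<open>s\<close> tends to \<open>t\<close>.\<close>

lemma Lip_b_bounded: "f \<in> Lip_b d \<Longrightarrow> bounded (range f)"
  and Lip_b_continuous: "f \<in> Lip_b d \<Longrightarrow> continuous_on UNIV f"
  by (auto simp: Lip_b_def)

lemma Lip_bE:
  assumes "f \<in> Lip_b d"
  obtains L where "0 \<le> L" "\<And>x y. ennreal \<bar>f x - f y\<bar> \<le> ennreal L * d x y"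
  using assms unfolding Lip_b_def by blast

lemma Lip_b_borel: "f \<in> Lip_b d \<Longrightarrow> f \<in> borel_measurable borel"
  by (intro borel_measurable_continuous_onI Lip_b_continuous)

text \<open>Closure of \<open>Lip_b d\<close> under sums, multiples, absolute values and products
  reduces to one real inequality between increments; the \<open>d\<close>-Lipschitz constant of
  \<open>h\<close> is then \<open>A * L + B * M\<close>.\<close>

lemma Lip_b_comb:
  assumes f: "f \<in> Lip_b d" and g: "g \<in> Lip_b d" and A: "0 \<le> A" and B: "0 \<le> B"
    and h: "\<And>x y. \<bar>h x - h y\<bar> \<le> A * \<bar>f x - f y\<bar> + B * \<bar>g x - g y\<bar>"
    and "bounded (range h)" "continuous_on UNIV h"
  shows "h \<in> Lip_b d"
proof -
  obtain L where L: "0 \<le> L" "\<And>x y. ennreal \<bar>f x - f y\<bar> \<le> ennreal L * d x y" by (rule Lip_bE[OF f]) blast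
  obtain M where M: "0 \<le> M" "\<And>x y. ennreal \<bar>g x - g y\<bar> \<le> ennreal M * d x y" by (rule Lip_bE[OF g]) blast
  have "ennreal \<bar>h x - h y\<bar> \<le> ennreal (A * L + B * M) * d x y" for x y
  proof -
    have "ennreal \<bar>h x - h y\<bar> \<le> ennreal (A * \<bar>f x - f y\<bar> + B * \<bar>g x - g y\<bar>)" by (intro ennreal_leI h)
    also have "\<dots> = ennreal A * ennreal \<bar>f x - f y\<bar> + ennreal B * ennreal \<bar>g x - g y\<bar>"
      using A B by (simp add: ennreal_mult)
    also have "\<dots> \<le> ennreal A * (ennreal L * d x y) + ennreal B * (ennreal M * d x y)"
      using A B L M by (intro add_mono mult_left_mono) auto
    also have "\<dots> = ennreal (A * L + B * M) * d x y"
      using A B L(1) M(1) by (simp add: ennreal_mult distrib_right mult.assoc)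
    finally show ?thesis .
  qed
  moreover have "0 \<le> A * L + B * M" using A B L(1) M(1) by simp
  ultimately show ?thesis using assms(6,7) by (auto simp: Lip_b_def)
qed

lemma Lip_b_const: "(\<lambda>_. c) \<in> Lip_b d"
  by (auto simp: Lip_b_def intro!: exI[of _ 0])

lemma bounded_range_real: "bounded (range f) \<longleftrightarrow> (\<exists>B. \<forall>x. \<bar>f x :: real\<bar> \<le> B)"
  by (auto simp: bounded_iff)

lemma Lip_b_add: assumes "f \<in> Lip_b d" "g \<in> Lip_b d" shows "(\<lambda>x. f x + g x) \<in> Lip_b d"
  by (rule Lip_b_comb[OF assms, of 1 1])
    (use assms in \<open>auto intro!: bounded_plus_comp continuous_on_add dest: Lip_b_bounded Lip_b_continuous\<close>)

lemma Lip_b_cmult: assumes f: "f \<in> Lip_b d" shows "(\<lambda>x. c * f x) \<in> Lip_b d"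
proof (rule Lip_b_comb[OF f f, of "\<bar>c\<bar>" 0])
  obtain B where B: "\<And>x. \<bar>f x\<bar> \<le> B" using Lip_b_bounded[OF f] by (auto simp: bounded_range_real)
  have "\<bar>c * f x\<bar> \<le> \<bar>c\<bar> * B" for x using B[of x] by (simp add: abs_mult mult_left_mono)
  then show "bounded (range (\<lambda>x. c * f x))" by (auto simp: bounded_range_real)
qed (use f in \<open>auto intro!: continuous_intros dest: Lip_b_continuous simp: abs_mult right_diff_distrib[symmetric]\<close>)

lemma Lip_b_diff: assumes "f \<in> Lip_b d" "g \<in> Lip_b d" shows "(\<lambda>x. f x - g x) \<in> Lip_b d"
  using Lip_b_add[OF assms(1) Lip_b_cmult[OF assms(2), of "-1"]] by simp

lemma Lip_b_uminus: assumes "f \<in> Lip_b d" shows "(\<lambda>x. - f x) \<in> Lip_b d"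
  using Lip_b_cmult[OF assms(1), of "-1"] by simp

lemma Lip_b_sum: "(\<And>i. i \<in> F \<Longrightarrow> f i \<in> Lip_b d) \<Longrightarrow> (\<lambda>x. \<Sum>i\<in>F. f i x) \<in> Lip_b d"
  by (induction F rule: infinite_finite_induct) (auto intro: Lip_b_const Lip_b_add)

lemma Lip_b_abs: assumes f: "f \<in> Lip_b d" shows "(\<lambda>x. \<bar>f x\<bar>) \<in> Lip_b d"
proof (rule Lip_b_comb[OF f f, of 1 0])
  show "bounded (range (\<lambda>x. \<bar>f x\<bar>))" using Lip_b_bounded[OF f] by (auto simp: bounded_range_real)
qed (use f in \<open>auto intro!: continuous_intros dest: Lip_b_continuous\<close>)

lemma Lip_b_max: assumes "f \<in> Lip_b d" "g \<in> Lip_b d" shows "(\<lambda>x. max (f x) (g x)) \<in> Lip_b d"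
proof -
  have "(\<lambda>x. max (f x) (g x)) = (\<lambda>x. (1/2) * ((f x + g x) + \<bar>f x - g x\<bar>))"
    by (auto simp: fun_eq_iff max_def)
  then show ?thesis by (simp only:) (intro Lip_b_cmult Lip_b_add Lip_b_abs Lip_b_diff assms)
qed

lemma Lip_b_min: assumes "f \<in> Lip_b d" "g \<in> Lip_b d" shows "(\<lambda>x. min (f x) (g x)) \<in> Lip_b d"
proof -
  have "(\<lambda>x. min (f x) (g x)) = (\<lambda>x. - max (- f x) (- g x))" by (auto simp: fun_eq_iff)
  then show ?thesis by (simp only:) (intro Lip_b_uminus Lip_b_max assms)
qed

lemma Lip_b_mult: assumes f: "f \<in> Lip_b d" and g: "g \<in> Lip_b d" shows "(\<lambda>x. f x * g x) \<in> Lip_b d"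
proof -
  obtain A where A: "\<And>x. \<bar>f x\<bar> \<le> A" using Lip_b_bounded[OF f] by (auto simp: bounded_range_real)
  obtain B where B: "\<And>x. \<bar>g x\<bar> \<le> B" using Lip_b_bounded[OF g] by (auto simp: bounded_range_real)
  have A0: "0 \<le> A" "0 \<le> B" using A[of undefined] B[of undefined] by auto
  show ?thesis
  proof (rule Lip_b_comb[OF f g, of B A])
    fix x y
    have "f x * g x - f y * g y = (f x - f y) * g x + f y * (g x - g y)" by (simp add: algebra_simps)
    then have "\<bar>f x * g x - f y * g y\<bar> \<le> \<bar>f x - f y\<bar> * \<bar>g x\<bar> + \<bar>f y\<bar> * \<bar>g x - g y\<bar>"
      by (metis abs_mult abs_triangle_ineq)
    also have "\<dots> \<le> B * \<bar>f x - f y\<bar> + A * \<bar>g x - g y\<bar>"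
      using mult_right_mono[OF B[of x], of "\<bar>f x - f y\<bar>"] mult_right_mono[OF A[of y], of "\<bar>g x - g y\<bar>"]
      by (simp add: mult.commute)
    finally show "\<bar>f x * g x - f y * g y\<bar> \<le> B * \<bar>f x - f y\<bar> + A * \<bar>g x - g y\<bar>" .
    have "\<bar>f x * g x\<bar> \<le> A * B" for x using A[of x] B[of x] A0 by (simp add: abs_mult mult_mono)
    then show "bounded (range (\<lambda>x. f x * g x))" by (auto simp: bounded_range_real)
  qed (use A0 f g in \<open>auto intro!: continuous_intros dest: Lip_b_continuous\<close>)
qed

text \<open>Preimages of open sets under \<open>Lip_b d\<close> generate the topology, so the
  function is built by induction along \<open>generate_topology\<close>: a tent over one Lipschitz
  function for a generating set, a minimum for an intersection.\<close>

lemma Lip_b_bump_point: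
  assumes d: "ext_metric_top_space d" and U: "open U" "x \<in> U"
  shows "\<exists>f\<in>Lip_b d. (\<forall>y. 0 \<le> f y \<and> f y \<le> 1) \<and> f x = 1 \<and> (\<forall>y. y \<notin> U \<longrightarrow> f y = 0)"
proof -
  have "generate_topology {f -` V |f V. f \<in> Lip_b d \<and> open V} U"
    using d U by (auto simp: ext_metric_top_space_def)
  then show ?thesis using \<open>x \<in> U\<close>
  proof (induction)
    case UNIV then show ?case by (auto intro!: bexI[of _ "\<lambda>_. 1"] Lip_b_const)
  next
    case (Int a b)
    then obtain f g where
      f: "f \<in> Lip_b d" "\<And>y. 0 \<le> f y \<and> f y \<le> 1" "f x = 1" "\<And>y. y \<notin> a \<Longrightarrow> f y = 0" and
      g: "g \<in> Lip_b d" "\<And>y. 0 \<le> g y \<and> g y \<le> 1" "g x = 1" "\<And>y. y \<notin> b \<Longrightarrow> g y = 0"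
      by (auto simp: Bex_def)
    show ?case
    proof (intro bexI conjI allI impI)
      show "(\<lambda>y. min (f y) (g y)) \<in> Lip_b d" by (intro Lip_b_min f g)
      show "min (f y) (g y) = 0" if "y \<notin> a \<inter> b" for y
        using that f(2,4)[of y] g(2,4)[of y] by (auto simp: min_def)
    qed (use f g in \<open>auto simp: min.coboundedI1\<close>)
  next
    case (UN S)
    then obtain k where k: "k \<in> S" "x \<in> k" by auto
    then obtain f where f: "f \<in> Lip_b d" "\<forall>y. 0 \<le> f y \<and> f y \<le> 1" "f x = 1" "\<forall>y. y \<notin> k \<longrightarrow> f y = 0"
      using UN by blast
    then show ?case using k by (intro bexI[of _ f]) auto
  next
    case (Basis s)
    then obtain f V where f: "f \<in> Lip_b d" "open V" "s = f -` V" by auto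
    then have "f x \<in> V" using Basis by auto
    then obtain e where e: "e > 0" "\<And>z. dist z (f x) < e \<Longrightarrow> z \<in> V"
      using f(2) by (auto simp: open_dist)
    \<comment> \<open>The slope \<open>1/e\<close> makes the tent vanish exactly where
      \<open>f y\<close> is at distance at least \<open>e\<close> from \<open>f x\<close>, hence off
      \<open>s\<close>.\<close>
    let ?g = "\<lambda>y. max 0 (1 - (1/e) * \<bar>f y - f x\<bar>)"
    show ?case
    proof (intro bexI conjI allI impI)
      show "?g \<in> Lip_b d" by (intro Lip_b_max Lip_b_const Lip_b_diff Lip_b_cmult Lip_b_abs f)
      show "?g y = 0" if "y \<notin> s" for y
      proof -
        have "\<not> \<bar>f y - f x\<bar> < e" using e(2)[of "f y"] that f by (auto simp: dist_real_def)
        then have "1 \<le> (1/e) * \<bar>f y - f x\<bar>" using e(1) by (simp add: field_simps)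
        then show ?thesis by simp
      qed
    qed (use e in auto)
  qed
qed

text \<open>Finitely many bumps exceeding 1/2 cover \<open>K\<close>; twice their sum, cut off at 1,
  is constant on an open neighbourhood of \<open>K\<close>. The value 1 is provided on the open set
  \<open>V\<close> and not just on \<open>K\<close>, because contents of compact sets will be
  computed from open supersets.\<close>

lemma Lip_b_urysohn:
  assumes d: "ext_metric_top_space d" and K: "compact K" and U: "open U" "K \<subseteq> U"
  obtains f V where "f \<in> Lip_b d" "\<And>y. 0 \<le> f y" "\<And>y. f y \<le> 1" "open V" "K \<subseteq> V"
    "\<And>y. y \<in> V \<Longrightarrow> f y = 1" "\<And>y. y \<notin> U \<Longrightarrow> f y = 0"
proof -
  have "\<forall>x\<in>K. \<exists>f. f \<in> Lip_b d \<and> (\<forall>y. 0 \<le> f y \<and> f y \<le> 1) \<and> f x = 1 \<and> (\<forall>y. y \<notin> U \<longrightarrow> f y = 0)"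
    using Lip_b_bump_point[OF d U(1)] U(2) by blast
  then obtain g where g: "\<And>x. x \<in> K \<Longrightarrow> g x \<in> Lip_b d" "\<And>x y. x \<in> K \<Longrightarrow> 0 \<le> g x y"
    "\<And>x. x \<in> K \<Longrightarrow> g x x = 1" "\<And>x y. x \<in> K \<Longrightarrow> y \<notin> U \<Longrightarrow> g x y = 0"
    by metis
  have op: "open {y. g x y > 1/2}" if "x \<in> K" for x
    using Lip_b_continuous[OF g(1)[OF that]] by (intro open_Collect_less continuous_intros)
  obtain F where F: "F \<subseteq> K" "finite F" "K \<subseteq> (\<Union>x\<in>F. {y. g x y > 1/2})"
    using op
  proof (rule compactE_image[OF K])
    show "K \<subseteq> (\<Union>x\<in>K. {y. g x y > 1/2})" using g(3) by force
  qed blast+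
  define h where "h y = (\<Sum>x\<in>F. g x y)" for y
  have h: "h \<in> Lip_b d" unfolding h_def using F g(1) by (intro Lip_b_sum) auto
  have hge: "g x y \<le> h y" if "x \<in> F" for x y
    unfolding h_def using F g(2) that by (intro member_le_sum) auto
  have h0: "0 \<le> h y" for y unfolding h_def using F g(2) by (intro sum_nonneg) auto
  show thesis
  proof (rule that[of "\<lambda>y. min 1 (2 * h y)" "{y. h y > 1/2}"])
    show "(\<lambda>y. min 1 (2 * h y)) \<in> Lip_b d" by (intro Lip_b_min Lip_b_const Lip_b_cmult h)
    show "open {y. 1/2 < h y}"
      using Lip_b_continuous[OF h] by (intro open_Collect_less continuous_intros)
    show "K \<subseteq> {y. 1/2 < h y}" using F(3) hge by (force intro: less_le_trans)
    show "min 1 (2 * h y) = 0" if "y \<notin> U" for y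
    proof -
      have "h y = 0" unfolding h_def using F(1) g(4) that by (intro sum.neutral) auto
      then show ?thesis by simp
    qed
  qed (use h0 in \<open>auto simp: min_def\<close>)
qed

text \<open>The bounded continuous semidistances below \<open>d\<close>; unlike a given generating family they are
  closed under maxima.\<close>

definition bcs :: "('a::topological_space \<Rightarrow> 'a \<Rightarrow> ennreal) \<Rightarrow> ('a \<Rightarrow> 'a \<Rightarrow> real) set" where
  "bcs d = {\<delta>. semidistance \<delta> \<and> bounded (range (\<lambda>(x, y). \<delta> x y)) \<and>
     continuous_on UNIV (\<lambda>(x, y). \<delta> x y) \<and> (\<forall>x y. ennreal (\<delta> x y) \<le> d x y)}"

lemma bcsD:
  assumes "\<delta> \<in> bcs d"
  shows bcs_nonneg: "0 \<le> \<delta> x y" and bcs_refl: "\<delta> x x = 0"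
    and bcs_commute: "\<delta> x y = \<delta> y x" and bcs_triangle: "\<delta> x z \<le> \<delta> x y + \<delta> y z"
    and bcs_continuous: "continuous_on UNIV (\<lambda>z. \<delta> (fst z) (snd z))"
    and bcs_le: "ennreal (\<delta> x y) \<le> d x y"
  using assms by (auto simp: bcs_def semidistance_def case_prod_beta)

lemma bcs_bounded: assumes "\<delta> \<in> bcs d" obtains B where "0 \<le> B" "\<And>x y. \<delta> x y \<le> B"
proof -
  have "bounded (range (\<lambda>z. \<delta> (fst z) (snd z)))" using assms by (auto simp: bcs_def case_prod_beta)
  then obtain B where B: "\<And>z. \<bar>\<delta> (fst z) (snd z)\<bar> \<le> B" by (auto simp: bounded_range_real)
  have "\<delta> x y \<le> B" for x y using B[of "(x, y)"] by simp
  moreover have "0 \<le> B" using B[of undefined] by linarith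
  ultimately show thesis using that by blast
qed

lemma bcs_zero: "(\<lambda>_ _. 0) \<in> bcs d"
  by (auto simp: bcs_def semidistance_def)

lemma bcs_max: assumes "\<delta> \<in> bcs d" "\<delta>' \<in> bcs d" shows "(\<lambda>x y. max (\<delta> x y) (\<delta>' x y)) \<in> bcs d"
proof -
  obtain B where B: "\<And>x y. \<delta> x y \<le> B" using bcs_bounded[OF assms(1)] by metis
  obtain B' where B': "\<And>x y. \<delta>' x y \<le> B'" using bcs_bounded[OF assms(2)] by metis
  note n = bcs_nonneg[OF assms(1)] bcs_nonneg[OF assms(2)]
  have "\<bar>case z of (x, y) \<Rightarrow> max (\<delta> x y) (\<delta>' x y)\<bar> \<le> max B B'" for z
    using B[of "fst z" "snd z"] B'[of "fst z" "snd z"] n(1)[of "fst z" "snd z"]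
    by (auto simp: case_prod_beta max_def)
  then have "bounded (range (\<lambda>(x, y). max (\<delta> x y) (\<delta>' x y)))" unfolding bounded_range_real by blast
  moreover have "continuous_on UNIV (\<lambda>(x, y). max (\<delta> x y) (\<delta>' x y))"
    using bcs_continuous[OF assms(1)] bcs_continuous[OF assms(2)]
    by (simp add: case_prod_beta continuous_on_max)
  moreover have "semidistance (\<lambda>x y. max (\<delta> x y) (\<delta>' x y))"
    unfolding semidistance_def
  proof (intro conjI allI)
    fix x y z
    show "0 \<le> max (\<delta> x y) (\<delta>' x y)" using n(1)[of x y] by simp
    show "max (\<delta> x y) (\<delta>' x y) = max (\<delta> y x) (\<delta>' y x)"
      using bcs_commute[OF assms(1), of x y] bcs_commute[OF assms(2), of x y] by simp
    show "max (\<delta> x z) (\<delta>' x z) \<le> max (\<delta> x y) (\<delta>' x y) + max (\<delta> y z) (\<delta>' y z)"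
      using bcs_triangle[OF assms(1), of x z y] bcs_triangle[OF assms(2), of x z y] by linarith
  qed (simp add: bcs_refl[OF assms(1)] bcs_refl[OF assms(2)])
  moreover have "ennreal (max (\<delta> x y) (\<delta>' x y)) \<le> d x y" for x y
    using bcs_le[OF assms(1), of x y] bcs_le[OF assms(2), of x y] by (auto simp: max_def)
  ultimately show ?thesis by (simp add: bcs_def)
qed

lemma ext_metric_eq_SUP_bcs:
  assumes d: "ext_metric_top_space d" shows "d x y = (SUP \<delta>\<in>bcs d. ennreal (\<delta> x y))"
proof (rule antisym)
  show "(SUP \<delta>\<in>bcs d. ennreal (\<delta> x y)) \<le> d x y" by (intro SUP_least bcs_le)
  obtain \<D> :: "('a \<Rightarrow> 'a \<Rightarrow> real) set" where D: "\<And>\<delta>. \<delta> \<in> \<D> \<Longrightarrow> semidistance \<delta> \<and> bounded (range (\<lambda>(x, y). \<delta> x y)) \<and>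
     continuous_on UNIV (\<lambda>(x, y). \<delta> x y)" and eq: "\<And>x y. d x y = (SUP \<delta>\<in>\<D>. ennreal (\<delta> x y))"
    using d unfolding ext_metric_top_space_def by blast
  have "\<D> \<subseteq> bcs d" using D by (auto simp: bcs_def eq intro: SUP_upper)
  then show "d x y \<le> (SUP \<delta>\<in>bcs d. ennreal (\<delta> x y))" unfolding eq by (rule SUP_subset_mono) auto
qed

lemma less_ext_metric_iff:
  assumes d: "ext_metric_top_space d" shows "c < d x y \<longleftrightarrow> (\<exists>\<delta>\<in>bcs d. c < ennreal (\<delta> x y))"
  by (subst ext_metric_eq_SUP_bcs[OF d]) (rule less_SUP_iff)

text \<open>A supremum of continuous functions is lower semicontinuous. Both the Borel measurability
  of \<open>d\<close> on the product and the closedness of its sublevel sets are drawn from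
  this.\<close>

lemma open_less_ext_metric:
  fixes d :: "'a::t2_space \<Rightarrow> 'a \<Rightarrow> ennreal"
  assumes d: "ext_metric_top_space d" shows "open {z. c < d (fst z) (snd z)}"
proof -
  have "{z. c < d (fst z) (snd z)} = (\<Union>\<delta>\<in>bcs d. {z. c < ennreal (\<delta> (fst z) (snd z))})"
    by (auto simp: less_ext_metric_iff[OF d])
  moreover have "open {z. c < ennreal (\<delta> (fst z) (snd z))}" if "\<delta> \<in> bcs d" for \<delta>
    using bcs_continuous[OF that] by (intro open_Collect_less continuous_on_const continuous_on_ennreal)
  ultimately show ?thesis by auto
qed

lemma borel_measurable_ext_metric:
  fixes d :: "'a::t2_space \<Rightarrow> 'a \<Rightarrow> ennreal"
  assumes d: "ext_metric_top_space d" shows "(\<lambda>z. d (fst z) (snd z)) \<in> borel_measurable borel"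
  by (rule borel_measurableI_greater) (simp add: open_less_ext_metric[OF d])

section \<open>A dominated linear functional\<close>

definition sublinear :: "('v::real_vector \<Rightarrow> real) \<Rightarrow> bool" where
  "sublinear p \<longleftrightarrow> (\<forall>x y. p (x + y) \<le> p x + p y) \<and> (\<forall>a x. 0 \<le> a \<longrightarrow> p (a *\<^sub>R x) = a * p x)"

lemma sublinear_add: "sublinear p \<Longrightarrow> p (x + y) \<le> p x + p y"
  and sublinear_scale: "sublinear p \<Longrightarrow> 0 \<le> a \<Longrightarrow> p (a *\<^sub>R x) = a * p x"
  by (auto simp: sublinear_def)

lemma sublinear_zero: "sublinear p \<Longrightarrow> p 0 = 0"
  using sublinear_scale[of p 0 0] by simp

lemma sublinear_lower: "sublinear p \<Longrightarrow> - p (- x) \<le> p x"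
  using sublinear_add[of p x "- x"] sublinear_zero[of p] by simp

text \<open>A minimal sublinear functional is linear, because it is not decreased by passing to
  \<open>x \<mapsto> inf\<^sub>t\<^sub>\<ge>\<^sub>0 (q (x + t y) - t q y)\<close>.\<close>

lemma sublinear_shift:
  assumes q: "sublinear q"
  shows "\<exists>q'. sublinear q' \<and> (\<forall>x. q' x \<le> q x) \<and> (\<forall>x. q' x \<le> q (x + y) - q y)"
proof -
  define F where "F x = (\<lambda>t. q (x + t *\<^sub>R y) - t * q y) ` {0..}" for x
  have F_lower: "- q (- x) \<le> z" if "z \<in> F x" for x z
  proof -
    obtain t where t: "t \<ge> 0" "z = q (x + t *\<^sub>R y) - t * q y" using \<open>z \<in> F x\<close> by (auto simp: F_def)
    have "t * q y = q (t *\<^sub>R y)" using sublinear_scale[OF q t(1)] by simp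
    also have "\<dots> \<le> q (x + t *\<^sub>R y) + q (- x)"
      using sublinear_add[OF q, of "x + t *\<^sub>R y" "-x"] by simp
    finally show ?thesis using t by simp
  qed
  have bdd: "bdd_below (F x)" for x using F_lower by (auto simp: bdd_below_def)
  have ne: "F x \<noteq> {}" for x by (auto simp: F_def)
  define q' where "q' x = Inf (F x)" for x
  have le: "q' x \<le> q (x + t *\<^sub>R y) - t * q y" if "t \<ge> 0" for x t
    unfolding q'_def using that by (intro cInf_lower[OF _ bdd]) (auto simp: F_def)
  have sub: "q' (x + x') \<le> q' x + q' x'" for x x'
  proof -
    have 1: "q' (x + x') \<le> z + z'" if zz: "z \<in> F x" "z' \<in> F x'" for z z'
    proof -
      obtain t where t: "t \<ge> 0" "z = q (x + t *\<^sub>R y) - t * q y" using zz(1) by (auto simp: F_def)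
      obtain t' where t': "t' \<ge> 0" "z' = q (x' + t' *\<^sub>R y) - t' * q y" using zz(2) by (auto simp: F_def)
      have "q' (x + x') \<le> q ((x + x') + (t + t') *\<^sub>R y) - (t + t') * q y"
        using le[of "t + t'" "x + x'"] t t' by simp
      moreover have "q ((x + x') + (t + t') *\<^sub>R y) \<le> q (x + t *\<^sub>R y) + q (x' + t' *\<^sub>R y)"
        using sublinear_add[OF q, of "x + t *\<^sub>R y" "x' + t' *\<^sub>R y"] by (simp add: algebra_simps)
      ultimately show ?thesis using t t' by (simp add: algebra_simps)
    qed
    have "q' (x + x') - z \<le> q' x'" if "z \<in> F x" for z
      unfolding q'_def[of x'] using 1[OF that] by (intro cInf_greatest[OF ne]) (auto simp: algebra_simps)
    then have "q' (x + x') - q' x' \<le> q' x"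
      unfolding q'_def[of x] by (intro cInf_greatest[OF ne]) (auto simp: algebra_simps)
    then show ?thesis by simp
  qed
  have zero: "q' 0 = 0"
  proof -
    have "(\<lambda>t. q (0 + t *\<^sub>R y) - t * q y) ` {0..} = (\<lambda>t. 0) ` {0::real..}"
      by (intro image_cong) (auto simp: sublinear_scale[OF q])
    then have "F 0 = {0}" by (auto simp: F_def)
    then show ?thesis by (simp add: q'_def)
  qed
  have hom1: "q' (a *\<^sub>R x) \<le> a * q' x" if "a > 0" for a x
  proof -
    have "q' (a *\<^sub>R x) / a \<le> z" if "z \<in> F x" for z
    proof -
      obtain t where t: "t \<ge> 0" "z = q (x + t *\<^sub>R y) - t * q y" using \<open>z \<in> F x\<close> by (auto simp: F_def)
      have "q' (a *\<^sub>R x) \<le> q (a *\<^sub>R x + (a * t) *\<^sub>R y) - (a * t) * q y"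
        using t \<open>a > 0\<close> by (intro le) auto
      also have "a *\<^sub>R x + (a * t) *\<^sub>R y = a *\<^sub>R (x + t *\<^sub>R y)" by (simp add: algebra_simps)
      also have "q \<dots> = a * q (x + t *\<^sub>R y)" using \<open>a > 0\<close> by (intro sublinear_scale[OF q]) auto
      finally have "q' (a *\<^sub>R x) \<le> a * z" by (simp add: t(2) right_diff_distrib mult.assoc)
      then show ?thesis using \<open>a > 0\<close> by (simp add: field_simps)
    qed
    then have "q' (a *\<^sub>R x) / a \<le> q' x" unfolding q'_def[of x] by (intro cInf_greatest[OF ne])
    then show ?thesis using \<open>a > 0\<close> by (simp add: field_simps)
  qed
  have hom: "q' (a *\<^sub>R x) = a * q' x" if "a \<ge> 0" for a x
  proof (cases "a = 0")
    case False
    then have a: "a > 0" using that by simp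
    have "q' ((1/a) *\<^sub>R (a *\<^sub>R x)) \<le> (1/a) * q' (a *\<^sub>R x)" using a by (intro hom1) auto
    then have "a * q' x \<le> q' (a *\<^sub>R x)" using a by (simp add: field_simps)
    then show ?thesis using hom1[OF a, of x] by simp
  qed (simp add: zero)
  show ?thesis
    using sub hom le[of 0] le[of 1] by (intro exI[of _ q']) (auto simp: sublinear_def)
qed

text \<open>The infima are finite because \<open>- p (- x)\<close> lies below every
  \<open>q x\<close>. The chain property enters in the subadditivity: an estimate with two different
  members is passed to the smaller of them.\<close>

lemma sublinear_INF_chain:
  assumes C: "C \<noteq> {}" and sub: "\<And>q. q \<in> C \<Longrightarrow> sublinear q" and le: "\<And>q x. q \<in> C \<Longrightarrow> q x \<le> p x"
    and chain: "\<And>q r. q \<in> C \<Longrightarrow> r \<in> C \<Longrightarrow> q \<le> r \<or> r \<le> q"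
  shows "sublinear (\<lambda>x. INF q\<in>C. q x)" and "\<And>q x. q \<in> C \<Longrightarrow> (INF q\<in>C. q x) \<le> q x"
proof -
  have bdd: "bdd_below ((\<lambda>q. q x) ` C)" for x
  proof (rule bdd_belowI2[of _ "- p (- x)"])
    fix q assume "q \<in> C"
    then show "- p (- x) \<le> q x" using sublinear_lower[OF sub, of q x] le[of q "- x"] by simp
  qed
  show low: "(INF q\<in>C. q x) \<le> q x" if "q \<in> C" for q x
    using that by (intro cINF_lower bdd)
  have "(INF q\<in>C. q (x + y)) \<le> (INF q\<in>C. q x) + (INF q\<in>C. q y)" for x y
  proof -
    have 1: "(INF q\<in>C. q (x + y)) \<le> q x + r y" if qr: "q \<in> C" "r \<in> C" for q r
    proof -
      obtain s where s: "s \<in> C" "s \<le> q" "s \<le> r" using chain[OF qr] qr by blast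
      have "(INF q\<in>C. q (x + y)) \<le> s (x + y)" by (rule low[OF s(1)])
      also have "\<dots> \<le> s x + s y" by (rule sublinear_add[OF sub[OF s(1)]])
      also have "\<dots> \<le> q x + r y" using s by (auto simp: le_fun_def intro: add_mono)
      finally show ?thesis .
    qed
    have "(INF q\<in>C. q (x + y)) - q x \<le> (INF q\<in>C. q y)" if "q \<in> C" for q
      using 1[OF that] by (intro cINF_greatest[OF C]) (auto simp: algebra_simps)
    then have "(INF q\<in>C. q (x + y)) - (INF q\<in>C. q y) \<le> (INF q\<in>C. q x)"
      by (intro cINF_greatest[OF C]) (auto simp: algebra_simps)
    then show ?thesis by simp
  qed
  moreover have "(INF q\<in>C. q (a *\<^sub>R x)) = a * (INF q\<in>C. q x)" if a: "a \<ge> 0" for a x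
  proof -
    have "(INF q\<in>C. q (a *\<^sub>R x)) = (INF q\<in>C. a * q x)"
      by (intro INF_cong) (auto simp: sublinear_scale[OF sub a])
    also have "\<dots> = a * (INF q\<in>C. q x)"
      using a
    proof (cases "a = 0")
      case False
      with a have a: "a > 0" by simp
      show ?thesis
      proof (rule antisym)
        have "(INF q\<in>C. a * q x) / a \<le> (INF q\<in>C. q x)"
          using a by (intro cINF_greatest[OF C])
            (auto simp: field_simps intro!: cINF_lower bdd_belowI2[of _ "a * (INF q\<in>C. q x)"] mult_left_mono low)
        then show "(INF q\<in>C. a * q x) \<le> a * (INF q\<in>C. q x)" using a by (simp add: field_simps)
        show "a * (INF q\<in>C. q x) \<le> (INF q\<in>C. a * q x)"
          using a by (intro cINF_greatest[OF C]) (auto intro: mult_left_mono low)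
      qed
    qed (use C in simp)
    finally show ?thesis .
  qed
  ultimately show "sublinear (\<lambda>x. INF q\<in>C. q x)" by (simp add: sublinear_def)
qed

text \<open>Zorn's lemma provides a minimal sublinear functional below \<open>p\<close>; the shift
  in direction \<open>y\<close> cannot lower it, which is additivity, and additivity makes it odd
  and so homogeneous for negative scalars too.\<close>

theorem dominated_linear_exists:
  fixes p :: "'v::real_vector \<Rightarrow> real"
  assumes p: "sublinear p"
  obtains l where "linear l" "\<And>x. l x \<le> p x"
proof -
  define A where "A = {q. sublinear q \<and> q \<le> p}"
  have "\<exists>m\<in>A. \<forall>a\<in>A. a \<le> m \<longrightarrow> a = m"
  \<comment> \<open>The order is reversed, so that a maximal element is a minimal
    functional.\<close>
  proof (rule predicate_Zorn)
    show "partial_order_on A (relation_of (\<lambda>a b. b \<le> a) A)"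
      by (rule partial_order_on_relation_ofI) auto
    fix C assume C: "C \<in> Chains (relation_of (\<lambda>a b. b \<le> a) A)"
    then have CA: "C \<subseteq> A" and ch: "\<And>q r. q \<in> C \<Longrightarrow> r \<in> C \<Longrightarrow> q \<le> r \<or> r \<le> q"
      by (auto simp: Chains_def relation_of_def)
    show "\<exists>u\<in>A. \<forall>a\<in>C. u \<le> a"
    proof (cases "C = {}")
      case True then show ?thesis using p by (auto simp: A_def)
    next
      case False
      note I = sublinear_INF_chain[OF False, of p]
      have s: "sublinear (\<lambda>x. INF q\<in>C. q x)"
        by (rule I(1)) (use CA ch in \<open>auto simp: A_def le_fun_def\<close>)
      have l: "(INF q\<in>C. q x) \<le> q x" if "q \<in> C" for q x
        by (rule I(2)[OF _ _ _ that]) (use CA ch in \<open>auto simp: A_def le_fun_def\<close>)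
      obtain q where q: "q \<in> C" using False by auto
      have "(\<lambda>x. INF q\<in>C. q x) \<le> p"
      proof (rule le_funI)
        fix x
        have "q x \<le> p x" using q CA by (auto simp: A_def le_fun_def)
        then show "(INF q\<in>C. q x) \<le> p x" using l[OF q, of x] by simp
      qed
      then show ?thesis using s l by (intro bexI[of _ "\<lambda>x. INF q\<in>C. q x"]) (auto simp: A_def le_fun_def)
    qed
  qed
  then obtain q where q: "sublinear q" "q \<le> p" and min: "\<And>r. sublinear r \<Longrightarrow> r \<le> q \<Longrightarrow> r = q"
    by (auto simp: A_def intro: order_trans)
  have add: "q (x + y) = q x + q y" for x y
  proof (rule antisym)
    show "q (x + y) \<le> q x + q y" by (rule sublinear_add[OF q(1)])
    obtain q' where q': "sublinear q'" "\<forall>x. q' x \<le> q x" "\<forall>x. q' x \<le> q (x + y) - q y"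
      using sublinear_shift[OF q(1)] by blast
    then have "q' = q" by (intro min) (auto simp: le_fun_def)
    then show "q x + q y \<le> q (x + y)" using q'(3) by (auto simp: algebra_simps)
  qed
  have neg: "q (- x) = - q x" for x
    using add[of x "- x"] sublinear_zero[OF q(1)] by simp
  have "q (a *\<^sub>R x) = a * q x" for a x
  proof (cases "a \<ge> 0")
    case False
    then show ?thesis using sublinear_scale[OF q(1), of "- a" "- x"] neg[of x] by simp
  qed (simp add: sublinear_scale[OF q(1)])
  then have "linear q" by (intro linearI) (auto simp: add)
  then show thesis using q(2) that by (auto simp: le_fun_def)
qed

typedef 'a bfun = "{f :: 'a \<Rightarrow> real. bounded (range f)}"
  morphisms bfun_apply Abs_bfun
  by (rule exI[of _ "\<lambda>_. 0"]) auto

setup_lifting type_definition_bfun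

instantiation bfun :: (type) real_vector
begin
lift_definition zero_bfun :: "'a bfun" is "\<lambda>_. 0" by auto
lift_definition plus_bfun :: "'a bfun \<Rightarrow> 'a bfun \<Rightarrow> 'a bfun" is "\<lambda>f g x. f x + g x"
  by (rule bounded_plus_comp)
lift_definition minus_bfun :: "'a bfun \<Rightarrow> 'a bfun \<Rightarrow> 'a bfun" is "\<lambda>f g x. f x - g x"
  by (rule bounded_minus_comp)
lift_definition uminus_bfun :: "'a bfun \<Rightarrow> 'a bfun" is "\<lambda>f x. - f x"
  by (simp add: bounded_iff)
lift_definition scaleR_bfun :: "real \<Rightarrow> 'a bfun \<Rightarrow> 'a bfun" is "\<lambda>a f x. a * f x"
  unfolding bounded_iff by (auto simp: abs_mult) (meson abs_ge_zero mult_left_mono)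
instance by standard (transfer; simp add: algebra_simps fun_eq_iff)+
end

section \<open>Radon measures from finitely additive ones\<close>

lemma compact_separation:
  fixes K1 K2 :: "'a::t2_space set"
  assumes "compact K1" "compact K2" "K1 \<inter> K2 = {}"
  obtains U1 U2 where "open U1" "open U2" "K1 \<subseteq> U1" "K2 \<subseteq> U2" "U1 \<inter> U2 = {}"
proof -
  have "Hausdorff_space (euclidean :: 'a topology)"
    unfolding Hausdorff_space_def disjnt_def using hausdorff by (simp, blast)
  then show thesis
    using Hausdorff_space_compact_separation[of "euclidean :: 'a topology" K1 K2] assms that
    by (auto simp: disjnt_def)
qed

text \<open>Disjoint neighbourhoods of the compact sets \<open>K - U1\<close> and
  \<open>K - U2\<close> are removed from \<open>K\<close>, one at a time; the two compact remainders
  still cover \<open>K\<close>.\<close>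

lemma compact_Un_split:
  fixes K :: "'a::t2_space set"
  assumes K: "compact K" and U: "open U1" "open U2" "K \<subseteq> U1 \<union> U2"
  obtains K1 K2 where "compact K1" "compact K2" "K1 \<subseteq> U1" "K2 \<subseteq> U2" "K = K1 \<union> K2"
proof -
  have "compact (K - U1)" "compact (K - U2)" "(K - U1) \<inter> (K - U2) = {}"
    using K U by (auto intro: compact_diff)
  then obtain V1 V2 where V: "open V1" "open V2" "K - U1 \<subseteq> V1" "K - U2 \<subseteq> V2" "V1 \<inter> V2 = {}"
    by (rule compact_separation)
  show thesis
    by (rule that[of "K - V1" "K - V2"]) (use V K in \<open>auto intro: compact_diff\<close>)
qed

text \<open>\<open>L\<close> lives on all sets and is only finitely additive. A Borel measure is
  extracted in three regularisations: \<open>kap\<close> from outside on compact sets,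
  \<open>opn\<close> from inside on open sets, \<open>out\<close> from outside on all sets.\<close>

locale finitely_additive =
  fixes L :: "'z::t2_space set \<Rightarrow> ennreal"
  assumes additive: "A \<inter> B = {} \<Longrightarrow> L (A \<union> B) = L A + L B"
    and finite_total: "L UNIV < \<top>"
begin

lemma mono: "A \<subseteq> B \<Longrightarrow> L A \<le> L B"
  using additive[of A "B - A"] by (simp add: Un_absorb1)

lemma finite_L: "L A < \<top>"
  using mono[of A UNIV] finite_total by (simp add: order.strict_trans1)

lemma subadditive: "L (A \<union> B) \<le> L A + L B"
  using additive[of A "B - A"] mono[of "B - A" B] by (simp add: add_left_mono)

definition kap :: "'z set \<Rightarrow> ennreal" where
  "kap K = (INF V\<in>{V. open V \<and> K \<subseteq> V}. L V)"

definition opn :: "'z set \<Rightarrow> ennreal" where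
  "opn U = (SUP K\<in>{K. compact K \<and> K \<subseteq> U}. kap K)"

definition out :: "'z set \<Rightarrow> ennreal" where
  "out A = (INF U\<in>{U. open U \<and> A \<subseteq> U}. opn U)"

lemma kap_le: "open V \<Longrightarrow> K \<subseteq> V \<Longrightarrow> kap K \<le> L V"
  unfolding kap_def by (rule INF_lower) auto

lemma kap_finite: "kap K < \<top>"
  using kap_le[of UNIV K] finite_total by (simp add: order.strict_trans1)

lemma kap_approx:
  assumes "0 < e" obtains V where "open V" "K \<subseteq> V" "L V \<le> kap K + ennreal e"
proof -
  have "kap K < kap K + ennreal e"
    using kap_finite[of K] \<open>0 < e\<close> by (simp add: ennreal_less_zero_iff less_top[symmetric])
  then obtain V where "open V" "K \<subseteq> V" "L V < kap K + ennreal e"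
    unfolding kap_def[of K] INF_less_iff by auto
  then show thesis using that by auto
qed

lemma kap_subadd: "kap (K1 \<union> K2) \<le> kap K1 + kap K2"
proof (rule ennreal_le_epsilon)
  fix e :: real assume "0 < e"
  then have e2: "0 < e/2" by simp
  obtain V1 where V1: "open V1" "K1 \<subseteq> V1" "L V1 \<le> kap K1 + ennreal (e/2)" by (rule kap_approx[OF e2])
  obtain V2 where V2: "open V2" "K2 \<subseteq> V2" "L V2 \<le> kap K2 + ennreal (e/2)" by (rule kap_approx[OF e2])
  note V = V1 V2
  have "kap (K1 \<union> K2) \<le> L (V1 \<union> V2)" using V by (intro kap_le) auto
  also have "\<dots> \<le> L V1 + L V2" by (rule subadditive)
  also have "\<dots> \<le> (kap K1 + ennreal (e/2)) + (kap K2 + ennreal (e/2))" using V by (intro add_mono)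
  also have "\<dots> = kap K1 + kap K2 + (ennreal (e/2) + ennreal (e/2))" by (simp add: ac_simps)
  also have "ennreal (e/2) + ennreal (e/2) = ennreal e"
    using \<open>0 < e\<close> by (subst ennreal_plus[symmetric]) auto
  finally show "kap (K1 \<union> K2) \<le> kap K1 + kap K2 + ennreal e" .
qed

text \<open>In a Hausdorff space disjoint compact sets have disjoint neighbourhoods, on which
  \<open>L\<close> is additive.\<close>

lemma kap_superadd:
  assumes "compact K1" "compact K2" "K1 \<inter> K2 = {}"
  shows "kap K1 + kap K2 \<le> kap (K1 \<union> K2)"
proof -
  obtain U1 U2 where U: "open U1" "open U2" "K1 \<subseteq> U1" "K2 \<subseteq> U2" "U1 \<inter> U2 = {}"
    using compact_separation[OF assms] .
  show ?thesis unfolding kap_def[of "K1 \<union> K2"]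
  proof (rule INF_greatest)
    fix V assume V: "V \<in> {V. open V \<and> K1 \<union> K2 \<subseteq> V}"
    have "kap K1 + kap K2 \<le> L (V \<inter> U1) + L (V \<inter> U2)"
      using U V by (intro add_mono kap_le) auto
    also have "\<dots> = L ((V \<inter> U1) \<union> (V \<inter> U2))" using U by (intro additive[symmetric]) auto
    also have "\<dots> \<le> L V" by (rule mono) auto
    finally show "kap K1 + kap K2 \<le> L V" .
  qed
qed

lemma opn_upper: "compact K \<Longrightarrow> K \<subseteq> U \<Longrightarrow> kap K \<le> opn U"
  unfolding opn_def by (rule SUP_upper) auto

lemma opn_least: "(\<And>K. compact K \<Longrightarrow> K \<subseteq> U \<Longrightarrow> kap K \<le> c) \<Longrightarrow> opn U \<le> c"
  unfolding opn_def by (rule SUP_least) auto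

lemma opn_mono: "U \<subseteq> U' \<Longrightarrow> opn U \<le> opn U'"
  unfolding opn_def by (rule SUP_subset_mono) auto

lemma opn_le: "open U \<Longrightarrow> opn U \<le> L U"
  by (rule opn_least) (rule kap_le)

lemma opn_finite: "opn U < \<top>"
  using opn_mono[of U UNIV] opn_le[of UNIV] finite_total by (auto simp: order.strict_trans1)

lemma opn_approx:
  assumes "0 < e" obtains K where "compact K" "K \<subseteq> U" "opn U \<le> kap K + ennreal e"
proof (cases "opn U = 0")
  case True then show thesis using that[of "{}"] by simp
next
  case False
  have "opn U - ennreal e < opn U"
    using False opn_finite[of U] \<open>0 < e\<close>
    by (intro ennreal_between) (auto simp: zero_less_iff_neq_zero)
  then obtain K where K: "compact K" "K \<subseteq> U" "opn U - ennreal e < kap K"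
    unfolding opn_def[of U] less_SUP_iff by auto
  then have "opn U \<le> kap K + ennreal e"
    by (metis add.commute ennreal_minus_le_iff less_imp_le ennreal_neq_top)
  with K show thesis using that by auto
qed

lemma opn_Un: assumes "open U1" "open U2" shows "opn (U1 \<union> U2) \<le> opn U1 + opn U2"
proof (rule opn_least)
  fix K assume "compact K" "K \<subseteq> U1 \<union> U2"
  then obtain K1 K2 where K: "compact K1" "compact K2" "K1 \<subseteq> U1" "K2 \<subseteq> U2" "K = K1 \<union> K2"
    using compact_Un_split assms by metis
  then have "kap K \<le> kap K1 + kap K2" using kap_subadd by simp
  also have "\<dots> \<le> opn U1 + opn U2" using K by (intro add_mono opn_upper)
  finally show "kap K \<le> opn U1 + opn U2" .
qed

lemma opn_empty: "opn {} = 0"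
proof -
  have "kap {} \<le> 0"
  proof -
    have "L {} + L {} = L {} + 0" using additive[of "{}" "{}"] by simp
    then have "L {} = 0" using finite_L[of "{}"] unfolding ennreal_add_left_cancel by auto
    then show ?thesis using kap_le[of "{}" "{}"] by simp
  qed
  then have "opn {} \<le> 0" by (intro opn_least) auto
  then show ?thesis by simp
qed

lemma opn_UN_lessThan: "(\<And>i. open (U i)) \<Longrightarrow> opn (\<Union>i<n::nat. U i) \<le> (\<Sum>i<n. opn (U i))"
proof (induction n)
  case (Suc n)
  have "opn (\<Union>i<Suc n. U i) = opn ((\<Union>i<n. U i) \<union> U n)" by (simp add: lessThan_Suc Un_commute)
  also have "\<dots> \<le> opn (\<Union>i<n. U i) + opn (U n)" using Suc by (intro opn_Un) auto
  also have "\<dots> \<le> (\<Sum>i<n. opn (U i)) + opn (U n)" using Suc by (intro add_right_mono) auto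
  finally show ?case by simp
qed (simp add: opn_empty)

text \<open>A compact subset of a countable union lies in a finite one. This is how countable
  subadditivity arises although \<open>L\<close> itself has only the finite version.\<close>

lemma opn_UN:
  assumes "\<And>i::nat. open (U i)" shows "opn (\<Union>i. U i) \<le> (\<Sum>i. opn (U i))"
proof (rule opn_least)
  fix K assume "compact K" "K \<subseteq> (\<Union>i. U i)"
  then obtain F where F: "finite F" "K \<subseteq> (\<Union>i\<in>F. U i)"
    using compactE_image[of K UNIV U] assms by metis
  obtain n where "F \<subseteq> {..<n}" using F(1) by (meson finite_nat_iff_bounded)
  then have "K \<subseteq> (\<Union>i<n. U i)" using F(2) by blast
  then have "kap K \<le> opn (\<Union>i<n. U i)" using \<open>compact K\<close> by (intro opn_upper)
  also have "\<dots> \<le> (\<Sum>i<n. opn (U i))" by (intro opn_UN_lessThan assms)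
  also have "\<dots> \<le> (\<Sum>i. opn (U i))" by (intro sum_le_suminf) auto
  finally show "kap K \<le> (\<Sum>i. opn (U i))" .
qed

lemma out_open: assumes "open U" shows "out U = opn U"
  unfolding out_def
proof (rule antisym)
  show "(INF V\<in>{V. open V \<and> U \<subseteq> V}. opn V) \<le> opn U" using assms by (intro INF_lower) auto
  show "opn U \<le> (INF V\<in>{V. open V \<and> U \<subseteq> V}. opn V)" by (intro INF_greatest opn_mono) auto
qed

lemma out_le: "open U \<Longrightarrow> A \<subseteq> U \<Longrightarrow> out A \<le> opn U"
  unfolding out_def by (rule INF_lower) auto

lemma out_mono: "A \<subseteq> B \<Longrightarrow> out A \<le> out B"
  unfolding out_def by (rule INF_superset_mono) auto

lemma out_finite: "out A < \<top>"
  using out_le[of UNIV A] opn_finite[of UNIV] by (auto simp: order.strict_trans1)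

lemma out_approx:
  assumes "0 < e" obtains U where "open U" "A \<subseteq> U" "opn U \<le> out A + ennreal e"
proof -
  have "out A < out A + ennreal e"
    using out_finite[of A] \<open>0 < e\<close> by (simp add: less_top[symmetric])
  then obtain U where "open U" "A \<subseteq> U" "opn U < out A + ennreal e"
    unfolding out_def[of A] INF_less_iff by auto
  then show thesis using that by auto
qed

lemma outer_measure_space_out: "outer_measure_space (Pow UNIV) out"
  unfolding outer_measure_space_def
proof (intro conjI)
  show "positive (Pow UNIV) out" using out_open[of "{}"] opn_empty by (simp add: positive_def)
  show "increasing (Pow UNIV) out" using out_mono by (auto simp: increasing_def)
  show "countably_subadditive (Pow UNIV) out"
    unfolding countably_subadditive_def
  proof (intro allI impI)
    fix A :: "nat \<Rightarrow> 'z set"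
    show "out (\<Union> (range A)) \<le> (\<Sum>i. out (A i))"
    proof (rule ennreal_le_epsilon)
      fix e :: real assume e: "0 < e"
      have "\<exists>U. open U \<and> A i \<subseteq> U \<and> opn U \<le> out (A i) + ennreal (e * (1/2)^Suc i)" for i
      proof -
        have "0 < e * (1/2)^Suc i" using e by simp
        then show ?thesis by (rule out_approx) blast
      qed
      then obtain U where U: "\<And>i. open (U i)" "\<And>i. A i \<subseteq> U i"
        "\<And>i. opn (U i) \<le> out (A i) + ennreal (e * (1/2)^Suc i)" by metis
      have "out (\<Union> (range A)) \<le> opn (\<Union>i. U i)" using U by (intro out_le) auto
      also have "\<dots> \<le> (\<Sum>i. opn (U i))" using U by (intro opn_UN)
      also have "\<dots> \<le> (\<Sum>i. out (A i) + ennreal (e * (1/2)^Suc i))" using U by (intro suminf_le) auto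
      also have "\<dots> = (\<Sum>i. out (A i)) + (\<Sum>i. ennreal (e * (1/2)^Suc i))"
        by (intro suminf_add[symmetric]) auto
      also have "(\<Sum>i. ennreal (e * (1/2)^Suc i)) = ennreal e"
      proof -
        have "(\<lambda>i. e * (1/2)^Suc i) sums (e * 1)" by (intro sums_mult power_half_series)
        then show ?thesis using e by (intro suminf_ennreal_eq) auto
      qed
      finally show "out (\<Union> (range A)) \<le> (\<Sum>i. out (A i)) + ennreal e" .
    qed
  qed
qed

text \<open>Fill \<open>V \<inter> U\<close> by a compact \<open>K1\<close>. Then
  \<open>V - K1\<close> is open and contains \<open>A - U\<close>, and a compact set inside it is
  disjoint from \<open>K1\<close>, so that superadditivity of \<open>kap\<close> applies. Thus open
  sets satisfy Caratheodory's criterion.\<close>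

lemma out_open_split: assumes U: "open U" shows "out (A \<inter> U) + out (A - U) \<le> out A"
proof (rule ennreal_le_epsilon)
  fix e :: real assume e: "0 < e"
  then have e3: "0 < e/3" by simp
  obtain V where V: "open V" "A \<subseteq> V" "opn V \<le> out A + ennreal (e/3)" by (rule out_approx[OF e3])
  obtain K1 where K1: "compact K1" "K1 \<subseteq> V \<inter> U" "opn (V \<inter> U) \<le> kap K1 + ennreal (e/3)"
    by (rule opn_approx[OF e3])
  obtain K2 where K2: "compact K2" "K2 \<subseteq> V - K1" "opn (V - K1) \<le> kap K2 + ennreal (e/3)"
    by (rule opn_approx[OF e3])
  have oK: "open (V - K1)" using V K1 by (intro open_Diff compact_imp_closed) auto
  have "out (A \<inter> U) + out (A - U) \<le> opn (V \<inter> U) + opn (V - K1)"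
    using V U K1 oK by (intro add_mono out_le) auto
  also have "\<dots> \<le> (kap K1 + ennreal (e/3)) + (kap K2 + ennreal (e/3))"
    using K1 K2 by (intro add_mono)
  also have "\<dots> = (kap K1 + kap K2) + ennreal (e/3) + ennreal (e/3)" by (simp add: ac_simps)
  also have "\<dots> \<le> opn V + ennreal (e/3) + ennreal (e/3)"
  proof (intro add_right_mono)
    have "kap K1 + kap K2 \<le> kap (K1 \<union> K2)" using K1 K2 by (intro kap_superadd) auto
    also have "\<dots> \<le> opn V" using K1 K2 by (intro opn_upper) auto
    finally show "kap K1 + kap K2 \<le> opn V" .
  qed
  also have "\<dots> \<le> (out A + ennreal (e/3)) + ennreal (e/3) + ennreal (e/3)"
    using V by (intro add_right_mono)
  also have "\<dots> = out A + ennreal e"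
    using e by (simp add: add.assoc ennreal_plus[symmetric] del: ennreal_plus)
  finally show "out (A \<inter> U) + out (A - U) \<le> out A + ennreal e" .
qed

lemma measure_space_out: "measure_space UNIV (sets borel) out"
proof -
  interpret P: sigma_algebra UNIV "Pow UNIV :: 'z set set" by (rule sigma_algebra_Pow)
  let ?L = "lambda_system UNIV (Pow UNIV) out"
  have ms: "measure_space UNIV ?L out" by (rule P.caratheodory_lemma[OF outer_measure_space_out])
  then interpret LS: sigma_algebra UNIV ?L by (simp add: measure_space_def)
  have "U \<in> ?L" if "open U" for U
  proof -
    have "out (U \<inter> x) + out ((UNIV - U) \<inter> x) = out x" for x
    proof (rule antisym)
      show "out (U \<inter> x) + out ((UNIV - U) \<inter> x) \<le> out x"
        using out_open_split[OF that, of x] by (simp add: Int_commute Diff_eq)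
      \<comment> \<open>Subadditivity for two sets is read off from the countable version by padding
        the pair with empty sets.\<close>
      have disj: "disjoint_family (binaryset (U \<inter> x) ((UNIV - U) \<inter> x))"
        by (auto simp: disjoint_family_on_def binaryset_def)
      have "out (\<Union>i. binaryset (U \<inter> x) ((UNIV - U) \<inter> x) i)
          \<le> (\<Sum>i. out (binaryset (U \<inter> x) ((UNIV - U) \<inter> x) i))"
        using outer_measure_space_out disj
        by (auto simp: outer_measure_space_def countably_subadditive_def)
      also have "\<dots> = out (U \<inter> x) + out ((UNIV - U) \<inter> x)"
        using outer_measure_space_out
        by (intro suminf_binaryset_eq) (auto simp: outer_measure_space_def positive_def)
      also have "(\<Union>i. binaryset (U \<inter> x) ((UNIV - U) \<inter> x) i) = x"
        by (auto simp: UN_binaryset_eq)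
      finally show "out x \<le> out (U \<inter> x) + out ((UNIV - U) \<inter> x)" .
    qed
    then show ?thesis by (auto simp: lambda_system_def)
  qed
  then have "sigma_sets UNIV {S. open S} \<subseteq> ?L" by (intro LS.sigma_sets_subset) auto
  then have sub: "sets borel \<subseteq> ?L" by (simp add: borel_def)
  have sa: "sigma_algebra UNIV (sets (borel :: 'z measure))"
    using sets.sigma_algebra_axioms[of "borel :: 'z measure"] by simp
  show ?thesis using ms sub sa unfolding measure_space_def
    by (auto simp: positive_def countably_additive_def)
qed

definition radonization :: "'z measure" where "radonization = measure_of UNIV (sets borel) out"

lemma sets_radonization: "sets radonization = sets borel"
  using sets.sigma_sets_eq[of "borel :: 'z measure"] by (simp add: radonization_def)

end

context finitely_additive begin

lemma space_radonization: "space radonization = UNIV"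
  using sets_eq_imp_space_eq[OF sets_radonization] by simp

lemma emeasure_radonization: "B \<in> sets borel \<Longrightarrow> emeasure radonization B = out B"
  unfolding radonization_def using measure_space_out
  by (intro emeasure_measure_of_sigma) (auto simp: measure_space_def)

lemma emeasure_radonization_open: "open U \<Longrightarrow> emeasure radonization U = opn U"
  by (simp add: emeasure_radonization out_open)

lemma kap_le_emeasure: "compact K \<Longrightarrow> kap K \<le> emeasure radonization K"
  by (auto simp: emeasure_radonization borel_compact out_def intro!: INF_greatest opn_upper)

lemma emeasure_radonization_finite: "emeasure radonization B < \<top>"
proof -
  have "emeasure radonization B \<le> emeasure radonization (space radonization)" by (rule emeasure_space)
  also have "\<dots> = opn UNIV" by (simp add: space_radonization emeasure_radonization_open)
  finally show ?thesis using opn_finite[of UNIV] by (simp add: order.strict_trans1)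
qed

text \<open>Outer regularity is built into \<open>out\<close>. For inner regularity take a compact
  \<open>K0\<close> carrying nearly all the mass and remove from it an open \<open>U\<close> that
  contains \<open>K0 - B\<close> and is hardly larger: the compact set \<open>K0 - U\<close> lies in
  \<open>B\<close> and misses only parts of \<open>B \<inter> U\<close> and of the complement of
  \<open>K0\<close>.\<close>

lemma radonization_inner_regular:
  assumes B: "B \<in> sets borel"
  shows "emeasure radonization B = (SUP K\<in>{K. compact K \<and> K \<subseteq> B}. emeasure radonization K)"
proof (rule antisym)
  let ?M = radonization
  note [simp] = sets_radonization
  note [measurable] = B
  show "(SUP K\<in>{K. compact K \<and> K \<subseteq> B}. emeasure ?M K) \<le> emeasure ?M B"
    using B by (intro SUP_least emeasure_mono) auto
  show "emeasure ?M B \<le> (SUP K\<in>{K. compact K \<and> K \<subseteq> B}. emeasure ?M K)"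
  proof (rule ennreal_le_epsilon)
    fix e :: real assume "0 < e"
    then have e2: "0 < e/2" by simp
    obtain K0 where K0: "compact K0" "opn UNIV \<le> kap K0 + ennreal (e/2)"
      using opn_approx[OF e2, of UNIV] by metis
    have [measurable]: "K0 \<in> sets borel" using K0 by (simp add: borel_compact)
    obtain U where U: "open U" "K0 - B \<subseteq> U" "opn U \<le> out (K0 - B) + ennreal (e/2)"
      using out_approx[OF e2, of "K0 - B"] by metis
    have [measurable]: "U \<in> sets borel" using U by simp
    have 1: "emeasure ?M (- K0) \<le> ennreal (e/2)"
    proof -
      have "emeasure ?M K0 + emeasure ?M (- K0) = emeasure ?M (K0 \<union> - K0)"
        by (intro plus_emeasure) (auto intro: borel_comp)
      also have "\<dots> \<le> emeasure ?M K0 + ennreal (e/2)"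
        using K0 kap_le_emeasure[OF K0(1)] by (simp add: emeasure_radonization_open add_right_mono order.trans)
      finally show ?thesis
        using emeasure_radonization_finite[of K0] by (auto simp: ennreal_add_left_cancel_le)
    qed
    have 2: "emeasure ?M (B \<inter> U) \<le> ennreal (e/2)"
    proof -
      have "emeasure ?M (K0 - B) + emeasure ?M (B \<inter> U) = emeasure ?M ((K0 - B) \<union> (B \<inter> U))"
        by (intro plus_emeasure) auto
      also have "\<dots> \<le> emeasure ?M U" using U by (intro emeasure_mono) auto
      also have "\<dots> \<le> emeasure ?M (K0 - B) + ennreal (e/2)"
        using U by (simp add: emeasure_radonization_open emeasure_radonization)
      finally show ?thesis
        using emeasure_radonization_finite[of "K0 - B"] by (auto simp: ennreal_add_left_cancel_le)
    qed
    have K: "compact (K0 - U)" "K0 - U \<subseteq> B" using K0 U by (auto intro: compact_diff)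
    have "emeasure ?M B \<le> emeasure ?M ((K0 - U) \<union> (- K0 \<union> (B \<inter> U)))"
      by (intro emeasure_mono) (auto intro!: borel_comp)
    also have "\<dots> \<le> emeasure ?M (K0 - U) + emeasure ?M (- K0 \<union> (B \<inter> U))"
      by (intro emeasure_subadditive) (auto intro!: borel_comp)
    also have "\<dots> \<le> emeasure ?M (K0 - U) + (emeasure ?M (- K0) + emeasure ?M (B \<inter> U))"
      by (intro add_left_mono emeasure_subadditive) (auto intro!: borel_comp)
    also have "\<dots> \<le> emeasure ?M (K0 - U) + (ennreal (e/2) + ennreal (e/2))"
      by (intro add_left_mono add_mono 1 2)
    also have "ennreal (e/2) + ennreal (e/2) = ennreal e"
      using \<open>0 < e\<close> by (subst ennreal_plus[symmetric]) auto
    also have "emeasure ?M (K0 - U) \<le> (SUP K\<in>{K. compact K \<and> K \<subseteq> B}. emeasure ?M K)"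
      using K by (intro SUP_upper) auto
    finally show "emeasure ?M B \<le> (SUP K\<in>{K. compact K \<and> K \<subseteq> B}. emeasure ?M K) + ennreal e"
      by (simp add: add_right_mono)
  qed
qed

text \<open>A finitely additive \<open>L\<close> can carry mass that no compact set sees, and this
  mass is lost in the regularisation; tightness rules it out.\<close>

lemma radonization_radon_prob:
  assumes "L UNIV = 1" and tight: "\<And>e. 0 < e \<Longrightarrow> \<exists>K. compact K \<and> 1 \<le> kap K + ennreal e"
  shows "radonization \<in> radon_prob"
proof -
  have "opn UNIV = 1"
  proof (rule antisym)
    show "opn UNIV \<le> 1" using opn_le[of UNIV] assms(1) by simp
    show "1 \<le> opn UNIV"
    proof (rule ennreal_le_epsilon)
      fix e :: real assume "0 < e"
      then have "\<exists>K. compact K \<and> 1 \<le> kap K + ennreal e" by (rule tight)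
      then obtain K where K: "compact K" "1 \<le> kap K + ennreal e" by blast
      have "kap K + ennreal e \<le> opn UNIV + ennreal e" using K(1) by (intro add_right_mono opn_upper) auto
      with K(2) show "1 \<le> opn UNIV + ennreal e" by (rule order_trans)
    qed
  qed
  then have "prob_space radonization"
    by (intro prob_spaceI) (simp add: space_radonization emeasure_radonization_open)
  then show ?thesis
    using radonization_inner_regular by (simp add: radon_prob_def sets_radonization)
qed

end

section \<open>Radon probability measures: approximation and uniqueness\<close>

lemma radon_probD:
  assumes "\<mu> \<in> radon_prob"
  shows radon_prob_prob_space: "prob_space \<mu>" and radon_prob_sets: "sets \<mu> = sets borel"
    and radon_prob_space: "space \<mu> = UNIV"
    and radon_prob_inner: "B \<in> sets borel \<Longrightarrow> emeasure \<mu> B = (SUP K\<in>{K. compact K \<and> K \<subseteq> B}. emeasure \<mu> K)"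
  using assms sets_eq_imp_space_eq[of \<mu> borel] by (auto simp: radon_prob_def)

lemma radon_prob_inner_approx:
  assumes \<mu>: "\<mu> \<in> radon_prob" and B: "B \<in> sets borel" and e: "0 < e"
  obtains K where "compact K" "K \<subseteq> B" "measure \<mu> B \<le> measure \<mu> K + e"
proof -
  interpret prob_space \<mu> using \<mu> by (rule radon_prob_prob_space)
  show thesis
  proof (cases "measure \<mu> B = 0")
    case True then show thesis using that[of "{}"] e by simp
  next
    case False
    then have pos: "0 < measure \<mu> B" by (simp add: zero_less_measure_iff)
    have "ennreal (measure \<mu> B - e) < ennreal (measure \<mu> B)"
      using e pos by (intro ennreal_lessI) auto
    also have "\<dots> = (SUP K\<in>{K. compact K \<and> K \<subseteq> B}. emeasure \<mu> K)"
      using radon_prob_inner[OF \<mu> B] by (simp add: emeasure_eq_measure)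
    finally obtain K where K: "compact K" "K \<subseteq> B" "ennreal (measure \<mu> B - e) < emeasure \<mu> K"
      unfolding less_SUP_iff by auto
    have "measure \<mu> B - e < measure \<mu> K"
    proof (rule ccontr)
      assume "\<not> ?thesis"
      then have "ennreal (measure \<mu> K) \<le> ennreal (measure \<mu> B - e)" by (intro ennreal_leI) simp
      then show False using K(3) by (simp add: emeasure_eq_measure)
    qed
    then show thesis using K that by force
  qed
qed

text \<open>By inner regularity of \<open>\<nu>\<close> on complements, \<open>\<nu>\<close> is outer regular, so an inequality on open
  sets is inherited by Borel sets and, for probabilities, turns into an equality.\<close>

lemma radon_prob_eqI:
  assumes \<nu>: "\<nu> \<in> radon_prob" and \<mu>: "prob_space \<mu>" "sets \<mu> = sets borel"
    and le: "\<And>U. open U \<Longrightarrow> emeasure \<mu> U \<le> emeasure \<nu> U"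
  shows "\<mu> = \<nu>"
proof (rule measure_eqI)
  interpret M: prob_space \<mu> by fact
  interpret N: prob_space \<nu> using \<nu> by (rule radon_prob_prob_space)
  have sp: "space \<mu> = UNIV" "space \<nu> = UNIV" using sets_eq_imp_space_eq[OF \<mu>(2)] radon_prob_space[OF \<nu>] by auto
  note [simp] = \<mu>(2) radon_prob_sets[OF \<nu>]
  show "sets \<mu> = sets \<nu>" by simp
  have *: "measure \<mu> B \<le> measure \<nu> B" if B: "B \<in> sets borel" for B
  proof (rule field_le_epsilon)
    fix e :: real assume e: "0 < e"
    have cB: "UNIV - B \<in> sets borel" using B by auto
    obtain K where K: "compact K" "K \<subseteq> UNIV - B" "measure \<nu> (UNIV - B) \<le> measure \<nu> K + e"
      by (rule radon_prob_inner_approx[OF \<nu> cB e])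
    have Kb: "K \<in> sets borel" using K by (simp add: borel_compact)
    have "measure \<mu> B \<le> measure \<mu> (UNIV - K)" using K Kb by (intro M.finite_measure_mono) auto
    also have "\<dots> \<le> measure \<nu> (UNIV - K)"
      using le[of "UNIV - K"] K by (simp add: M.emeasure_eq_measure N.emeasure_eq_measure open_Diff compact_imp_closed)
    also have "\<dots> \<le> measure \<nu> B + e"
      using N.prob_compl[of K] N.prob_compl[of B] K Kb B by (simp add: sp)
    finally show "measure \<mu> B \<le> measure \<nu> B + e" .
  qed
  fix B assume "B \<in> sets \<mu>"
  then have B: "B \<in> sets borel" by simp
  then have "measure \<mu> (UNIV - B) \<le> measure \<nu> (UNIV - B)" by (intro *) auto
  then have "measure \<nu> B \<le> measure \<mu> B"
    using N.prob_compl[of B] M.prob_compl[of B] B by (simp add: sp)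
  with *[OF B] show "emeasure \<mu> B = emeasure \<nu> B"
    by (simp add: M.emeasure_eq_measure N.emeasure_eq_measure)
qed

text \<open>\<open>G x\<close> stands for the values of all competitors for \<open>x\<close>. The
  infimum is finite because a member of \<open>G x\<close> plus a fixed member of
  \<open>G (- x)\<close> is a member of \<open>G 0\<close>, hence nonnegative.\<close>

lemma sublinear_INF:
  fixes G :: "'v::real_vector \<Rightarrow> real set"
  assumes ne: "\<And>x. G x \<noteq> {}" and add: "\<And>x y z w. z \<in> G x \<Longrightarrow> w \<in> G y \<Longrightarrow> z + w \<in> G (x + y)"
    and scale: "\<And>a x z. 0 < a \<Longrightarrow> z \<in> G x \<Longrightarrow> a * z \<in> G (a *\<^sub>R x)"
    and zero: "0 \<in> G 0" "\<And>z. z \<in> G 0 \<Longrightarrow> 0 \<le> z"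
  shows "sublinear (\<lambda>x. Inf (G x))" and "z \<in> G x \<Longrightarrow> Inf (G x) \<le> z"
proof -
  have bdd: "bdd_below (G x)" for x
  proof -
    obtain w where "w \<in> G (- x)" using ne by blast
    then show ?thesis using add[of _ x w "- x"] zero(2) by (intro bdd_belowI[of _ "- w"]) force
  qed
  show low: "Inf (G x) \<le> z" if "z \<in> G x" for x z using that by (intro cInf_lower bdd)
  have "Inf (G (x + y)) \<le> Inf (G x) + Inf (G y)" for x y
  proof -
    have "Inf (G (x + y)) - z \<le> Inf (G y)" if "z \<in> G x" for z
    proof (intro cInf_greatest[OF ne])
      fix w assume "w \<in> G y"
      then show "Inf (G (x + y)) - z \<le> w" using low[OF add[OF that], of w y] by simp
    qed
    then have "Inf (G (x + y)) - Inf (G y) \<le> Inf (G x)"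
      by (intro cInf_greatest[OF ne]) (auto simp: algebra_simps)
    then show ?thesis by simp
  qed
  moreover have "Inf (G (a *\<^sub>R x)) = a * Inf (G x)" if "0 \<le> a" for a x
  proof (cases "a = 0")
    case True
    have "Inf (G 0) = 0" using low[OF zero(1)] zero(2) by (intro antisym cInf_greatest[OF ne]) auto
    then show ?thesis using True by simp
  next
    case False
    have le: "Inf (G (b *\<^sub>R y)) \<le> b * Inf (G y)" if "0 < b" for b y
    proof -
      have "Inf (G (b *\<^sub>R y)) / b \<le> Inf (G y)"
        using low[OF scale[OF that]] that by (intro cInf_greatest[OF ne]) (simp add: field_simps)
      then show ?thesis using that by (simp add: field_simps)
    qed
    have a: "0 < a" using False that by simp
    have "Inf (G ((1/a) *\<^sub>R (a *\<^sub>R x))) \<le> (1/a) * Inf (G (a *\<^sub>R x))" using a by (intro le) auto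
    then show ?thesis using le[OF a, of x] a by (simp add: field_simps)
  qed
  ultimately show "sublinear (\<lambda>x. Inf (G x))" by (simp add: sublinear_def)
qed

lemma compact_Times_open_tube:
  fixes K :: "'a::topological_space set" and K' :: "'b::topological_space set"
  assumes K: "compact K" "compact K'" and V: "open V" "K \<times> K' \<subseteq> V"
  obtains U U' where "open U" "open U'" "K \<subseteq> U" "K' \<subseteq> U'" "U \<times> U' \<subseteq> V"
  using Wallace_theorem_prod_topology[of euclidean K euclidean K' V] assms that
  by (auto simp: prod_topology_euclidean)

section \<open>Kantorovich duality\<close>

lemma integrable_Lip_b:
  assumes "prob_space \<mu>" "sets \<mu> = sets borel" "f \<in> Lip_b d"
  shows "integrable \<mu> f"
proof -
  interpret prob_space \<mu> by fact
  obtain B where "\<And>x. \<bar>f x\<bar> \<le> B" using Lip_b_bounded[OF assms(3)] by (auto simp: bounded_range_real)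
  then show ?thesis using Lip_b_borel[OF assms(3)] assms(2)
    by (intro integrable_const_bound[of _ B]) (auto simp: measurable_cong_sets[OF assms(2) refl])
qed

lemma measure_integral_Lip_b_bounds:
  assumes \<mu>: "prob_space \<mu>" "sets \<mu> = sets borel" and f: "f \<in> Lip_b d" and A: "A \<in> sets borel"
  shows "(\<And>x. indicator A x \<le> f x) \<Longrightarrow> measure \<mu> A \<le> (LINT x|\<mu>. f x)"
    and "(\<And>x. f x \<le> indicator A x) \<Longrightarrow> (LINT x|\<mu>. f x) \<le> measure \<mu> A"
proof -
  interpret prob_space \<mu> by fact
  have sp: "space \<mu> = UNIV" using sets_eq_imp_space_eq[OF \<mu>(2)] by simp
  have i: "integrable \<mu> (indicator A :: 'a \<Rightarrow> real)" using A \<mu>(2) by (simp add: emeasure_eq_measure)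
  have e: "(LINT x|\<mu>. indicator A x) = measure \<mu> A" by (simp add: sp)
  show "measure \<mu> A \<le> (LINT x|\<mu>. f x)" if "\<And>x. indicator A x \<le> f x"
    unfolding e[symmetric] by (rule integral_mono[OF i integrable_Lip_b[OF \<mu> f]]) (rule that)
  show "(LINT x|\<mu>. f x) \<le> measure \<mu> A" if "\<And>x. f x \<le> indicator A x"
    unfolding e[symmetric] by (rule integral_mono[OF integrable_Lip_b[OF \<mu> f] i]) (rule that)
qed

text \<open>The hypothesis \<open>dual\<close> bounds the dual problem over potentials in
  \<open>Lip_b d\<close> and bounded continuous semidistances below \<open>d\<close>, which is the
  form in which the Hopf-Lax functions deliver it. The outcome of the locale is a plan whose cost
  for \<open>d\<close> itself is at most \<open>C\<close>.\<close>

locale transport_dual =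
  fixes d :: "'a::t2_space \<Rightarrow> 'a \<Rightarrow> ennreal" and \<mu> \<nu> :: "'a measure" and C :: real
  assumes d: "ext_metric_top_space d" and \<mu>: "\<mu> \<in> radon_prob" and \<nu>: "\<nu> \<in> radon_prob" and C: "0 \<le> C"
    and dual: "\<lbrakk>\<phi> \<in> Lip_b d; \<psi> \<in> Lip_b d; \<delta> \<in> bcs d; \<And>x y. \<phi> x + \<psi> y \<le> (\<delta> x y)\<^sup>2\<rbrakk>
      \<Longrightarrow> (LINT x|\<mu>. \<phi> x) + (LINT x|\<nu>. \<psi> x) \<le> C"
begin

sublocale M: prob_space \<mu> using \<mu> by (rule radon_prob_prob_space)
sublocale N: prob_space \<nu> using \<nu> by (rule radon_prob_prob_space)

lemma integrable_M: "f \<in> Lip_b d \<Longrightarrow> integrable \<mu> f" and integrable_N: "f \<in> Lip_b d \<Longrightarrow> integrable \<nu> f"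
  using integrable_Lip_b radon_prob_sets[OF \<mu>] radon_prob_sets[OF \<nu>] M.prob_space_axioms N.prob_space_axioms
  by auto

text \<open>\<open>a\<close> is the price charged per unit of cost. The semidistance belongs to the
  competitor, so that two competitors can be added after passing to the maximum of their
  semidistances.\<close>

definition dual_values :: "('a \<times> 'a) bfun \<Rightarrow> real set" where
  "dual_values h = {(LINT x|\<mu>. \<phi> x) + (LINT x|\<nu>. \<psi> x) + a * C |\<phi> \<psi> a \<delta>.
     \<phi> \<in> Lip_b d \<and> \<psi> \<in> Lip_b d \<and> 0 \<le> a \<and> \<delta> \<in> bcs d \<and>
     (\<forall>x y. bfun_apply h (x, y) \<le> \<phi> x + \<psi> y + a * (\<delta> x y)\<^sup>2)}"

lemma dual_valuesI:
  assumes "\<phi> \<in> Lip_b d" "\<psi> \<in> Lip_b d" "0 \<le> a" "\<delta> \<in> bcs d"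
    "\<And>x y. bfun_apply h (x, y) \<le> \<phi> x + \<psi> y + a * (\<delta> x y)\<^sup>2"
    "z = (LINT x|\<mu>. \<phi> x) + (LINT x|\<nu>. \<psi> x) + a * C"
  shows "z \<in> dual_values h"
  using assms unfolding dual_values_def by blast

lemma dual_valuesE:
  assumes "z \<in> dual_values h"
  obtains \<phi> \<psi> a \<delta> where "\<phi> \<in> Lip_b d" "\<psi> \<in> Lip_b d" "0 \<le> a" "\<delta> \<in> bcs d"
    "\<And>x y. bfun_apply h (x, y) \<le> \<phi> x + \<psi> y + a * (\<delta> x y)\<^sup>2"
    "z = (LINT x|\<mu>. \<phi> x) + (LINT x|\<nu>. \<psi> x) + a * C"
  using assms unfolding dual_values_def by blast

text \<open>A competitor for 0 satisfies
  \<open>- \<phi> x - \<psi> y \<le> a * (\<delta> x y)\<^sup>2\<close>; after division by the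
  price, the negated potentials are admissible in \<open>dual\<close>.\<close>

lemma dual_values_nonneg: assumes "z \<in> dual_values 0" shows "0 \<le> z"
proof -
  obtain \<phi> \<psi> a \<delta> where f: "\<phi> \<in> Lip_b d" "\<psi> \<in> Lip_b d" "0 \<le> a" "\<delta> \<in> bcs d"
    and le: "\<And>x y. 0 \<le> \<phi> x + \<psi> y + a * (\<delta> x y)\<^sup>2"
    and z: "z = (LINT x|\<mu>. \<phi> x) + (LINT x|\<nu>. \<psi> x) + a * C"
    using dual_valuesE[OF assms] by (metis zero_bfun.rep_eq)
  have 1: "- z \<le> e * C" if e: "0 < e" for e
  proof -
    \<comment> \<open>\<open>a\<close> may be 0 and cannot be divided by. Enlarging it by
      \<open>e\<close> costs \<open>e * C\<close>, which disappears in the limit.\<close>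
    define b where "b = a + e"
    have b: "0 < b" "a \<le> b" using e f(3) by (auto simp: b_def)
    have "(LINT x|\<mu>. (- (1/b)) * \<phi> x) + (LINT x|\<nu>. (- (1/b)) * \<psi> x) \<le> C"
    proof (rule dual[OF Lip_b_cmult[OF f(1)] Lip_b_cmult[OF f(2)] f(4)])
      fix x y
      have "0 \<le> (b - a) * (\<delta> x y)\<^sup>2" using b by simp
      then have "- \<phi> x - \<psi> y \<le> b * (\<delta> x y)\<^sup>2" using le[of x y] by (simp add: algebra_simps)
      then show "- (1 / b) * \<phi> x + - (1 / b) * \<psi> y \<le> (\<delta> x y)\<^sup>2" using b by (simp add: field_simps)
    qed
    then have "- (LINT x|\<mu>. \<phi> x) - (LINT x|\<nu>. \<psi> x) \<le> b * C"
      using b by (simp add: field_simps)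
    then show ?thesis by (simp add: z b_def algebra_simps)
  qed
  have "- z \<le> 0"
  proof (rule field_le_epsilon)
    fix e :: real assume e: "0 < e"
    have "- z \<le> (e / (C + 1)) * C" using e C by (intro 1) (auto simp: field_simps)
    also have "\<dots> \<le> e" using e C by (simp add: field_simps)
    finally show "- z \<le> 0 + e" by simp
  qed
  then show ?thesis by simp
qed

lemma dual_values_add:
  assumes "z \<in> dual_values h" "z' \<in> dual_values h'" shows "z + z' \<in> dual_values (h + h')"
proof -
  from dual_valuesE[OF assms(1)] obtain \<phi> \<psi> a \<delta> where f: "\<phi> \<in> Lip_b d" "\<psi> \<in> Lip_b d" "0 \<le> a" "\<delta> \<in> bcs d"
    "\<And>x y. bfun_apply h (x, y) \<le> \<phi> x + \<psi> y + a * (\<delta> x y)\<^sup>2"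
    "z = (LINT x|\<mu>. \<phi> x) + (LINT x|\<nu>. \<psi> x) + a * C" by metis
  from dual_valuesE[OF assms(2)] obtain \<phi>' \<psi>' a' \<delta>' where g: "\<phi>' \<in> Lip_b d" "\<psi>' \<in> Lip_b d" "0 \<le> a'" "\<delta>' \<in> bcs d"
    "\<And>x y. bfun_apply h' (x, y) \<le> \<phi>' x + \<psi>' y + a' * (\<delta>' x y)\<^sup>2"
    "z' = (LINT x|\<mu>. \<phi>' x) + (LINT x|\<nu>. \<psi>' x) + a' * C" by metis
  show ?thesis
  proof (rule dual_valuesI[OF Lip_b_add[OF f(1) g(1)] Lip_b_add[OF f(2) g(2)] _ bcs_max[OF f(4) g(4)]])
    show "0 \<le> a + a'" using f(3) g(3) by simp
    fix x y
    let ?m = "max (\<delta> x y) (\<delta>' x y)"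
    have "a * (\<delta> x y)\<^sup>2 \<le> a * ?m\<^sup>2" "a' * (\<delta>' x y)\<^sup>2 \<le> a' * ?m\<^sup>2"
      using f(3) g(3) bcs_nonneg[OF f(4)] bcs_nonneg[OF g(4)] by (auto intro!: mult_left_mono power_mono)
    then show "bfun_apply (h + h') (x, y) \<le> \<phi> x + \<phi>' x + (\<psi> y + \<psi>' y) + (a + a') * ?m\<^sup>2"
      using f(5)[of x y] g(5)[of x y] unfolding plus_bfun.rep_eq distrib_right by linarith
  qed (simp add: f(6) g(6) integrable_M[OF f(1)] integrable_M[OF g(1)] integrable_N[OF f(2)] integrable_N[OF g(2)]
        algebra_simps)
qed

lemma dual_values_scale:
  assumes "0 < c" "z \<in> dual_values h" shows "c * z \<in> dual_values (c *\<^sub>R h)"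
proof -
  from dual_valuesE[OF assms(2)] obtain \<phi> \<psi> a \<delta> where f: "\<phi> \<in> Lip_b d" "\<psi> \<in> Lip_b d" "0 \<le> a" "\<delta> \<in> bcs d"
    "\<And>x y. bfun_apply h (x, y) \<le> \<phi> x + \<psi> y + a * (\<delta> x y)\<^sup>2"
    "z = (LINT x|\<mu>. \<phi> x) + (LINT x|\<nu>. \<psi> x) + a * C" by metis
  show ?thesis
  proof (rule dual_valuesI[OF Lip_b_cmult[OF f(1), of c] Lip_b_cmult[OF f(2), of c] _ f(4), of "c * a"])
    fix x y
    show "bfun_apply (c *\<^sub>R h) (x, y) \<le> c * \<phi> x + c * \<psi> y + c * a * (\<delta> x y)\<^sup>2"
      using mult_left_mono[OF f(5)[of x y], of c] assms(1)
      by (simp add: scaleR_bfun.rep_eq algebra_simps)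
  qed (use assms(1) f(3) in \<open>auto simp: f(6) algebra_simps\<close>)
qed

lemma dual_values_nonempty: "dual_values h \<noteq> {}"
proof -
  have "bounded (range (bfun_apply h))" using bfun_apply[of h] by simp
  then obtain B where B: "\<And>z. bfun_apply h z \<le> B" unfolding bounded_range_real by (meson abs_le_D1)
  have "(LINT x|\<mu>. B) + (LINT x|\<nu>. 0) + 0 * C \<in> dual_values h"
    by (rule dual_valuesI[OF Lip_b_const[of B] Lip_b_const[of 0] order_refl bcs_zero]) (use B in auto)
  then show ?thesis by auto
qed

lemma functional_exists: "\<exists>l. linear l \<and> (\<forall>h. \<forall>z\<in>dual_values h. l h \<le> z)"
proof -
  have zero: "0 \<in> dual_values 0"
    by (rule dual_valuesI[OF Lip_b_const[of 0] Lip_b_const[of 0] order_refl bcs_zero]) (auto simp: zero_bfun.rep_eq)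
  note I = sublinear_INF[of dual_values, OF dual_values_nonempty dual_values_add dual_values_scale zero dual_values_nonneg]
  obtain l where "linear l" "\<And>h. l h \<le> Inf (dual_values h)" using dominated_linear_exists[OF I(1)] by blast
  then show ?thesis using I(2) by (intro exI[of _ l]) (auto intro: order_trans)
qed

definition functional :: "('a \<times> 'a) bfun \<Rightarrow> real" where
  "functional = (SOME l. linear l \<and> (\<forall>h. \<forall>z\<in>dual_values h. l h \<le> z))"

lemma linear_functional: "linear functional" and functional_le_dual: "z \<in> dual_values h \<Longrightarrow> functional h \<le> z"
  using someI_ex[OF functional_exists] unfolding functional_def by blast+

text \<open>Price 0: this controls the marginals. The companion \<open>functional_cost\<close> uses
  price 1 and zero potentials and controls the cost.\<close>

lemma functional_upper:
  assumes "\<phi> \<in> Lip_b d" "\<psi> \<in> Lip_b d" "\<And>x y. bfun_apply h (x, y) \<le> \<phi> x + \<psi> y"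
  shows "functional h \<le> (LINT x|\<mu>. \<phi> x) + (LINT x|\<nu>. \<psi> x)"
  by (rule functional_le_dual, rule dual_valuesI[OF assms(1,2) order_refl bcs_zero]) (use assms(3) in auto)

lemma functional_cost:
  assumes "\<delta> \<in> bcs d" "\<And>x y. bfun_apply h (x, y) \<le> (\<delta> x y)\<^sup>2"
  shows "functional h \<le> C"
  by (rule functional_le_dual, rule dual_valuesI[OF Lip_b_const[of 0] Lip_b_const[of 0] zero_le_one assms(1)])
    (use assms(2) in auto)

lemma functional_mono: assumes "\<And>z. bfun_apply h z \<le> bfun_apply k z" shows "functional h \<le> functional k"
proof -
  have "functional (h - k) \<le> (LINT x|\<mu>. 0) + (LINT x|\<nu>. 0)"
    by (rule functional_upper[OF Lip_b_const Lip_b_const]) (use assms in \<open>auto simp: minus_bfun.rep_eq\<close>)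
  then show ?thesis using linear_diff[OF linear_functional, of h k] by simp
qed

definition ind :: "('a \<times> 'a) set \<Rightarrow> ('a \<times> 'a) bfun" where "ind A = Abs_bfun (indicator A)"

lemma ind_apply: "bfun_apply (ind A) z = indicator A z"
  unfolding ind_def
  by (subst Abs_bfun_inverse) (auto simp: bounded_range_real indicator_def intro!: exI[of _ 1])

lemma functional_zero: "functional 0 = 0" by (rule linear_0[OF linear_functional])

lemma functional_nonneg: "0 \<le> functional (ind A)"
  using functional_mono[of 0 "ind A"] by (simp add: functional_zero zero_bfun.rep_eq ind_apply)

lemma functional_UNIV: "functional (ind UNIV) = 1"
proof (rule antisym)
  show "functional (ind UNIV) \<le> 1"
    using functional_upper[OF Lip_b_const[of 1] Lip_b_const[of 0], of "ind UNIV"]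
    by (simp add: ind_apply M.prob_space)
  have "functional (- ind UNIV) \<le> -1"
    using functional_upper[OF Lip_b_const[of "-1"] Lip_b_const[of 0], of "- ind UNIV"]
    by (simp add: ind_apply M.prob_space uminus_bfun.rep_eq)
  then show "1 \<le> functional (ind UNIV)" using linear_neg[OF linear_functional] by simp
qed

definition content :: "('a \<times> 'a) set \<Rightarrow> ennreal" where "content A = ennreal (functional (ind A))"

sublocale F: finitely_additive content
proof
  fix A B :: "('a \<times> 'a) set" assume "A \<inter> B = {}"
  then have "ind (A \<union> B) = ind A + ind B"
    by (intro bfun_apply_inject[THEN iffD1] ext)
      (auto simp: ind_apply plus_bfun.rep_eq indicator_def)
  then show "content (A \<union> B) = content A + content B"
    by (simp add: content_def linear_add[OF linear_functional] functional_nonneg)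
qed (simp add: content_def)

definition plan :: "('a \<times> 'a) measure" where "plan = F.radonization"

text \<open>An open set around \<open>K \<times> K'\<close> contains an open rectangle around it,
  and Urysohn functions of the sides bound its indicator from below by
  \<open>\<phi> x + \<psi> y - 1\<close>. As the functional is controlled from above only, this is
  applied to \<open>- ind V\<close>.\<close>

lemma content_tight: assumes e: "0 < e" shows "\<exists>K. compact K \<and> 1 \<le> F.kap K + ennreal e"
proof -
  have e2: "0 < e/2" using e by simp
  obtain K where K: "compact K" "measure \<mu> UNIV \<le> measure \<mu> K + e/2"
    using radon_prob_inner_approx[OF \<mu> _ e2, of UNIV] by auto
  obtain K' where K': "compact K'" "measure \<nu> UNIV \<le> measure \<nu> K' + e/2"
    using radon_prob_inner_approx[OF \<nu> _ e2, of UNIV] by auto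
  have sp: "space \<mu> = UNIV" "space \<nu> = UNIV" by (rule radon_prob_space[OF \<mu>], rule radon_prob_space[OF \<nu>])
  have p1: "measure \<mu> UNIV = 1" "measure \<nu> UNIV = 1" by (rule M.prob_space[unfolded sp], rule N.prob_space[unfolded sp])
  have "ennreal (1 - e) \<le> F.kap (K \<times> K')"
    unfolding F.kap_def
  proof (rule INF_greatest)
    fix V assume "V \<in> {V. open V \<and> K \<times> K' \<subseteq> V}"
    then have V: "open V" "K \<times> K' \<subseteq> V" by auto
    obtain U U' where U: "open U" "open U'" "K \<subseteq> U" "K' \<subseteq> U'" "U \<times> U' \<subseteq> V"
      by (rule compact_Times_open_tube[OF K(1) K'(1) V])
    obtain \<phi> W where \<phi>: "\<phi> \<in> Lip_b d" "\<And>x. 0 \<le> \<phi> x" "\<And>x. \<phi> x \<le> 1" "open W" "K \<subseteq> W"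
      "\<And>x. x \<in> W \<Longrightarrow> \<phi> x = 1" "\<And>x. x \<notin> U \<Longrightarrow> \<phi> x = 0"
      by (rule Lip_b_urysohn[OF d K(1) U(1,3)]) blast
    obtain \<psi> W' where \<psi>: "\<psi> \<in> Lip_b d" "\<And>x. 0 \<le> \<psi> x" "\<And>x. \<psi> x \<le> 1" "open W'" "K' \<subseteq> W'"
      "\<And>x. x \<in> W' \<Longrightarrow> \<psi> x = 1" "\<And>x. x \<notin> U' \<Longrightarrow> \<psi> x = 0"
      by (rule Lip_b_urysohn[OF d K'(1) U(2,4)]) blast
    have "functional (- ind V) \<le> (LINT x|\<mu>. 1 - \<phi> x) + (LINT x|\<nu>. - \<psi> x)"
    proof (rule functional_upper)
      show "(\<lambda>x. 1 - \<phi> x) \<in> Lip_b d" "(\<lambda>x. - \<psi> x) \<in> Lip_b d" by (intro Lip_b_diff Lip_b_const Lip_b_uminus \<phi> \<psi>)+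
      fix x y
      have "\<phi> x + \<psi> y - 1 \<le> indicator V (x, y)"
      proof (cases "(x, y) \<in> V")
        case True then show ?thesis using \<phi>(3)[of x] \<psi>(3)[of y] by simp
      next
        case False
        then have "x \<notin> U \<or> y \<notin> U'" using U(5) by auto
        then show ?thesis using False \<phi>(3)[of x] \<psi>(3)[of y] \<phi>(7)[of x] \<psi>(7)[of y] by auto
      qed
      then show "bfun_apply (- ind V) (x, y) \<le> 1 - \<phi> x + - \<psi> y" by (simp add: uminus_bfun.rep_eq ind_apply)
    qed
    then have "(LINT x|\<mu>. \<phi> x) + (LINT x|\<nu>. \<psi> x) - 1 \<le> functional (ind V)"
      using linear_neg[OF linear_functional, of "ind V"] integrable_M[OF \<phi>(1)] by (simp add: M.prob_space)
    moreover have "measure \<mu> K \<le> (LINT x|\<mu>. \<phi> x)"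
      using \<phi>(2,5,6) by (intro measure_integral_Lip_b_bounds(1)[OF M.prob_space_axioms radon_prob_sets[OF \<mu>] \<phi>(1)]
          borel_compact K) (auto simp: indicator_def)
    moreover have "measure \<nu> K' \<le> (LINT x|\<nu>. \<psi> x)"
      using \<psi>(2,5,6) by (intro measure_integral_Lip_b_bounds(1)[OF N.prob_space_axioms radon_prob_sets[OF \<nu>] \<psi>(1)]
          borel_compact K') (auto simp: indicator_def)
    ultimately show "ennreal (1 - e) \<le> content V"
      unfolding content_def using K K' p1 by (intro ennreal_leI) linarith
  qed
  moreover have "1 \<le> ennreal (1 - e) + ennreal e"
  proof (cases "e \<le> 1")
    case True then show ?thesis using e by (simp add: ennreal_plus[symmetric] del: ennreal_plus)
  next
    case False
    then have "1 \<le> ennreal e" by simp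
    then show ?thesis by (simp add: add_increasing)
  qed
  ultimately have "1 \<le> F.kap (K \<times> K') + ennreal e" by (meson add_right_mono order_trans)
  then show ?thesis using compact_Times[OF K(1) K'(1)] by blast
qed

lemma plan_radon: "plan \<in> radon_prob"
  unfolding plan_def
  by (rule F.radonization_radon_prob[OF _ content_tight]) (simp_all add: content_def functional_UNIV)

text \<open>A compact set over \<open>U\<close> projects onto a compact subset of \<open>U\<close>.
  Its Urysohn function equals 1 on an open \<open>V\<close>, and the cylinder over \<open>V\<close>
  is an admissible open superset for \<open>kap K\<close>. An upper bound on open sets is all that
  \<open>radon_prob_eqI\<close> asks for to identify the marginal.\<close>

lemma plan_fst_le: assumes U: "open U" shows "emeasure plan (fst -` U) \<le> emeasure \<mu> U"
proof -
  have "open (fst -` U :: ('a \<times> 'a) set)" using U by (rule open_vimage_fst)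
  then have "emeasure plan (fst -` U) = F.opn (fst -` U)" by (simp add: plan_def F.emeasure_radonization_open)
  also have "\<dots> \<le> emeasure \<mu> U"
  proof (rule F.opn_least)
    fix K :: "('a \<times> 'a) set" assume K: "compact K" "K \<subseteq> fst -` U"
    have cK: "compact (fst ` K)" "fst ` K \<subseteq> U" using K by (auto intro!: compact_continuous_image continuous_intros)
    obtain \<phi> V where \<phi>: "\<phi> \<in> Lip_b d" "\<And>x. 0 \<le> \<phi> x" "\<And>x. \<phi> x \<le> 1" "open V" "fst ` K \<subseteq> V"
      "\<And>x. x \<in> V \<Longrightarrow> \<phi> x = 1" "\<And>x. x \<notin> U \<Longrightarrow> \<phi> x = 0"
      by (rule Lip_b_urysohn[OF d cK(1) U cK(2)]) blast
    have "F.kap K \<le> content (fst -` V)" using \<phi> by (intro F.kap_le open_vimage_fst) auto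
    also have "\<dots> \<le> ennreal ((LINT x|\<mu>. \<phi> x) + (LINT x|\<nu>. 0))"
      unfolding content_def
      by (intro ennreal_leI functional_upper Lip_b_const \<phi>) (auto simp: ind_apply indicator_def \<phi>)
    also have "\<dots> \<le> ennreal (measure \<mu> U)"
    proof -
      have "(LINT x|\<mu>. \<phi> x) \<le> measure \<mu> U"
        using \<phi>(3,7) U by (intro measure_integral_Lip_b_bounds(2)[OF M.prob_space_axioms radon_prob_sets[OF \<mu>] \<phi>(1)])
          (auto simp: indicator_def)
      then show ?thesis by (intro ennreal_leI) simp
    qed
    finally show "F.kap K \<le> emeasure \<mu> U" by (simp add: M.emeasure_eq_measure)
  qed
  finally show ?thesis .
qed

lemma plan_snd_le: assumes U: "open U" shows "emeasure plan (snd -` U) \<le> emeasure \<nu> U"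
proof -
  have "open (snd -` U :: ('a \<times> 'a) set)" using U by (rule open_vimage_snd)
  then have "emeasure plan (snd -` U) = F.opn (snd -` U)" by (simp add: plan_def F.emeasure_radonization_open)
  also have "\<dots> \<le> emeasure \<nu> U"
  proof (rule F.opn_least)
    fix K :: "('a \<times> 'a) set" assume K: "compact K" "K \<subseteq> snd -` U"
    have cK: "compact (snd ` K)" "snd ` K \<subseteq> U" using K by (auto intro!: compact_continuous_image continuous_intros)
    obtain \<phi> V where \<phi>: "\<phi> \<in> Lip_b d" "\<And>x. 0 \<le> \<phi> x" "\<And>x. \<phi> x \<le> 1" "open V" "snd ` K \<subseteq> V"
      "\<And>x. x \<in> V \<Longrightarrow> \<phi> x = 1" "\<And>x. x \<notin> U \<Longrightarrow> \<phi> x = 0"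
      by (rule Lip_b_urysohn[OF d cK(1) U cK(2)]) blast
    have "F.kap K \<le> content (snd -` V)" using \<phi> by (intro F.kap_le open_vimage_snd) auto
    also have "\<dots> \<le> ennreal ((LINT x|\<mu>. 0) + (LINT x|\<nu>. \<phi> x))"
      unfolding content_def
      by (intro ennreal_leI functional_upper Lip_b_const \<phi>) (auto simp: ind_apply indicator_def \<phi>)
    also have "\<dots> \<le> ennreal (measure \<nu> U)"
    proof -
      have "(LINT x|\<nu>. \<phi> x) \<le> measure \<nu> U"
        using \<phi>(3,7) U by (intro measure_integral_Lip_b_bounds(2)[OF N.prob_space_axioms radon_prob_sets[OF \<nu>] \<phi>(1)])
          (auto simp: indicator_def)
      then show ?thesis by (intro ennreal_leI) simp
    qed
    finally show "F.kap K \<le> emeasure \<nu> U" by (simp add: N.emeasure_eq_measure)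
  qed
  finally show ?thesis .
qed

lemma measurable_fst_snd_borel:
  "fst \<in> borel_measurable (borel :: ('a \<times> 'a) measure)" "snd \<in> borel_measurable (borel :: ('a \<times> 'a) measure)"
  by (auto intro!: borel_measurable_continuous_onI continuous_intros)

lemma plan_in_plans: "plan \<in> plans \<mu> \<nu>"
proof -
  interpret P: prob_space plan using plan_radon by (rule radon_prob_prob_space)
  have m: "fst \<in> plan \<rightarrow>\<^sub>M borel" "snd \<in> plan \<rightarrow>\<^sub>M borel"
    using measurable_fst_snd_borel by (simp_all add: measurable_cong_sets[OF radon_prob_sets[OF plan_radon] refl])
  have "distr plan borel fst = \<mu>"
    using plan_fst_le by (intro radon_prob_eqI[OF \<mu>] P.prob_space_distr m)
      (auto simp: emeasure_distr m radon_prob_space[OF plan_radon])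
  moreover have "distr plan borel snd = \<nu>"
    using plan_snd_le by (intro radon_prob_eqI[OF \<nu>] P.prob_space_distr m)
      (auto simp: emeasure_distr m radon_prob_space[OF plan_radon])
  ultimately show ?thesis using plan_radon by (simp add: plans_def)
qed

end

section \<open>The cost of the plan through a discretised layer cake formula\<close>

lemma layer_sum_full:
  assumes "0 < n" "real m / n < t"
  shows "(\<Sum>k<m. (1 / real n) * of_bool (real (Suc k) / n < t)) = real m / n"
proof -
  have "(\<Sum>k<m. (1 / real n) * of_bool (real (Suc k) / n < t)) = (\<Sum>k<m. 1 / real n)"
  proof (intro sum.cong refl)
    fix k assume "k \<in> {..<m}"
    then have "real (Suc k) / n \<le> real m / n" by (intro divide_right_mono) auto
    then show "(1 / real n) * of_bool (real (Suc k) / n < t) = 1 / real n" using assms by simp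
  qed
  then show ?thesis by simp
qed

text \<open>The sum counts, with weight \<open>1 / n\<close>, the levels \<open>Suc k / n\<close>
  strictly below \<open>t\<close>: a Riemann sum in right endpoints for the length of the interval
  from 0 to \<open>t\<close>. It therefore stays below \<open>t\<close>, and up to height
  \<open>m / n\<close> it misses at most one mesh.\<close>

lemma layer_sum_le:
  assumes n: "0 < n" and "0 \<le> t"
  shows "(\<Sum>k<m. (1 / real n) * of_bool (real (Suc k) / n < t)) \<le> t"
proof (induction m)
  case (Suc m)
  show ?case
  proof (cases "real (Suc m) / n < t")
    case True
    then show ?thesis using layer_sum_full[OF n True] by simp
  qed (use Suc in simp)
qed (use assms in simp)

lemma layer_sum_ge:
  assumes n: "0 < n"
  shows "min t (real m / n) \<le> 1 / n + (\<Sum>k<m. (1 / real n) * of_bool (real (Suc k) / n < t))"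
proof (induction m)
  case (Suc m)
  show ?case
  proof (cases "real m / n < t")
    case True
    have "real (Suc m) / n = 1 / n + real m / n" by (simp add: add_divide_distrib)
    moreover have "real m / n \<le> (\<Sum>k<Suc m. (1 / real n) * of_bool (real (Suc k) / n < t))"
      unfolding sum.lessThan_Suc layer_sum_full[OF n True] by simp
    ultimately show ?thesis by linarith
  next
    case False
    then have "min t (real (Suc m) / n) = min t (real m / n)" using n by (simp add: min_def field_simps)
    also have "\<dots> \<le> 1 / n + (\<Sum>k<Suc m. (1 / real n) * of_bool (real (Suc k) / n < t))"
      using Suc by (simp add: add.assoc[symmetric] add_increasing2)
    finally show ?thesis .
  qed
next
  case 0
  have "min t 0 \<le> 0" "0 \<le> 1 / real n" by auto
  then have "min t 0 \<le> 1 / real n" by linarith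
  then show ?case by simp
qed

lemma ennreal_less_power2_iff:
  assumes "0 \<le> c" shows "ennreal c < x\<^sup>2 \<longleftrightarrow> ennreal (sqrt c) < x"
proof (cases x)
  case (real r)
  have "c < r\<^sup>2 \<longleftrightarrow> sqrt c < r"
    using real assms by (metis real_sqrt_abs abs_of_nonneg real_sqrt_less_iff)
  then show ?thesis using real assms by (simp add: ennreal_power ennreal_less_iff)
qed (simp add: power2_eq_square ennreal_top_mult less_top[symmetric])

lemma esqrt_le: "a \<le> ennreal c \<Longrightarrow> 0 \<le> c \<Longrightarrow> esqrt a \<le> ennreal (sqrt c)"
  by (cases a) (auto simp: esqrt_def top_unique intro!: ennreal_leI)

lemma bfun_apply_sum: "bfun_apply (\<Sum>k\<in>I. f k) z = (\<Sum>k\<in>I. bfun_apply (f k) z)"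
  by (induction I rule: infinite_finite_induct) (auto simp: zero_bfun.rep_eq plus_bfun.rep_eq)

context transport_dual begin

definition level :: "real \<Rightarrow> ('a \<times> 'a) set" where "level c = {z. ennreal c < (d (fst z) (snd z))\<^sup>2}"

lemma level_eq: "0 \<le> c \<Longrightarrow> level c = {z. ennreal (sqrt c) < d (fst z) (snd z)}"
  by (simp add: level_def ennreal_less_power2_iff)

lemma open_level: "0 \<le> c \<Longrightarrow> open (level c)"
  by (simp add: level_eq open_less_ext_metric[OF d])

text \<open>A Dini argument: the sets where a single \<open>\<delta>\<close> exceeds
  \<open>sqrt c\<close> are open and cover \<open>K\<close>, and the maximum over a finite subcover
  works on all of \<open>K\<close>.\<close>

lemma compact_level_bcs:
  assumes K: "compact K" "K \<subseteq> level c" and c: "0 \<le> c"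
  shows "\<exists>\<delta>\<in>bcs d. \<forall>z\<in>K. c < (\<delta> (fst z) (snd z))\<^sup>2"
proof -
  let ?W = "\<lambda>\<delta>. {z. sqrt c < \<delta> (fst z) (snd z)}"
  have op: "open (?W \<delta>)" if "\<delta> \<in> bcs d" for \<delta>
    using bcs_continuous[OF that] by (intro open_Collect_less continuous_intros)
  have cov: "K \<subseteq> (\<Union>\<delta>\<in>bcs d. ?W \<delta>)"
    using K(2) c by (auto simp: level_eq less_ext_metric_iff[OF d] ennreal_less_iff subset_eq)
  obtain F where F: "F \<subseteq> bcs d" "finite F" "K \<subseteq> (\<Union>\<delta>\<in>F. ?W \<delta>)"
    by (rule compactE_image[OF K(1) op cov])
  have "\<exists>\<delta>\<in>bcs d. (\<Union>\<delta>\<in>F. ?W \<delta>) \<subseteq> ?W \<delta>" using F(2,1)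
  proof (induction F)
    case empty then show ?case using bcs_zero by auto
  next
    case (insert \<delta> F)
    then obtain \<delta>' where "\<delta>' \<in> bcs d" "(\<Union>\<delta>\<in>F. ?W \<delta>) \<subseteq> ?W \<delta>'" by auto
    then show ?case using insert bcs_max[of \<delta> d \<delta>']
      by (intro bexI[of _ "\<lambda>x y. max (\<delta> x y) (\<delta>' x y)"]) (auto simp: less_max_iff_disj)
  qed
  then obtain \<delta> where \<delta>: "\<delta> \<in> bcs d" "K \<subseteq> ?W \<delta>" using F(3) by blast
  have "c < (\<delta> (fst z) (snd z))\<^sup>2" if "z \<in> K" for z
  proof -
    have "sqrt c < \<delta> (fst z) (snd z)" using \<delta>(2) that by auto
    then have "(sqrt c)\<^sup>2 < (\<delta> (fst z) (snd z))\<^sup>2" using c by (intro power_strict_mono) auto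
    then show ?thesis using c by simp
  qed
  then show ?thesis using \<delta>(1) by blast
qed

lemma compact_levels_bcs:
  assumes K: "\<And>k. compact (K k)" "\<And>k. K k \<subseteq> level (c k)" and c: "\<And>k. 0 \<le> c k"
  shows "\<exists>\<delta>\<in>bcs d. \<forall>k<m::nat. \<forall>z\<in>K k. c k < (\<delta> (fst z) (snd z))\<^sup>2"
proof (induction m)
  case 0 then show ?case using bcs_zero by auto
next
  case (Suc m)
  then obtain \<delta> where \<delta>: "\<delta> \<in> bcs d" "\<And>k z. k < m \<Longrightarrow> z \<in> K k \<Longrightarrow> c k < (\<delta> (fst z) (snd z))\<^sup>2" by auto
  obtain \<delta>' where \<delta>': "\<delta>' \<in> bcs d" "\<And>z. z \<in> K m \<Longrightarrow> c m < (\<delta>' (fst z) (snd z))\<^sup>2"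
    using compact_level_bcs[OF K[of m] c] by auto
  have sq: "(\<delta> x y)\<^sup>2 \<le> (max (\<delta> x y) (\<delta>' x y))\<^sup>2" "(\<delta>' x y)\<^sup>2 \<le> (max (\<delta> x y) (\<delta>' x y))\<^sup>2" for x y
    using bcs_nonneg[OF \<delta>(1), of x y] bcs_nonneg[OF \<delta>'(1), of x y] by (auto intro!: power_mono)
  show ?case
    by (intro bexI[of _ "\<lambda>x y. max (\<delta> x y) (\<delta>' x y)"] bcs_max \<delta> \<delta>')
      (auto simp: less_Suc_eq intro: less_le_trans[OF \<delta>(2) sq(1)] less_le_trans[OF \<delta>'(2) sq(2)])
qed

lemma functional_layers:
  assumes \<delta>: "\<delta> \<in> bcs d" and n: "0 < n"
  shows "(\<Sum>k<m. (1 / real n) * functional (ind {z. real (Suc k) / n < (\<delta> (fst z) (snd z))\<^sup>2})) \<le> C"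
proof -
  let ?h = "\<Sum>k<m. (1 / real n) *\<^sub>R ind {z. real (Suc k) / n < (\<delta> (fst z) (snd z))\<^sup>2}"
  have "bfun_apply ?h (x, y) = (\<Sum>k<m. (1 / real n) * of_bool (real (Suc k) / n < (\<delta> x y)\<^sup>2))" for x y
    by (simp add: bfun_apply_sum scaleR_bfun.rep_eq ind_apply indicator_def)
  then have "functional ?h \<le> C" using layer_sum_le[OF n] by (intro functional_cost[OF \<delta>]) simp
  then show ?thesis by (simp add: linear_sum[OF linear_functional] linear_scale[OF linear_functional])
qed

text \<open>The functional bounds the cost of one bounded continuous \<open>\<delta>\<close>,
  whereas the levels are those of \<open>d\<close>. Each open level is exhausted by a compact set,
  and one \<open>\<delta>\<close> exceeds the required heights on all these compact sets at once.
  Its own levels are open neighbourhoods of them and carry their content.\<close>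

lemma plan_layers:
  assumes n: "0 < n"
  shows "(\<Sum>k<m. ennreal (1 / real n) * emeasure plan (level (real (Suc k) / n))) \<le> ennreal C"
proof (rule ennreal_le_epsilon)
  fix e :: real assume e: "0 < e"
  define c where "c k = real (Suc k) / n" for k
  have c0: "0 \<le> c k" for k by (simp add: c_def)
  \<comment> \<open>Chosen so that \<open>m\<close> layers of weight \<open>1 / n\<close> lose at
    most \<open>e\<close> together.\<close>
  define e' where "e' = e * n / (m + 1)"
  have e': "0 < e'" using e n by (simp add: e'_def)
  have "\<exists>K. compact K \<and> K \<subseteq> level (c k) \<and> F.opn (level (c k)) \<le> F.kap K + ennreal e'" for k
    using F.opn_approx[OF e', of "level (c k)"] by metis
  then obtain K where K: "\<And>k. compact (K k)" "\<And>k. K k \<subseteq> level (c k)"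
    "\<And>k. F.opn (level (c k)) \<le> F.kap (K k) + ennreal e'" by metis
  obtain \<delta> where \<delta>: "\<delta> \<in> bcs d" "\<And>k z. k < m \<Longrightarrow> z \<in> K k \<Longrightarrow> c k < (\<delta> (fst z) (snd z))\<^sup>2"
    using compact_levels_bcs[of K c m, OF K(1,2) c0] by blast
  let ?B = "\<lambda>k. {z. c k < (\<delta> (fst z) (snd z))\<^sup>2}"
  have oB: "open (?B k)" for k
    using bcs_continuous[OF \<delta>(1)] by (intro open_Collect_less continuous_intros)
  have 1: "emeasure plan (level (c k)) \<le> ennreal (functional (ind (?B k)) + e')" if "k < m" for k
  proof -
    have "emeasure plan (level (c k)) = F.opn (level (c k))"
      unfolding plan_def by (intro F.emeasure_radonization_open open_level c0)
    also have "\<dots> \<le> F.kap (K k) + ennreal e'" by (rule K)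
    also have "F.kap (K k) \<le> content (?B k)" using \<delta>(2)[OF that] by (intro F.kap_le oB) auto
    finally show ?thesis using e' by (simp add: content_def functional_nonneg add_right_mono)
  qed
  have "(\<Sum>k<m. ennreal (1 / real n) * emeasure plan (level (c k)))
      \<le> (\<Sum>k<m. ennreal ((1 / real n) * (functional (ind (?B k)) + e')))"
  proof (rule sum_mono)
    fix k assume "k \<in> {..<m}"
    then have "ennreal (1 / real n) * emeasure plan (level (c k)) \<le> ennreal (1 / real n) * ennreal (functional (ind (?B k)) + e')"
      by (intro mult_left_mono 1) auto
    also have "\<dots> = ennreal ((1 / real n) * (functional (ind (?B k)) + e'))"
      using e' by (intro ennreal_mult[symmetric]) (auto intro: add_nonneg_nonneg functional_nonneg)
    finally show "ennreal (1 / real n) * emeasure plan (level (c k)) \<le> \<dots>" .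
  qed
  also have "\<dots> = ennreal (\<Sum>k<m. (1 / real n) * (functional (ind (?B k)) + e'))"
    using e' by (intro sum_ennreal) (auto intro!: divide_nonneg_nonneg add_nonneg_nonneg functional_nonneg)
  also have "(\<Sum>k<m. (1 / real n) * (functional (ind (?B k)) + e'))
      = (\<Sum>k<m. (1 / real n) * functional (ind (?B k))) + real m * e' / n"
    by (simp add: distrib_left sum.distrib add_divide_distrib)
  also have "ennreal \<dots> \<le> ennreal (C + e)"
  proof (intro ennreal_leI add_mono)
    show "(\<Sum>k<m. (1 / real n) * functional (ind (?B k))) \<le> C" unfolding c_def by (rule functional_layers[OF \<delta>(1) n])
    have "real m * e' / n = e * (real m / (m + 1))" using n by (simp add: e'_def)
    also have "\<dots> \<le> e" using e by (intro mult_left_le) auto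
    finally show "real m * e' / n \<le> e" .
  qed
  finally show "(\<Sum>k<m. ennreal (1 / real n) * emeasure plan (level (real (Suc k) / n))) \<le> ennreal C + ennreal e"
    using C e by (simp add: c_def)
qed

lemma plan_cost: "(\<integral>\<^sup>+ (x, y). (d x y)\<^sup>2 \<partial>plan) \<le> ennreal C"
proof -
  let ?g = "\<lambda>z. (d (fst z) (snd z))\<^sup>2"
  interpret P: prob_space plan using plan_radon by (rule radon_prob_prob_space)
  note [measurable_cong] = radon_prob_sets[OF plan_radon]
  have [measurable]: "(\<lambda>z. d (fst z) (snd z)) \<in> borel_measurable borel" by (rule borel_measurable_ext_metric[OF d])
  have [measurable]: "level c \<in> sets borel" if "0 \<le> c" for c using open_level[OF that] by simp
  have pt: "min (?g z) (ennreal (real m / n)) \<le> ennreal (1 / n) + (\<Sum>k<m. ennreal (1 / real n) * indicator (level (real (Suc k) / n)) z)"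
    if n: "0 < n" for z n m
  proof (cases "?g z")
    case (real t)
    have *: "ennreal (1 / real n) * indicator (level (real (Suc k) / n)) z = ennreal ((1 / real n) * of_bool (real (Suc k) / n < t))" for k
      using real by (auto simp: level_def indicator_def ennreal_less_iff)
    have "min (?g z) (ennreal (real m / n)) = ennreal (min t (real m / n))"
      using real by (simp add: min_def ennreal_le_iff)
    also have "\<dots> \<le> ennreal (1 / n + (\<Sum>k<m. (1 / real n) * of_bool (real (Suc k) / n < t)))"
      by (intro ennreal_leI layer_sum_ge n)
    also have "\<dots> = ennreal (1 / n) + (\<Sum>k<m. ennreal ((1 / real n) * of_bool (real (Suc k) / n < t)))"
      by (subst ennreal_plus) (auto intro!: sum_nonneg simp: sum_ennreal)
    finally show ?thesis unfolding * .
  next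
    case top
    then have "(\<Sum>k<m. ennreal (1 / real n) * indicator (level (real (Suc k) / n)) z) = (\<Sum>k<m. ennreal (1 / real n))"
      by (intro sum.cong) (auto simp: level_def)
    also have "\<dots> = ennreal (\<Sum>k<m. 1 / real n)" by (intro sum_ennreal) auto
    finally have "(\<Sum>k<m. ennreal (1 / real n) * indicator (level (real (Suc k) / n)) z) = ennreal (real m / n)" by simp
    then show ?thesis using top by (simp add: add_increasing)
  qed
  \<comment> \<open>Truncation at height \<open>N\<close> takes \<open>n * N\<close> layers of
    thickness \<open>1 / n\<close>; the discretisation error is the constant \<open>1 / n\<close>,
    with the same integral under a probability.\<close>
  have 1: "(\<integral>\<^sup>+ z. min (?g z) (of_nat N) \<partial>plan) \<le> ennreal C" for N
  proof (rule ennreal_le_epsilon)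
    fix e :: real assume e: "0 < e"
    then obtain n :: nat where n: "0 < n" "1 / n < e" using nat_approx_posE[OF e] by (metis zero_less_Suc)
    have "real (n * N) / n = N" using n by simp
    then have "(\<integral>\<^sup>+ z. min (?g z) (of_nat N) \<partial>plan)
       \<le> (\<integral>\<^sup>+ z. ennreal (1 / n) + (\<Sum>k<n*N. ennreal (1 / real n) * indicator (level (real (Suc k) / n)) z) \<partial>plan)"
      using pt[OF n(1), of _ "n * N"] by (intro nn_integral_mono) (simp add: ennreal_of_nat_eq_real_of_nat)
    also have "\<dots> = (\<integral>\<^sup>+ z. ennreal (1 / n) \<partial>plan)
        + (\<integral>\<^sup>+ z. (\<Sum>k<n*N. ennreal (1 / real n) * indicator (level (real (Suc k) / n)) z) \<partial>plan)"
      by (intro nn_integral_add) measurable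
    also have "(\<integral>\<^sup>+ z. (\<Sum>k<n*N. ennreal (1 / real n) * indicator (level (real (Suc k) / n)) z) \<partial>plan)
        = (\<Sum>k<n*N. \<integral>\<^sup>+ z. ennreal (1 / real n) * indicator (level (real (Suc k) / n)) z \<partial>plan)"
      by (intro nn_integral_sum) measurable
    also have "\<dots> = (\<Sum>k<n*N. ennreal (1 / real n) * emeasure plan (level (real (Suc k) / n)))"
      by (intro sum.cong refl nn_integral_cmult_indicator) measurable
    also have "(\<integral>\<^sup>+ z. ennreal (1 / n) \<partial>plan) = ennreal (1 / n)"
      by (simp add: P.emeasure_space_1)
    also have "ennreal (1 / n) + (\<Sum>k<n*N. ennreal (1 / real n) * emeasure plan (level (real (Suc k) / n))) \<le> ennreal e + ennreal C"
      using n by (intro add_mono plan_layers ennreal_leI) auto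
    finally show "(\<integral>\<^sup>+ z. min (?g z) (of_nat N) \<partial>plan) \<le> ennreal C + ennreal e" by (simp add: add.commute)
  qed
  have sup: "?g z = (SUP N. min (?g z) (of_nat N))" for z
  proof (rule antisym)
    show "(SUP N. min (?g z) (of_nat N)) \<le> ?g z" by (rule SUP_least) simp
    show "?g z \<le> (SUP N. min (?g z) (of_nat N))"
    proof (cases "?g z")
      case (real t)
      obtain N :: nat where "t \<le> N" using real_arch_simple by blast
      then have "?g z \<le> min (?g z) (of_nat N)" using real by (simp add: ennreal_of_nat_eq_real_of_nat)
      also have "\<dots> \<le> (SUP N. min (?g z) (of_nat N))" by (rule SUP_upper) simp
      finally show ?thesis .
    next
      case top
      then show ?thesis by (simp add: ennreal_SUP_of_nat_eq_top)
    qed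
  qed
  have "(\<integral>\<^sup>+ (x, y). (d x y)\<^sup>2 \<partial>plan) = (\<integral>\<^sup>+ z. (SUP N. min (?g z) (of_nat N)) \<partial>plan)"
    by (subst sup[symmetric], intro nn_integral_cong) (auto split: prod.splits)
  also have "\<dots> = (SUP N. \<integral>\<^sup>+ z. min (?g z) (of_nat N) \<partial>plan)"
    by (intro nn_integral_monotone_convergence_SUP) (auto simp: incseq_def le_fun_def min.coboundedI2)
  also have "\<dots> \<le> ennreal C" by (intro SUP_least 1)
  finally show ?thesis .
qed

theorem W2_le: "W2 d \<mu> \<nu> \<le> ennreal (sqrt C)"
proof -
  have "(INF \<pi>\<in>plans \<mu> \<nu>. \<integral>\<^sup>+ (x, y). (d x y)\<^sup>2 \<partial>\<pi>) \<le> ennreal C"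
    by (rule INF_lower2[OF plan_in_plans]) (rule plan_cost)
  then show ?thesis unfolding W2_def by (rule esqrt_le[OF _ C])
qed

end

section \<open>Lebesgue differentiation on the line\<close>

lemma set_integrable_lborel: "integrable lborel f \<Longrightarrow> A \<in> sets borel \<Longrightarrow> set_integrable lborel A (f :: real \<Rightarrow> real)"
  unfolding set_integrable_def by (intro integrable_mult_indicator) auto

lemma set_integrable_const_Icc: "set_integrable lborel {a..b::real} (\<lambda>_. c :: real)"
proof -
  have "emeasure lborel {a..b} < \<infinity>" by (rule emeasure_bounded_finite) simp
  then have "integrable lborel (indicator {a..b} :: real \<Rightarrow> real)" by (intro integrable_real_indicator) auto
  then show ?thesis by (simp add: set_integrable_def)
qed

lemma LBINT_Icc_combine:
  fixes f :: "real \<Rightarrow> real"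
  assumes "integrable lborel f" "a \<le> b" "b \<le> c"
  shows "(LBINT x:{a..c}. f x) = (LBINT x:{a..b}. f x) + (LBINT x:{b..c}. f x)"
proof -
  have "(LBINT x:{a..c}. f x) = (LBINT x:{a..b} \<union> {b<..c}. f x)"
    using assms by (auto intro!: arg_cong[where f="\<lambda>A. LBINT x:A. f x"])
  also have "\<dots> = (LBINT x:{a..b}. f x) + (LBINT x:{b<..c}. f x)"
    using assms by (intro set_integral_Un set_integrable_lborel) auto
  also have "(LBINT x:{b<..c}. f x) = (LBINT x:{b..c}. f x)"
    unfolding set_lebesgue_integral_def
    by (intro integral_cong_AE borel_measurable_scaleR borel_measurable_indicator borel_measurable_integrable[OF assms(1)])
      (use AE_lborel_singleton[of b] in \<open>auto elim!: eventually_mono simp: indicator_def\<close>)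
  finally show ?thesis .
qed

text \<open>The outer measure of the bad set is estimated by a Vitali cover inside an open
  neighbourhood of \<open>{f < p}\<close> that is tight for the finite measure \<open>(1 + \<bar>f\<bar>) dx\<close>; the bad set
  itself need not be measurable.\<close>

lemma negligible_upper_average:
  fixes f :: "real \<Rightarrow> real"
  assumes f: "integrable lborel f" and pq: "p < q"
    and E: "\<And>t e. t \<in> E \<Longrightarrow> 0 < e \<Longrightarrow>
      \<exists>a b. a \<le> t \<and> t \<le> b \<and> a < b \<and> b - a < e \<and> q * (b - a) < (LBINT x:{a..b}. f x)"
    and Ef: "\<And>t. t \<in> E \<Longrightarrow> f t < p" and En: "E \<subseteq> {- N<..<N}"
  shows "negligible E"
  unfolding negligible_outer_le
proof (intro allI impI)
  fix e0 :: real assume e0: "0 < e0"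
  note [measurable] = borel_measurable_integrable[OF f]
  \<comment> \<open>The final comparison loses the factor \<open>1 + \<bar>p\<bar>\<close>; this
    \<open>e\<close> turns the loss into \<open>e0 * (q - p)\<close>.\<close>
  define e where "e = e0 * (q - p) / (1 + \<bar>p\<bar>)"
  have e: "0 < e" using e0 pq by (simp add: e_def)
  let ?J = "{- N<..<N}"
  have iJ: "integrable lborel (indicator ?J :: real \<Rightarrow> real)"
    by (cases "- N \<le> N") auto
  define \<kappa> where "\<kappa> = density lborel (\<lambda>x. ennreal (indicator ?J x * (1 + \<bar>f x\<bar>)))"
  have \<kappa>_eq: "emeasure \<kappa> A = ennreal (LBINT x:A \<inter> ?J. 1 + \<bar>f x\<bar>)"
    and \<kappa>_int: "set_integrable lborel (A \<inter> ?J) (\<lambda>x. 1 + \<bar>f x\<bar>)" if [measurable]: "A \<in> sets borel" for A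
  proof -
    show i: "set_integrable lborel (A \<inter> ?J) (\<lambda>x. 1 + \<bar>f x\<bar>)"
    proof (rule set_integral_add)
      show "set_integrable lborel (A \<inter> ?J) (\<lambda>x. 1::real)"
        unfolding set_integrable_def
        by (rule Bochner_Integration.integrable_bound[OF iJ]) (auto simp: indicator_def)
      show "set_integrable lborel (A \<inter> ?J) (\<lambda>x. \<bar>f x\<bar>)" using f by (intro set_integrable_lborel) auto
    qed
    have "emeasure \<kappa> A = (\<integral>\<^sup>+ x. ennreal (indicator (A \<inter> ?J) x * (1 + \<bar>f x\<bar>)) \<partial>lborel)"
      unfolding \<kappa>_def by (subst emeasure_density) (auto intro!: nn_integral_cong simp: indicator_def)
    also have "\<dots> = ennreal (LBINT x:A \<inter> ?J. 1 + \<bar>f x\<bar>)"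
      using i unfolding set_lebesgue_integral_def set_integrable_def
      by (subst nn_integral_eq_integral) (auto simp: real_scaleR_def)
    finally show "emeasure \<kappa> A = ennreal (LBINT x:A \<inter> ?J. 1 + \<bar>f x\<bar>)" .
  qed
  have i\<kappa>: "integrable lborel (\<lambda>x. indicator (U - A) x * (1 + \<bar>f x\<bar>))" if "U \<in> sets borel" "A \<in> sets borel" "U \<subseteq> ?J" for U A
  proof -
    have "(U - A) \<inter> ?J = U - A" using that(3) by auto
    then show ?thesis using \<kappa>_int[of "U - A"] that by (simp add: set_integrable_def)
  qed
  have sk: "sets \<kappa> = sets borel" by (simp add: \<kappa>_def)
  have k_fin: "emeasure \<kappa> (space \<kappa>) \<noteq> \<infinity>" using \<kappa>_eq[of UNIV] by (simp add: \<kappa>_def)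
  interpret K: finite_measure \<kappa> using k_fin by (intro finite_measureI) simp
  define A where "A = {x \<in> ?J. f x < p}"
  have A[measurable]: "A \<in> sets borel" unfolding A_def by measurable
  have EA: "E \<subseteq> A" using Ef En by (auto simp: A_def)
  have "emeasure \<kappa> A < emeasure \<kappa> A + ennreal e" using e by (simp add: K.emeasure_eq_measure)
  then have "(INF U \<in> {U. A \<subseteq> U \<and> open U}. emeasure \<kappa> U) < emeasure \<kappa> A + ennreal e"
    using outer_regular[OF sk k_fin A] by simp
  then obtain U0 where U0: "A \<subseteq> U0" "open U0" "emeasure \<kappa> U0 < emeasure \<kappa> A + ennreal e"
    unfolding INF_less_iff by auto
  define U where "U = U0 \<inter> ?J"
  have U: "open U" "A \<subseteq> U" "U \<subseteq> ?J" using U0 by (auto simp: U_def A_def)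
  have [measurable]: "U \<in> sets borel" "U0 \<in> sets borel" using U U0 by auto
  have small: "(LBINT x:U - A. 1 + \<bar>f x\<bar>) \<le> e"
  proof -
    have "measure \<kappa> (U0 - A) = measure \<kappa> U0 - measure \<kappa> A" using U0 by (intro K.finite_measure_Diff) (auto simp: sk)
    moreover have "measure \<kappa> U0 < measure \<kappa> A + e"
      using U0(3) e by (simp add: K.emeasure_eq_measure ennreal_plus[symmetric] ennreal_less_iff del: ennreal_plus)
    ultimately have "measure \<kappa> (U0 - A) \<le> e" by simp
    moreover have "measure \<kappa> (U0 - A) = (LBINT x:(U0 - A) \<inter> ?J. 1 + \<bar>f x\<bar>)"
      using \<kappa>_eq[of "U0 - A"] by (simp add: measure_def set_lebesgue_integral_def Bochner_Integration.integral_nonneg)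
    moreover have "(U0 - A) \<inter> ?J = U - A" by (auto simp: U_def)
    ultimately show ?thesis by simp
  qed
  note i\<kappa> = i\<kappa>[OF \<open>U \<in> sets borel\<close> A U(3)]
  have intF: "set_integrable lborel B f" if "B \<in> sets borel" for B using f that by (rule set_integrable_lborel)

  \<comment> \<open>An interval is coded by its midpoint and radius. It contains the point of
    \<open>E\<close> it belongs to without being centred there, which the covering theorem
    allows.\<close>
  define I where "I = {(c, r). 0 < r \<and> cball c r \<subseteq> U \<and> q * (2 * r) < (LBINT x:cball c r. f x)}"
  have Ipos: "0 < snd i" if "i \<in> I" for i using that by (auto simp: I_def)
  have Icov: "\<exists>i. i \<in> I \<and> t \<in> cball (fst i) (snd i) \<and> snd i < \<epsilon>" if t: "t \<in> E" "0 < \<epsilon>" for t \<epsilon>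
  proof -
    have "t \<in> U" using t EA U by auto
    then obtain \<delta> where \<delta>: "0 < \<delta>" "ball t \<delta> \<subseteq> U" using U(1) open_contains_ball by blast
    obtain a b where ab: "a \<le> t" "t \<le> b" "a < b" "b - a < min \<epsilon> \<delta>" "q * (b - a) < (LBINT x:{a..b}. f x)"
      using E[OF t(1), of "min \<epsilon> \<delta>"] t \<delta> by auto
    have cb: "cball ((a + b) / 2) ((b - a) / 2) = {a..b}"
      by (simp add: cball_eq_atLeastAtMost field_simps)
    have "{a..b} \<subseteq> ball t \<delta>" using ab by (auto simp: dist_real_def)
    moreover have "q * (2 * ((b - a) / 2)) = q * (b - a)" "0 < (b - a) / 2" using ab by auto
    ultimately have "((a + b) / 2, (b - a) / 2) \<in> I"
      unfolding I_def mem_Collect_eq prod.case cb using ab(5) \<delta>(2) by (intro conjI) (auto simp only:)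
    moreover have "t \<in> cball ((a + b) / 2) ((b - a) / 2)" using ab unfolding cb by simp
    ultimately show "\<exists>i. i \<in> I \<and> t \<in> cball (fst i) (snd i) \<and> snd i < \<epsilon>"
      using ab by (intro exI[of _ "((a + b) / 2, (b - a) / 2)"]) auto
  qed
  obtain D where D: "countable D" "D \<subseteq> I"
    "pairwise (\<lambda>i j. disjnt (cball (fst i) (snd i)) (cball (fst j) (snd j))) D"
    "negligible (E - (\<Union>i\<in>D. cball (fst i) (snd i)))"
    by (rule Vitali_covering_theorem_cballs[of I snd E fst, OF Ipos Icov])
  let ?B = "\<lambda>i. cball (fst i) (snd i) :: real set"
  have fin: "measure lborel (\<Union>i\<in>F. ?B i) \<le> e0" if F: "F \<subseteq> D" "finite F" for F
  proof -
    let ?S = "\<Union>i\<in>F. ?B i"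
    have ID: "0 < snd i \<and> ?B i \<subseteq> U \<and> q * (2 * snd i) < (LBINT x:?B i. f x)" if "i \<in> F" for i
    proof -
      have "i \<in> I" using F(1) D(2) that by blast
      then show ?thesis unfolding I_def mem_Collect_eq case_prod_beta .
    qed
    have S: "?S \<subseteq> U" using ID by blast
    have [measurable]: "?S \<in> sets borel" using F by (intro sets.finite_UN) auto
    have dj: "disjoint_family_on ?B F"
      using D(3) F unfolding disjoint_family_on_def pairwise_def disjnt_def by blast
    have iS: "integrable lborel (\<lambda>x. indicator ?S x * c)" for c :: real
    proof -
      have "?S \<subseteq> {- N..N}" using S U(3) by force
      then have "bounded ?S" by (rule bounded_subset[OF bounded_closed_interval])
      then have "emeasure lborel ?S < \<infinity>" by (rule emeasure_bounded_finite)
      then have "integrable lborel (indicator ?S :: real \<Rightarrow> real)" by (intro integrable_real_indicator) auto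
      then show ?thesis by (rule integrable_mult_left)
    qed
    have "(LBINT x:?S. q - f x) = (\<Sum>i\<in>F. LBINT x:?B i. q - f x)"
    proof (intro set_integral_finite_Union F dj)
      fix i assume "i \<in> F"
      have "set_integrable lborel (?B i) (\<lambda>x. q)"
        by (simp only: cball_eq_atLeastAtMost set_integrable_const_Icc)
      then show "set_integrable lborel (?B i) (\<lambda>x. q - f x)" by (intro set_integral_diff intF) auto
    qed auto
    also have "\<dots> \<le> (\<Sum>i\<in>F. 0)"
    proof (rule sum_mono)
      fix i assume "i \<in> F"
      then have i: "0 < snd i" "q * (2 * snd i) < (LBINT x:?B i. f x)" using ID by auto
      have "set_integrable lborel (?B i) (\<lambda>x. q)"
        by (simp only: cball_eq_atLeastAtMost set_integrable_const_Icc)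
      then have "(LBINT x:?B i. q - f x) = (LBINT x:?B i. q) - (LBINT x:?B i. f x)" by (intro set_integral_diff intF) auto
      also have "(LBINT x:?B i. q) = q * (2 * snd i)"
        using i by (simp add: set_lebesgue_integral_def cball_eq_atLeastAtMost)
      finally show "(LBINT x:?B i. q - f x) \<le> 0" using i by simp
    qed
    finally have "(LBINT x:?S. q - f x) \<le> 0" by simp
    \<comment> \<open>On \<open>A\<close> one has \<open>f < p\<close>, so \<open>q - f\<close>
      exceeds \<open>q - p\<close>. Off \<open>A\<close> only a crude bound by
      \<open>(1 + \<bar>p\<bar>) * (1 + \<bar>f x\<bar>)\<close> is available, but
      \<open>U - A\<close> has small mass for exactly this weight.\<close>
    moreover have "(LINT x|lborel. indicator ?S x * (q - p) - (1 + \<bar>p\<bar>) * (indicator (U - A) x * (1 + \<bar>f x\<bar>)))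
        \<le> (LINT x|lborel. indicator ?S x * (q - f x))"
    proof (rule integral_mono)
      show "integrable lborel (\<lambda>x. indicator ?S x * (q - p) - (1 + \<bar>p\<bar>) * (indicator (U - A) x * (1 + \<bar>f x\<bar>)))"
        using i\<kappa> by (intro Bochner_Integration.integrable_diff iS integrable_mult_right)
      have "integrable lborel (\<lambda>x. indicator ?S x * q - indicator ?S x * f x)"
        using intF[of ?S] by (intro Bochner_Integration.integrable_diff iS) (auto simp: set_integrable_def)
      then show "integrable lborel (\<lambda>x. indicator ?S x * (q - f x))" by (simp add: right_diff_distrib)
      fix x
      have "(1 + \<bar>p\<bar>) * (1 + \<bar>f x\<bar>) = 1 + \<bar>p\<bar> + \<bar>f x\<bar> + \<bar>p\<bar> * \<bar>f x\<bar>" by (simp add: algebra_simps)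
      moreover have "0 \<le> \<bar>p\<bar> * \<bar>f x\<bar>" by simp
      ultimately have "q - f x \<ge> (q - p) - (1 + \<bar>p\<bar>) * (1 + \<bar>f x\<bar>)"
        using abs_ge_self[of "f x"] abs_ge_minus_self[of p] by linarith
      then show "indicator ?S x * (q - p) - (1 + \<bar>p\<bar>) * (indicator (U - A) x * (1 + \<bar>f x\<bar>)) \<le> indicator ?S x * (q - f x)"
      proof -
        have 1: "x \<in> ?S \<Longrightarrow> x \<in> U" using S by blast
        have 2: "x \<in> A \<Longrightarrow> f x < p" by (simp add: A_def)
        show ?thesis
        proof (cases "x \<in> ?S")
          case True
          then have i: "indicator ?S x = (1::real)" by (rule indicator_simps(1))
          show ?thesis using 1[OF True] 2 \<open>(q - p) - (1 + \<bar>p\<bar>) * (1 + \<bar>f x\<bar>) \<le> q - f x\<close>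
            unfolding i by (cases "x \<in> A") auto
        next
          case False
          then have i: "indicator ?S x = (0::real)" by (rule indicator_simps(2))
          show ?thesis unfolding i by simp
        qed
      qed
    qed
    ultimately have "(LINT x|lborel. indicator ?S x * (q - p) - (1 + \<bar>p\<bar>) * (indicator (U - A) x * (1 + \<bar>f x\<bar>))) \<le> 0"
      by (simp add: set_lebesgue_integral_def)
    then have "(LINT x|lborel. indicator ?S x * (q - p)) - (1 + \<bar>p\<bar>) * (LINT x|lborel. indicator (U - A) x * (1 + \<bar>f x\<bar>)) \<le> 0"
      by (simp only: Bochner_Integration.integral_diff[OF iS integrable_mult_right[OF i\<kappa>]] integral_mult_right_zero)
    then have "measure lborel ?S * (q - p) \<le> (1 + \<bar>p\<bar>) * (LINT x|lborel. indicator (U - A) x * (1 + \<bar>f x\<bar>))"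
      by simp
    also have "\<dots> \<le> (1 + \<bar>p\<bar>) * e" using small by (intro mult_left_mono) (auto simp: set_lebesgue_integral_def)
    also have "\<dots> = e0 * (q - p)" by (simp add: e_def)
    finally show ?thesis using pq by simp
  qed
  let ?T = "\<Union>i\<in>D. ?B i"
  have T: "?T \<in> lmeasurable" "measure lebesgue ?T \<le> e0"
  proof -
    have "measure lebesgue (\<Union>i\<in>F. ?B i) \<le> e0" if "F \<subseteq> D" "finite F" for F
    proof -
      have "(\<Union>i\<in>F. ?B i) \<in> sets borel" using that by (intro sets.finite_UN) auto
      then show ?thesis using fin[OF that] by (simp add: measure_completion)
    qed
    then show "?T \<in> lmeasurable" "measure lebesgue ?T \<le> e0"
      by (intro fmeasurable_UN_bound[OF D(1)] measure_UN_bound[OF D(1)] lmeasurable_cball; assumption)+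
  qed
  show "\<exists>T. E \<subseteq> T \<and> T \<in> lmeasurable \<and> measure lebesgue T \<le> e0"
  proof (intro exI[of _ "?T \<union> (E - ?T)"] conjI)
    have n: "E - ?T \<in> lmeasurable" "measure lebesgue (E - ?T) = 0"
      using D(4) negligible_imp_measurable negligible_imp_measure0 by auto
    then show "?T \<union> (E - ?T) \<in> lmeasurable" using T by (intro fmeasurable.Un)
    show "measure lebesgue (?T \<union> (E - ?T)) \<le> e0"
      using measure_Un_le[of ?T lebesgue "E - ?T"] n T by auto
  qed auto
qed

lemma LBINT_Icc_uminus: "(LBINT x:{a..b::real}. - f x :: real) = - (LBINT x:{a..b}. f x)"
  by (simp add: set_lebesgue_integral_def)

text \<open>For rational \<open>p < q\<close> and a bounded window the points with
  \<open>f t < p\<close> but averages beyond \<open>q\<close> are negligible; countably many such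
  sets contain every point where the claim fails.\<close>

lemma AE_upper_average_le:
  fixes f :: "real \<Rightarrow> real"
  assumes f: "integrable lborel f"
  shows "AE t in lborel. \<forall>q>f t. \<exists>e>0. \<forall>a b. a \<le> t \<longrightarrow> t \<le> b \<longrightarrow> a < b \<longrightarrow> b - a < e \<longrightarrow>
    (LBINT x:{a..b}. f x) \<le> q * (b - a)"
proof -
  define bad where "bad q t \<longleftrightarrow> (\<forall>e>0. \<exists>a b. a \<le> t \<and> t \<le> b \<and> a < b \<and> b - a < e \<and> q * (b - a) < (LBINT x:{a..b}. f x))" for q t
  define E where "E p q N = {t. f t < p \<and> bad q t \<and> - real N < t \<and> t < real N}" for p q N
  have "negligible (E p q N)" if "p < q" for p q N
    by (rule negligible_upper_average[OF f that, of _ "real N"]) (auto simp: E_def bad_def)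
  then have "AE t in lborel. t \<notin> E p q N" if "p < q" for p q N
    using AE_not_in[of "E p q N" lebesgue] that by (simp add: negligible_iff_null_sets AE_completion_iff)
  then have "AE t in lborel. \<forall>p q :: rat. \<forall>N. of_rat p < (of_rat q :: real) \<longrightarrow> t \<notin> E (of_rat p) (of_rat q) N"
    unfolding AE_all_countable by auto
  then show ?thesis
  proof (rule AE_mp, intro AE_I2 impI allI)
    fix t q assume t: "\<forall>p q :: rat. \<forall>N. of_rat p < (of_rat q :: real) \<longrightarrow> t \<notin> E (of_rat p) (of_rat q) N" and q: "f t < q"
    obtain p :: rat where p: "f t < of_rat p" "of_rat p < q" using of_rat_dense[OF q] by blast
    obtain q' :: rat where q': "(of_rat p :: real) < of_rat q'" "of_rat q' < q" using of_rat_dense[OF p(2)] by blast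
    obtain N :: nat where N: "\<bar>t\<bar> < N" using reals_Archimedean2 by blast
    have "t \<notin> E (of_rat p) (of_rat q') N" using t q' by auto
    then have "\<not> bad (of_rat q') t" using p N by (auto simp: E_def)
    then obtain e where e: "e > 0" "\<And>a b. a \<le> t \<Longrightarrow> t \<le> b \<Longrightarrow> a < b \<Longrightarrow> b - a < e \<Longrightarrow> (LBINT x:{a..b}. f x) \<le> of_rat q' * (b - a)"
      unfolding bad_def by (meson linorder_not_less)
    have le: "of_rat q' * (b - a) \<le> q * (b - a)" if "a < b" for a b :: real using q' that by (intro mult_right_mono) auto
    show "\<exists>e>0. \<forall>a b. a \<le> t \<longrightarrow> t \<le> b \<longrightarrow> a < b \<longrightarrow> b - a < e \<longrightarrow> (LBINT x:{a..b}. f x) \<le> q * (b - a)"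
      using e(1) by (intro exI[of _ e] conjI allI impI order_trans[OF e(2) le])
  qed
qed

text \<open>The upper estimate is used for \<open>f\<close> and for \<open>- f\<close>. The
  intervals only have to contain \<open>t\<close>, possibly as an endpoint, so increments from one
  side are included.\<close>

theorem lebesgue_differentiation:
  fixes f :: "real \<Rightarrow> real"
  assumes f: "integrable lborel f"
  shows "AE t in lborel. \<forall>\<epsilon>>0. \<exists>e>0. \<forall>a b. a \<le> t \<longrightarrow> t \<le> b \<longrightarrow> a < b \<longrightarrow> b - a < e \<longrightarrow>
    \<bar>(LBINT x:{a..b}. f x) - f t * (b - a)\<bar> \<le> \<epsilon> * (b - a)"
  using AE_upper_average_le[OF f] AE_upper_average_le[OF Bochner_Integration.integrable_minus[OF f]]
proof eventually_elim
  case (elim t)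
  show ?case
  proof (intro allI impI)
    fix \<epsilon> :: real assume \<epsilon>: "0 < \<epsilon>"
    obtain e1 where e1: "e1 > 0" "\<And>a b. a \<le> t \<Longrightarrow> t \<le> b \<Longrightarrow> a < b \<Longrightarrow> b - a < e1 \<Longrightarrow> (LBINT x:{a..b}. f x) \<le> (f t + \<epsilon>) * (b - a)"
      using elim(1)[rule_format, of "f t + \<epsilon>"] \<epsilon> by auto
    obtain e2 where e2: "e2 > 0" "\<And>a b. a \<le> t \<Longrightarrow> t \<le> b \<Longrightarrow> a < b \<Longrightarrow> b - a < e2 \<Longrightarrow> - (LBINT x:{a..b}. f x) \<le> (- f t + \<epsilon>) * (b - a)"
      using elim(2)[rule_format, of "- f t + \<epsilon>"] \<epsilon> by (auto simp: LBINT_Icc_uminus)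
    show "\<exists>e>0. \<forall>a b. a \<le> t \<longrightarrow> t \<le> b \<longrightarrow> a < b \<longrightarrow> b - a < e \<longrightarrow> \<bar>(LBINT x:{a..b}. f x) - f t * (b - a)\<bar> \<le> \<epsilon> * (b - a)"
    proof (intro exI[of _ "min e1 e2"] conjI allI impI)
      fix a b assume ab: "a \<le> t" "t \<le> b" "a < b" "b - a < min e1 e2"
      then have "(LBINT x:{a..b}. f x) \<le> (f t + \<epsilon>) * (b - a)" "- (LBINT x:{a..b}. f x) \<le> (- f t + \<epsilon>) * (b - a)"
        using e1(2)[of a b] e2(2)[of a b] by auto
      then show "\<bar>(LBINT x:{a..b}. f x) - f t * (b - a)\<bar> \<le> \<epsilon> * (b - a)"
        unfolding distrib_right by linarith
    qed (use e1 e2 in auto)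
  qed
qed

section \<open>Comparison of integrands, and densities of absolutely continuous functions\<close>

lemma AE_nonneg_of_LBINT_Icc_nonneg:
  fixes k :: "real \<Rightarrow> real"
  assumes k: "integrable lborel k" and nn: "\<And>a b. a < b \<Longrightarrow> 0 \<le> (LBINT x:{a..b}. k x)"
  shows "AE t in lborel. 0 \<le> k t"
  using lebesgue_differentiation[OF k]
proof eventually_elim
  case (elim t)
  show "0 \<le> k t"
  proof (rule field_le_epsilon)
    fix \<epsilon> :: real assume "0 < \<epsilon>"
    then obtain e where e: "e > 0" "\<And>a b. a \<le> t \<Longrightarrow> t \<le> b \<Longrightarrow> a < b \<Longrightarrow> b - a < e \<Longrightarrow>
        \<bar>(LBINT x:{a..b}. k x) - k t * (b - a)\<bar> \<le> \<epsilon> * (b - a)"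
      using elim by blast
    have "\<bar>(LBINT x:{t..t+e/2}. k x) - k t * (e/2)\<bar> \<le> \<epsilon> * (e/2)" using e(2)[of t "t + e/2"] e(1) by simp
    then have "0 \<le> k t * (e/2) + \<epsilon> * (e/2)" using nn[of t "t + e/2"] e(1) by linarith
    then have "0 \<le> (k t + \<epsilon>) * (e/2)" by (simp add: distrib_right)
    then show "0 \<le> k t + \<epsilon>" using e(1) by (simp add: zero_le_mult_iff)
  qed
qed

lemma AE_le_of_LBINT_Icc_le:
  fixes f g :: "real \<Rightarrow> real"
  assumes f: "integrable lborel f" and g: "integrable lborel g"
    and le: "\<And>a b. a < b \<Longrightarrow> (LBINT x:{a..b}. f x) \<le> (LBINT x:{a..b}. g x)"
  shows "AE t in lborel. f t \<le> g t"
proof -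
  have "AE t in lborel. 0 \<le> g t - f t"
  proof (rule AE_nonneg_of_LBINT_Icc_nonneg)
    show "integrable lborel (\<lambda>t. g t - f t)" using f g by auto
    fix a b :: real assume "a < b"
    then show "0 \<le> (LBINT x:{a..b}. g x - f x)"
      using le[of a b] by (subst set_integral_diff) (auto intro: set_integrable_lborel f g)
  qed
  then show ?thesis by auto
qed

lemma LBINT_Ioc_eq_Icc:
  fixes f :: "real \<Rightarrow> real"
  assumes "integrable lborel f" shows "(LBINT x:{a<..b}. f x) = (LBINT x:{a..b}. (f x :: real))"
  unfolding set_lebesgue_integral_def
proof (rule integral_cong_AE)
  note [measurable] = borel_measurable_integrable[OF assms]
  show "(\<lambda>x. indicator {a<..b} x *\<^sub>R f x) \<in> borel_measurable lborel"
    "(\<lambda>x. indicator {a..b} x *\<^sub>R f x) \<in> borel_measurable lborel" by measurable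
  show "AE x in lborel. indicator {a<..b} x *\<^sub>R f x = indicator {a..b} x *\<^sub>R f x"
    using AE_lborel_singleton[of a] by eventually_elim (auto simp: indicator_def less_le)
qed

text \<open>If \<open>H\<close> is a primitive of \<open>h\<close>, then \<open>H + \<Phi>\<close>
  and \<open>H - \<Phi>\<close> are nondecreasing and right-continuous. Their Stieltjes measures add
  up to the measure with density \<open>2 * h\<close>, so the first one has a Radon-Nikodym density;
  subtracting \<open>h\<close> from it gives the density of \<open>\<Phi>\<close>.\<close>

theorem AC_density:
  fixes \<Phi> h :: "real \<Rightarrow> real"
  assumes h: "integrable lborel h" and h0: "\<And>x. 0 \<le> h x"
    and \<Phi>: "\<And>s t. s \<le> t \<Longrightarrow> \<bar>\<Phi> t - \<Phi> s\<bar> \<le> (LBINT x:{s..t}. h x)"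
  obtains \<phi> where "integrable lborel \<phi>" "AE x in lborel. \<bar>\<phi> x\<bar> \<le> h x"
    "\<And>s t. s \<le> t \<Longrightarrow> \<Phi> t - \<Phi> s = (LBINT x:{s..t}. \<phi> x)"
proof -
  note [measurable] = borel_measurable_integrable[OF h]
  define \<kappa> where "\<kappa> = density lborel (\<lambda>x. ennreal (h x))"
  have \<kappa>_eq: "emeasure \<kappa> A = ennreal (LBINT x:A. h x)" if "A \<in> sets borel" for A
  proof -
    have "emeasure \<kappa> A = (\<integral>\<^sup>+ x. ennreal (indicator A x * h x) \<partial>lborel)"
      unfolding \<kappa>_def using that by (subst emeasure_density) (auto intro!: nn_integral_cong simp: indicator_def)
    also have "\<dots> = ennreal (LBINT x:A. h x)"
      using set_integrable_lborel[OF h that] h0 unfolding set_lebesgue_integral_def set_integrable_def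
      by (subst nn_integral_eq_integral) auto
    finally show ?thesis .
  qed
  have sp: "space \<kappa> = UNIV" "sets \<kappa> = sets borel" by (auto simp: \<kappa>_def)
  interpret K: finite_measure \<kappa> using \<kappa>_eq[of UNIV] by (intro finite_measureI) (simp add: sp)
  interpret K: finite_borel_measure \<kappa> by unfold_locales (simp_all add: sp)
  define H where "H = cdf \<kappa>"
  have nn: "0 \<le> (LBINT x:A. h x)" for A
    unfolding set_lebesgue_integral_def using h0 by (intro Bochner_Integration.integral_nonneg) auto
  have Hd: "H t - H s = (LBINT x:{s..t}. h x)" if "s \<le> t" for s t
  proof -
    have "H t - H s = measure \<kappa> {s<..t}" unfolding H_def
      using that by (cases "s = t") (auto simp: K.cdf_diff_eq)
    also have "\<dots> = (LBINT x:{s<..t}. h x)"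
      using \<kappa>_eq[of "{s<..t}"] nn by (simp add: K.emeasure_eq_measure)
    finally show ?thesis by (simp add: LBINT_Ioc_eq_Icc[OF h])
  qed
  have rc: "continuous (at_right a) H" for a unfolding H_def by (rule K.cdf_is_right_cont)
  have rc\<Phi>: "continuous (at_right a) \<Phi>" for a
  proof -
    have "((\<lambda>t. H t - H a) \<longlongrightarrow> 0) (at_right a)"
      using rc[of a] by (auto simp: continuous_within intro!: tendsto_eq_intros)
    then have "((\<lambda>t. \<Phi> t - \<Phi> a) \<longlongrightarrow> 0) (at_right a)"
      by (rule Lim_null_comparison[rotated])
        (use \<Phi>[of a] Hd[of a] in \<open>auto simp: eventually_at_right_field intro!: exI[of _ "a + 1"]\<close>)
    then show ?thesis by (simp add: continuous_within LIM_zero_iff)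
  qed
  define F where "F t = H t + \<Phi> t" for t
  define G where "G t = H t - \<Phi> t" for t
  have Fm: "F s \<le> F t" and Gm: "G s \<le> G t" if "s \<le> t" for s t
    using \<Phi>[OF that] Hd[OF that] by (auto simp: F_def G_def)
  have Frc: "continuous (at_right a) F" and Grc: "continuous (at_right a) G" for a
    unfolding F_def G_def by (intro continuous_intros rc rc\<Phi>)+
  define N N' where "N = interval_measure F" and "N' = interval_measure G"
  have N: "emeasure N {a<..b} = ennreal (F b - F a)" and N': "emeasure N' {a<..b} = ennreal (G b - G a)" if "a \<le> b" for a b
    unfolding N_def N'_def by (intro emeasure_interval_measure_Ioc that Fm Gm Frc Grc; assumption)+
  have sN: "sets N = sets borel" "sets N' = sets borel" by (simp_all add: N_def N'_def)
  define S where "S = measure_of UNIV (sets borel) (\<lambda>A. emeasure N A + emeasure N' A)"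
  have sS: "sets S = sets borel" using sets.sigma_sets_eq[of "borel :: real measure"] by (simp add: S_def)
  have S: "emeasure S A = emeasure N A + emeasure N' A" if "A \<in> sets borel" for A
    unfolding S_def
  proof (rule emeasure_measure_of_sigma)
    show "sigma_algebra UNIV (sets (borel :: real measure))"
      using sets.sigma_algebra_axioms[of "borel :: real measure"] by simp
    show "countably_additive (sets borel) (\<lambda>A. emeasure N A + emeasure N' A)"
      unfolding countably_additive_def
    proof (intro allI impI)
      fix A :: "nat \<Rightarrow> real set" assume A: "range A \<subseteq> sets borel" "disjoint_family A"
      have "(\<Sum>i. emeasure N (A i) + emeasure N' (A i)) = (\<Sum>i. emeasure N (A i)) + (\<Sum>i. emeasure N' (A i))"
        by (intro suminf_add[symmetric]) auto
      also have "\<dots> = emeasure N (\<Union> (range A)) + emeasure N' (\<Union> (range A))"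
        using A by (intro arg_cong2[where f="(+)"] suminf_emeasure) (auto simp: sN)
      finally show "(\<Sum>i. emeasure N (A i) + emeasure N' (A i)) = emeasure N (\<Union> (range A)) + emeasure N' (\<Union> (range A))" .
    qed
  qed (auto simp: positive_def that)
  define D where "D = density lborel (\<lambda>x. ennreal (2 * h x))"
  have D_eq: "emeasure D A = 2 * emeasure \<kappa> A" if "A \<in> sets borel" for A
    unfolding D_def \<kappa>_def using that h0
    by (simp add: emeasure_density ennreal_mult nn_integral_cmult mult.assoc)
  \<comment> \<open>Both measures are determined by half-open intervals, and there the contributions
    of \<open>\<Phi>\<close> cancel.\<close>
  have SD: "S = D"
  proof (rule measure_eqI_generator_eq[where \<Omega>=UNIV])
    show "Int_stable (range (\<lambda>(a, b). {a<..b::real}))"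
    proof (rule Int_stableI)
      fix A B assume "A \<in> range (\<lambda>(a, b). {a<..b::real})" "B \<in> range (\<lambda>(a, b). {a<..b::real})"
      then obtain a b c d where "A = {a<..b}" "B = {c<..d}" by auto
      then have "A \<inter> B = (\<lambda>(a, b). {a<..b}) (max a c, min b d)" by auto
      then show "A \<inter> B \<in> range (\<lambda>(a, b). {a<..b})" by (rule range_eqI)
    qed
    show "emeasure S X = emeasure D X" if X_in: "X \<in> range (\<lambda>(a, b). {a<..b::real})" for X
    proof -
      obtain a b where X: "X = {a<..b}" using X_in by auto
      show ?thesis
      proof (cases "a \<le> b")
        case True
        have "emeasure S X = ennreal (F b - F a) + ennreal (G b - G a)" unfolding X by (simp add: S N[OF True] N'[OF True])
        also have "\<dots> = ennreal (2 * (H b - H a))"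
          using Fm[OF True] Gm[OF True] by (subst ennreal_plus[symmetric]) (auto simp: F_def G_def)
        also have "\<dots> = 2 * ennreal (LBINT x:{a<..b}. h x)"
          using Hd[OF True] nn by (simp add: ennreal_mult LBINT_Ioc_eq_Icc[OF h])
        also have "\<dots> = emeasure D X" unfolding X by (simp add: D_eq \<kappa>_eq)
        finally show ?thesis .
      next
        case False then have "X = {}" using X by auto
        then show ?thesis by simp
      qed
    qed
    show "sets S = sigma_sets UNIV (range (\<lambda>(a, b). {a<..b::real}))"
      "sets D = sigma_sets UNIV (range (\<lambda>(a, b). {a<..b::real}))"
      by (simp_all add: sS D_def, simp_all add: borel_sigma_sets_Ioc sets_measure_of)
    show "range (\<lambda>i::nat. {- real i<..real i}) \<subseteq> range (\<lambda>(a, b). {a<..b::real})" by auto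
    show "(\<Union>i::nat. {- real i<..real i}) = UNIV"
      by (auto simp: set_eq_iff) (metis reals_Archimedean2 abs_less_iff less_imp_le minus_less_iff)
    show "emeasure S {- real i<..real i} \<noteq> \<infinity>" for i by (simp add: S N N')
  qed auto
  have N_le: "emeasure N A \<le> 2 * emeasure \<kappa> A" if "A \<in> sets borel" for A
    using S[OF that] SD D_eq[OF that] by simp
  have "absolutely_continuous lborel N"
    unfolding absolutely_continuous_def
  proof
    fix A :: "real set" assume A: "A \<in> null_sets lborel"
    then have "A \<in> sets borel" by auto
    moreover have "emeasure \<kappa> A = 0"
      using A absolutely_continuousI_density[of "\<lambda>x. ennreal (h x)" lborel]
      by (auto simp: absolutely_continuous_def \<kappa>_def null_sets_def)
    ultimately show "A \<in> null_sets N" using N_le[of A] by (auto simp: sN null_sets_def)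
  qed
  then obtain \<psi> where \<psi>[measurable]: "\<psi> \<in> borel_measurable lborel" and dens: "density lborel \<psi> = N"
    using sigma_finite_measure.Radon_Nikodym[OF sigma_finite_lborel, of N] sN by auto
  have Nint: "(\<integral>\<^sup>+ x. \<psi> x * indicator A x \<partial>lborel) = emeasure N A" if "A \<in> sets borel" for A
    using that by (simp add: dens[symmetric] emeasure_density)
  have fin: "(\<integral>\<^sup>+ x. \<psi> x \<partial>lborel) < \<infinity>"
  proof -
    have "(\<integral>\<^sup>+ x. \<psi> x \<partial>lborel) = emeasure N UNIV" using Nint[of UNIV] by simp
    also have "\<dots> \<le> 2 * emeasure \<kappa> UNIV" by (intro N_le) auto
    also have "\<dots> < \<infinity>" by (simp add: K.emeasure_eq_measure ennreal_mult_eq_top_iff less_top[symmetric])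
    finally show ?thesis .
  qed
  have AEfin: "AE x in lborel. \<psi> x \<noteq> \<infinity>" using fin by (intro nn_integral_PInf_AE) auto
  define p where "p x = enn2real (\<psi> x)" for x
  have pm[measurable]: "p \<in> borel_measurable borel" unfolding p_def by measurable
  have p: "integrable lborel p"
  proof (rule integrableI_bounded)
    have "(\<integral>\<^sup>+ x. ennreal (norm (p x)) \<partial>lborel) \<le> (\<integral>\<^sup>+ x. \<psi> x \<partial>lborel)"
      by (intro nn_integral_mono) (auto simp: p_def ennreal_enn2real_if)
    then show "(\<integral>\<^sup>+ x. ennreal (norm (p x)) \<partial>lborel) < \<infinity>" using fin by simp
  qed simp
  have pF: "F t - F s = (LBINT x:{s..t}. p x)" if st: "s \<le> t" for s t
  proof -
    have "ennreal (LBINT x:{s<..t}. p x) = (\<integral>\<^sup>+ x. ennreal (indicator {s<..t} x * p x) \<partial>lborel)"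
      using set_integrable_lborel[OF p, of "{s<..t}"] unfolding set_lebesgue_integral_def set_integrable_def
      by (subst nn_integral_eq_integral) (auto simp: p_def)
    also have "\<dots> = (\<integral>\<^sup>+ x. \<psi> x * indicator {s<..t} x \<partial>lborel)"
      using AEfin by (intro nn_integral_cong_AE) (auto simp: p_def indicator_def less_top elim!: eventually_mono)
    also have "\<dots> = ennreal (F t - F s)" using Nint[of "{s<..t}"] N[OF st] by simp
    finally have "(LBINT x:{s<..t}. p x) = F t - F s"
      using Fm[OF st] by (subst (asm) ennreal_inj) (auto simp: set_lebesgue_integral_def p_def intro!: Bochner_Integration.integral_nonneg)
    then show ?thesis by (simp add: LBINT_Ioc_eq_Icc[OF p])
  qed
  define \<phi> where "\<phi> x = p x - h x" for x
  have i\<phi>: "integrable lborel \<phi>" using p h by (auto simp: \<phi>_def[abs_def])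
  have \<phi>\<Phi>: "\<Phi> t - \<Phi> s = (LBINT x:{s..t}. \<phi> x)" if "s \<le> t" for s t
    unfolding \<phi>_def using pF[OF that] Hd[OF that]
    by (subst set_integral_diff) (auto simp: F_def intro!: set_integrable_lborel p h)
  have "AE x in lborel. \<phi> x \<le> h x"
    using \<Phi> \<phi>\<Phi> by (intro AE_le_of_LBINT_Icc_le i\<phi> h) (metis abs_le_D1 less_imp_le)
  moreover have "AE x in lborel. - \<phi> x \<le> h x"
  proof (intro AE_le_of_LBINT_Icc_le Bochner_Integration.integrable_minus i\<phi> h)
    fix a b :: real assume "a < b"
    then show "(LBINT x:{a..b}. - \<phi> x) \<le> (LBINT x:{a..b}. h x)"
      using \<Phi>[of a b] \<phi>\<Phi>[of a b] by (simp add: LBINT_Icc_uminus)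
  qed
  ultimately have "AE x in lborel. \<bar>\<phi> x\<bar> \<le> h x" by eventually_elim auto
  with i\<phi> \<phi>\<Phi> that show thesis by blast
qed

text \<open>For an uncountable family the pointwise infimum can be meaningless, so the integral is
  minimised instead, after composition with \<open>arctan\<close>: this is bounded, hence integrable
  for every member, and strictly increasing, hence sensitive to any gain on a set of positive
  measure.\<close>

lemma ess_inf_sequence:
  fixes \<H> :: "('a \<Rightarrow> real) set"
  assumes M: "finite_measure M" and ne: "\<H> \<noteq> {}" and meas: "\<And>f. f \<in> \<H> \<Longrightarrow> f \<in> borel_measurable M"
    and min: "\<And>f g. f \<in> \<H> \<Longrightarrow> g \<in> \<H> \<Longrightarrow> (\<lambda>x. min (f x) (g x)) \<in> \<H>"
  shows "\<exists>F :: nat \<Rightarrow> 'a \<Rightarrow> real. (\<forall>n. F n \<in> \<H>) \<and> (\<forall>n x. F (Suc n) x \<le> F n x) \<and>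
    (\<forall>f\<in>\<H>. AE x in M. \<forall>e>0. \<exists>n. F n x < f x + e)"
proof -
  interpret finite_measure M by fact
  define J where "J f = (LINT x|M. arctan (f x))" for f
  have b: "\<bar>arctan y\<bar> \<le> pi/2" for y using arctan_bounded[of y] by auto
  have i: "integrable M (\<lambda>x. arctan (f x))" if "f \<in> borel_measurable M" for f
    using b that by (intro integrable_const_bound[of _ "pi/2"]) auto
  have bdd: "bdd_below (J ` \<H>)"
  proof (rule bdd_belowI2)
    fix f assume f: "f \<in> \<H>"
    have "(LINT x|M. - (pi/2)) \<le> J f" unfolding J_def
      using i[OF meas[OF f]] arctan_lbound by (intro integral_mono) (auto intro: less_imp_le)
    then show "(LINT x|M. - (pi/2)) \<le> J f" .
  qed
  define I where "I = Inf (J ` \<H>)"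
  have "\<exists>f\<in>\<H>. J f < I + 1 / Suc n" for n
    using cInf_lessD[of "J ` \<H>" "I + 1 / Suc n"] ne by (auto simp: I_def)
  then obtain g where g: "\<And>n. g n \<in> \<H>" "\<And>n. J (g n) < I + 1 / Suc n" by metis
  define F where "F = rec_nat (g 0) (\<lambda>n f x. min (f x) (g (Suc n) x))"
  have F0: "F 0 = g 0" and FS: "F (Suc n) = (\<lambda>x. min (F n x) (g (Suc n) x))" for n by (simp_all add: F_def)
  have FH: "F n \<in> \<H>" for n by (induction n) (auto simp: F0 FS intro: g min)
  have Fg: "F n x \<le> g n x" for n x by (cases n) (auto simp: F0 FS)
  have Fdec: "F (Suc n) x \<le> F n x" for n x by (simp add: FS)
  have JF: "J (F n) < I + 1 / Suc n" for n
  proof -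
    have "J (F n) \<le> J (g n)" unfolding J_def
      by (intro integral_mono i meas FH g) (simp add: arctan_monotone' Fg)
    then show ?thesis using g(2)[of n] by simp
  qed
  have "AE x in M. \<forall>e>0. \<exists>n. F n x < f x + e" if f: "f \<in> \<H>" for f
  proof -
    \<comment> \<open>The gain from replacing \<open>F n\<close> by its minimum with
      \<open>f\<close>. The minimum stays in the family, so the integral of the gain is at most the
      gap \<open>1 / Suc n\<close> to the infimum \<open>I\<close>.\<close>
    define D where "D n x = arctan (F n x) - arctan (min (F n x) (f x))" for n x
    have D0: "0 \<le> D n x" for n x by (simp add: D_def arctan_monotone')
    have mH: "(\<lambda>x. min (F n x) (f x)) \<in> \<H>" for n by (intro min FH f)
    have iD: "integrable M (D n)" for n
      unfolding D_def[abs_def] by (intro Bochner_Integration.integrable_diff i meas FH mH)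
    have ID: "(LINT x|M. D n x) \<le> 1 / Suc n" for n
    proof -
      have "(LINT x|M. D n x) = J (F n) - J (\<lambda>x. min (F n x) (f x))"
        unfolding D_def J_def by (intro Bochner_Integration.integral_diff i meas FH mH)
      moreover have "I \<le> J (\<lambda>x. min (F n x) (f x))" unfolding I_def by (rule cInf_lower[OF _ bdd]) (use mH in auto)
      ultimately show ?thesis using JF[of n] by simp
    qed
    define DI where "DI x = (INF n. D n x)" for x
    have DIle: "DI x \<le> D n x" and DI0: "0 \<le> DI x" for n x
      unfolding DI_def by (auto intro!: cINF_lower cINF_greatest bdd_belowI2[of _ 0] D0)
    have mD: "DI \<in> borel_measurable M"
      unfolding DI_def[abs_def] by (intro borel_measurable_cINF bdd_belowI2[of _ 0] D0 borel_measurable_integrable iD) auto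
    have iDI: "integrable M DI" by (rule Bochner_Integration.integrable_bound[OF iD[of 0] mD]) (use DIle DI0 D0 in \<open>auto simp: abs_of_nonneg\<close>)
    have "(LINT x|M. DI x) \<le> 0"
    proof (rule LIMSEQ_le_const)
      show "(\<lambda>n. 1 / real (Suc n)) \<longlonglongrightarrow> 0" by (rule LIMSEQ_Suc[OF lim_1_over_n])
      have "(LINT x|M. DI x) \<le> 1 / Suc n" for n
        using integral_mono[OF iDI iD[of n]] DIle ID[of n] by (meson order_trans)
      then show "\<exists>N. \<forall>n\<ge>N. (LINT x|M. DI x) \<le> 1 / real (Suc n)" by blast
    qed
    then have "(LINT x|M. DI x) = 0" using DI0 by (intro antisym Bochner_Integration.integral_nonneg) auto
    then have "AE x in M. DI x = 0" using integral_nonneg_eq_0_iff_AE[OF iDI] DI0 by auto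
    then show ?thesis
    proof eventually_elim
      case (elim x)
      show ?case
      proof (rule ccontr)
        assume "\<not> (\<forall>e>0. \<exists>n. F n x < f x + e)"
        then obtain e where e: "e > 0" "\<And>n. f x + e \<le> F n x" by (auto simp: not_less)
        have L: "(\<lambda>n. D n x) = (\<lambda>n. arctan (F n x) - arctan (f x))"
        proof
          fix n
          have "min (F n x) (f x) = f x" using e(1) e(2)[of n] by simp
          then show "D n x = arctan (F n x) - arctan (f x)" by (simp add: D_def)
        qed
        have "arctan (f x + e) - arctan (f x) \<le> D n x" for n using e(2)[of n] by (simp add: L[THEN fun_cong] arctan_monotone')
        then have "arctan (f x + e) - arctan (f x) \<le> DI x" unfolding DI_def by (intro cINF_greatest) auto
        then show False using elim arctan_monotone[of "f x" "f x + e"] e(1) by simp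
      qed
    qed
  qed
  then show ?thesis using FH Fdec by (intro exI[of _ F]) auto
qed

section \<open>An estimate along characteristics\<close>

text \<open>A function that satisfies, in difference form, \<open>\<partial>\<^sub>\<tau> w \<le> A - \<partial>\<^sub>\<sigma> w\<close> grows at most by \<open>A\<close> along the
  diagonal.  As \<open>w\<close> is only Lipschitz, it is averaged over \<open>k\<^sup>2\<close> points of a grid of width
  \<open>k\<^sup>-\<^sup>4\<close>, which makes the mixed second difference \<open>Z (j + 1) - Z j\<close> negligible against the step
  \<open>k\<^sup>-\<^sup>3\<close> of the path.\<close>

lemma characteristic_estimate:
  fixes w :: "real \<Rightarrow> real \<Rightarrow> real"
  assumes \<sigma>0: "0 < \<sigma>0" and A: "0 \<le> A" and \<Lambda>: "0 \<le> \<Lambda>" and B: "0 \<le> B"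
    and lip\<tau>: "\<And>\<sigma> \<tau> \<tau>'. \<sigma>0 \<le> \<sigma> \<Longrightarrow> \<bar>w \<sigma> \<tau> - w \<sigma> \<tau>'\<bar> \<le> \<Lambda> * \<bar>\<tau> - \<tau>'\<bar>"
    and lip\<sigma>: "\<And>\<sigma> \<sigma>' \<tau>. \<sigma>0 \<le> \<sigma> \<Longrightarrow> \<sigma>0 \<le> \<sigma>' \<Longrightarrow> \<bar>w \<sigma> \<tau> - w \<sigma>' \<tau>\<bar> \<le> B * \<bar>\<sigma> - \<sigma>'\<bar>"
    and ev: "\<And>\<sigma> \<kappa> \<tau>1 \<tau>2 S. \<sigma>0 \<le> \<sigma> \<Longrightarrow> 0 < \<kappa> \<Longrightarrow> \<tau>1 \<le> \<tau>2 \<Longrightarrow>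
      (\<And>\<tau>. \<tau>1 \<le> \<tau> \<Longrightarrow> \<tau> \<le> \<tau>2 \<Longrightarrow> w \<sigma> \<tau> - w (\<sigma> + \<kappa>) \<tau> \<le> S) \<Longrightarrow>
      w \<sigma> \<tau>2 - w \<sigma> \<tau>1 \<le> (\<tau>2 - \<tau>1) * (A + (\<sigma> + \<kappa>) / (\<sigma> * \<kappa>) * S)"
  shows "w (\<sigma>0 + 1) 1 \<le> w \<sigma>0 0 + A"
proof -
  \<comment> \<open>Collects the errors of order \<open>1 / k\<close>: \<open>B / \<sigma>0\<close>
    from the factor \<open>h / \<sigma>\<close> in front of \<open>Z\<close>, the rest from the
    drift of the averages and the oscillation within a grid cell.\<close>
  define E0 where "E0 = B / \<sigma>0 + (1 + 1 / \<sigma>0) * (2 * B + 2 * \<Lambda>)"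
  have E0: "0 \<le> E0" using \<sigma>0 B \<Lambda> by (simp add: E0_def)
  have main: "w (\<sigma>0 + 1) 1 - w \<sigma>0 0 - A \<le> (E0 + 2 * \<Lambda>) / k" if k: "0 < k" for k :: nat
  proof -
    \<comment> \<open>\<open>k\<close> cells of width \<open>\<eta>\<close> make one step
      \<open>h\<close>. The window of \<open>n\<close> cells has length
      \<open>1 / k\<^sup>2\<close>: long compared with the step, short in absolute terms.\<close>
    define h where "h = 1 / real k ^ 3"
    define \<eta> where "\<eta> = h / k"
    define n where "n = k ^ 2"
    have pos: "0 < h" "0 < \<eta>" "0 < n" using k by (auto simp: h_def \<eta>_def n_def)
    have h1: "h \<le> 1 / k" "h \<le> 1"
    proof -
      have "real k \<le> real k ^ 3" using k by (intro self_le_power) auto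
      moreover have "1 \<le> real k ^ 3" using k by (intro one_le_power) auto
      ultimately show "h \<le> 1 / k" "h \<le> 1" using k by (auto simp: h_def field_simps)
    qed
    have k\<eta>: "real k * \<eta> = h" using k by (simp add: \<eta>_def)
    define u where "u \<sigma> j = w \<sigma> (real j * \<eta>)" for \<sigma> and j :: nat
    define z where "z \<sigma> j = u \<sigma> j - u (\<sigma> + h) j" for \<sigma> j
    define W where "W \<sigma> j = (\<Sum>i<n. u \<sigma> (j + i)) / n" for \<sigma> j
    define Z where "Z \<sigma> j = W \<sigma> j - W (\<sigma> + h) j" for \<sigma> j
    have Z_eq: "Z \<sigma> j = (\<Sum>i<n. z \<sigma> (j + i)) / n" for \<sigma> j
      by (simp add: Z_def W_def z_def sum_subtractf diff_divide_distrib)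
    have zB: "\<bar>z \<sigma> j\<bar> \<le> B * h" if "\<sigma>0 \<le> \<sigma>" for \<sigma> j
      using lip\<sigma>[of \<sigma> "\<sigma> + h" "real j * \<eta>"] that pos by (simp add: z_def u_def)
    have ZB: "Z \<sigma> j \<le> B * h" if "\<sigma>0 \<le> \<sigma>" for \<sigma> j
    proof -
      have "(\<Sum>i<n. z \<sigma> (j + i)) \<le> (\<Sum>i<n. B * h)" using zB[OF that] by (intro sum_mono) (auto dest: abs_le_D1)
      then show ?thesis using pos by (simp add: Z_eq field_simps)
    qed
    have st1: "u \<sigma> (Suc j) - u \<sigma> j \<le> \<eta> * (A + (\<sigma> + h) / (\<sigma> * h) * (z \<sigma> j + 2 * \<Lambda> * \<eta>))" if \<sigma>: "\<sigma>0 \<le> \<sigma>" for \<sigma> j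
    proof -
      have "w \<sigma> (real (Suc j) * \<eta>) - w \<sigma> (real j * \<eta>)
          \<le> (real (Suc j) * \<eta> - real j * \<eta>) * (A + (\<sigma> + h) / (\<sigma> * h) * (z \<sigma> j + 2 * \<Lambda> * \<eta>))"
      proof (rule ev[OF \<sigma> pos(1)])
        show "real j * \<eta> \<le> real (Suc j) * \<eta>" using pos by (intro mult_right_mono) auto
        fix \<tau> assume \<tau>: "real j * \<eta> \<le> \<tau>" "\<tau> \<le> real (Suc j) * \<eta>"
        then have "\<bar>\<tau> - real j * \<eta>\<bar> \<le> \<eta>" by (simp add: algebra_simps)
        then have "\<Lambda> * \<bar>\<tau> - real j * \<eta>\<bar> \<le> \<Lambda> * \<eta>" using \<Lambda> by (intro mult_left_mono)
        then show "w \<sigma> \<tau> - w (\<sigma> + h) \<tau> \<le> z \<sigma> j + 2 * \<Lambda> * \<eta>"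
          using lip\<tau>[OF \<sigma>, of \<tau> "real j * \<eta>"] lip\<tau>[of "\<sigma> + h" \<tau> "real j * \<eta>"] \<sigma> pos
          unfolding z_def u_def by linarith
      qed
      then show ?thesis by (simp add: u_def algebra_simps)
    qed
    have st2: "W \<sigma> (Suc j) - W \<sigma> j \<le> \<eta> * (A + (\<sigma> + h) / (\<sigma> * h) * (Z \<sigma> j + 2 * \<Lambda> * \<eta>))" if \<sigma>: "\<sigma>0 \<le> \<sigma>" for \<sigma> j
    proof -
      define c where "c = (\<sigma> + h) / (\<sigma> * h)"
      have "(\<Sum>i<n. u \<sigma> (Suc (j + i)) - u \<sigma> (j + i)) \<le> (\<Sum>i<n. \<eta> * (A + c * (z \<sigma> (j + i) + 2 * \<Lambda> * \<eta>)))"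
        unfolding c_def by (intro sum_mono st1 \<sigma>)
      also have "\<dots> = \<eta> * (real n * A + c * ((\<Sum>i<n. z \<sigma> (j + i)) + real n * (2 * \<Lambda> * \<eta>)))"
        by (simp add: sum.distrib sum_distrib_left[symmetric])
      also have "(\<Sum>i<n. z \<sigma> (j + i)) = real n * Z \<sigma> j" using pos by (simp add: Z_eq)
      also have "\<eta> * (real n * A + c * (real n * Z \<sigma> j + real n * (2 * \<Lambda> * \<eta>)))
          = real n * (\<eta> * (A + c * (Z \<sigma> j + 2 * \<Lambda> * \<eta>)))" by (simp add: algebra_simps)
      finally have "(\<Sum>i<n. u \<sigma> (Suc (j + i)) - u \<sigma> (j + i)) / n \<le> \<eta> * (A + c * (Z \<sigma> j + 2 * \<Lambda> * \<eta>))"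
        using pos by (simp add: divide_le_eq mult.commute)
      then show ?thesis by (simp add: W_def c_def sum_subtractf diff_divide_distrib)
    qed
    \<comment> \<open>Shifting the window by one cell exchanges a single summand, of size at most
      \<open>B * h\<close>; the average divides this change by \<open>n\<close>.\<close>
    have st3: "Z \<sigma> j \<le> Z \<sigma> (Suc j) + 2 * B * h / n" if \<sigma>: "\<sigma>0 \<le> \<sigma>" for \<sigma> j
    proof -
      have "(\<Sum>i<n. z \<sigma> (j + i)) + z \<sigma> (j + n) = z \<sigma> j + (\<Sum>i<n. z \<sigma> (Suc j + i))"
        using sum.lessThan_Suc_shift[of "\<lambda>i. z \<sigma> (j + i)" n] by simp
      then have "(\<Sum>i<n. z \<sigma> (j + i)) \<le> (\<Sum>i<n. z \<sigma> (Suc j + i)) + 2 * B * h"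
        using zB[OF \<sigma>, of j] zB[OF \<sigma>, of "j + n"] by linarith
      then have "(\<Sum>i<n. z \<sigma> (j + i)) / n \<le> ((\<Sum>i<n. z \<sigma> (Suc j + i)) + 2 * B * h) / n" using pos by (intro divide_right_mono) auto
      then show ?thesis unfolding Z_eq add_divide_distrib .
    qed
    have st3': "Z \<sigma> j \<le> Z \<sigma> (j + i) + real i * (2 * B * h / n)" if \<sigma>: "\<sigma>0 \<le> \<sigma>" for \<sigma> i j
    proof (induction i)
      case (Suc i)
      then show ?case using st3[OF \<sigma>, of "j + i"] unfolding add_Suc_right of_nat_Suc distrib_right by linarith
    qed simp
    \<comment> \<open>\<open>k\<close> cells in the direction of \<open>\<tau>\<close> at fixed
      \<open>\<sigma>\<close>, all compared with the last value of \<open>Z\<close>. The factor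
      \<open>(\<sigma> + h) / (\<sigma> * h)\<close> times the step \<open>h\<close> is
      \<open>1 + h / \<sigma>\<close>.\<close>
    have st4: "W \<sigma> (j + k) - W \<sigma> j \<le> h * A + (1 + h / \<sigma>) * (Z \<sigma> (j + k) + real k * (2 * B * h / n) + 2 * \<Lambda> * \<eta>)"
      if \<sigma>: "\<sigma>0 \<le> \<sigma>" for \<sigma> j
    proof -
      have \<sigma>p: "0 < \<sigma>" using \<sigma> \<sigma>0 by simp
      define c where "c = (\<sigma> + h) / (\<sigma> * h)"
      have c: "0 \<le> c" "c * h = 1 + h / \<sigma>" using \<sigma>p pos by (auto simp: c_def field_simps)
      define Y where "Y = Z \<sigma> (j + k) + real k * (2 * B * h / n) + 2 * \<Lambda> * \<eta>"
      have *: "i \<le> k \<Longrightarrow> W \<sigma> (j + i) - W \<sigma> j \<le> real i * (\<eta> * (A + c * Y))" for i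
      proof (induction i)
        case (Suc i)
        have nn: "0 \<le> 2 * B * h / n" using B pos by simp
        have "Z \<sigma> (j + i) \<le> Z \<sigma> (j + k) + real (k - i) * (2 * B * h / n)"
          using st3'[OF \<sigma>, of "j + i" "k - i"] Suc.prems by simp
        also have "real (k - i) * (2 * B * h / n) \<le> real k * (2 * B * h / n)" using nn by (intro mult_right_mono) auto
        finally have "Z \<sigma> (j + i) + 2 * \<Lambda> * \<eta> \<le> Y" by (simp add: Y_def)
        then have "\<eta> * (A + c * (Z \<sigma> (j + i) + 2 * \<Lambda> * \<eta>)) \<le> \<eta> * (A + c * Y)"
          using c pos by (intro mult_left_mono add_left_mono) auto
        then have "W \<sigma> (Suc (j + i)) - W \<sigma> (j + i) \<le> \<eta> * (A + c * Y)"
          using st2[OF \<sigma>, of "j + i"] unfolding c_def by linarith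
        then show ?case using Suc by (simp add: distrib_right)
      qed simp
      have "W \<sigma> (j + k) - W \<sigma> j \<le> (real k * \<eta>) * (A + c * Y)" using *[of k] by (simp add: mult.assoc)
      also have "\<dots> = h * A + (c * h) * Y" unfolding k\<eta> by (simp add: algebra_simps)
      finally show ?thesis by (simp add: c Y_def)
    qed
    \<comment> \<open>The step in \<open>\<sigma>\<close> contributes \<open>- Z\<close>, which
      cancels the leading 1 of \<open>1 + h / \<sigma>\<close>. What remains,
      \<open>(h / \<sigma>) * Z\<close>, is of second order in \<open>h\<close> by
      \<open>ZB\<close>.\<close>
    have st5: "W (\<sigma> + h) (j + k) - W \<sigma> j \<le> h * (A + E0 / k)" if \<sigma>: "\<sigma>0 \<le> \<sigma>" for \<sigma> j
    proof -
      have \<sigma>p: "0 < \<sigma>" using \<sigma> \<sigma>0 by simp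
      have q: "0 \<le> h / \<sigma>" "h / \<sigma> \<le> h / \<sigma>0" using \<sigma> \<sigma>0 pos by (auto intro!: divide_left_mono)
      have q2: "h / \<sigma> \<le> 1 / \<sigma>0" using q(2) h1(2) \<sigma>0 by (meson divide_right_mono less_imp_le order_trans)
      have r: "real k * (2 * B * h / n) + 2 * \<Lambda> * \<eta> = h * ((2 * B + 2 * \<Lambda>) / k)"
        using k by (simp add: n_def \<eta>_def power2_eq_square field_simps)
      have "W (\<sigma> + h) (j + k) - W \<sigma> j = (W \<sigma> (j + k) - W \<sigma> j) - Z \<sigma> (j + k)" by (simp add: Z_def)
      also have "\<dots> \<le> h * A + (h / \<sigma>) * Z \<sigma> (j + k) + (1 + h / \<sigma>) * (h * ((2 * B + 2 * \<Lambda>) / k))"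
        using st4[OF \<sigma>, of j] unfolding add.assoc r by (simp add: algebra_simps)
      also have "(h / \<sigma>) * Z \<sigma> (j + k) \<le> (h / \<sigma>0) * (B * (1 / k))"
      proof -
        have "(h / \<sigma>) * Z \<sigma> (j + k) \<le> (h / \<sigma>) * (B * h)" using ZB[OF \<sigma>] q by (intro mult_left_mono)
        also have "\<dots> \<le> (h / \<sigma>0) * (B * (1 / k))" using q h1 B pos by (intro mult_mono mult_left_mono) auto
        finally show ?thesis .
      qed
      also have "(1 + h / \<sigma>) * (h * ((2 * B + 2 * \<Lambda>) / k)) \<le> (1 + 1 / \<sigma>0) * (h * ((2 * B + 2 * \<Lambda>) / k))"
        using q2 pos B \<Lambda> by (intro mult_right_mono) auto
      also have "h * A + (h / \<sigma>0) * (B * (1 / k)) + (1 + 1 / \<sigma>0) * (h * ((2 * B + 2 * \<Lambda>) / k)) = h * (A + E0 / k)"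
        by (simp add: E0_def add_divide_distrib algebra_simps)
      finally show ?thesis by simp
    qed
    have st6: "W (\<sigma>0 + real m * h) (m * k) - W \<sigma>0 0 \<le> real m * (h * (A + E0 / k))" for m
    proof (induction m)
      case (Suc m)
      have "W (\<sigma>0 + real m * h + h) (m * k + k) - W (\<sigma>0 + real m * h) (m * k) \<le> h * (A + E0 / k)"
        using pos by (intro st5) simp
      moreover have "\<sigma>0 + real (Suc m) * h = \<sigma>0 + real m * h + h" "Suc m * k = m * k + k" by (auto simp: algebra_simps)
      ultimately show ?case using Suc by (simp only: of_nat_Suc distrib_right)
    qed simp
    have Wu: "\<bar>W \<sigma> j - u \<sigma> j\<bar> \<le> \<Lambda> / k" if \<sigma>: "\<sigma>0 \<le> \<sigma>" for \<sigma> j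
    proof -
      have "\<bar>u \<sigma> (j + i) - u \<sigma> j\<bar> \<le> \<Lambda> / k" if "i < n" for i
      proof -
        have "\<bar>u \<sigma> (j + i) - u \<sigma> j\<bar> \<le> \<Lambda> * \<bar>real (j + i) * \<eta> - real j * \<eta>\<bar>" unfolding u_def by (rule lip\<tau>[OF \<sigma>])
        also have "\<bar>real (j + i) * \<eta> - real j * \<eta>\<bar> = real i * \<eta>" using pos by (simp add: algebra_simps)
        also have "\<Lambda> * (real i * \<eta>) \<le> \<Lambda> * (real n * \<eta>)" using that \<Lambda> pos by (intro mult_left_mono mult_right_mono) auto
        also have "real n * \<eta> = real k * h" using k by (simp add: n_def \<eta>_def power2_eq_square)
        also have "real k * h \<le> 1 / k"
        proof -
          have "real k * h = 1 / real k ^ 2" using k by (simp add: h_def power2_eq_square power3_eq_cube)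
          also have "\<dots> \<le> 1 / k" using k by (simp add: power2_eq_square field_simps)
          finally show ?thesis .
        qed
        finally show ?thesis using \<Lambda> by (simp add: mult_left_mono)
      qed
      then have "\<bar>\<Sum>i<n. u \<sigma> (j + i) - u \<sigma> j\<bar> \<le> (\<Sum>i<n. \<Lambda> / k)" by (intro order_trans[OF sum_abs] sum_mono) auto
      then have "\<bar>\<Sum>i<n. u \<sigma> (j + i) - u \<sigma> j\<bar> / n \<le> \<Lambda> / k" using pos by (simp add: divide_le_eq mult.commute)
      moreover have "(\<Sum>i<n. u \<sigma> (j + i) - u \<sigma> j) / n = W \<sigma> j - u \<sigma> j"
        using pos by (simp add: W_def sum_subtractf diff_divide_distrib)
      ultimately show ?thesis by (metis abs_divide abs_of_nat)
    qed
    \<comment> \<open>After \<open>k ^ 3\<close> diagonal steps both coordinates have advanced by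
      1.\<close>
    have kh: "real (k ^ 3) * h = 1" "real (k ^ 3 * k) * \<eta> = 1" using k by (auto simp: h_def \<eta>_def)
    have "W (\<sigma>0 + 1) (k ^ 3 * k) - W \<sigma>0 0 \<le> A + E0 / k"
      using st6[of "k ^ 3"] unfolding mult.assoc[symmetric] kh by simp
    moreover have "u (\<sigma>0 + 1) (k ^ 3 * k) = w (\<sigma>0 + 1) 1" "u \<sigma>0 0 = w \<sigma>0 0" unfolding u_def kh by auto
    ultimately have "w (\<sigma>0 + 1) 1 - w \<sigma>0 0 - A \<le> E0 / k + \<Lambda> / k + \<Lambda> / k"
      using Wu[of "\<sigma>0 + 1" "k ^ 3 * k"] Wu[of \<sigma>0 0] by auto
    then show ?thesis by (simp add: add_divide_distrib)
  qed
  have "w (\<sigma>0 + 1) 1 - w \<sigma>0 0 - A \<le> 0"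
  proof (rule LIMSEQ_le_const)
    show "(\<lambda>k. (E0 + 2 * \<Lambda>) / real k) \<longlonglongrightarrow> 0" by (rule lim_const_over_n)
    show "\<exists>N. \<forall>n\<ge>N. w (\<sigma>0 + 1) 1 - w \<sigma>0 0 - A \<le> (E0 + 2 * \<Lambda>) / real n"
      using main by (intro exI[of _ 1]) auto
  qed
  then show ?thesis by simp
qed

section \<open>Asymptotic slopes and the Hopf--Lax flow\<close>

text \<open>The supremum under the limit in \<open>Lip_a\<close>. It is monotone in
  \<open>r\<close>, so that limit is an infimum.\<close>

definition slope_sup :: "('a \<Rightarrow> 'a \<Rightarrow> ennreal) \<Rightarrow> ('a \<Rightarrow> real) \<Rightarrow> 'a \<Rightarrow> real \<Rightarrow> ennreal" where
  "slope_sup d f x r = (SUP (y, z)\<in>{(y, z). max (d y x) (d z x) < ennreal r \<and> 0 < d y z}.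
       ennreal \<bar>f y - f z\<bar> / d y z)"

lemma slope_sup_mono: assumes "r \<le> r'" shows "slope_sup d f x r \<le> slope_sup d f x r'"
proof -
  have le: "ennreal r \<le> ennreal r'" using assms by (rule ennreal_leI)
  show ?thesis unfolding slope_sup_def
    by (rule SUP_subset_mono) (auto dest: less_le_trans[OF _ le])
qed

lemma tendsto_at_right_INF_mono:
  fixes S :: "real \<Rightarrow> ennreal"
  assumes "\<And>r r'. r \<le> r' \<Longrightarrow> S r \<le> S r'"
  shows "(S \<longlongrightarrow> (INF r\<in>{0<..}. S r)) (at_right 0)"
proof (rule order_tendstoI)
  fix a assume "a < (INF r\<in>{0<..}. S r)"
  then have "a < S x" if "0 < x" for x using that by (elim less_le_trans) (auto intro: INF_lower)
  then show "eventually (\<lambda>x. a < S x) (at_right 0)"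
    unfolding eventually_at_right_field by (intro exI[of _ 1]) auto
next
  fix a assume "(INF r\<in>{0<..}. S r) < a"
  then obtain r where "0 < r" "S r < a" unfolding INF_less_iff by auto
  moreover have "S x < a" if "x < r" for x
    using assms[of x r] that \<open>S r < a\<close> by (simp add: le_less_trans)
  ultimately show "eventually (\<lambda>x. S x < a) (at_right 0)"
    unfolding eventually_at_right_field by (intro exI[of _ r]) auto
qed

lemma Lip_a_eq_INF: "Lip_a d f x = enn2real (INF r\<in>{0<..}. slope_sup d f x r)"
proof -
  have "Lim (at_right (0::real)) (\<lambda>r. slope_sup d f x r) = (INF r\<in>{0<..}. slope_sup d f x r)"
    by (intro tendsto_Lim tendsto_at_right_INF_mono slope_sup_mono) auto
  then show ?thesis by (simp add: Lip_a_def slope_sup_def)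
qed

lemma Lip_a_nonneg: "0 \<le> Lip_a d f x"
  by (simp add: Lip_a_eq_INF)

lemma slope_sup_le:
  assumes "\<And>y z. d y x < ennreal r \<Longrightarrow> d z x < ennreal r \<Longrightarrow> ennreal \<bar>f y - f z\<bar> \<le> ennreal L * d y z"
  shows "slope_sup d f x r \<le> ennreal L"
  unfolding slope_sup_def
proof (rule SUP_least, clarify)
  fix y z assume yz: "max (d y x) (d z x) < ennreal r" "0 < d y z"
  show "ennreal \<bar>f y - f z\<bar> / d y z \<le> ennreal L"
  proof (cases "d y z = \<top>")
    case True then show ?thesis by simp
  next
    case False
    have "ennreal \<bar>f y - f z\<bar> / d y z \<le> (ennreal L * d y z) / d y z"
      using yz assms[of y z] by (intro divide_right_mono_ennreal) auto
    also have "\<dots> = ennreal L" using yz False by (simp add: ennreal_mult_divide_eq)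
    finally show ?thesis .
  qed
qed

lemma Lip_a_le:
  assumes "0 < r" "0 \<le> L"
    and "\<And>y z. d y x < ennreal r \<Longrightarrow> d z x < ennreal r \<Longrightarrow> ennreal \<bar>f y - f z\<bar> \<le> ennreal L * d y z"
  shows "Lip_a d f x \<le> L"
proof -
  have "(INF r\<in>{0<..}. slope_sup d f x r) \<le> slope_sup d f x r" using assms(1) by (intro INF_lower) auto
  also have "\<dots> \<le> ennreal L" by (rule slope_sup_le[OF assms(3)])
  finally show ?thesis unfolding Lip_a_eq_INF using assms(2) by (intro enn2real_leI)
qed

lemma Lip_a_bound:
  assumes "0 \<le> L" "\<And>y z. ennreal \<bar>f y - f z\<bar> \<le> ennreal L * d y z"
  shows "Lip_a d f x \<le> L"
  by (rule Lip_a_le[of 1]) (use assms in auto)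

text \<open>The quotient omits pairs at distance 0 and vanishes for pairs at distance
  \<open>\<top>\<close>. The inequality survives in both cases: points at distance 0 coincide, and
  the constant \<open>Lip_a d f x + e\<close> is strictly positive, which makes the right-hand side
  infinite.\<close>

lemma Lip_a_approx:
  assumes d: "extended_metric d" and f: "f \<in> Lip_b d" and e: "0 < e"
  obtains r where "0 < r" "\<And>y z. d y x < ennreal r \<Longrightarrow> d z x < ennreal r \<Longrightarrow>
    ennreal \<bar>f y - f z\<bar> \<le> ennreal (Lip_a d f x + e) * d y z"
proof -
  obtain L where L: "0 \<le> L" "\<And>x y. ennreal \<bar>f x - f y\<bar> \<le> ennreal L * d x y" by (rule Lip_bE[OF f]) blast
  let ?I = "INF r\<in>{0<..}. slope_sup d f x r"
  have "?I \<le> slope_sup d f x 1" by (intro INF_lower) auto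
  also have "\<dots> \<le> ennreal L" by (rule slope_sup_le[OF L(2)])
  finally have fin: "?I < \<top>" using ennreal_less_top by (rule order.strict_trans1)
  have I: "?I = ennreal (Lip_a d f x)" unfolding Lip_a_eq_INF using fin by (simp only: ennreal_enn2real)
  also have "\<dots> < ennreal (Lip_a d f x + e)" using e Lip_a_nonneg[of d f x] by (intro ennreal_lessI) auto
  finally obtain r where r: "0 < r" "slope_sup d f x r < ennreal (Lip_a d f x + e)" unfolding INF_less_iff by auto
  show thesis
  proof (rule that[OF r(1)])
    fix y z assume yz: "d y x < ennreal r" "d z x < ennreal r"
    show "ennreal \<bar>f y - f z\<bar> \<le> ennreal (Lip_a d f x + e) * d y z"
    proof (cases "d y z = 0 \<or> d y z = \<top>")
      case True
      then show ?thesis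
      proof
        assume "d y z = 0"
        then have "y = z" using d by (auto simp: extended_metric_def)
        then show ?thesis by simp
      next
        assume "d y z = \<top>"
        moreover have "ennreal (Lip_a d f x + e) \<noteq> 0" using e Lip_a_nonneg[of d f x] by (simp add: ennreal_eq_0_iff)
        ultimately show ?thesis by (simp add: ennreal_mult_top)
      qed
    next
      case False
      then have p: "0 < d y z" by (simp add: zero_less_iff_neq_zero)
      have "ennreal \<bar>f y - f z\<bar> / d y z \<le> slope_sup d f x r"
        unfolding slope_sup_def using yz p by (intro SUP_upper2[of "(y, z)"]) auto
      also have "\<dots> \<le> ennreal (Lip_a d f x + e)" using r by simp
      finally have "(ennreal \<bar>f y - f z\<bar> / d y z) * d y z \<le> ennreal (Lip_a d f x + e) * d y z"
        by (intro mult_right_mono) auto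
      also have "(ennreal \<bar>f y - f z\<bar> / d y z) * d y z = ennreal \<bar>f y - f z\<bar>"
        using False by (simp add: ennreal_divide_times ennreal_divide_self less_top)
      finally show ?thesis .
    qed
  qed
qed

section \<open>The Hopf-Lax functions of a bounded continuous semidistance\<close>

locale hopf_lax =
  fixes d :: "'a::t2_space \<Rightarrow> 'a \<Rightarrow> ennreal" and \<delta> :: "'a \<Rightarrow> 'a \<Rightarrow> real" and f :: "'a \<Rightarrow> real" and M Bf :: real
  assumes \<delta>: "\<delta> \<in> bcs d" and \<delta>M: "\<And>x y. \<delta> x y \<le> M" and fB: "\<And>x. \<bar>f x\<bar> \<le> Bf"
begin

definition val :: "real \<Rightarrow> 'a \<Rightarrow> 'a \<Rightarrow> real" where "val \<sigma> x y = f y + (\<delta> x y)\<^sup>2 / (2 * \<sigma>)"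

definition Q :: "real \<Rightarrow> 'a \<Rightarrow> real" where "Q \<sigma> x = (INF y. val \<sigma> x y)"

lemmas dnn = bcs_nonneg[OF \<delta>] and drefl = bcs_refl[OF \<delta>] and dcomm = bcs_commute[OF \<delta>] and dtri = bcs_triangle[OF \<delta>]

lemma M_nonneg: "0 \<le> M" using dnn \<delta>M order_trans by blast

lemma val_ge: "0 < \<sigma> \<Longrightarrow> - Bf \<le> val \<sigma> x y"
  using fB[of y] by (auto simp: val_def intro!: add_increasing2)

lemma Q_le: "0 < \<sigma> \<Longrightarrow> Q \<sigma> x \<le> val \<sigma> x y"
  unfolding Q_def by (intro cINF_lower bdd_belowI2[of _ "- Bf"] val_ge) auto

lemma Q_greatest: "(\<And>y. c \<le> val \<sigma> x y) \<Longrightarrow> c \<le> Q \<sigma> x"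
  unfolding Q_def by (intro cINF_greatest) auto

lemma Q_approx: assumes "0 < \<sigma>" "0 < e" obtains y where "val \<sigma> x y < Q \<sigma> x + e"
  using cInf_lessD[of "range (val \<sigma> x)" "Q \<sigma> x + e"] assms unfolding Q_def by auto

lemma Q_le_f: "0 < \<sigma> \<Longrightarrow> Q \<sigma> x \<le> f x"
  using Q_le[of \<sigma> x x] by (simp add: val_def drefl)

lemma Q_bound: assumes "0 < \<sigma>" shows "\<bar>Q \<sigma> x\<bar> \<le> Bf"
proof -
  have "- Bf \<le> Q \<sigma> x" using val_ge[OF assms] by (rule Q_greatest)
  moreover have "Q \<sigma> x \<le> Bf" using Q_le_f[OF assms, of x] fB[of x] by linarith
  ultimately show ?thesis by auto
qed

lemma val_diff: "0 < \<sigma> \<Longrightarrow> 0 < \<sigma>' \<Longrightarrow> val \<sigma> x y - val \<sigma>' x y = (\<delta> x y)\<^sup>2 * ((\<sigma>' - \<sigma>) / (2 * \<sigma> * \<sigma>'))"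
  by (simp add: val_def field_simps)

lemma Q_antimono: assumes "0 < \<sigma>" "\<sigma> \<le> \<sigma>'" shows "Q \<sigma>' x \<le> Q \<sigma> x"
proof (rule Q_greatest)
  fix y
  have "0 \<le> (\<delta> x y)\<^sup>2 * ((\<sigma>' - \<sigma>) / (2 * \<sigma> * \<sigma>'))" using assms by auto
  then have "val \<sigma>' x y \<le> val \<sigma> x y" using val_diff[of \<sigma> \<sigma>' x y] assms by linarith
  then show "Q \<sigma>' x \<le> val \<sigma> x y" using Q_le[of \<sigma>' x y] assms by linarith
qed

text \<open>The coefficients \<open>1 / (2 * \<sigma>)\<close> and
  \<open>1 / (2 * \<sigma>')\<close> differ by at most
  \<open>\<bar>\<sigma> - \<sigma>'\<bar> / (2 * \<sigma>0\<^sup>2)\<close>, and they multiply a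
  square bounded by \<open>M\<^sup>2\<close>.\<close>

lemma Q_lipschitz_time:
  assumes s: "0 < \<sigma>0" "\<sigma>0 \<le> \<sigma>" "\<sigma>0 \<le> \<sigma>'"
  shows "\<bar>Q \<sigma> x - Q \<sigma>' x\<bar> \<le> M\<^sup>2 / (2 * \<sigma>0\<^sup>2) * \<bar>\<sigma> - \<sigma>'\<bar>"
proof -
  have *: "Q \<sigma> x - Q \<sigma>' x \<le> M\<^sup>2 / (2 * \<sigma>0\<^sup>2) * (\<sigma>' - \<sigma>)" if "\<sigma>0 \<le> \<sigma>" "\<sigma> \<le> \<sigma>'" for \<sigma> \<sigma>'
  proof -
    have "Q \<sigma> x - M\<^sup>2 / (2 * \<sigma>0\<^sup>2) * (\<sigma>' - \<sigma>) \<le> Q \<sigma>' x"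
    proof (rule Q_greatest)
      fix y
      have "(\<delta> x y)\<^sup>2 * ((\<sigma>' - \<sigma>) / (2 * \<sigma> * \<sigma>')) \<le> M\<^sup>2 * ((\<sigma>' - \<sigma>) / (2 * \<sigma>0 * \<sigma>0))"
        using that s dnn \<delta>M by (intro mult_mono power_mono divide_left_mono) (auto intro!: mult_mono)
      then show "Q \<sigma> x - M\<^sup>2 / (2 * \<sigma>0\<^sup>2) * (\<sigma>' - \<sigma>) \<le> val \<sigma>' x y"
        using val_diff[of \<sigma> \<sigma>' x y] Q_le[of \<sigma> x y] that s by (simp add: power2_eq_square)
    qed
    then show ?thesis by simp
  qed
  show ?thesis
  proof (cases "\<sigma> \<le> \<sigma>'")
    case True then show ?thesis using *[of \<sigma> \<sigma>'] Q_antimono[of \<sigma> \<sigma>' x] s by simp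
  next
    case False then show ?thesis using *[of \<sigma>' \<sigma>] Q_antimono[of \<sigma>' \<sigma> x] s by simp
  qed
qed

text \<open>Difference of squares: one factor is at most \<open>\<delta> x x'\<close> by the
  triangle inequality, the other at most \<open>2 * M\<close>.\<close>

lemma Q_lipschitz:
  assumes "0 < \<sigma>" shows "\<bar>Q \<sigma> x - Q \<sigma> x'\<bar> \<le> M / \<sigma> * \<delta> x x'"
proof -
  have *: "Q \<sigma> x - Q \<sigma> x' \<le> M / \<sigma> * \<delta> x x'" for x x'
  proof -
    have "Q \<sigma> x - M / \<sigma> * \<delta> x x' \<le> Q \<sigma> x'"
    proof (rule Q_greatest)
      fix y
      have "(\<delta> x y)\<^sup>2 - (\<delta> x' y)\<^sup>2 = (\<delta> x y - \<delta> x' y) * (\<delta> x y + \<delta> x' y)" by (simp add: power2_eq_square algebra_simps)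
      also have "\<dots> \<le> \<delta> x x' * (2 * M)"
      proof (cases "\<delta> x y \<le> \<delta> x' y")
        case True
        then have "(\<delta> x y - \<delta> x' y) * (\<delta> x y + \<delta> x' y) \<le> 0" using dnn by (intro mult_nonpos_nonneg) auto
        also have "0 \<le> \<delta> x x' * (2 * M)" using dnn M_nonneg by simp
        finally show ?thesis .
      next
        case False
        then show ?thesis using dtri[of x y x'] \<delta>M[of x y] \<delta>M[of x' y] dnn by (intro mult_mono) auto
      qed
      finally have "((\<delta> x y)\<^sup>2 - (\<delta> x' y)\<^sup>2) / (2 * \<sigma>) \<le> \<delta> x x' * (2 * M) / (2 * \<sigma>)" using assms by (intro divide_right_mono) auto
      then show "Q \<sigma> x - M / \<sigma> * \<delta> x x' \<le> val \<sigma> x' y"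
        using Q_le[OF assms, of x y] by (simp add: val_def diff_divide_distrib mult.commute)
    qed
    then show ?thesis by simp
  qed
  show ?thesis using *[of x x'] *[of x' x] dcomm[of x x'] by auto
qed

lemma Q_in_Lip_b: assumes "0 < \<sigma>" shows "Q \<sigma> \<in> Lip_b d"
  unfolding Lip_b_def
proof (intro CollectI conjI exI[of _ "M / \<sigma>"] allI)
  show "bounded (range (Q \<sigma>))" using Q_bound[OF assms] by (auto simp: bounded_range_real)
  show "0 \<le> M / \<sigma>" using M_nonneg assms by simp
  show "continuous_on UNIV (Q \<sigma>)"
    unfolding continuous_on_def
  proof
    fix x
    have "continuous_on UNIV (\<lambda>y. \<delta> (fst (x, y)) (snd (x, y)))"
      by (rule continuous_on_compose2[OF bcs_continuous[OF \<delta>]]) (auto intro!: continuous_intros)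
    then have "((\<lambda>y. \<delta> x y) \<longlongrightarrow> \<delta> x x) (at x within UNIV)" by (auto simp: continuous_on_def)
    then have "((\<lambda>y. M / \<sigma> * \<delta> x y) \<longlongrightarrow> M / \<sigma> * 0) (at x within UNIV)" by (intro tendsto_mult_left) (simp add: drefl)
    then have lim: "((\<lambda>y. M / \<sigma> * \<delta> x y) \<longlongrightarrow> 0) (at x within UNIV)" by simp
    have "norm (Q \<sigma> y - Q \<sigma> x) \<le> M / \<sigma> * \<delta> x y" for y
      using Q_lipschitz[OF assms, of x y] by (simp only: real_norm_def abs_minus_commute)
    then have "((\<lambda>y. Q \<sigma> y - Q \<sigma> x) \<longlongrightarrow> 0) (at x within UNIV)"
      by (intro Lim_null_comparison[OF always_eventually lim]) simp
    then show "(Q \<sigma> \<longlongrightarrow> Q \<sigma> x) (at x within UNIV)" by (simp add: LIM_zero_iff)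
  qed
  fix x y
  have "ennreal \<bar>Q \<sigma> x - Q \<sigma> y\<bar> \<le> ennreal (M / \<sigma> * \<delta> x y)" by (intro ennreal_leI Q_lipschitz assms)
  also have "\<dots> = ennreal (M / \<sigma>) * ennreal (\<delta> x y)" using M_nonneg assms dnn by (intro ennreal_mult) auto
  also have "\<dots> \<le> ennreal (M / \<sigma>) * d x y" by (intro mult_left_mono bcs_le[OF \<delta>]) auto
  finally show "ennreal \<bar>Q \<sigma> x - Q \<sigma> y\<bar> \<le> ennreal (M / \<sigma>) * d x y" .
qed

text \<open>Near-minimisers \<open>z\<close> for points \<open>y\<close> close to \<open>x\<close> have \<open>\<delta> y z\<close> bounded through the decrease of
  \<open>Q\<close> in time, and \<open>Q \<sigma>\<close> has slope \<open>\<delta> y z / \<sigma>\<close> there.\<close>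

lemma Lip_a_Q:
  assumes s: "0 < \<sigma>" "\<sigma> < \<sigma>'"
  shows "(Lip_a d (Q \<sigma>) x)\<^sup>2 \<le> 2 * (Q \<sigma> x - Q \<sigma>' x) * (\<sigma>' / (\<sigma> * (\<sigma>' - \<sigma>)))"
proof -
  have s': "0 < \<sigma>'" using s by simp
  \<comment> \<open>The constant for which \<open>val \<sigma> y z - val \<sigma>' y z\<close>
    equals \<open>(\<delta> y z)\<^sup>2 / k\<close>.\<close>
  define k where "k = 2 * \<sigma> * \<sigma>' / (\<sigma>' - \<sigma>)"
  have k: "0 < k" using s by (simp add: k_def)
  define c where "c = k * (1 + M / \<sigma> + M / \<sigma>')"
  have c: "0 \<le> c" using k M_nonneg s s' by (simp add: c_def)
  define D2 where "D2 = k * (Q \<sigma> x - Q \<sigma>' x)"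
  have D2: "0 \<le> D2" using k Q_antimono[of \<sigma> \<sigma>' x] s by (simp add: D2_def)
  \<comment> \<open>\<open>z\<close> competes for \<open>Q \<sigma>' y\<close> as well. Passing from
    \<open>y\<close> to \<open>x\<close> in both values of \<open>Q\<close> costs the two Lipschitz
    constants collected in \<open>c\<close>.\<close>
  have near: "(\<delta> y z)\<^sup>2 \<le> D2 + c * r" if y: "\<delta> y x \<le> r" and z: "val \<sigma> y z \<le> Q \<sigma> y + r" for y z r
  proof -
    have "(\<delta> y z)\<^sup>2 / k = val \<sigma> y z - val \<sigma>' y z" using val_diff[of \<sigma> \<sigma>' y z] s s' by (simp add: k_def)
    also have "\<dots> \<le> Q \<sigma> y + r - Q \<sigma>' y" using z Q_le[OF s', of y z] by simp
    finally have "(\<delta> y z)\<^sup>2 / k \<le> Q \<sigma> y + r - Q \<sigma>' y" .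
    moreover have "Q \<sigma> y \<le> Q \<sigma> x + M / \<sigma> * r"
    proof -
      have "M / \<sigma> * \<delta> y x \<le> M / \<sigma> * r" using y M_nonneg s by (intro mult_left_mono) auto
      then show ?thesis using Q_lipschitz[OF s(1), of y x] by linarith
    qed
    moreover have "- Q \<sigma>' y \<le> - Q \<sigma>' x + M / \<sigma>' * r"
    proof -
      have "M / \<sigma>' * \<delta> y x \<le> M / \<sigma>' * r" using y M_nonneg s' by (intro mult_left_mono) auto
      then show ?thesis using Q_lipschitz[OF s', of y x] by linarith
    qed
    ultimately have "(\<delta> y z)\<^sup>2 / k \<le> (Q \<sigma> x - Q \<sigma>' x) + (1 + M / \<sigma> + M / \<sigma>') * r"
      unfolding distrib_right by linarith
    then have "(\<delta> y z)\<^sup>2 \<le> k * ((Q \<sigma> x - Q \<sigma>' x) + (1 + M / \<sigma> + M / \<sigma>') * r)" using k by (simp add: field_simps)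
    then show ?thesis by (simp add: D2_def c_def algebra_simps)
  qed
  have bound: "Lip_a d (Q \<sigma>) x \<le> (sqrt (D2 + c * r) + r) / \<sigma>" if r: "0 < r" for r
  proof (rule Lip_a_le[OF r])
    have cr: "0 \<le> D2 + c * r" using c D2 r by simp
    show L0: "0 \<le> (sqrt (D2 + c * r) + r) / \<sigma>" using cr r s by simp
    fix y z assume "d y x < ennreal r" "d z x < ennreal r"
    then have "ennreal (\<delta> y x) < ennreal r" "ennreal (\<delta> z x) < ennreal r" using bcs_le[OF \<delta>] by (auto intro: le_less_trans)
    then have yz: "\<delta> y x < r" "\<delta> z x < r" using dnn by (auto simp: ennreal_less_iff)
    have half: "Q \<sigma> z - Q \<sigma> y \<le> (sqrt (D2 + c * r) + r) / \<sigma> * \<delta> y z" if yz: "\<delta> y x < r" "\<delta> z x < r" for y z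
    proof (rule field_le_epsilon)
      fix e :: real assume e: "0 < e"
      \<comment> \<open>Precision \<open>e\<close> for the increment under estimate, precision
        \<open>r\<close> for the use of \<open>near\<close>.\<close>
      obtain p where p: "val \<sigma> y p < Q \<sigma> y + min e r" using Q_approx[OF s(1), of "min e r" y] e r by auto
      have dp: "\<delta> y p \<le> sqrt (D2 + c * r)" using near[of y r p] yz p by (intro real_le_rsqrt) auto
      have "Q \<sigma> z - Q \<sigma> y \<le> val \<sigma> z p - val \<sigma> y p + e" using Q_le[OF s(1), of z p] p by simp
      also have "val \<sigma> z p - val \<sigma> y p = ((\<delta> z p)\<^sup>2 - (\<delta> y p)\<^sup>2) / (2 * \<sigma>)" by (simp add: val_def diff_divide_distrib)
      also have "(\<delta> z p)\<^sup>2 - (\<delta> y p)\<^sup>2 \<le> \<delta> y z * (2 * (sqrt (D2 + c * r) + r))"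
      proof -
        have "\<delta> z p \<le> \<delta> y z + \<delta> y p" using dtri[of z p y] dcomm[of z y] by simp
        then have "(\<delta> z p)\<^sup>2 \<le> (\<delta> y z + \<delta> y p)\<^sup>2" using dnn by (intro power_mono) auto
        then have "(\<delta> z p)\<^sup>2 - (\<delta> y p)\<^sup>2 \<le> \<delta> y z * (\<delta> y z + 2 * \<delta> y p)" by (simp add: power2_eq_square algebra_simps)
        also have "\<delta> y z * (\<delta> y z + 2 * \<delta> y p) \<le> \<delta> y z * (2 * (sqrt (D2 + c * r) + r))"
          using dp dtri[of y z x] yz dcomm[of x z] dnn by (intro mult_left_mono) auto
        finally show ?thesis .
      qed
      then have "((\<delta> z p)\<^sup>2 - (\<delta> y p)\<^sup>2) / (2 * \<sigma>) \<le> (\<delta> y z * (2 * (sqrt (D2 + c * r) + r))) / (2 * \<sigma>)"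
        using s by (intro divide_right_mono) auto
      also have "(\<delta> y z * (2 * (sqrt (D2 + c * r) + r))) / (2 * \<sigma>) = (sqrt (D2 + c * r) + r) / \<sigma> * \<delta> y z"
        using s by (simp add: field_simps)
      finally show "Q \<sigma> z - Q \<sigma> y \<le> (sqrt (D2 + c * r) + r) / \<sigma> * \<delta> y z + e" by simp
    qed
    have "\<bar>Q \<sigma> y - Q \<sigma> z\<bar> \<le> (sqrt (D2 + c * r) + r) / \<sigma> * \<delta> y z"
      using half[OF yz] half[OF yz(2,1)] dcomm[of y z] by auto
    then have "ennreal \<bar>Q \<sigma> y - Q \<sigma> z\<bar> \<le> ennreal ((sqrt (D2 + c * r) + r) / \<sigma> * \<delta> y z)" by (rule ennreal_leI)
    also have "\<dots> = ennreal ((sqrt (D2 + c * r) + r) / \<sigma>) * ennreal (\<delta> y z)" using L0 dnn by (intro ennreal_mult) auto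
    also have "\<dots> \<le> ennreal ((sqrt (D2 + c * r) + r) / \<sigma>) * d y z" by (intro mult_left_mono bcs_le[OF \<delta>]) auto
    finally show "ennreal \<bar>Q \<sigma> y - Q \<sigma> z\<bar> \<le> ennreal ((sqrt (D2 + c * r) + r) / \<sigma>) * d y z" .
  qed
  have "((\<lambda>r. (sqrt (D2 + c * r) + r) / \<sigma>) \<longlongrightarrow> (sqrt (D2 + c * 0) + 0) / \<sigma>) (at_right 0)"
    using s by (intro tendsto_intros) auto
  then have "Lip_a d (Q \<sigma>) x \<le> (sqrt (D2 + c * 0) + 0) / \<sigma>"
  proof (rule tendsto_lowerbound)
    show "eventually (\<lambda>r. Lip_a d (Q \<sigma>) x \<le> (sqrt (D2 + c * r) + r) / \<sigma>) (at_right 0)"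
      unfolding eventually_at_right_field using bound by (intro exI[of _ 1]) auto
  qed simp
  then have "(Lip_a d (Q \<sigma>) x)\<^sup>2 \<le> (sqrt D2 / \<sigma>)\<^sup>2" by (intro power_mono Lip_a_nonneg) simp
  also have "\<dots> = D2 / \<sigma>\<^sup>2" using D2 by (simp add: power_divide)
  also have "\<dots> = 2 * (Q \<sigma> x - Q \<sigma>' x) * (\<sigma>' / (\<sigma> * (\<sigma>' - \<sigma>)))"
    using s by (simp add: D2_def k_def power2_eq_square divide_simps)
  finally show ?thesis .
qed

end

section \<open>Square integrable functions\<close>

definition n2 :: "'a measure \<Rightarrow> ('a \<Rightarrow> real) \<Rightarrow> real" where "n2 M f = (LINT x|M. (f x)\<^sup>2)"

lemma n2_nonneg: "0 \<le> n2 M f" by (simp add: n2_def)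

lemma L2_measurable: "f \<in> L2 M \<Longrightarrow> f \<in> borel_measurable M" and L2_integrable: "f \<in> L2 M \<Longrightarrow> integrable M (\<lambda>x. (f x)\<^sup>2)"
  by (auto simp: L2_def)

lemma L2_I_bound:
  assumes "f \<in> borel_measurable M" "integrable M g" "AE x in M. (f x)\<^sup>2 \<le> g x" shows "f \<in> L2 M"
  unfolding L2_def using assms
  by (auto intro!: Bochner_Integration.integrable_bound[OF assms(2)] elim!: eventually_mono)

lemma integrable_mult_L2:
  assumes "f \<in> L2 M" "g \<in> L2 M" shows "integrable M (\<lambda>x. f x * g x)"
proof (rule Bochner_Integration.integrable_bound[OF Bochner_Integration.integrable_add[OF L2_integrable[OF assms(1)] L2_integrable[OF assms(2)]]])
  show "(\<lambda>x. f x * g x) \<in> borel_measurable M" by (intro borel_measurable_times L2_measurable assms)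
  have "\<bar>a * b\<bar> \<le> \<bar>a\<^sup>2 + b\<^sup>2\<bar>" for a b :: real
  proof -
    have "0 \<le> (\<bar>a\<bar> - \<bar>b\<bar>)\<^sup>2" by simp
    then have "2 * (\<bar>a\<bar> * \<bar>b\<bar>) \<le> a\<^sup>2 + b\<^sup>2" by (simp add: power2_diff)
    moreover have "0 \<le> \<bar>a\<bar> * \<bar>b\<bar>" by simp
    ultimately show ?thesis unfolding abs_mult by linarith
  qed
  then show "AE x in M. norm (f x * g x) \<le> norm ((f x)\<^sup>2 + (g x)\<^sup>2)" by auto
qed

lemma L2_cmult: "f \<in> L2 M \<Longrightarrow> (\<lambda>x. c * f x) \<in> L2 M"
  by (auto simp: L2_def power_mult_distrib)

lemma L2_add: assumes "f \<in> L2 M" "g \<in> L2 M" shows "(\<lambda>x. f x + g x) \<in> L2 M"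
proof -
  have "integrable M (\<lambda>x. (f x)\<^sup>2 + 2 * (f x * g x) + (g x)\<^sup>2)"
    using assms by (intro Bochner_Integration.integrable_add integrable_mult_right integrable_mult_L2 L2_integrable)
  then show ?thesis using assms by (auto simp: L2_def power2_sum ac_simps)
qed

lemma L2_diff: assumes "f \<in> L2 M" "g \<in> L2 M" shows "(\<lambda>x. f x - g x) \<in> L2 M"
  using L2_add[OF assms(1) L2_cmult[OF assms(2), of "-1"]] by simp

lemma n2_add_le: assumes "f \<in> L2 M" "g \<in> L2 M" shows "n2 M (\<lambda>x. f x + g x) \<le> 2 * n2 M f + 2 * n2 M g"
proof -
  have "n2 M (\<lambda>x. f x + g x) \<le> (LINT x|M. 2 * (f x)\<^sup>2 + 2 * (g x)\<^sup>2)" unfolding n2_def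
  proof (rule integral_mono)
    show "(f x + g x)\<^sup>2 \<le> 2 * (f x)\<^sup>2 + 2 * (g x)\<^sup>2" for x
      using sum_squares_bound[of "f x" "g x"] by (simp add: power2_sum)
  qed (use assms in \<open>auto intro!: L2_integrable L2_add\<close>)
  also have "\<dots> = 2 * n2 M f + 2 * n2 M g" using assms by (simp add: n2_def L2_integrable)
  finally show ?thesis .
qed

lemma n2_triangle:
  assumes "f \<in> L2 M" "g \<in> L2 M" "h \<in> L2 M"
  shows "n2 M (\<lambda>x. f x - h x) \<le> 2 * n2 M (\<lambda>x. f x - g x) + 2 * n2 M (\<lambda>x. g x - h x)"
  using n2_add_le[OF L2_diff[OF assms(1,2)] L2_diff[OF assms(2,3)]] by simp

lemma n2_cmult: "n2 M (\<lambda>x. c * f x) = c\<^sup>2 * n2 M f"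
  by (simp add: n2_def power_mult_distrib)

lemma n2_commute: "n2 M (\<lambda>x. f x - g x) = n2 M (\<lambda>x. g x - f x)"
  by (simp add: n2_def power2_commute)

lemma n2_expand:
  assumes "f \<in> L2 M" "g \<in> L2 M"
  shows "n2 M (\<lambda>x. f x + c * g x) = n2 M f + 2 * c * (LINT x|M. f x * g x) + c\<^sup>2 * n2 M g"
proof -
  have "n2 M (\<lambda>x. f x + c * g x) = (LINT x|M. (f x)\<^sup>2 + (2 * c) * (f x * g x) + c\<^sup>2 * (g x)\<^sup>2)"
    unfolding n2_def by (intro Bochner_Integration.integral_cong) (auto simp: power2_eq_square algebra_simps)
  also have "\<dots> = n2 M f + 2 * c * (LINT x|M. f x * g x) + c\<^sup>2 * n2 M g"
    using assms by (simp add: n2_def L2_integrable integrable_mult_L2)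
  finally show ?thesis .
qed

lemma n2_parallelogram:
  assumes "f \<in> L2 M" "g \<in> L2 M"
  shows "n2 M (\<lambda>x. f x - g x) = 2 * n2 M f + 2 * n2 M g - 4 * n2 M (\<lambda>x. (1/2) * f x + (1/2) * g x)"
proof -
  have "(\<lambda>x. (1/2) * f x + (1/2) * g x) = (\<lambda>x. (1/2) * (f x + 1 * g x))" by (auto simp: algebra_simps)
  then have "n2 M (\<lambda>x. (1/2) * f x + (1/2) * g x) = (1/2)\<^sup>2 * n2 M (\<lambda>x. f x + 1 * g x)" by (simp only: n2_cmult)
  then show ?thesis using n2_expand[OF assms, of 1] n2_expand[OF assms, of "-1"] by (simp add: power2_eq_square)
qed

lemma cauchy_schwarz_L2:
  assumes "f \<in> L2 M" "g \<in> L2 M" shows "\<bar>LINT x|M. f x * g x\<bar> \<le> sqrt (n2 M f) * sqrt (n2 M g)"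
proof -
  define b where "b = (LINT x|M. f x * g x)"
  have q: "0 \<le> n2 M f + 2 * c * b + c\<^sup>2 * n2 M g" for c
    using n2_expand[OF assms, of c] n2_nonneg[of M "\<lambda>x. f x + c * g x"] by (simp add: b_def)
  have "b\<^sup>2 \<le> n2 M f * n2 M g"
  proof (cases "n2 M g = 0")
    case True
    have "b = 0"
    proof (rule ccontr)
      assume "b \<noteq> 0"
      then have "n2 M f + 2 * (- (n2 M f + 1) / (2 * b)) * b = -1" by (simp add: field_simps)
      then show False using q[of "- (n2 M f + 1) / (2 * b)"] True by simp
    qed
    then show ?thesis using True by simp
  next
    case False
    then have p: "0 < n2 M g" using n2_nonneg[of M g] by simp
    have "0 \<le> n2 M f + 2 * (- b / n2 M g) * b + (- b / n2 M g)\<^sup>2 * n2 M g" by (rule q)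
    also have "\<dots> = n2 M f - b\<^sup>2 / n2 M g" using p by (simp add: power2_eq_square field_simps)
    finally show ?thesis using p by (simp add: field_simps)
  qed
  then have "\<bar>b\<bar> \<le> sqrt (n2 M f * n2 M g)" by (metis real_sqrt_abs real_sqrt_le_iff)
  then show ?thesis by (simp add: b_def real_sqrt_mult)
qed

lemma n2_eq_0_AE: "f \<in> L2 M \<Longrightarrow> n2 M f = 0 \<Longrightarrow> AE x in M. f x = 0"
  using integral_nonneg_eq_0_iff_AE[OF L2_integrable, of f M] by (auto simp: n2_def)

lemma L2_Fatou:
  fixes f :: "nat \<Rightarrow> 'a \<Rightarrow> real"
  assumes f: "\<And>n. f n \<in> L2 M" and g: "g \<in> borel_measurable M" and lim: "AE x in M. (\<lambda>n. f n x) \<longlonglongrightarrow> g x"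
    and le: "\<And>n. N \<le> n \<Longrightarrow> n2 M (f n) \<le> c"
  shows "g \<in> L2 M" and "n2 M g \<le> c"
proof -
  have c: "0 \<le> c" using le[of N] n2_nonneg[of M "f N"] by simp
  note [measurable] = L2_measurable[OF f] g
  have "(\<integral>\<^sup>+ x. ennreal ((g x)\<^sup>2) \<partial>M) = (\<integral>\<^sup>+ x. liminf (\<lambda>n. ennreal ((f n x)\<^sup>2)) \<partial>M)"
  proof (rule nn_integral_cong_AE, use lim in eventually_elim)
    fix x assume "(\<lambda>n. f n x) \<longlonglongrightarrow> g x"
    then have "(\<lambda>n. ennreal ((f n x)\<^sup>2)) \<longlonglongrightarrow> ennreal ((g x)\<^sup>2)" by (intro tendsto_ennrealI tendsto_intros)
    then show "ennreal ((g x)\<^sup>2) = liminf (\<lambda>n. ennreal ((f n x)\<^sup>2))"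
      by (rule lim_imp_Liminf[OF trivial_limit_sequentially, symmetric])
  qed
  also have "\<dots> \<le> liminf (\<lambda>n. \<integral>\<^sup>+ x. ennreal ((f n x)\<^sup>2) \<partial>M)" by (rule nn_integral_liminf) measurable
  also have "\<dots> \<le> ennreal c"
  proof (rule Liminf_le)
    have "(\<integral>\<^sup>+ x. ennreal ((f n x)\<^sup>2) \<partial>M) \<le> ennreal c" if "N \<le> n" for n
      using le[OF that] L2_integrable[OF f[of n]] by (simp add: nn_integral_eq_integral n2_def ennreal_leI)
    then show "\<forall>\<^sub>F n in sequentially. (\<integral>\<^sup>+ x. ennreal ((f n x)\<^sup>2) \<partial>M) \<le> ennreal c"
      by (auto simp: eventually_sequentially)
  qed simp
  finally have b: "(\<integral>\<^sup>+ x. ennreal ((g x)\<^sup>2) \<partial>M) \<le> ennreal c" .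
  have i: "integrable M (\<lambda>x. (g x)\<^sup>2)"
    by (rule integrableI_bounded) (use b in \<open>auto intro: le_less_trans\<close>)
  then show "g \<in> L2 M" by (simp add: L2_def g)
  show "n2 M g \<le> c" using b i c by (simp add: nn_integral_eq_integral n2_def)
qed

text \<open>The weights \<open>2^n\<close> still leave a convergent series of integrals, so the
  weighted squares are summable almost everywhere;
  \<open>\<bar>a\<bar> \<le> 2^n * a\<^sup>2 + (1/2)^n\<close> turns this into absolute convergence
  of the increments.\<close>

lemma L2_fast_cauchy:
  fixes f :: "nat \<Rightarrow> 'a \<Rightarrow> real"
  assumes f: "\<And>n. f n \<in> L2 M" and fast: "\<And>n. n2 M (\<lambda>x. f (Suc n) x - f n x) \<le> (1/4)^n"
  shows "AE x in M. convergent (\<lambda>n. f n x)"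
proof -
  note [measurable] = L2_measurable[OF f]
  let ?D = "\<lambda>n x. f (Suc n) x - f n x"
  have "(\<integral>\<^sup>+ x. (\<Sum>n. ennreal (2^n * (?D n x)\<^sup>2)) \<partial>M) = (\<Sum>n. \<integral>\<^sup>+ x. ennreal (2^n * (?D n x)\<^sup>2) \<partial>M)"
    by (rule nn_integral_suminf) measurable
  also have "\<dots> \<le> (\<Sum>n. ennreal ((1/2)^n))"
  proof (rule suminf_le)
    fix n
    have "integrable M (\<lambda>x. (?D n x)\<^sup>2)" using f by (intro L2_integrable L2_diff)
    then have "(\<integral>\<^sup>+ x. ennreal (2^n * (?D n x)\<^sup>2) \<partial>M) = ennreal (2^n * n2 M (?D n))"
      by (subst nn_integral_eq_integral) (auto simp: n2_def)
    also have "\<dots> \<le> ennreal (2^n * (1/4)^n)" using fast by (intro ennreal_leI mult_left_mono) auto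
    also have "2^n * (1/4)^n = ((1/2)^n :: real)" by (simp add: power_mult_distrib[symmetric])
    finally show "(\<integral>\<^sup>+ x. ennreal (2^n * (?D n x)\<^sup>2) \<partial>M) \<le> ennreal ((1/2)^n)" .
  qed auto
  also have "\<dots> < \<infinity>"
    using summable_geometric[of "1/2 :: real"] by (subst suminf_ennreal2) auto
  finally have "AE x in M. (\<Sum>n. ennreal (2^n * (?D n x)\<^sup>2)) \<noteq> \<infinity>" by (intro nn_integral_PInf_AE) auto
  then show ?thesis
  proof eventually_elim
    case (elim x)
    then have s: "summable (\<lambda>n. 2^n * (?D n x)\<^sup>2)" by (intro summable_suminf_not_top) auto
    have "summable (\<lambda>n. norm (?D n x))"
    proof (rule summable_comparison_test[OF _ summable_add[OF s summable_geometric[of "1/2 :: real"]]])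
      have "\<bar>a\<bar> \<le> 2^n * a\<^sup>2 + (1/2)^n" for n and a :: real
      proof -
        have "0 \<le> 2^n * (\<bar>a\<bar> - (1/2)^n)\<^sup>2" by simp
        also have "\<dots> = 2^n * a\<^sup>2 - 2 * (2^n * (1/2)^n) * \<bar>a\<bar> + (2^n * (1/2)^n) * (1/2)^n"
          by (simp add: power2_diff power2_eq_square algebra_simps)
        also have "(2^n * (1/2)^n :: real) = 1" by (simp add: power_mult_distrib[symmetric])
        finally show ?thesis using abs_ge_zero[of a] by linarith
      qed
      then show "\<exists>N. \<forall>n\<ge>N. norm (norm (?D n x)) \<le> 2^n * (?D n x)\<^sup>2 + (1/2)^n" by auto
    qed simp
    then have "summable (\<lambda>n. ?D n x)" by (rule summable_norm_cancel)
    then have "convergent (\<lambda>n. f 0 x + (\<Sum>i<n. ?D i x))"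
      by (intro convergent_add convergent_const) (simp add: summable_iff_convergent)
    moreover have "f 0 x + (\<Sum>i<n. ?D i x) = f n x" for n by (induction n) auto
    ultimately show ?case by simp
  qed
qed

lemma L2_complete:
  fixes f :: "nat \<Rightarrow> 'a \<Rightarrow> real"
  assumes f: "\<And>n. f n \<in> L2 M" and cauchy: "\<And>e. 0 < e \<Longrightarrow> \<exists>N. \<forall>n\<ge>N. \<forall>k\<ge>N. n2 M (\<lambda>x. f n x - f k x) \<le> e"
  obtains g where "g \<in> L2 M" "(\<lambda>n. n2 M (\<lambda>x. f n x - g x)) \<longlonglongrightarrow> 0"
proof -
  have "\<exists>N. \<forall>n\<ge>N. \<forall>k\<ge>N. n2 M (\<lambda>x. f n x - f k x) \<le> (1/4)^j" for j :: nat by (rule cauchy) simp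
  then obtain N where N: "\<And>j n k. N j \<le> n \<Longrightarrow> N j \<le> k \<Longrightarrow> n2 M (\<lambda>x. f n x - f k x) \<le> (1/4)^j" by metis
  \<comment> \<open>\<open>r j\<close> lies beyond all thresholds up to \<open>j\<close>, so
    consecutive terms are close enough for \<open>L2_fast_cauchy\<close>, and beyond
    \<open>j\<close>, so Fatou's lemma can compare any late \<open>f n\<close> with the
    limit.\<close>
  define r where "r j = Max (N ` {..j}) + j" for j
  have rN: "N i \<le> r j" if "i \<le> j" for i j unfolding r_def using that by (intro trans_le_add1 Max_ge) auto
  have rj: "j \<le> r j" for j by (simp add: r_def)
  have "AE x in M. convergent (\<lambda>j. f (r j) x)"
    by (rule L2_fast_cauchy[OF f]) (rule N[OF rN rN], auto)
  then have ae: "AE x in M. (\<lambda>j. f (r j) x) \<longlonglongrightarrow> lim (\<lambda>j. f (r j) x)" by (simp add: convergent_LIMSEQ_iff)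
  define g where "g x = lim (\<lambda>j. f (r j) x)" for x
  have g[measurable]: "g \<in> borel_measurable M" unfolding g_def using L2_measurable[OF f] by measurable
  have est: "(\<lambda>x. f n x - g x) \<in> L2 M" "n2 M (\<lambda>x. f n x - g x) \<le> e" if le: "\<And>k. K \<le> k \<Longrightarrow> n2 M (\<lambda>x. f n x - f k x) \<le> e" for n K e
  proof -
    have 1: "AE x in M. (\<lambda>j. f n x - f (r j) x) \<longlonglongrightarrow> f n x - g x"
      using ae by eventually_elim (auto simp: g_def intro!: tendsto_intros)
    have 2: "n2 M (\<lambda>x. f n x - f (r j) x) \<le> e" if "K \<le> j" for j
      by (rule le) (rule order_trans[OF that rj])
    have 3: "(\<lambda>x. f n x - g x) \<in> borel_measurable M"
      by (intro borel_measurable_diff L2_measurable f g)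
    show "(\<lambda>x. f n x - g x) \<in> L2 M" "n2 M (\<lambda>x. f n x - g x) \<le> e"
      by (rule L2_Fatou[OF L2_diff[OF f f] 3 1 2], assumption)+
  qed
  show thesis
  proof (rule that)
    have "(\<lambda>x. f (N 0) x - g x) \<in> L2 M" by (rule est(1)[of "N 0" _ 1]) (use N[of 0] in auto)
    from L2_diff[OF f[of "N 0"] this] show "g \<in> L2 M" by simp
    show "(\<lambda>n. n2 M (\<lambda>x. f n x - g x)) \<longlonglongrightarrow> 0"
    proof (rule LIMSEQ_I)
      fix e :: real assume e: "0 < e"
      then obtain N where N: "\<And>n k. N \<le> n \<Longrightarrow> N \<le> k \<Longrightarrow> n2 M (\<lambda>x. f n x - f k x) \<le> e/2" using cauchy[of "e/2"] by auto
      have "norm (n2 M (\<lambda>x. f n x - g x) - 0) < e" if "N \<le> n" for n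
        using est(2)[of N n "e/2"] N[OF that] n2_nonneg[of M "\<lambda>x. f n x - g x"] e by auto
      then show "\<exists>no. \<forall>n\<ge>no. norm (n2 M (\<lambda>x. f n x - g x) - 0) < e" by blast
    qed
  qed
qed

lemma n2_tendsto:
  assumes f: "\<And>n. f n \<in> L2 M" and g: "g \<in> L2 M" and lim: "(\<lambda>n. n2 M (\<lambda>x. f n x - g x)) \<longlonglongrightarrow> 0"
  shows "(\<lambda>n. n2 M (f n)) \<longlonglongrightarrow> n2 M g" and "h \<in> L2 M \<Longrightarrow> (\<lambda>n. LINT x|M. f n x * h x) \<longlonglongrightarrow> (LINT x|M. g x * h x)"
proof -
  show inner: "(\<lambda>n. LINT x|M. f n x * h x) \<longlonglongrightarrow> (LINT x|M. g x * h x)" if h: "h \<in> L2 M" for h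
  proof -
    have "(\<lambda>n. sqrt (n2 M (\<lambda>x. f n x - g x)) * sqrt (n2 M h)) \<longlonglongrightarrow> sqrt 0 * sqrt (n2 M h)"
      by (intro tendsto_intros lim)
    then have l0: "(\<lambda>n. sqrt (n2 M (\<lambda>x. f n x - g x)) * sqrt (n2 M h)) \<longlonglongrightarrow> 0" by simp
    have "norm ((LINT x|M. f n x * h x) - (LINT x|M. g x * h x)) \<le> sqrt (n2 M (\<lambda>x. f n x - g x)) * sqrt (n2 M h)" for n
    proof -
      have "(LINT x|M. f n x * h x) - (LINT x|M. g x * h x) = (LINT x|M. (f n x - g x) * h x)"
        using f g h by (subst Bochner_Integration.integral_diff[symmetric]) (auto intro: integrable_mult_L2 simp: algebra_simps)
      then show ?thesis using cauchy_schwarz_L2[OF L2_diff[OF f g] h, of n] by simp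
    qed
    then have "(\<lambda>n. (LINT x|M. f n x * h x) - (LINT x|M. g x * h x)) \<longlonglongrightarrow> 0"
      by (intro Lim_null_comparison[OF always_eventually l0]) simp
    then show ?thesis by (simp add: LIM_zero_iff)
  qed
  have "n2 M (f n) = n2 M (\<lambda>x. f n x - g x) + 2 * (LINT x|M. f n x * g x) - n2 M g" for n
    using n2_expand[OF f[of n] g, of "-1"] by simp
  moreover have "(\<lambda>n. n2 M (\<lambda>x. f n x - g x) + 2 * (LINT x|M. f n x * g x) - n2 M g) \<longlonglongrightarrow> 0 + 2 * (LINT x|M. g x * g x) - n2 M g"
    by (intro tendsto_intros lim inner g)
  moreover have "(LINT x|M. g x * g x) = n2 M g" by (simp add: n2_def power2_eq_square)
  ultimately show "(\<lambda>n. n2 M (f n)) \<longlonglongrightarrow> n2 M g" by simp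
qed

lemma sqrt_n2_triangle:
  assumes "f \<in> L2 M" "k \<in> L2 M" shows "sqrt (n2 M f) \<le> sqrt (n2 M k) + sqrt (n2 M (\<lambda>x. f x - k x))"
proof (rule real_le_lsqrt)
  let ?a = "sqrt (n2 M k)" and ?b = "sqrt (n2 M (\<lambda>x. f x - k x))"
  show "0 \<le> ?a + ?b" by (simp add: n2_nonneg)
  have "n2 M (\<lambda>x. k x + 1 * (f x - k x)) = n2 M k + 2 * 1 * (LINT x|M. k x * (f x - k x)) + 1\<^sup>2 * n2 M (\<lambda>x. f x - k x)"
    by (rule n2_expand[OF assms(2) L2_diff[OF assms]])
  moreover have "(LINT x|M. k x * (f x - k x)) \<le> ?a * ?b" using cauchy_schwarz_L2[OF assms(2) L2_diff[OF assms]] by linarith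
  moreover have "(?a + ?b)\<^sup>2 = n2 M k + 2 * (?a * ?b) + n2 M (\<lambda>x. f x - k x)" by (simp add: power2_sum n2_nonneg)
  ultimately show "n2 M f \<le> (?a + ?b)\<^sup>2" by simp
qed

text \<open>A minimising sequence is Cauchy by the parallelogram identity. Its limit
  \<open>w\<close> lies only in the closure of \<open>K\<close>, so the variational inequality is
  obtained by moving from \<open>u n\<close> towards \<open>v\<close>, letting \<open>n\<close> tend
  to infinity, and only then shrinking \<open>\<theta>\<close>.\<close>

lemma L2_projection:
  assumes K: "K \<subseteq> L2 M" "K \<noteq> {}" and g: "g \<in> L2 M"
    and conv: "\<And>v w \<theta>. v \<in> K \<Longrightarrow> w \<in> K \<Longrightarrow> 0 \<le> \<theta> \<Longrightarrow> \<theta> \<le> 1 \<Longrightarrow> (\<lambda>x. (1 - \<theta>) * v x + \<theta> * w x) \<in> K"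
  obtains w u where "w \<in> L2 M" "\<And>n. u n \<in> K" "(\<lambda>n. n2 M (\<lambda>x. u n x - w x)) \<longlonglongrightarrow> 0"
    "\<And>v. v \<in> K \<Longrightarrow> 0 \<le> (LINT x|M. (w x - g x) * (v x - w x))"
proof -
  let ?J = "\<lambda>v. n2 M (\<lambda>x. v x - g x)"
  define D where "D = Inf (?J ` K)"
  have D: "D \<le> ?J v" if "v \<in> K" for v
    unfolding D_def using that by (intro cInf_lower bdd_belowI2[of _ 0] n2_nonneg) auto
  have "\<exists>v\<in>K. ?J v < D + 1 / Suc n" for n
    using cInf_lessD[of "?J ` K" "D + 1 / Suc n"] K(2) by (auto simp: D_def)
  then obtain u where u: "\<And>n. u n \<in> K" "\<And>n. ?J (u n) < D + 1 / Suc n" by metis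
  have uL: "u n \<in> L2 M" for n using u K by auto
  have par: "n2 M (\<lambda>x. u n x - u k x) \<le> 2 * (1 / Suc n) + 2 * (1 / Suc k)" for n k
  proof -
    have mid: "(\<lambda>x. (1 - 1/2) * u n x + (1/2) * u k x) \<in> K" by (rule conv) (use u in auto)
    have "n2 M (\<lambda>x. u n x - u k x) = n2 M (\<lambda>x. (u n x - g x) - (u k x - g x))" by (simp add: n2_def)
    also have "\<dots> = 2 * ?J (u n) + 2 * ?J (u k) - 4 * n2 M (\<lambda>x. (1/2) * (u n x - g x) + (1/2) * (u k x - g x))"
      by (rule n2_parallelogram) (intro L2_diff uL g)+
    also have "(\<lambda>x. (1/2) * (u n x - g x) + (1/2) * (u k x - g x)) = (\<lambda>x. ((1 - 1/2) * u n x + (1/2) * u k x) - g x)"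
      by (auto simp: algebra_simps)
    finally show ?thesis using D[OF mid] u(2)[of n] u(2)[of k] by simp
  qed
  have "\<exists>N. \<forall>n\<ge>N. \<forall>k\<ge>N. n2 M (\<lambda>x. u n x - u k x) \<le> e" if e: "0 < e" for e
  proof -
    obtain N where N: "1 / real (Suc N) < e/4" using nat_approx_posE[of "e/4"] e by auto
    have "n2 M (\<lambda>x. u n x - u k x) \<le> e" if "N \<le> n" "N \<le> k" for n k
    proof -
      have "1 / real (Suc n) \<le> 1 / real (Suc N)" "1 / real (Suc k) \<le> 1 / real (Suc N)" using that by (auto intro!: divide_left_mono)
      then show ?thesis using par[of n k] N by linarith
    qed
    then show ?thesis by blast
  qed
  then obtain w where w: "w \<in> L2 M" "(\<lambda>n. n2 M (\<lambda>x. u n x - w x)) \<longlonglongrightarrow> 0" by (rule L2_complete[OF uL])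
  have Jw: "?J w \<le> D"
  proof -
    have "(\<lambda>n. ?J (u n)) \<longlonglongrightarrow> ?J w"
      by (rule n2_tendsto(1)) (use w uL g in \<open>auto intro: L2_diff\<close>)
    moreover have "(\<lambda>n. D + 1 / real (Suc n)) \<longlonglongrightarrow> D + 0" by (intro tendsto_intros LIMSEQ_Suc[OF lim_1_over_n])
    ultimately have "?J w \<le> D + 0" by (rule LIMSEQ_le) (use u(2) in \<open>auto intro: less_imp_le\<close>)
    then show ?thesis by simp
  qed
  have "0 \<le> (LINT x|M. (w x - g x) * (v x - w x))" if v: "v \<in> K" for v
  proof -
    have vL: "v \<in> L2 M" using v K by auto
    define b where "b = (LINT x|M. (w x - g x) * (v x - w x))"
    have *: "- 2 * b \<le> \<theta> * n2 M (\<lambda>x. v x - w x)" if \<theta>: "0 < \<theta>" "\<theta> \<le> 1" for \<theta>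
    proof -
      have "(\<lambda>n. n2 M (\<lambda>x. ((1 - \<theta>) * u n x + \<theta> * v x) - g x)) \<longlonglongrightarrow> n2 M (\<lambda>x. ((1 - \<theta>) * w x + \<theta> * v x) - g x)"
      proof (rule n2_tendsto(1))
        have "(\<lambda>n. (1 - \<theta>)\<^sup>2 * n2 M (\<lambda>x. u n x - w x)) \<longlonglongrightarrow> (1 - \<theta>)\<^sup>2 * 0" by (intro tendsto_intros w)
        moreover have "n2 M (\<lambda>x. ((1 - \<theta>) * u n x + \<theta> * v x - g x) - ((1 - \<theta>) * w x + \<theta> * v x - g x)) = (1 - \<theta>)\<^sup>2 * n2 M (\<lambda>x. u n x - w x)" for n
          unfolding n2_cmult[symmetric] by (simp add: algebra_simps)
        ultimately show "(\<lambda>n. n2 M (\<lambda>x. ((1 - \<theta>) * u n x + \<theta> * v x - g x) - ((1 - \<theta>) * w x + \<theta> * v x - g x))) \<longlonglongrightarrow> 0" by simp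
      qed (intro L2_diff L2_add L2_cmult uL vL g w)+
      moreover have "D \<le> n2 M (\<lambda>x. ((1 - \<theta>) * u n x + \<theta> * v x) - g x)" for n
        by (rule D, rule conv) (use u v \<theta> in auto)
      ultimately have "D \<le> n2 M (\<lambda>x. ((1 - \<theta>) * w x + \<theta> * v x) - g x)" by (intro LIMSEQ_le_const) auto
      also have "(\<lambda>x. ((1 - \<theta>) * w x + \<theta> * v x) - g x) = (\<lambda>x. (w x - g x) + \<theta> * (v x - w x))" by (auto simp: algebra_simps)
      also have "n2 M \<dots> = ?J w + 2 * \<theta> * b + \<theta>\<^sup>2 * n2 M (\<lambda>x. v x - w x)"
        unfolding b_def by (rule n2_expand) (intro L2_diff w g vL)+
      finally have "0 \<le> \<theta> * (2 * b + \<theta> * n2 M (\<lambda>x. v x - w x))" using Jw by (simp add: power2_eq_square algebra_simps)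
      then show ?thesis using \<theta> by (simp add: zero_le_mult_iff)
    qed
    have "- 2 * b \<le> 0"
    proof (rule field_le_epsilon)
      fix e :: real assume e: "0 < e"
      define c where "c = n2 M (\<lambda>x. v x - w x)"
      have c: "0 \<le> c" by (simp add: c_def n2_nonneg)
      have "- 2 * b \<le> min 1 (e / (c + 1)) * c" unfolding c_def by (rule *) (use e c in \<open>auto simp: c_def\<close>)
      also have "\<dots> \<le> (e / (c + 1)) * c" using c by (intro mult_right_mono) auto
      also have "\<dots> \<le> e" using c e by (simp add: field_simps)
      finally show "- 2 * b \<le> 0 + e" by simp
    qed
    then show ?thesis by (simp add: b_def)
  qed
  with w u(1) that show thesis by blast
qed

section \<open>Relaxed slopes\<close>

text \<open>The measurable majorants of \<open>F\<close> are closed under minima and contain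
  \<open>B\<close>. Along the decreasing sequence of \<open>ess_inf_sequence\<close> only countably
  many null sets occur, so the limit still majorises \<open>F\<close>, which itself may fail to be
  measurable.\<close>

lemma ess_envelope_exists:
  assumes M: "finite_measure M" and B: "B \<in> borel_measurable M" "AE x in M. F x \<le> B x"
  shows "\<exists>G. is_ess_envelope M F G"
proof -
  define \<H> where "\<H> = {H \<in> borel_measurable M. AE x in M. F x \<le> H x}"
  have "\<exists>S :: nat \<Rightarrow> 'a \<Rightarrow> real. (\<forall>n. S n \<in> \<H>) \<and> (\<forall>n x. S (Suc n) x \<le> S n x) \<and>
    (\<forall>f\<in>\<H>. AE x in M. \<forall>e>0. \<exists>n. S n x < f x + e)"
  proof (rule ess_inf_sequence[OF M])
    show "\<H> \<noteq> {}" using B by (auto simp: \<H>_def)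
    show "(\<lambda>x. min (f x) (g x)) \<in> \<H>" if "f \<in> \<H>" "g \<in> \<H>" for f g
      using that by (auto simp: \<H>_def elim: AE_mp)
  qed (auto simp: \<H>_def)
  then obtain S :: "nat \<Rightarrow> 'a \<Rightarrow> real" where S: "\<And>n. S n \<in> \<H>" "\<And>n x. S (Suc n) x \<le> S n x"
    and inf: "\<And>f. f \<in> \<H> \<Longrightarrow> AE x in M. \<forall>e>0. \<exists>n. S n x < f x + e" by blast
  have Sm[measurable]: "S n \<in> borel_measurable M" and SF: "AE x in M. F x \<le> S n x" for n using S(1)[of n] by (auto simp: \<H>_def)
  define G where "G x = lim (\<lambda>n. S n x)" for x
  have Gm: "G \<in> borel_measurable M" unfolding G_def by measurable
  have dec: "decseq (\<lambda>n. S n x)" for x using S(2) by (simp add: decseq_Suc_iff)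
  have all: "AE x in M. \<forall>n. F x \<le> S n x" using SF by (simp add: AE_all_countable)
  have conv: "AE x in M. (\<lambda>n. S n x) \<longlonglongrightarrow> G x \<and> F x \<le> G x"
    using all
  proof eventually_elim
    case (elim x)
    have "convergent (\<lambda>n. S n x)"
      using decseq_convergent[OF dec[of x], of "F x"] elim by (metis convergentI)
    then have "(\<lambda>n. S n x) \<longlonglongrightarrow> G x" by (simp add: G_def convergent_LIMSEQ_iff)
    moreover have "F x \<le> G x" using LIMSEQ_le_const[OF \<open>(\<lambda>n. S n x) \<longlonglongrightarrow> G x\<close>] elim by blast
    ultimately show ?case by simp
  qed
  have "AE x in M. G x \<le> H x" if H: "H \<in> \<H>" for H
    using conv inf[OF H]
  proof eventually_elim
    case (elim x)
    show ?case
    proof (rule field_le_epsilon)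
      fix e :: real assume "0 < e"
      then obtain n where "S n x < H x + e" using elim by blast
      moreover have "G x \<le> S n x" using decseq_ge[OF dec[of x]] elim by blast
      ultimately show "G x \<le> H x + e" by simp
    qed
  qed
  then show ?thesis using Gm conv by (intro exI[of _ G]) (auto simp: is_ess_envelope_def \<H>_def elim: AE_mp)
qed

lemma ennreal_mult_add3:
  assumes "0 \<le> a1" "0 \<le> b1" "0 \<le> a2" "0 \<le> b2" "0 \<le> a3" "0 \<le> b3"
  shows "ennreal a1 * ennreal b1 + ennreal a2 * ennreal b2 + ennreal a3 * ennreal b3 = ennreal (a1 * b1 + a2 * b2 + b3 * a3)"
  using assms by (simp add: ennreal_mult mult.commute[of "ennreal b3"])

locale metric_measure =
  fixes d :: "'a::t2_space \<Rightarrow> 'a \<Rightarrow> ennreal" and m :: "'a measure"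
  assumes emm: "ext_metric_measure_space d m"
begin

lemma top: "ext_metric_top_space d" and radon: "m \<in> radon_prob" and extm: "extended_metric d"
  using emm by (auto simp: ext_metric_measure_space_def ext_metric_top_space_def)

sublocale prob_space m using radon by (rule radon_prob_prob_space)

lemmas sets_m = radon_prob_sets[OF radon] and space_m = radon_prob_space[OF radon]

lemma borel_m: "f \<in> borel_measurable borel \<Longrightarrow> f \<in> borel_measurable m"
  by (simp add: measurable_cong_sets[OF sets_m refl])

lemma Lip_b_m: "f \<in> Lip_b d \<Longrightarrow> f \<in> borel_measurable m" by (intro borel_m Lip_b_borel)

lemma L2_bounded: assumes "f \<in> borel_measurable m" "AE x in m. \<bar>f x\<bar> \<le> B" shows "f \<in> L2 m"
proof (rule L2_I_bound[OF assms(1)])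
  show "integrable m (\<lambda>x. B\<^sup>2)" by simp
  show "AE x in m. (f x)\<^sup>2 \<le> B\<^sup>2" using assms(2)
  proof eventually_elim
    case (elim x)
    then have "\<bar>f x\<bar>\<^sup>2 \<le> B\<^sup>2" by (intro power_mono) auto
    then show ?case by simp
  qed
qed

lemma Lip_b_L2: assumes "f \<in> Lip_b d" shows "f \<in> L2 m"
proof -
  obtain B where "\<And>x. \<bar>f x\<bar> \<le> B" using Lip_b_bounded[OF assms] by (auto simp: bounded_range_real)
  then show ?thesis by (intro L2_bounded[of _ B] Lip_b_m assms) auto
qed

abbreviation LA :: "('a \<Rightarrow> real) \<Rightarrow> 'a \<Rightarrow> real" where "LA \<equiv> Lip_a_star d m"

lemma LA_envelope: assumes f: "f \<in> Lip_b d" shows "is_ess_envelope m (Lip_a d f) (LA f)"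
proof -
  obtain L where L: "0 \<le> L" "\<And>x y. ennreal \<bar>f x - f y\<bar> \<le> ennreal L * d x y" by (rule Lip_bE[OF f]) blast
  have "Lip_a d f x \<le> L" for x by (rule Lip_a_bound[OF L(1)]) (rule L(2))
  then have "\<exists>G. is_ess_envelope m (Lip_a d f) G"
    by (intro ess_envelope_exists[OF finite_measure_axioms, of "\<lambda>_. L"]) auto
  then show ?thesis unfolding Lip_a_star_def by (rule someI_ex)
qed

lemma LA_measurable: "f \<in> Lip_b d \<Longrightarrow> LA f \<in> borel_measurable m"
  and LA_ge: "f \<in> Lip_b d \<Longrightarrow> AE x in m. Lip_a d f x \<le> LA f x"
  and LA_least: "f \<in> Lip_b d \<Longrightarrow> H \<in> borel_measurable m \<Longrightarrow> AE x in m. Lip_a d f x \<le> H x \<Longrightarrow> AE x in m. LA f x \<le> H x"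
  using LA_envelope by (auto simp: is_ess_envelope_def)

lemma LA_nonneg: assumes "f \<in> Lip_b d" shows "AE x in m. 0 \<le> LA f x"
  using LA_ge[OF assms] by eventually_elim (meson Lip_a_nonneg order_trans)

lemma LA_le_const:
  assumes "f \<in> Lip_b d" "0 \<le> L" "\<And>x y. ennreal \<bar>f x - f y\<bar> \<le> ennreal L * d x y"
  shows "AE x in m. LA f x \<le> L"
proof -
  have "Lip_a d f x \<le> L" for x by (rule Lip_a_bound[OF assms(2)]) (rule assms(3))
  then show ?thesis by (intro LA_least assms) auto
qed

lemma LA_bounded: assumes f: "f \<in> Lip_b d" shows "\<exists>L\<ge>0. AE x in m. 0 \<le> LA f x \<and> LA f x \<le> L"
proof -
  obtain L where L: "0 \<le> L" "\<And>x y. ennreal \<bar>f x - f y\<bar> \<le> ennreal L * d x y" by (rule Lip_bE[OF f]) blast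
  have "AE x in m. 0 \<le> LA f x \<and> LA f x \<le> L" using LA_nonneg[OF f] LA_le_const[OF f L] by eventually_elim auto
  then show ?thesis using L(1) by blast
qed

lemma LA_L2: assumes f: "f \<in> Lip_b d" shows "LA f \<in> L2 m"
proof -
  obtain L where "AE x in m. 0 \<le> LA f x \<and> LA f x \<le> L" using LA_bounded[OF f] by blast
  then have "AE x in m. \<bar>LA f x\<bar> \<le> L" by eventually_elim auto
  then show ?thesis by (intro L2_bounded[of _ L] LA_measurable f)
qed

text \<open>Leibniz rule: in the increment of the combination the increment of the weight
  \<open>\<eta>\<close> multiplies only the difference \<open>u - v\<close>. On a small
  \<open>d\<close>-ball around \<open>x\<close> every factor is within order \<open>e\<close> of its
  value at \<open>x\<close>, which gives the bound \<open>P e\<close>.\<close>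

lemma Lip_a_combination:
  assumes u: "u \<in> Lip_b d" and v: "v \<in> Lip_b d" and \<eta>: "\<And>x. 0 \<le> \<eta> x" "\<And>x. \<eta> x \<le> 1"
    and Lc: "0 \<le> Lc" "\<And>x y. ennreal \<bar>\<eta> x - \<eta> y\<bar> \<le> ennreal Lc * d x y"
  shows "Lip_a d (\<lambda>x. \<eta> x * u x + (1 - \<eta> x) * v x) x \<le> \<eta> x * Lip_a d u x + (1 - \<eta> x) * Lip_a d v x + Lc * \<bar>u x - v x\<bar>"
proof -
  obtain Lu where Lu: "0 \<le> Lu" "\<And>x y. ennreal \<bar>u x - u y\<bar> \<le> ennreal Lu * d x y" by (rule Lip_bE[OF u]) blast
  obtain Lv where Lv: "0 \<le> Lv" "\<And>x y. ennreal \<bar>v x - v y\<bar> \<le> ennreal Lv * d x y" by (rule Lip_bE[OF v]) blast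
  define a b where "a = Lip_a d u x" and "b = Lip_a d v x"
  have ab: "0 \<le> a" "0 \<le> b" by (simp_all add: a_def b_def Lip_a_nonneg)
  define P where "P e = (\<eta> x + Lc * e) * (a + e) + ((1 - \<eta> x) + Lc * e) * (b + e) + Lc * (\<bar>u x - v x\<bar> + (Lu + Lv) * e)" for e
  have main: "Lip_a d (\<lambda>x. \<eta> x * u x + (1 - \<eta> x) * v x) x \<le> P e" if e: "0 < e" for e
  proof -
    obtain ru where ru: "0 < ru" "\<And>y z. d y x < ennreal ru \<Longrightarrow> d z x < ennreal ru \<Longrightarrow>
      ennreal \<bar>u y - u z\<bar> \<le> ennreal (a + e) * d y z" unfolding a_def by (rule Lip_a_approx[OF extm u e]) blast
    obtain rv where rv: "0 < rv" "\<And>y z. d y x < ennreal rv \<Longrightarrow> d z x < ennreal rv \<Longrightarrow>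
      ennreal \<bar>v y - v z\<bar> \<le> ennreal (b + e) * d y z" unfolding b_def by (rule Lip_a_approx[OF extm v e]) blast
    define r where "r = min e (min ru rv)"
    have r: "0 < r" "r \<le> e" "r \<le> ru" "r \<le> rv" using e ru rv by (auto simp: r_def)
    have close: "\<bar>f y - f x\<bar> \<le> L * e" if "0 \<le> L" "\<And>x y. ennreal \<bar>f x - f y\<bar> \<le> ennreal L * d x y" "d y x < ennreal r" for f L y
    proof -
      have "ennreal \<bar>f y - f x\<bar> \<le> ennreal L * d y x" by (rule that(2))
      also have "\<dots> \<le> ennreal L * ennreal e" using that(3) r(2) by (intro mult_left_mono) (auto intro: less_imp_le less_le_trans ennreal_leI)
      also have "\<dots> = ennreal (L * e)" using that(1) e by (simp add: ennreal_mult)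
      finally show ?thesis using that(1) e by (simp add: ennreal_le_iff)
    qed
    have P0: "0 \<le> \<eta> x + Lc * e" "0 \<le> (1 - \<eta> x) + Lc * e" "0 \<le> Lc * (\<bar>u x - v x\<bar> + (Lu + Lv) * e)"
      using \<eta>[of x] Lc(1) Lu(1) Lv(1) e by auto
    have "0 \<le> (\<eta> x + Lc * e) * (a + e)" "0 \<le> ((1 - \<eta> x) + Lc * e) * (b + e)"
      using P0 ab e by (auto intro: mult_nonneg_nonneg)
    then have Pn: "0 \<le> P e" using P0(3) unfolding P_def by linarith
    show ?thesis
    proof (rule Lip_a_le[OF r(1) Pn])
      fix y z assume y: "d y x < ennreal r" and z: "d z x < ennreal r"
      have yz: "d y x < ennreal ru" "d z x < ennreal ru" "d y x < ennreal rv" "d z x < ennreal rv"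
        using y z r by (auto intro: less_le_trans ennreal_leI)
      have "\<bar>\<eta> y - \<eta> x\<bar> \<le> Lc * e" by (rule close[OF Lc y])
      then have \<eta>y: "\<eta> y \<le> \<eta> x + Lc * e" "1 - \<eta> y \<le> (1 - \<eta> x) + Lc * e" by linarith+
      have uvz: "\<bar>u z - v z\<bar> \<le> \<bar>u x - v x\<bar> + (Lu + Lv) * e"
        using close[OF Lu z] close[OF Lv z] unfolding distrib_right by linarith
      have "(\<eta> y * u y + (1 - \<eta> y) * v y) - (\<eta> z * u z + (1 - \<eta> z) * v z)
          = \<eta> y * (u y - u z) + (1 - \<eta> y) * (v y - v z) + (\<eta> y - \<eta> z) * (u z - v z)" by (simp add: algebra_simps)
      then have "\<bar>(\<eta> y * u y + (1 - \<eta> y) * v y) - (\<eta> z * u z + (1 - \<eta> z) * v z)\<bar>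
          \<le> \<bar>\<eta> y * (u y - u z)\<bar> + \<bar>(1 - \<eta> y) * (v y - v z)\<bar> + \<bar>(\<eta> y - \<eta> z) * (u z - v z)\<bar>" by linarith
      also have "\<dots> = \<eta> y * \<bar>u y - u z\<bar> + (1 - \<eta> y) * \<bar>v y - v z\<bar> + \<bar>u z - v z\<bar> * \<bar>\<eta> y - \<eta> z\<bar>"
        using \<eta>[of y] by (simp add: abs_mult mult.commute)
      also have "\<dots> \<le> (\<eta> x + Lc * e) * \<bar>u y - u z\<bar> + ((1 - \<eta> x) + Lc * e) * \<bar>v y - v z\<bar>
          + (\<bar>u x - v x\<bar> + (Lu + Lv) * e) * \<bar>\<eta> y - \<eta> z\<bar>"
        using \<eta>y uvz by (intro add_mono mult_right_mono) auto
      finally have "ennreal \<bar>(\<eta> y * u y + (1 - \<eta> y) * v y) - (\<eta> z * u z + (1 - \<eta> z) * v z)\<bar>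
          \<le> ennreal ((\<eta> x + Lc * e) * \<bar>u y - u z\<bar> + ((1 - \<eta> x) + Lc * e) * \<bar>v y - v z\<bar>
          + (\<bar>u x - v x\<bar> + (Lu + Lv) * e) * \<bar>\<eta> y - \<eta> z\<bar>)" by (rule ennreal_leI)
      also have "\<dots> = ennreal (\<eta> x + Lc * e) * ennreal \<bar>u y - u z\<bar> + ennreal ((1 - \<eta> x) + Lc * e) * ennreal \<bar>v y - v z\<bar>
          + ennreal (\<bar>u x - v x\<bar> + (Lu + Lv) * e) * ennreal \<bar>\<eta> y - \<eta> z\<bar>"
        using P0 Lu(1) Lv(1) e by (simp add: ennreal_mult)
      also have "\<dots> \<le> ennreal (\<eta> x + Lc * e) * (ennreal (a + e) * d y z) + ennreal ((1 - \<eta> x) + Lc * e) * (ennreal (b + e) * d y z)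
          + ennreal (\<bar>u x - v x\<bar> + (Lu + Lv) * e) * (ennreal Lc * d y z)"
        by (intro add_mono mult_left_mono ru(2) rv(2) yz Lc(2)) auto
      also have "\<dots> = (ennreal (\<eta> x + Lc * e) * ennreal (a + e) + ennreal ((1 - \<eta> x) + Lc * e) * ennreal (b + e)
          + ennreal (\<bar>u x - v x\<bar> + (Lu + Lv) * e) * ennreal Lc) * d y z" by (simp add: distrib_right mult.assoc)
      also have "ennreal (\<eta> x + Lc * e) * ennreal (a + e) + ennreal ((1 - \<eta> x) + Lc * e) * ennreal (b + e)
          + ennreal (\<bar>u x - v x\<bar> + (Lu + Lv) * e) * ennreal Lc = ennreal (P e)"
      proof -
        have nn: "0 \<le> a + e" "0 \<le> b + e" "0 \<le> \<bar>u x - v x\<bar> + (Lu + Lv) * e" using ab e Lu(1) Lv(1) by auto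
        show ?thesis unfolding P_def by (rule ennreal_mult_add3) (use P0 nn Lc(1) in auto)
      qed
      finally show "ennreal \<bar>(\<eta> y * u y + (1 - \<eta> y) * v y) - (\<eta> z * u z + (1 - \<eta> z) * v z)\<bar> \<le> ennreal (P e) * d y z" .
    qed
  qed
  have "(P \<longlongrightarrow> P 0) (at_right 0)" unfolding P_def by (intro tendsto_intros)
  then have "Lip_a d (\<lambda>x. \<eta> x * u x + (1 - \<eta> x) * v x) x \<le> P 0"
  proof (rule tendsto_lowerbound)
    show "\<forall>\<^sub>F e in at_right 0. Lip_a d (\<lambda>x. \<eta> x * u x + (1 - \<eta> x) * v x) x \<le> P e"
      unfolding eventually_at_right_field using main by (intro exI[of _ 1]) auto
  qed simp
  then show ?thesis by (simp add: P_def a_def b_def)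
qed

lemma Lip_b_combination: "u \<in> Lip_b d \<Longrightarrow> v \<in> Lip_b d \<Longrightarrow> \<eta> \<in> Lip_b d \<Longrightarrow> (\<lambda>x. \<eta> x * u x + (1 - \<eta> x) * v x) \<in> Lip_b d"
  by (intro Lip_b_add Lip_b_mult Lip_b_diff Lip_b_const)

lemma LA_combination:
  assumes u: "u \<in> Lip_b d" and v: "v \<in> Lip_b d" and \<eta>: "\<eta> \<in> Lip_b d" "\<And>x. 0 \<le> \<eta> x" "\<And>x. \<eta> x \<le> 1"
    and Lc: "0 \<le> Lc" "\<And>x y. ennreal \<bar>\<eta> x - \<eta> y\<bar> \<le> ennreal Lc * d x y"
  shows "AE x in m. LA (\<lambda>x. \<eta> x * u x + (1 - \<eta> x) * v x) x \<le> \<eta> x * LA u x + (1 - \<eta> x) * LA v x + Lc * \<bar>u x - v x\<bar>"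
proof (rule LA_least)
  show "(\<lambda>x. \<eta> x * u x + (1 - \<eta> x) * v x) \<in> Lip_b d" by (rule Lip_b_combination[OF u v \<eta>(1)])
  note [measurable] = Lip_b_m[OF u] Lip_b_m[OF v] Lip_b_m[OF \<eta>(1)] LA_measurable[OF u] LA_measurable[OF v]
  show "(\<lambda>x. \<eta> x * LA u x + (1 - \<eta> x) * LA v x + Lc * \<bar>u x - v x\<bar>) \<in> borel_measurable m" by measurable
  show "AE x in m. Lip_a d (\<lambda>x. \<eta> x * u x + (1 - \<eta> x) * v x) x \<le> \<eta> x * LA u x + (1 - \<eta> x) * LA v x + Lc * \<bar>u x - v x\<bar>"
    using LA_ge[OF u] LA_ge[OF v]
  proof eventually_elim
    case (elim x)
    have "\<eta> x * Lip_a d u x + (1 - \<eta> x) * Lip_a d v x \<le> \<eta> x * LA u x + (1 - \<eta> x) * LA v x"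
      using elim \<eta>(2,3)[of x] by (intro add_mono mult_left_mono) auto
    then show ?case using Lip_a_combination[OF u v \<eta>(2,3) Lc, of x] by linarith
  qed
qed

section \<open>Convex sets of slopes and strong relaxed slopes\<close>

lemma n2_mono:
  assumes "f \<in> borel_measurable m" "g \<in> L2 m" "AE x in m. \<bar>f x\<bar> \<le> \<bar>g x\<bar>"
  shows "f \<in> L2 m" "n2 m f \<le> n2 m g"
proof -
  have ae: "AE x in m. (f x)\<^sup>2 \<le> (g x)\<^sup>2" using assms(3) by eventually_elim (simp add: abs_le_square_iff)
  show f: "f \<in> L2 m" by (rule L2_I_bound[OF assms(1) L2_integrable[OF assms(2)] ae])
  show "n2 m f \<le> n2 m g" unfolding n2_def by (intro integral_mono_AE L2_integrable f assms(2) ae)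
qed

text \<open>The weight varies with the point, so convexity of the square yields only the crude sum
  of both norms; this is good enough for errors that tend to 0.\<close>

lemma n2_convex:
  assumes "f \<in> L2 m" "g \<in> L2 m" "\<And>x. 0 \<le> \<theta> x" "\<And>x. \<theta> x \<le> 1" "\<theta> \<in> borel_measurable m"
  shows "(\<lambda>x. \<theta> x * f x + (1 - \<theta> x) * g x) \<in> L2 m"
    and "n2 m (\<lambda>x. \<theta> x * f x + (1 - \<theta> x) * g x) \<le> n2 m f + n2 m g"
proof -
  have pt: "(t * a + (1 - t) * b)\<^sup>2 \<le> a\<^sup>2 + b\<^sup>2" if "0 \<le> t" "t \<le> 1" for t a b :: real
  proof -
    have "(t * a + (1 - t) * b)\<^sup>2 = t * a\<^sup>2 + (1 - t) * b\<^sup>2 - t * (1 - t) * (a - b)\<^sup>2"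
      by (simp add: power2_eq_square algebra_simps)
    also have "\<dots> \<le> t * a\<^sup>2 + (1 - t) * b\<^sup>2" using that by simp
    also have "\<dots> \<le> 1 * a\<^sup>2 + 1 * b\<^sup>2" using that by (intro add_mono mult_right_mono) auto
    finally show ?thesis by simp
  qed
  note [measurable] = L2_measurable[OF assms(1)] L2_measurable[OF assms(2)] assms(5)
  have i: "integrable m (\<lambda>x. (f x)\<^sup>2 + (g x)\<^sup>2)" by (intro Bochner_Integration.integrable_add L2_integrable assms)
  show l: "(\<lambda>x. \<theta> x * f x + (1 - \<theta> x) * g x) \<in> L2 m"
    by (rule L2_I_bound[OF _ i]) (use pt assms in auto)
  have "n2 m (\<lambda>x. \<theta> x * f x + (1 - \<theta> x) * g x) \<le> (LINT x|m. (f x)\<^sup>2 + (g x)\<^sup>2)"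
    unfolding n2_def by (intro integral_mono L2_integrable l i pt assms)
  then show "n2 m (\<lambda>x. \<theta> x * f x + (1 - \<theta> x) * g x) \<le> n2 m f + n2 m g"
    using assms by (simp add: n2_def L2_integrable)
qed

lemma n2_convex_const:
  assumes "f \<in> L2 m" "g \<in> L2 m" "0 \<le> \<theta>" "\<theta> \<le> 1"
  shows "n2 m (\<lambda>x. (1 - \<theta>) * f x + \<theta> * g x) \<le> (1 - \<theta>) * n2 m f + \<theta> * n2 m g"
proof -
  have pt: "((1 - \<theta>) * a + \<theta> * b)\<^sup>2 \<le> (1 - \<theta>) * a\<^sup>2 + \<theta> * b\<^sup>2" for a b :: real
  proof -
    have "((1 - \<theta>) * a + \<theta> * b)\<^sup>2 = (1 - \<theta>) * a\<^sup>2 + \<theta> * b\<^sup>2 - \<theta> * (1 - \<theta>) * (a - b)\<^sup>2"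
      by (simp add: power2_eq_square algebra_simps)
    also have "\<dots> \<le> (1 - \<theta>) * a\<^sup>2 + \<theta> * b\<^sup>2" using assms by simp
    finally show ?thesis .
  qed
  have "n2 m (\<lambda>x. (1 - \<theta>) * f x + \<theta> * g x) \<le> (LINT x|m. (1 - \<theta>) * (f x)\<^sup>2 + \<theta> * (g x)\<^sup>2)"
    unfolding n2_def
    by (intro integral_mono L2_integrable L2_add L2_cmult pt Bochner_Integration.integrable_add integrable_mult_right assms)
  then show ?thesis using assms by (simp add: n2_def L2_integrable)
qed

text \<open>Majorants of slopes rather than slopes: by \<open>LA_combination\<close> a convex
  combination of majorants majorises the slope of the combined function, whereas the slopes
  themselves need not form a convex set.\<close>

definition Kset :: "('a \<Rightarrow> real) \<Rightarrow> real \<Rightarrow> ('a \<Rightarrow> real) set" where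
  "Kset f e = {h \<in> L2 m. \<exists>u\<in>Lip_b d. n2 m (\<lambda>x. u x - f x) \<le> e \<and> (AE x in m. LA u x \<le> h x)}"

lemma Kset_LA: "u \<in> Lip_b d \<Longrightarrow> n2 m (\<lambda>x. u x - f x) \<le> e \<Longrightarrow> LA u \<in> Kset f e"
  by (auto simp: Kset_def LA_L2)

lemma Kset_mono: "e \<le> e' \<Longrightarrow> Kset f e \<subseteq> Kset f e'"
  by (auto simp: Kset_def intro: order_trans)

lemma Kset_convex:
  assumes f: "f \<in> L2 m" and vw: "v \<in> Kset f e" "w \<in> Kset f e" and \<theta>: "0 \<le> \<theta>" "\<theta> \<le> 1"
  shows "(\<lambda>x. (1 - \<theta>) * v x + \<theta> * w x) \<in> Kset f e"
proof -
  obtain u1 where u1: "u1 \<in> Lip_b d" "n2 m (\<lambda>x. u1 x - f x) \<le> e" "AE x in m. LA u1 x \<le> v x" using vw(1) by (auto simp: Kset_def)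
  obtain u2 where u2: "u2 \<in> Lip_b d" "n2 m (\<lambda>x. u2 x - f x) \<le> e" "AE x in m. LA u2 x \<le> w x" using vw(2) by (auto simp: Kset_def)
  let ?u = "\<lambda>x. (1 - \<theta>) * u1 x + (1 - (1 - \<theta>)) * u2 x"
  have u: "?u \<in> Lip_b d" by (intro Lip_b_add Lip_b_cmult u1 u2)
  have "AE x in m. LA ?u x \<le> (1 - \<theta>) * LA u1 x + (1 - (1 - \<theta>)) * LA u2 x + 0 * \<bar>u1 x - u2 x\<bar>"
    by (rule LA_combination[OF u1(1) u2(1) Lip_b_const]) (use \<theta> in auto)
  with u1(3) u2(3) have le: "AE x in m. LA ?u x \<le> (1 - \<theta>) * v x + \<theta> * w x"
  proof eventually_elim
    case (elim x)
    have "(1 - \<theta>) * LA u1 x + \<theta> * LA u2 x \<le> (1 - \<theta>) * v x + \<theta> * w x" using elim \<theta> by (intro add_mono mult_left_mono) auto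
    then show ?case using elim by simp
  qed
  have "n2 m (\<lambda>x. ?u x - f x) = n2 m (\<lambda>x. (1 - \<theta>) * (u1 x - f x) + \<theta> * (u2 x - f x))"
    by (simp add: n2_def algebra_simps)
  also have "\<dots> \<le> (1 - \<theta>) * n2 m (\<lambda>x. u1 x - f x) + \<theta> * n2 m (\<lambda>x. u2 x - f x)"
    by (intro n2_convex_const L2_diff Lip_b_L2 u1 u2 f \<theta>)
  also have "\<dots> \<le> (1 - \<theta>) * e + \<theta> * e" using u1 u2 \<theta> by (intro add_mono mult_left_mono) auto
  finally have "n2 m (\<lambda>x. ?u x - f x) \<le> e" by (simp add: algebra_simps)
  moreover have "(\<lambda>x. (1 - \<theta>) * v x + \<theta> * w x) \<in> L2 m" using vw by (intro L2_add L2_cmult) (auto simp: Kset_def)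
  ultimately show ?thesis using u le by (auto simp: Kset_def)
qed

text \<open>Strong relaxed slopes; they coincide with the relaxed slopes up to the choice of the
  approximating functions, but are manifestly stable under strong limits.\<close>

definition strong_slope :: "('a \<Rightarrow> real) \<Rightarrow> ('a \<Rightarrow> real) \<Rightarrow> bool" where
  "strong_slope f G \<longleftrightarrow> G \<in> L2 m \<and> (\<forall>e>0. \<exists>h\<in>Kset f e. n2 m (\<lambda>x. h x - G x) \<le> e)"

lemma strong_slopeD: "strong_slope f G \<Longrightarrow> 0 < e \<Longrightarrow> \<exists>h\<in>Kset f e. n2 m (\<lambda>x. h x - G x) \<le> e"
  and strong_slope_L2: "strong_slope f G \<Longrightarrow> G \<in> L2 m"
  by (auto simp: strong_slope_def)

lemma KsetD: "h \<in> Kset f e \<Longrightarrow> h \<in> L2 m" by (simp add: Kset_def)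

lemma strong_slope_LA: assumes "f \<in> Lip_b d" shows "strong_slope f (LA f)"
  unfolding strong_slope_def
  using Kset_LA[of f f] assms by (auto simp: LA_L2 n2_def intro!: bexI[of _ "LA f"])

lemma strong_slope_closed:
  assumes G: "G \<in> L2 m" and lim: "\<And>e. 0 < e \<Longrightarrow> \<exists>G'. strong_slope f G' \<and> n2 m (\<lambda>x. G' x - G x) \<le> e"
  shows "strong_slope f G"
  unfolding strong_slope_def
proof (intro conjI allI impI G)
  fix e :: real assume e: "0 < e"
  then have e4: "0 < e/4" by simp
  obtain G' where G': "strong_slope f G'" "n2 m (\<lambda>x. G' x - G x) \<le> e/4" using lim[OF e4] by blast
  obtain h where h: "h \<in> Kset f (e/4)" "n2 m (\<lambda>x. h x - G' x) \<le> e/4" using strong_slopeD[OF G'(1) e4] by blast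
  have "n2 m (\<lambda>x. h x - G x) \<le> 2 * n2 m (\<lambda>x. h x - G' x) + 2 * n2 m (\<lambda>x. G' x - G x)"
    by (intro n2_triangle KsetD[OF h(1)] strong_slope_L2[OF G'(1)] G)
  also have "\<dots> \<le> e" using h G' by simp
  finally show "\<exists>h\<in>Kset f e. n2 m (\<lambda>x. h x - G x) \<le> e" using h(1) Kset_mono[of "e/4" e f] e by (intro bexI[of _ h]) auto
qed

text \<open>Mazur's lemma: project the weak limit onto \<open>Kset f e\<close>.\<close>

lemma strong_slope_of_relaxed_slope:
  assumes f: "f \<in> L2 m" and G: "relaxed_slope d m f G"
  shows "strong_slope f G"
proof -
  obtain fs g k where fs: "fs \<in> Lip_approx d m f" and g: "g \<in> L2 m" and k: "strict_mono k"
    and weak: "tends_weakly_L2 m (\<lambda>n. LA (fs (k n))) g" and gG: "AE x in m. g x \<le> G x" and GL: "G \<in> L2 m"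
    using G by (auto simp: relaxed_slope_def)
  have fsL: "\<And>n. fs n \<in> Lip_b d" and fslim: "(\<lambda>n. n2 m (\<lambda>x. fs n x - f x)) \<longlonglongrightarrow> 0"
    using fs by (auto simp: Lip_approx_def tends_L2_def n2_def)
  show ?thesis unfolding strong_slope_def
  proof (intro conjI allI impI GL)
    fix e :: real assume e: "0 < e"
    have "\<forall>\<^sub>F n in sequentially. n2 m (\<lambda>x. fs n x - f x) < e" using fslim e by (rule order_tendstoD)
    then obtain N where N: "\<And>n. N \<le> n \<Longrightarrow> n2 m (\<lambda>x. fs n x - f x) < e" by (auto simp: eventually_sequentially)
    have inK: "LA (fs (k n)) \<in> Kset f e" if "N \<le> n" for n
      using N[of "k n"] seq_suble[OF k, of n] that by (intro Kset_LA fsL) auto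
    have KL: "Kset f e \<subseteq> L2 m" "Kset f e \<noteq> {}" using inK[of N] by (blast intro: KsetD)+
    obtain w u where w: "w \<in> L2 m" "\<And>n. u n \<in> Kset f e" "(\<lambda>n. n2 m (\<lambda>x. u n x - w x)) \<longlonglongrightarrow> 0"
      and pr: "\<And>v. v \<in> Kset f e \<Longrightarrow> 0 \<le> (LINT x|m. (w x - g x) * (v x - w x))"
      by (rule L2_projection[OF KL g Kset_convex[OF f]]) blast+
    have wg: "(\<lambda>x. w x - g x) \<in> L2 m" by (intro L2_diff w g)
    have split: "(LINT x|m. (w x - g x) * (v x - w x)) = (LINT x|m. v x * (w x - g x)) - (LINT x|m. w x * (w x - g x))" if "v \<in> L2 m" for v
      using integrable_mult_L2[OF that wg] integrable_mult_L2[OF w(1) wg]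
      by (subst Bochner_Integration.integral_diff[symmetric]) (auto simp: algebra_simps)
    \<comment> \<open>The variational inequality of the projection is tested with the slopes, which
      converge only weakly; this is enough since it is affine in the test function. In the limit it
      reads \<open>0 \<le> - n2 m (\<lambda>x. w x - g x)\<close>.\<close>
    have "(\<lambda>n. LINT x|m. LA (fs (k n)) x * (w x - g x)) \<longlonglongrightarrow> (LINT x|m. g x * (w x - g x))"
      using weak wg by (auto simp: tends_weakly_L2_def)
    then have "(\<lambda>n. LINT x|m. (w x - g x) * (LA (fs (k n)) x - w x)) \<longlonglongrightarrow> (LINT x|m. (w x - g x) * (g x - w x))"
      unfolding split[OF LA_L2[OF fsL]] split[OF g] by (intro tendsto_intros)
    then have "0 \<le> (LINT x|m. (w x - g x) * (g x - w x))"
      by (rule LIMSEQ_le_const) (use pr inK in blast)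
    also have "\<dots> = - n2 m (\<lambda>x. w x - g x)"
      unfolding n2_def Bochner_Integration.integral_minus[symmetric]
      by (intro Bochner_Integration.integral_cong) (auto simp: power2_eq_square algebra_simps)
    finally have "n2 m (\<lambda>x. w x - g x) = 0" using n2_nonneg[of m "\<lambda>x. w x - g x"] by simp
    then have ae: "AE x in m. w x = g x" using n2_eq_0_AE[OF wg] by auto
    have "\<forall>\<^sub>F n in sequentially. n2 m (\<lambda>x. u n x - w x) < e" using w(3) e by (rule order_tendstoD)
    then obtain n where n: "n2 m (\<lambda>x. u n x - w x) < e" by (auto simp: eventually_sequentially)
    obtain q where q: "q \<in> Lip_b d" "n2 m (\<lambda>x. q x - f x) \<le> e" "AE x in m. LA q x \<le> u n x" using w(2)[of n] by (auto simp: Kset_def)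
    \<comment> \<open>Adding \<open>G - g\<close>, nonnegative almost everywhere, preserves the
      majorant property and turns an approximation of \<open>g\<close> into one of
      \<open>G\<close>.\<close>
    let ?h = "\<lambda>x. u n x + (G x - g x)"
    have "?h \<in> Kset f e" unfolding Kset_def
    proof (intro CollectI conjI bexI[of _ q] q)
      show "?h \<in> L2 m" by (intro L2_add L2_diff KsetD[OF w(2)] GL g)
      show "AE x in m. LA q x \<le> ?h x" using q(3) gG by eventually_elim auto
    qed
    moreover have "n2 m (\<lambda>x. ?h x - G x) = n2 m (\<lambda>x. u n x - w x)"
      unfolding n2_def using ae L2_measurable[OF KsetD[OF w(2)]] L2_measurable[OF GL] L2_measurable[OF g] L2_measurable[OF w(1)]
      by (intro integral_cong_AE) (auto elim!: eventually_mono)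
    ultimately show "\<exists>h\<in>Kset f e. n2 m (\<lambda>x. h x - G x) \<le> e" using n by (intro bexI[of _ ?h]) auto
  qed
qed

end

section \<open>Locality and pointwise minimality of relaxed slopes\<close>

context metric_measure begin

text \<open>Inner regularity of \<open>B\<close> and of its complement leaves little mass between
  two compact sets, which a Urysohn function separates. A subsequence of these approximations in
  \<open>L^1\<close> converges almost everywhere.\<close>

lemma indicator_approx:
  assumes B: "B \<in> sets borel"
  obtains c :: "nat \<Rightarrow> 'a \<Rightarrow> real" where "\<And>n. c n \<in> Lip_b d" "\<And>n x. 0 \<le> c n x" "\<And>n x. c n x \<le> 1"
    "AE x in m. (\<lambda>n. c n x) \<longlonglongrightarrow> indicator B x"
proof -
  have cB: "UNIV - B \<in> sets borel" using B by auto
  have "\<exists>f. f \<in> Lip_b d \<and> (\<forall>x. 0 \<le> f x \<and> f x \<le> 1) \<and> (LINT x|m. \<bar>f x - indicator B x\<bar>) \<le> 2 * e" if e: "0 < e" for e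
  proof -
    obtain K where K: "compact K" "K \<subseteq> B" "measure m B \<le> measure m K + e" by (rule radon_prob_inner_approx[OF radon B e])
    obtain K' where K': "compact K'" "K' \<subseteq> UNIV - B" "measure m (UNIV - B) \<le> measure m K' + e"
      by (rule radon_prob_inner_approx[OF radon cB e])
    have U: "open (- K')" "K \<subseteq> - K'" using K K' by (auto intro: compact_imp_closed)
    obtain f V where f: "f \<in> Lip_b d" "\<And>y. 0 \<le> f y" "\<And>y. f y \<le> 1" "open V" "K \<subseteq> V"
      "\<And>y. y \<in> V \<Longrightarrow> f y = 1" "\<And>y. y \<notin> - K' \<Longrightarrow> f y = 0" by (rule Lip_b_urysohn[OF top K(1) U]) blast
    have [measurable]: "K \<in> sets m" "K' \<in> sets m" "B \<in> sets m" using K K' B by (auto simp: sets_m borel_compact)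
    have [measurable]: "f \<in> borel_measurable m" by (rule Lip_b_m[OF f(1)])
    have iA: "integrable m (indicator A :: 'a \<Rightarrow> real)" if "A \<in> sets m" for A
      using that by (intro integrable_real_indicator) (auto simp: emeasure_eq_measure)
    have "(LINT x|m. \<bar>f x - indicator B x\<bar>) \<le> (LINT x|m. indicator (B - K) x + indicator ((UNIV - B) - K') x)"
    proof (rule integral_mono)
      have b: "\<bar>f x - indicator B x\<bar> \<le> 1" for x using f(2,3)[of x] by (auto simp: indicator_def)
      show "integrable m (\<lambda>x. \<bar>f x - indicator B x\<bar>)"
        by (rule integrable_const_bound[of _ 1]) (use b in auto)
      show "integrable m (\<lambda>x. indicator (B - K) x + indicator ((UNIV - B) - K') x :: real)"
        using cB by (intro Bochner_Integration.integrable_add iA sets.Diff) (auto simp: sets_m K K' B borel_compact)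
      show "\<bar>f x - indicator B x\<bar> \<le> indicator (B - K) x + indicator ((UNIV - B) - K') x" for x
        using b[of x] f(5) f(6,7)[of x] by (auto simp: indicator_def)
    qed
    also have "\<dots> = measure m (B - K) + measure m ((UNIV - B) - K')"
      using cB B K K' by (subst Bochner_Integration.integral_add[OF iA iA]) (auto simp: sets_m space_m borel_compact)
    also have "\<dots> = (measure m B - measure m K) + (measure m (UNIV - B) - measure m K')"
      using K K' cB B by (intro arg_cong2[where f="(+)"] finite_measure_Diff) (auto simp: sets_m borel_compact)
    also have "\<dots> \<le> 2 * e" using K K' by simp
    finally show ?thesis using f(1,2,3) by blast
  qed
  then have "\<exists>f. f \<in> Lip_b d \<and> (\<forall>x. 0 \<le> f x \<and> f x \<le> 1) \<and> (LINT x|m. \<bar>f x - indicator B x\<bar>) \<le> 2 * (1 / real (Suc n))" for n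
    by (rule meta_spec) simp
  then obtain c where c: "\<And>n. c n \<in> Lip_b d" "\<And>n x. 0 \<le> c n x" "\<And>n x. c n x \<le> 1"
    "\<And>n. (LINT x|m. \<bar>c n x - indicator B x\<bar>) \<le> 2 * (1 / real (Suc n))" by metis
  have [measurable]: "B \<in> sets m" using B by (simp add: sets_m)
  have i: "integrable m (\<lambda>x. c n x - indicator B x)" for n
    using c(2,3)[of n] Lip_b_m[OF c(1)[of n]] by (intro integrable_const_bound[of _ 1]) (auto simp: indicator_def)
  have "(\<lambda>n. LINT x|m. norm (c n x - indicator B x)) \<longlonglongrightarrow> 0"
  proof (rule Lim_null_comparison)
    show "(\<lambda>n. 2 * (1 / real (Suc n))) \<longlonglongrightarrow> 0" using tendsto_mult_left[OF LIMSEQ_Suc[OF lim_1_over_n], of 2] by simp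
    show "\<forall>\<^sub>F n in sequentially. norm (LINT x|m. norm (c n x - indicator B x)) \<le> 2 * (1 / real (Suc n))"
      using c(4) by (intro always_eventually) simp
  qed
  then obtain r where r: "strict_mono r" "AE x in m. (\<lambda>n. c (r n) x - indicator B x) \<longlonglongrightarrow> 0"
    using tendsto_L1_AE_subseq[where u="\<lambda>n x. c n x - indicator B x" and M=m, OF i] by blast
  show thesis
  proof (rule that[of "\<lambda>n. c (r n)"])
    show "AE x in m. (\<lambda>n. c (r n) x) \<longlonglongrightarrow> indicator B x" using r(2) by (simp add: LIM_zero_iff)
  qed (use c in auto)
qed

text \<open>Two Lipschitz functions \<open>u\<close> and \<open>v\<close>, with slopes near
  \<open>G\<close> and near \<open>H\<close>, are glued by the cut-off. The Leibniz term
  \<open>Lc * \<bar>u x - v x\<bar>\<close> can be made small for any \<open>Lc\<close>, because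
  both functions approximate the same \<open>f\<close>.\<close>

lemma strong_slope_cutoff:
  assumes f: "f \<in> L2 m" and G: "strong_slope f G" "strong_slope f H"
    and c: "c \<in> Lip_b d" "\<And>x. 0 \<le> c x" "\<And>x. c x \<le> 1"
  shows "strong_slope f (\<lambda>x. c x * G x + (1 - c x) * H x)"
  unfolding strong_slope_def
proof (intro conjI allI impI)
  note cm = Lip_b_m[OF c(1)]
  show "(\<lambda>x. c x * G x + (1 - c x) * H x) \<in> L2 m"
    by (rule n2_convex(1)[OF strong_slope_L2[OF G(1)] strong_slope_L2[OF G(2)] c(2,3) cm])
  fix e :: real assume e: "0 < e"
  obtain Lc where Lc: "0 \<le> Lc" "\<And>x y. ennreal \<bar>c x - c y\<bar> \<le> ennreal Lc * d x y" by (rule Lip_bE[OF c(1)]) blast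
  \<comment> \<open>Dominates the final errors, \<open>4 * e'\<close> from the slopes and
    \<open>8 * Lc\<^sup>2 * e'\<close> from the Leibniz term.\<close>
  define e' where "e' = e / (8 + 8 * Lc\<^sup>2)"
  have Lp: "0 < 8 + 8 * Lc\<^sup>2" by (simp add: add_pos_nonneg)
  have e': "0 < e'" "e' * (8 + 8 * Lc\<^sup>2) = e" using e Lp by (auto simp: e'_def)
  obtain h where h: "h \<in> Kset f e'" "n2 m (\<lambda>x. h x - G x) \<le> e'" using strong_slopeD[OF G(1) e'(1)] by blast
  obtain k where k: "k \<in> Kset f e'" "n2 m (\<lambda>x. k x - H x) \<le> e'" using strong_slopeD[OF G(2) e'(1)] by blast
  obtain u where u: "u \<in> Lip_b d" "n2 m (\<lambda>x. u x - f x) \<le> e'" "AE x in m. LA u x \<le> h x" using h(1) by (auto simp: Kset_def)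
  obtain v where v: "v \<in> Lip_b d" "n2 m (\<lambda>x. v x - f x) \<le> e'" "AE x in m. LA v x \<le> k x" using k(1) by (auto simp: Kset_def)
  define w where "w x = c x * u x + (1 - c x) * v x" for x
  define j where "j x = (c x * h x + (1 - c x) * k x) + Lc * \<bar>u x - v x\<bar>" for x
  have w: "w \<in> Lip_b d" unfolding w_def[abs_def] by (rule Lip_b_combination[OF u(1) v(1) c(1)])
  have uv: "n2 m (\<lambda>x. u x - v x) \<le> 4 * e'"
    using n2_triangle[OF Lip_b_L2[OF u(1)] f Lip_b_L2[OF v(1)]] u(2) v(2) n2_commute[of m f v] by simp
  have uvL: "(\<lambda>x. \<bar>u x - v x\<bar>) \<in> L2 m" "n2 m (\<lambda>x. \<bar>u x - v x\<bar>) \<le> 4 * e'"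
  proof -
    have 1: "(\<lambda>x. u x - v x) \<in> L2 m" by (intro L2_diff Lip_b_L2 u v)
    show "(\<lambda>x. \<bar>u x - v x\<bar>) \<in> L2 m" by (rule n2_mono(1)[OF _ 1]) (use Lip_b_m[OF u(1)] Lip_b_m[OF v(1)] in auto)
    show "n2 m (\<lambda>x. \<bar>u x - v x\<bar>) \<le> 4 * e'" using uv by (simp add: n2_def)
  qed
  have jL: "j \<in> L2 m" unfolding j_def
    by (intro L2_add L2_cmult uvL n2_convex(1)[OF KsetD[OF h(1)] KsetD[OF k(1)] c(2,3) cm])
  have "j \<in> Kset f e" unfolding Kset_def
  proof (intro CollectI conjI bexI[OF _ w] jL)
    have "AE x in m. LA w x \<le> c x * LA u x + (1 - c x) * LA v x + Lc * \<bar>u x - v x\<bar>"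
      unfolding w_def[abs_def] by (rule LA_combination[OF u(1) v(1) c Lc])
    with u(3) v(3) show "AE x in m. LA w x \<le> j x"
    proof eventually_elim
      case (elim x)
      have "c x * LA u x + (1 - c x) * LA v x \<le> c x * h x + (1 - c x) * k x"
        using elim c(2,3)[of x] by (intro add_mono mult_left_mono) auto
      then show ?case using elim by (simp add: j_def)
    qed
    have "n2 m (\<lambda>x. w x - f x) = n2 m (\<lambda>x. c x * (u x - f x) + (1 - c x) * (v x - f x))"
      unfolding n2_def w_def by (intro Bochner_Integration.integral_cong) (auto simp: algebra_simps)
    also have "\<dots> \<le> n2 m (\<lambda>x. u x - f x) + n2 m (\<lambda>x. v x - f x)"
      by (intro n2_convex(2) L2_diff Lip_b_L2 u v f c cm)
    also have "\<dots> \<le> 2 * e'" using u v by simp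
    also have "2 * e' \<le> e' * (8 + 8 * Lc\<^sup>2)"
    proof -
      have "0 \<le> e' * (8 * Lc\<^sup>2)" using e' by (intro mult_nonneg_nonneg) auto
      then show ?thesis using e'(1) unfolding distrib_left by linarith
    qed
    finally show "n2 m (\<lambda>x. w x - f x) \<le> e" using e' by simp
  qed
  moreover have "n2 m (\<lambda>x. j x - (c x * G x + (1 - c x) * H x)) \<le> e"
  proof -
    have "n2 m (\<lambda>x. j x - (c x * G x + (1 - c x) * H x))
        = n2 m (\<lambda>x. (c x * (h x - G x) + (1 - c x) * (k x - H x)) + Lc * \<bar>u x - v x\<bar>)"
      unfolding n2_def j_def by (intro Bochner_Integration.integral_cong) (auto simp: algebra_simps)
    also have "\<dots> \<le> 2 * n2 m (\<lambda>x. c x * (h x - G x) + (1 - c x) * (k x - H x)) + 2 * n2 m (\<lambda>x. Lc * \<bar>u x - v x\<bar>)"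
      by (intro n2_add_le L2_cmult uvL n2_convex(1) L2_diff KsetD[OF h(1)] KsetD[OF k(1)] strong_slope_L2[OF G(1)]
          strong_slope_L2[OF G(2)] c cm)
    also have "n2 m (\<lambda>x. c x * (h x - G x) + (1 - c x) * (k x - H x)) \<le> n2 m (\<lambda>x. h x - G x) + n2 m (\<lambda>x. k x - H x)"
      by (intro n2_convex(2) L2_diff KsetD[OF h(1)] KsetD[OF k(1)] strong_slope_L2[OF G(1)] strong_slope_L2[OF G(2)] c cm)
    also have "n2 m (\<lambda>x. Lc * \<bar>u x - v x\<bar>) \<le> Lc\<^sup>2 * (4 * e')"
      unfolding n2_cmult by (intro mult_left_mono uvL) auto
    finally have "n2 m (\<lambda>x. j x - (c x * G x + (1 - c x) * H x)) \<le> 4 * e' + 8 * (Lc\<^sup>2 * e')" using h(2) k(2) by simp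
    also have "\<dots> \<le> e' * (8 + 8 * Lc\<^sup>2)" using e' by (simp add: algebra_simps)
    finally show ?thesis using e' by simp
  qed
  ultimately show "\<exists>h\<in>Kset f e. n2 m (\<lambda>x. h x - (c x * G x + (1 - c x) * H x)) \<le> e" by blast
qed

text \<open>Lipschitz cut-offs converge boundedly to the indicator, so gluing along Borel sets
  follows by dominated convergence and closedness. This locality turns minimality of the norm into
  minimality at almost every point.\<close>

lemma strong_slope_local:
  assumes f: "f \<in> L2 m" and G: "strong_slope f G" "strong_slope f H" and B: "B \<in> sets borel"
  shows "strong_slope f (\<lambda>x. indicator B x * G x + (1 - indicator B x) * H x)"
proof (rule strong_slope_closed)
  note GL = strong_slope_L2[OF G(1)] and HL = strong_slope_L2[OF G(2)]
  have Bm[measurable]: "B \<in> sets m" using B by (simp add: sets_m)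
  show "(\<lambda>x. indicator B x * G x + (1 - indicator B x) * H x) \<in> L2 m"
    by (rule n2_convex(1)[OF GL HL]) auto
  fix e :: real assume e: "0 < e"
  obtain c where c: "\<And>n. c n \<in> Lip_b d" "\<And>n x. 0 \<le> c n x" "\<And>n x. c n x \<le> 1"
    "AE x in m. (\<lambda>n. c n x) \<longlonglongrightarrow> indicator B x" by (rule indicator_approx[OF B]) blast
  note [measurable] = Lip_b_m[OF c(1)] L2_measurable[OF GL] L2_measurable[OF HL]
  have GH: "integrable m (\<lambda>x. (G x - H x)\<^sup>2)" by (intro L2_integrable L2_diff GL HL)
  have "(\<lambda>n. LINT x|m. ((c n x - indicator B x) * (G x - H x))\<^sup>2) \<longlonglongrightarrow> (LINT x|m. 0)"
  proof (rule integral_dominated_convergence[OF _ _ GH])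
    show "AE x in m. (\<lambda>n. ((c n x - indicator B x) * (G x - H x))\<^sup>2) \<longlonglongrightarrow> 0"
      using c(4)
    proof eventually_elim
      case (elim x)
      have "(\<lambda>n. ((c n x - indicator B x) * (G x - H x))\<^sup>2) \<longlonglongrightarrow> ((indicator B x - indicator B x) * (G x - H x))\<^sup>2"
        by (intro tendsto_intros elim)
      then show ?case by simp
    qed
    show "AE x in m. norm (((c n x - indicator B x) * (G x - H x))\<^sup>2) \<le> (G x - H x)\<^sup>2" for n
    proof (intro AE_I2)
      fix x
      have "\<bar>c n x - indicator B x\<bar> \<le> 1" using c(2,3)[of n x] by (auto simp: indicator_def)
      then have "(c n x - indicator B x)\<^sup>2 \<le> 1" by (simp only: abs_square_le_1)
      then show "norm (((c n x - indicator B x) * (G x - H x))\<^sup>2) \<le> (G x - H x)\<^sup>2"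
        using mult_right_mono[of "(c n x - indicator B x)\<^sup>2" 1 "(G x - H x)\<^sup>2"] by (simp add: power_mult_distrib)
    qed
  qed auto
  then have "\<forall>\<^sub>F n in sequentially. (LINT x|m. ((c n x - indicator B x) * (G x - H x))\<^sup>2) < e"
    using e by (intro order_tendstoD(2)) auto
  then obtain n where n: "(LINT x|m. ((c n x - indicator B x) * (G x - H x))\<^sup>2) < e" by (auto simp: eventually_sequentially)
  show "\<exists>G'. strong_slope f G' \<and> n2 m (\<lambda>x. G' x - (indicator B x * G x + (1 - indicator B x) * H x)) \<le> e"
  proof (intro exI conjI)
    show "strong_slope f (\<lambda>x. c n x * G x + (1 - c n x) * H x)" by (rule strong_slope_cutoff[OF f G c(1,2,3)])
    have "n2 m (\<lambda>x. (c n x * G x + (1 - c n x) * H x) - (indicator B x * G x + (1 - indicator B x) * H x))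
        = (LINT x|m. ((c n x - indicator B x) * (G x - H x))\<^sup>2)"
      unfolding n2_def by (intro Bochner_Integration.integral_cong) (auto simp: algebra_simps)
    then show "n2 m (\<lambda>x. (c n x * G x + (1 - c n x) * H x) - (indicator B x * G x + (1 - indicator B x) * H x)) \<le> e"
      using n by simp
  qed
qed

text \<open>The approximating majorants are nonnegative, so the negative part of \<open>G\<close> is
  dominated by the approximation error.\<close>

lemma strong_slope_nonneg:
  assumes G: "strong_slope f G" shows "AE x in m. 0 \<le> G x"
proof -
  note GL = strong_slope_L2[OF G]
  define N where "N x = min 0 (G x)" for x
  have [measurable]: "G \<in> borel_measurable m" by (rule L2_measurable[OF GL])
  have NL: "N \<in> L2 m" unfolding N_def by (rule n2_mono(1)[OF _ GL]) auto
  have "n2 m N \<le> 0"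
  proof (rule field_le_epsilon)
    fix e :: real assume e: "0 < e"
    obtain h where h: "h \<in> Kset f e" "n2 m (\<lambda>x. h x - G x) \<le> e" using strong_slopeD[OF G e] by blast
    obtain u where u: "u \<in> Lip_b d" "AE x in m. LA u x \<le> h x" using h(1) by (auto simp: Kset_def)
    have "n2 m N \<le> n2 m (\<lambda>x. h x - G x)"
    proof (rule n2_mono(2))
      show "AE x in m. \<bar>N x\<bar> \<le> \<bar>h x - G x\<bar>" using u(2) LA_nonneg[OF u(1)] by eventually_elim (auto simp: N_def)
    qed (use NL in \<open>auto intro: L2_measurable L2_diff KsetD[OF h(1)] GL\<close>)
    then show "n2 m N \<le> 0 + e" using h(2) by simp
  qed
  then have "n2 m N = 0" using n2_nonneg[of m N] by simp
  then have "AE x in m. N x = 0" by (rule n2_eq_0_AE[OF NL])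
  then show ?thesis by eventually_elim (auto simp: N_def min_def split: if_splits)
qed

text \<open>Lipschitz functions of almost minimal energy have a Cauchy sequence of slopes, by the
  parallelogram identity in the convex sets \<open>Kset f e\<close>.\<close>

lemma minimal_slope_exists:
  assumes f: "f \<in> L2 m" and bd: "\<And>e. 0 < e \<Longrightarrow> \<exists>u\<in>Lip_b d. n2 m (\<lambda>x. u x - f x) \<le> e \<and> n2 m (LA u) \<le> C"
  obtains G where "relaxed_slope d m f G" "\<And>H. strong_slope f H \<Longrightarrow> n2 m G \<le> n2 m H"
proof -
  define \<epsilon> where "\<epsilon> n = 1 / real (Suc n)" for n
  have \<epsilon>: "0 < \<epsilon> n" for n by (simp add: \<epsilon>_def)
  have \<epsilon>_anti: "\<epsilon> k \<le> \<epsilon> n" if "n \<le> k" for n k using that by (auto simp: \<epsilon>_def intro!: divide_left_mono)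
  define U where "U n = {u \<in> Lip_b d. n2 m (\<lambda>x. u x - f x) \<le> \<epsilon> n}" for n
  \<comment> \<open>The least energy among Lipschitz functions within \<open>\<epsilon> n\<close> of
    \<open>f\<close>; it increases with \<open>n\<close> and stays below \<open>C\<close>, hence
    converges.\<close>
  define J where "J n = Inf ((\<lambda>u. n2 m (LA u)) ` U n)" for n
  have bdd: "bdd_below ((\<lambda>u. n2 m (LA u)) ` U n)" for n by (intro bdd_belowI2[of _ 0] n2_nonneg)
  have Jle: "J n \<le> n2 m (LA u)" if "u \<in> U n" for n u unfolding J_def using that by (intro cInf_lower bdd) auto
  have JC: "J n \<le> C" for n using bd[OF \<epsilon>[of n]] Jle[of _ n] by (force simp: U_def)
  have JK: "J n \<le> n2 m h" if h: "h \<in> Kset f (\<epsilon> n)" for n h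
  proof -
    obtain u where u: "u \<in> Lip_b d" "n2 m (\<lambda>x. u x - f x) \<le> \<epsilon> n" "AE x in m. LA u x \<le> h x" using h by (auto simp: Kset_def)
    have "n2 m (LA u) \<le> n2 m h"
    proof (rule n2_mono(2)[OF LA_measurable[OF u(1)] KsetD[OF h]])
      show "AE x in m. \<bar>LA u x\<bar> \<le> \<bar>h x\<bar>" using u(3) LA_nonneg[OF u(1)] by eventually_elim auto
    qed
    then show ?thesis using Jle[of u n] u by (simp add: U_def)
  qed
  have "\<exists>u\<in>U n. n2 m (LA u) < J n + \<epsilon> n" for n
  proof -
    have "U n \<noteq> {}" using bd[OF \<epsilon>[of n]] by (auto simp: U_def)
    then show ?thesis using cInf_lessD[of "(\<lambda>u. n2 m (LA u)) ` U n" "J n + \<epsilon> n"] \<epsilon>[of n] by (auto simp: J_def)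
  qed
  then obtain u where u: "\<And>n. u n \<in> U n" "\<And>n. n2 m (LA (u n)) < J n + \<epsilon> n" by metis
  have uL: "u n \<in> Lip_b d" and uf: "n2 m (\<lambda>x. u n x - f x) \<le> \<epsilon> n" for n using u(1)[of n] by (auto simp: U_def)
  have Jmono: "J n \<le> J k" if "n \<le> k" for n k
  proof -
    have "U k \<noteq> {}" using u(1) by blast
    moreover have "U k \<subseteq> U n" using \<epsilon>_anti[OF that] by (auto simp: U_def)
    ultimately show ?thesis unfolding J_def by (intro cInf_superset_mono bdd) auto
  qed
  have "convergent J" by (rule incseq_convergent[of J C]) (auto simp: incseq_def Jmono JC convergent_def)
  then obtain J0 where J0: "J \<longlonglongrightarrow> J0" by (auto simp: convergent_def)
  have JJ0: "J n \<le> J0" for n using incseq_le[OF _ J0] Jmono by (auto simp: incseq_def)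
  have eps0: "\<epsilon> \<longlonglongrightarrow> 0" unfolding \<epsilon>_def by (rule LIMSEQ_Suc[OF lim_1_over_n])
  \<comment> \<open>For \<open>n \<le> k\<close> both slopes lie in
    \<open>Kset f (\<epsilon> n)\<close>, where midpoints have energy at least \<open>J n\<close>,
    while the endpoints have nearly the limit energy.\<close>
  have par: "n2 m (\<lambda>x. LA (u n) x - LA (u k) x) \<le> 4 * (J0 - J n) + 4 * \<epsilon> n" if nk: "n \<le> k" for n k
  proof -
    have un: "LA (u n) \<in> Kset f (\<epsilon> n)" using uL uf by (intro Kset_LA)
    have uk: "LA (u k) \<in> Kset f (\<epsilon> n)" using uL uf[of k] \<epsilon>_anti[OF nk] by (intro Kset_LA) auto
    have "(\<lambda>x. (1 - 1/2) * LA (u n) x + (1/2) * LA (u k) x) \<in> Kset f (\<epsilon> n)" by (rule Kset_convex[OF f un uk]) auto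
    then have "J n \<le> n2 m (\<lambda>x. (1 - 1/2) * LA (u n) x + (1/2) * LA (u k) x)" by (rule JK)
    moreover define X where "X = n2 m (\<lambda>x. (1/2) * LA (u n) x + (1/2) * LA (u k) x)"
    moreover have "n2 m (\<lambda>x. LA (u n) x - LA (u k) x) = 2 * n2 m (LA (u n)) + 2 * n2 m (LA (u k)) - 4 * X"
      unfolding X_def by (rule n2_parallelogram[OF LA_L2[OF uL[of n]] LA_L2[OF uL[of k]]])
    moreover have "(1 - 1/2 :: real) = 1/2" by simp
    ultimately have "J n \<le> X" "n2 m (\<lambda>x. LA (u n) x - LA (u k) x) = 2 * n2 m (LA (u n)) + 2 * n2 m (LA (u k)) - 4 * X"
      by metis+
    moreover have "2 * n2 m (LA (u n)) + 2 * n2 m (LA (u k)) \<le> 2 * (J n + \<epsilon> n) + 2 * (J k + \<epsilon> k)"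
      by (intro add_mono mult_left_mono less_imp_le[OF u(2)]) auto
    ultimately have "n2 m (\<lambda>x. LA (u n) x - LA (u k) x) \<le> 2 * (J n + \<epsilon> n) + 2 * (J k + \<epsilon> k) - 4 * J n"
      by simp
    also have "\<dots> \<le> 4 * (J0 - J n) + 4 * \<epsilon> n" using JJ0[of n] JJ0[of k] \<epsilon>_anti[OF nk] \<epsilon>[of n] by (simp only: right_diff_distrib distrib_left)
    finally show ?thesis .
  qed
  have "\<exists>N. \<forall>n\<ge>N. \<forall>k\<ge>N. n2 m (\<lambda>x. LA (u n) x - LA (u k) x) \<le> e" if e: "0 < e" for e
  proof -
    have "(\<lambda>n. 4 * (J0 - J n) + 4 * \<epsilon> n) \<longlonglongrightarrow> 4 * (J0 - J0) + 4 * 0" by (intro tendsto_intros J0 eps0)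
    then have "\<forall>\<^sub>F n in sequentially. 4 * (J0 - J n) + 4 * \<epsilon> n < e" using e by (intro order_tendstoD(2)) auto
    then obtain N where N: "\<And>n. N \<le> n \<Longrightarrow> 4 * (J0 - J n) + 4 * \<epsilon> n < e" by (auto simp: eventually_sequentially)
    have "n2 m (\<lambda>x. LA (u n) x - LA (u k) x) \<le> e" if "N \<le> n" "N \<le> k" for n k
    proof (cases "n \<le> k")
      case True then show ?thesis using par[OF True] N[OF that(1)] by simp
    next
      case False then show ?thesis using par[of k n] N[OF that(2)] n2_commute[of m "LA (u n)" "LA (u k)"] by simp
    qed
    then show ?thesis by blast
  qed
  then obtain G where G: "G \<in> L2 m" "(\<lambda>n. n2 m (\<lambda>x. LA (u n) x - G x)) \<longlonglongrightarrow> 0" by (rule L2_complete[OF LA_L2[OF uL]])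
  have "(\<lambda>n. n2 m (LA (u n))) \<longlonglongrightarrow> n2 m G" by (rule n2_tendsto(1)[OF LA_L2[OF uL] G])
  moreover have "(\<lambda>n. J n + \<epsilon> n) \<longlonglongrightarrow> J0 + 0" by (intro tendsto_intros J0 eps0)
  ultimately have GJ: "n2 m G \<le> J0 + 0" by (rule LIMSEQ_le) (use u(2) in \<open>auto intro: less_imp_le\<close>)
  show thesis
  proof (rule that)
    show "relaxed_slope d m f G" unfolding relaxed_slope_def
    proof (intro conjI G(1) bexI[of _ u] bexI[of _ G] exI[of _ "\<lambda>n. n"])
      show "tends_weakly_L2 m (\<lambda>n. LA (u n)) G"
        unfolding tends_weakly_L2_def using n2_tendsto(2)[OF LA_L2[OF uL] G] by blast
      have "(\<lambda>n. n2 m (\<lambda>x. u n x - f x)) \<longlonglongrightarrow> 0"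
        by (rule Lim_null_comparison[OF always_eventually eps0]) (simp add: n2_nonneg uf)
      then show "u \<in> Lip_approx d m f" using uL by (auto simp: Lip_approx_def tends_L2_def n2_def)
    qed (auto simp: strict_mono_def)
    fix H assume H: "strong_slope f H"
    have "J n \<le> n2 m H" for n
    proof (rule field_le_epsilon)
      fix e :: real assume e: "0 < e"
      note HL = strong_slope_L2[OF H]
      have "\<exists>h\<in>Kset f (\<epsilon> k). n2 m (\<lambda>x. h x - H x) \<le> \<epsilon> k" for k by (rule strong_slopeD[OF H \<epsilon>])
      then obtain h where h: "\<And>k. h k \<in> Kset f (\<epsilon> k)" "\<And>k. n2 m (\<lambda>x. h k x - H x) \<le> \<epsilon> k" by metis
      have "(\<lambda>k. n2 m (\<lambda>x. h k x - H x)) \<longlonglongrightarrow> 0"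
        by (rule Lim_null_comparison[OF always_eventually eps0]) (simp add: n2_nonneg h)
      then have "(\<lambda>k. n2 m (h k)) \<longlonglongrightarrow> n2 m H" by (rule n2_tendsto(1)[OF KsetD[OF h(1)] HL])
      then have "J n \<le> n2 m H"
      proof (rule LIMSEQ_le_const)
        have "J n \<le> n2 m (h k)" if "n \<le> k" for k using JK[OF h(1)[of k]] Jmono[OF that] by simp
        then show "\<exists>N. \<forall>k\<ge>N. J n \<le> n2 m (h k)" by blast
      qed
      then show "J n \<le> n2 m H + e" using e by simp
    qed
    then have "J0 \<le> n2 m H" using LIMSEQ_le_const2[OF J0] by blast
    then show "n2 m G \<le> n2 m H" using GJ by simp
  qed
qed

abbreviation mslope :: "('a \<Rightarrow> real) \<Rightarrow> 'a \<Rightarrow> real" where "mslope \<equiv> min_relaxed_slope d m"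

text \<open>A finite lower limit leaves infinitely many indices with energy below a fixed number,
  while accuracy improves along the whole sequence. Finiteness of \<open>Ch\<close> is used in this
  form only.\<close>

lemma D_Ch_bounded_energies:
  assumes f: "f \<in> D_Ch d m"
  obtains C where "\<And>e. 0 < e \<Longrightarrow> \<exists>u\<in>Lip_b d. n2 m (\<lambda>x. u x - f x) \<le> e \<and> n2 m (LA u) \<le> C"
proof -
  have "Ch d m f < \<top>" using f by (simp add: D_Ch_def)
  then obtain fs where fs: "fs \<in> Lip_approx d m f" and lim: "liminf (\<lambda>n. \<integral>\<^sup>+ x. ennreal ((LA (fs n) x)\<^sup>2) \<partial>m) < \<top>"
    unfolding Ch_def INF_less_iff by auto
  have fsL: "\<And>n. fs n \<in> Lip_b d" and fslim: "(\<lambda>n. n2 m (\<lambda>x. fs n x - f x)) \<longlonglongrightarrow> 0"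
    using fs by (auto simp: Lip_approx_def tends_L2_def n2_def)
  obtain c where c: "liminf (\<lambda>n. \<integral>\<^sup>+ x. ennreal ((LA (fs n) x)\<^sup>2) \<partial>m) < ennreal c"
  proof (cases "liminf (\<lambda>n. \<integral>\<^sup>+ x. ennreal ((LA (fs n) x)\<^sup>2) \<partial>m)")
    case (real r)
    then show thesis using that[of "r + 1"] by (simp add: ennreal_lessI)
  qed (use lim in simp)
  have eq: "(\<integral>\<^sup>+ x. ennreal ((LA (fs n) x)\<^sup>2) \<partial>m) = ennreal (n2 m (LA (fs n)))" for n
    using L2_integrable[OF LA_L2[OF fsL]] by (simp add: nn_integral_eq_integral n2_def)
  have "\<exists>u\<in>Lip_b d. n2 m (\<lambda>x. u x - f x) \<le> e \<and> n2 m (LA u) \<le> c" if e: "0 < e" for e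
  proof -
    have "\<forall>\<^sub>F n in sequentially. n2 m (\<lambda>x. fs n x - f x) < e" using fslim e by (rule order_tendstoD)
    then obtain N where N: "\<And>n. N \<le> n \<Longrightarrow> n2 m (\<lambda>x. fs n x - f x) < e" by (auto simp: eventually_sequentially)
    have "\<exists>n\<ge>N. (\<integral>\<^sup>+ x. ennreal ((LA (fs n) x)\<^sup>2) \<partial>m) < ennreal c"
    proof (rule ccontr)
      assume "\<not> ?thesis"
      then have "ennreal c \<le> liminf (\<lambda>n. \<integral>\<^sup>+ x. ennreal ((LA (fs n) x)\<^sup>2) \<partial>m)"
        by (intro Liminf_bounded) (auto simp: eventually_sequentially not_less)
      then show False using c by simp
    qed
    then obtain n where n: "N \<le> n" "ennreal (n2 m (LA (fs n))) < ennreal c" unfolding eq by blast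
    then have "n2 m (LA (fs n)) \<le> c" by (metis ennreal_less_iff less_imp_le n2_nonneg)
    then show ?thesis using fsL[of n] N[OF n(1)] by (intro bexI[of _ "fs n"]) auto
  qed
  then show thesis using that by blast
qed

text \<open>\<open>min_relaxed_slope\<close> minimises over relaxed slopes, but minimality is wanted
  among strong ones. The minimiser of the strong problem is itself relaxed, and every relaxed slope
  is strong, so the two minima agree.\<close>

lemma mslope_props:
  assumes f: "f \<in> D_Ch d m"
  shows mslope_strong: "strong_slope f (mslope f)" and mslope_min: "strong_slope f H \<Longrightarrow> n2 m (mslope f) \<le> n2 m H"
proof -
  have fL: "f \<in> L2 m" using f by (simp add: D_Ch_def)
  obtain C where C: "\<And>e. 0 < e \<Longrightarrow> \<exists>u\<in>Lip_b d. n2 m (\<lambda>x. u x - f x) \<le> e \<and> n2 m (LA u) \<le> C"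
    using D_Ch_bounded_energies[OF f] by blast
  obtain G where G: "relaxed_slope d m f G" "\<And>H. strong_slope f H \<Longrightarrow> n2 m G \<le> n2 m H"
    using minimal_slope_exists[OF fL C] by blast
  let ?P = "\<lambda>G. relaxed_slope d m f G \<and> (\<forall>H. relaxed_slope d m f H \<longrightarrow> (LINT x|m. (G x)\<^sup>2) \<le> (LINT x|m. (H x)\<^sup>2))"
  have "?P G" using G strong_slope_of_relaxed_slope[OF fL] by (auto simp: n2_def)
  then have P: "?P (mslope f)" unfolding min_relaxed_slope_def by (rule someI[of ?P])
  then show "strong_slope f (mslope f)" by (intro strong_slope_of_relaxed_slope fL) simp
  assume "strong_slope f H"
  then have "n2 m G \<le> n2 m H" by (rule G(2))
  moreover have "n2 m (mslope f) \<le> n2 m G" using P G(1) by (auto simp: n2_def)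
  ultimately show "n2 m (mslope f) \<le> n2 m H" by simp
qed

text \<open>On the set where \<open>H\<close> is smaller, the minimal slope is replaced by
  \<open>H\<close>. By locality the result is again a strong slope, so minimality of the norm forces
  this set to be null; nonnegativity makes a smaller function have a smaller square.\<close>

lemma mslope_le:
  assumes f: "f \<in> D_Ch d m" and H: "strong_slope f H" shows "AE x in m. mslope f x \<le> H x"
proof -
  have fL: "f \<in> L2 m" using f by (simp add: D_Ch_def)
  let ?G = "mslope f"
  note G = mslope_strong[OF f]
  note GL = strong_slope_L2[OF G] and HL = strong_slope_L2[OF H]
  note [measurable] = L2_measurable[OF GL] L2_measurable[OF HL]
  define B where "B = {x \<in> space m. H x < ?G x}"
  have Bm[measurable]: "B \<in> sets m" unfolding B_def by measurable
  then have "B \<in> sets borel" by (simp add: sets_m)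
  then have K: "strong_slope f (\<lambda>x. indicator B x * H x + (1 - indicator B x) * ?G x)" (is "strong_slope f ?K")
    by (rule strong_slope_local[OF fL H G])
  have "0 \<le> n2 m ?K - n2 m ?G" using mslope_min[OF f K] by simp
  also have "\<dots> = (LINT x|m. (?K x)\<^sup>2 - (?G x)\<^sup>2)"
    unfolding n2_def by (intro Bochner_Integration.integral_diff[symmetric] L2_integrable strong_slope_L2[OF K] GL)
  also have "\<dots> = - (LINT x|m. indicator B x * ((?G x)\<^sup>2 - (H x)\<^sup>2))"
    unfolding Bochner_Integration.integral_minus[symmetric]
    by (intro Bochner_Integration.integral_cong) (auto simp: indicator_def)
  finally have le: "(LINT x|m. indicator B x * ((?G x)\<^sup>2 - (H x)\<^sup>2)) \<le> 0" by simp
  have i: "integrable m (\<lambda>x. indicator B x * ((?G x)\<^sup>2 - (H x)\<^sup>2))"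
  proof -
    have "integrable m (\<lambda>x. (?G x)\<^sup>2 - (H x)\<^sup>2)" by (intro Bochner_Integration.integrable_diff L2_integrable GL HL)
    from integrable_mult_indicator[OF Bm this] show ?thesis by simp
  qed
  have nn: "AE x in m. 0 \<le> indicator B x * ((?G x)\<^sup>2 - (H x)\<^sup>2)"
    using strong_slope_nonneg[OF H] by eventually_elim (auto simp: B_def indicator_def intro!: power_mono)
  have "(LINT x|m. indicator B x * ((?G x)\<^sup>2 - (H x)\<^sup>2)) = 0"
    using le integral_nonneg_AE[OF nn] by simp
  then have "AE x in m. indicator B x * ((?G x)\<^sup>2 - (H x)\<^sup>2) = 0"
    using integral_nonneg_eq_0_iff_AE[OF i nn] by simp
  with strong_slope_nonneg[OF H] show ?thesis
  proof (rule AE_mp[OF AE_conjI], intro AE_I2 impI)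
    fix x assume x: "x \<in> space m" and *: "0 \<le> H x \<and> indicator B x * ((?G x)\<^sup>2 - (H x)\<^sup>2) = 0"
    show "?G x \<le> H x"
    proof (rule ccontr)
      assume "\<not> ?G x \<le> H x"
      then have lt: "H x < ?G x" by simp
      then have "x \<in> B" using x by (simp add: B_def)
      moreover have "(H x)\<^sup>2 < (?G x)\<^sup>2" using lt * by (intro power_strict_mono) auto
      ultimately show False using * by simp
    qed
  qed
qed

lemma mslope_nonneg: "f \<in> D_Ch d m \<Longrightarrow> AE x in m. 0 \<le> mslope f x"
  by (rule strong_slope_nonneg[OF mslope_strong])

lemma mslope_measurable: "f \<in> D_Ch d m \<Longrightarrow> mslope f \<in> borel_measurable m"
  by (rule L2_measurable[OF strong_slope_L2[OF mslope_strong]])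

lemma Linf_I: assumes "f \<in> borel_measurable m" "AE x in m. \<bar>f x\<bar> \<le> B" shows "f \<in> Linf m"
proof -
  have "Linf_norm m f \<le> ennreal B" unfolding Linf_norm_def
    using assms by (intro esssup_I) (auto elim!: eventually_mono intro: ennreal_leI)
  then show ?thesis using assms(1) by (auto simp: Linf_def intro: le_less_trans)
qed

lemma Linf_D: assumes "f \<in> Linf m" obtains B where "0 \<le> B" "AE x in m. \<bar>f x\<bar> \<le> B"
proof -
  have "Linf_norm m f < \<top>" using assms by (simp add: Linf_def)
  then obtain B where B: "0 \<le> B" "Linf_norm m f = ennreal B" by (metis ennreal_cases less_irrefl)
  have "AE x in m. ennreal \<bar>f x\<bar> \<le> ennreal B" using esssup_AE[of "\<lambda>x. ennreal \<bar>f x\<bar>" m] B by (simp add: Linf_norm_def)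
  then have "AE x in m. \<bar>f x\<bar> \<le> B" by eventually_elim (simp add: B(1) ennreal_le_iff)
  then show thesis using that B by blast
qed

lemma Lip_b_D_Ch: assumes f: "f \<in> Lip_b d" shows "f \<in> D_Ch d m"
proof -
  have "Ch d m f \<le> liminf (\<lambda>n::nat. \<integral>\<^sup>+ x. ennreal ((LA f x)\<^sup>2) \<partial>m)"
    unfolding Ch_def by (rule INF_lower2[of "\<lambda>_. f"]) (auto simp: Lip_approx_def tends_L2_def f)
  also have "\<dots> = ennreal (n2 m (LA f))"
    using L2_integrable[OF LA_L2[OF f]] by (simp add: Liminf_const nn_integral_eq_integral n2_def)
  finally show ?thesis using Lip_b_L2[OF f] by (auto simp: D_Ch_def intro: le_less_trans)
qed

lemma mslope_le_LA: "f \<in> Lip_b d \<Longrightarrow> AE x in m. mslope f x \<le> LA f x"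
  by (intro mslope_le Lip_b_D_Ch strong_slope_LA)

lemma Lip_b_A_Ch: assumes f: "f \<in> Lip_b d" shows "f \<in> A_Ch d m"
proof -
  obtain L where L: "AE x in m. 0 \<le> LA f x \<and> LA f x \<le> L" using LA_bounded[OF f] by blast
  have "AE x in m. \<bar>mslope f x\<bar> \<le> L" using L mslope_le_LA[OF f] mslope_nonneg[OF Lip_b_D_Ch[OF f]] by eventually_elim auto
  moreover obtain B where "\<And>x. \<bar>f x\<bar> \<le> B" using Lip_b_bounded[OF f] by (auto simp: bounded_range_real)
  ultimately show ?thesis unfolding A_Ch_def
    using Lip_b_D_Ch[OF f] mslope_measurable[OF Lip_b_D_Ch[OF f]] Lip_b_m[OF f] by (auto intro!: Linf_I)
qed

end

section \<open>Curves satisfying the continuity inequality\<close>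

text \<open>With \<open>H\<close> a primitive of \<open>h\<close>, both \<open>H\<close> and
  \<open>H + \<Phi>\<close> are nondecreasing, and a difference of monotone functions is
  Borel.\<close>

lemma AC_measurable:
  fixes \<Phi> h :: "real \<Rightarrow> real"
  assumes h: "integrable lborel h" and \<Phi>: "\<And>s t. s \<le> t \<Longrightarrow> \<bar>\<Phi> t - \<Phi> s\<bar> \<le> (LBINT x:{s..t}. h x)"
  shows "\<Phi> \<in> borel_measurable borel"
proof -
  define H where "H t = (LBINT x:{..t}. h x)" for t
  have Hd: "H t - H s = (LBINT x:{s..t}. h x)" if "s \<le> t" for s t
  proof -
    have "{..t} = {..s} \<union> {s<..t}" using that by auto
    then have "H t = (LBINT x:{..s}. h x) + (LBINT x:{s<..t}. h x)"
      unfolding H_def by (simp only:) (intro set_integral_Un set_integrable_lborel h, auto)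
    then show ?thesis by (simp add: H_def LBINT_Ioc_eq_Icc[OF h])
  qed
  have "mono H"
  proof (rule monoI)
    fix s t :: real assume "s \<le> t"
    then show "H s \<le> H t" using Hd[of s t] \<Phi>[of s t] abs_ge_zero[of "\<Phi> t - \<Phi> s"] by linarith
  qed
  moreover have "mono (\<lambda>t. H t + \<Phi> t)"
  proof (rule monoI)
    fix s t :: real assume "s \<le> t"
    then show "H s + \<Phi> s \<le> H t + \<Phi> t" using Hd[of s t] \<Phi>[of s t] by linarith
  qed
  ultimately have "(\<lambda>t. (H t + \<Phi> t) - H t) \<in> borel_measurable borel"
    by (intro borel_measurable_diff borel_measurable_mono)
  then show ?thesis by simp
qed

lemma continuous_on_LBINT_Icc:
  fixes h :: "real \<Rightarrow> real"
  assumes "integrable lborel h" shows "continuous_on {a..b} (\<lambda>t. LBINT x:{a..t}. h x)"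
proof -
  have i: "set_integrable lborel {a..t} h" for t using assms by (rule set_integrable_lborel) auto
  have "(\<lambda>t. LBINT x:{a..t}. h x) = (\<lambda>t. integral {a..t} h)"
    using set_borel_integral_eq_integral(2)[OF i] by auto
  then show ?thesis by (simp only: indefinite_integral_continuous_1[OF set_borel_integral_eq_integral(1)[OF i]])
qed

text \<open>Extension by zero from the open time interval. It turns interval integrals and
  statements over \<open>leb_Ioo\<close> into ones over the line, where the differentiation results
  live.\<close>

definition ext0 :: "real \<Rightarrow> (real \<Rightarrow> real) \<Rightarrow> real \<Rightarrow> real" where
  "ext0 T c r = indicator {0<..<T} r * c r"

lemma ext0_measurable: "c \<in> borel_measurable (leb_Ioo T) \<Longrightarrow> ext0 T c \<in> borel_measurable lborel"
  unfolding ext0_def[abs_def] by (subst (asm) borel_measurable_restrict_space_iff) auto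

lemma AE_ext0: "(AE r in leb_Ioo T. P r) \<longleftrightarrow> (AE r in lborel. r \<in> {0<..<T} \<longrightarrow> P r)"
  by (subst AE_restrict_space_iff) auto

lemma finite_measure_leb_Ioo: "finite_measure (leb_Ioo T)"
proof (rule finite_measureI)
  have "emeasure lborel {0<..<T} < \<infinity>" by (rule emeasure_bounded_finite) simp
  then show "emeasure (leb_Ioo T) (space (leb_Ioo T)) \<noteq> \<infinity>"
    by (simp add: emeasure_restrict_space space_restrict_space)
qed

lemma ext0_integrable:
  assumes c: "c \<in> L2 (leb_Ioo T)" shows "integrable lborel (ext0 T c)"
proof -
  have m: "ext0 T c \<in> borel_measurable lborel" using c by (intro ext0_measurable L2_measurable)
  have "integrable lborel (\<lambda>r. indicator {0<..<T} r *\<^sub>R (c r)\<^sup>2)"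
    using L2_integrable[OF c] by (subst (asm) integrable_restrict_space) auto
  moreover have "emeasure lborel {0<..<T} < \<infinity>" by (rule emeasure_bounded_finite) simp
  then have "integrable lborel (indicator {0<..<T} :: real \<Rightarrow> real)" by (intro integrable_real_indicator) auto
  ultimately have "integrable lborel (\<lambda>r. indicator {0<..<T} r + indicator {0<..<T} r *\<^sub>R (c r)\<^sup>2)"
    by (intro Bochner_Integration.integrable_add)
  then show ?thesis
  proof (rule Bochner_Integration.integrable_bound[OF _ m], intro AE_I2)
    fix r
    have "0 \<le> (\<bar>c r\<bar> - 1)\<^sup>2" by simp
    then have "2 * \<bar>c r\<bar> \<le> 1 + (c r)\<^sup>2" by (simp add: power2_diff)
    then have "\<bar>c r\<bar> \<le> 1 + (c r)\<^sup>2" using abs_ge_zero[of "c r"] by linarith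
    then show "norm (ext0 T c r) \<le> norm (indicator {0<..<T} r + indicator {0<..<T} r *\<^sub>R (c r)\<^sup>2)"
      by (auto simp: ext0_def indicator_def)
  qed
qed

lemma interval_integral_ext0:
  assumes "0 \<le> s" "s \<le> t" "t \<le> T"
  shows "(LBINT r=s..t. c r * X r) = (LBINT r:{s<..<t}. ext0 T c r * X r)"
proof -
  have "(LBINT r=s..t. c r * X r) = (LBINT r:{s<..<t}. c r * X r)"
    using assms by (simp add: interval_integral_Ioo)
  also have "\<dots> = (LBINT r:{s<..<t}. ext0 T c r * X r)"
    unfolding set_lebesgue_integral_def using assms
    by (intro Bochner_Integration.integral_cong) (auto simp: indicator_def ext0_def)
  finally show ?thesis .
qed

lemma interval_integral_ext0_1:
  assumes "0 \<le> s" "s \<le> t" "t \<le> T" shows "(LBINT r=s..t. c r) = (LBINT r:{s<..<t}. ext0 T c r)"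
  using interval_integral_ext0[OF assms, of c "\<lambda>_. 1"] by simp

lemma LBINT_Ioo_eq_Icc:
  fixes f :: "real \<Rightarrow> real"
  assumes "integrable lborel f" shows "(LBINT x:{a<..<b}. f x) = (LBINT x:{a..b}. f x)"
  unfolding set_lebesgue_integral_def
proof (rule integral_cong_AE)
  note [measurable] = borel_measurable_integrable[OF assms]
  show "(\<lambda>x. indicator {a<..<b} x *\<^sub>R f x) \<in> borel_measurable lborel"
    "(\<lambda>x. indicator {a..b} x *\<^sub>R f x) \<in> borel_measurable lborel" by measurable
  show "AE x in lborel. indicator {a<..<b} x *\<^sub>R f x = indicator {a..b} x *\<^sub>R f x"
    using AE_lborel_singleton[of a] AE_lborel_singleton[of b] by eventually_elim (auto simp: indicator_def less_le)
qed

lemma Icc_ext0_clamp: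
  assumes f: "\<And>r. r \<notin> {0<..<T} \<Longrightarrow> f r = 0" and T: "0 < T" and i: "integrable lborel (f :: real \<Rightarrow> real)" and st: "s \<le> t"
  shows "(LBINT r:{max 0 (min T s)..max 0 (min T t)}. f r) = (LBINT r:{s..t}. f r)"
proof -
  have "(LBINT r:{max 0 (min T s)<..<max 0 (min T t)}. f r) = (LBINT r:{s<..<t}. f r)"
    unfolding set_lebesgue_integral_def
  proof (rule Bochner_Integration.integral_cong)
    fix x
    show "indicator {max 0 (min T s)<..<max 0 (min T t)} x *\<^sub>R f x = indicator {s<..<t} x *\<^sub>R f x"
      using f[of x] T st by (cases "x \<in> {0<..<T}") (auto simp: indicator_def max_def min_def)
  qed simp
  then show ?thesis by (simp add: LBINT_Ioo_eq_Icc[OF i])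
qed

section \<open>Curves of probability densities tested against functions\<close>

locale curve = metric_measure +
  fixes T :: real and \<rho> :: "real \<Rightarrow> 'a \<Rightarrow> real"
  assumes T: "0 < T" and dens: "\<And>t. 0 \<le> t \<Longrightarrow> t \<le> T \<Longrightarrow> prob_density m (\<rho> t)"
begin

text \<open>The null remainder is null also for every measure with a density with respect to
  \<open>m\<close>. This transfers the Radon property to \<open>\<mu> t\<close>, and it supplies the
  set on which measurable slopes are constructed.\<close>

lemma sigma_compact:
  assumes B: "B \<in> sets borel"
  obtains L :: "nat \<Rightarrow> 'a set" where "\<And>n. compact (L n)" "incseq L" "\<And>n. L n \<subseteq> B" "emeasure m (B - (\<Union>n. L n)) = 0"
proof -
  have "\<exists>K. compact K \<and> K \<subseteq> B \<and> measure m B \<le> measure m K + 1 / real (Suc n)" for n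
    by (rule radon_prob_inner_approx[OF radon B, of "1 / real (Suc n)"]) auto
  then obtain K where K: "\<And>n. compact (K n)" "\<And>n. K n \<subseteq> B" "\<And>n. measure m B \<le> measure m (K n) + 1 / real (Suc n)" by metis
  define L where "L n = (\<Union>i\<le>n. K i)" for n
  have Kb: "K n \<in> sets m" for n using K by (simp add: sets_m borel_compact)
  have Bm: "B \<in> sets m" using B by (simp add: sets_m)
  have Lc: "compact (L n)" for n unfolding L_def using K by (intro compact_UN) auto
  have LB: "L n \<subseteq> B" for n using K by (auto simp: L_def)
  have U: "(\<Union>n. L n) \<in> sets m" using Lc by (auto simp: sets_m borel_compact)
  have "measure m (B - (\<Union>n. L n)) \<le> 0"
  proof (rule LIMSEQ_le_const[OF LIMSEQ_Suc[OF lim_1_over_n]])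
    have "measure m (B - (\<Union>n. L n)) \<le> 1 / real (Suc n)" for n
    proof -
      have "measure m (B - (\<Union>n. L n)) \<le> measure m (B - K n)"
        using Bm Kb by (intro finite_measure_mono) (auto simp: L_def)
      also have "\<dots> = measure m B - measure m (K n)" using Bm Kb K by (intro finite_measure_Diff) auto
      finally show ?thesis using K(3)[of n] by simp
    qed
    then show "\<exists>N. \<forall>n\<ge>N. measure m (B - (\<Union>n. L n)) \<le> 1 / real (Suc n)" by blast
  qed
  then have "emeasure m (B - (\<Union>n. L n)) = 0" by (simp add: emeasure_eq_measure measure_le_0_iff)
  moreover have "incseq L" unfolding L_def by (intro incseq_SucI) (auto simp: atMost_Suc)
  ultimately show thesis using that Lc LB by blast
qed

lemma rho_measurable: "0 \<le> t \<Longrightarrow> t \<le> T \<Longrightarrow> \<rho> t \<in> borel_measurable m"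
  and rho_nonneg: "0 \<le> t \<Longrightarrow> t \<le> T \<Longrightarrow> AE x in m. 0 \<le> \<rho> t x"
  and rho_integrable: "0 \<le> t \<Longrightarrow> t \<le> T \<Longrightarrow> integrable m (\<rho> t)"
  and rho_integral: "0 \<le> t \<Longrightarrow> t \<le> T \<Longrightarrow> (LINT x|m. \<rho> t x) = 1"
  using dens by (auto simp: prob_density_def)

abbreviation \<mu> :: "real \<Rightarrow> 'a measure" where "\<mu> \<equiv> density_curve m \<rho>"

lemma sets_mu: "sets (\<mu> t) = sets borel" by (simp add: density_curve_def sets_m)
lemma space_mu: "space (\<mu> t) = UNIV" using sets_eq_imp_space_eq[OF sets_mu] by simp

lemma emeasure_mu_null:
  assumes t: "0 \<le> t" "t \<le> T" and A: "A \<in> sets borel" "emeasure m A = 0" shows "emeasure (\<mu> t) A = 0"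
proof -
  have [measurable]: "\<rho> t \<in> borel_measurable m" by (rule rho_measurable[OF t])
  have "A \<in> null_sets m" using A by (auto simp: null_sets_def sets_m)
  moreover have "absolutely_continuous m (\<mu> t)" unfolding density_curve_def by (rule absolutely_continuousI_density) measurable
  ultimately show ?thesis by (auto simp: absolutely_continuous_def null_sets_def)
qed

lemma mu_prob: assumes t: "0 \<le> t" "t \<le> T" shows "prob_space (\<mu> t)"
proof (rule prob_spaceI)
  have [measurable]: "\<rho> t \<in> borel_measurable m" by (rule rho_measurable[OF t])
  have "emeasure (\<mu> t) (space (\<mu> t)) = (\<integral>\<^sup>+ x. ennreal (\<rho> t x) \<partial>m)"
    by (simp add: density_curve_def emeasure_density cong: nn_integral_cong)
  also have "\<dots> = ennreal 1"
    using rho_nonneg[OF t] rho_integrable[OF t] rho_integral[OF t] by (simp add: nn_integral_eq_integral)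
  finally show "emeasure (\<mu> t) (space (\<mu> t)) = 1" by simp
qed

lemma mu_radon: assumes t: "0 \<le> t" "t \<le> T" shows "\<mu> t \<in> radon_prob"
  unfolding radon_prob_def
proof (intro CollectI conjI ballI mu_prob[OF t] sets_mu antisym)
  fix B assume "B \<in> sets (\<mu> t)"
  then have B: "B \<in> sets borel" by (simp add: sets_mu)
  show "(SUP K\<in>{K. compact K \<and> K \<subseteq> B}. emeasure (\<mu> t) K) \<le> emeasure (\<mu> t) B"
    using B by (intro SUP_least emeasure_mono) (auto simp: sets_mu)
  obtain L where L: "\<And>n. compact (L n)" "incseq L" "\<And>n. L n \<subseteq> B" "emeasure m (B - (\<Union>n. L n)) = 0"
    by (rule sigma_compact[OF B]) blast
  have Lb: "L n \<in> sets borel" for n using L by (simp add: borel_compact)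
  have "emeasure (\<mu> t) B \<le> emeasure (\<mu> t) ((\<Union>n. L n) \<union> (B - (\<Union>n. L n)))"
    using B Lb by (intro emeasure_mono) (auto simp: sets_mu)
  also have "\<dots> \<le> emeasure (\<mu> t) (\<Union>n. L n) + emeasure (\<mu> t) (B - (\<Union>n. L n))"
    using B Lb by (intro emeasure_subadditive) (auto simp: sets_mu)
  also have "emeasure (\<mu> t) (B - (\<Union>n. L n)) = 0" using B Lb L by (intro emeasure_mu_null t) auto
  also have "emeasure (\<mu> t) (\<Union>n. L n) = (SUP n. emeasure (\<mu> t) (L n))"
    using Lb L by (intro SUP_emeasure_incseq[symmetric]) (auto simp: sets_mu)
  also have "\<dots> \<le> (SUP K\<in>{K. compact K \<and> K \<subseteq> B}. emeasure (\<mu> t) K)"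
    using L by (intro SUP_least SUP_upper) auto
  finally show "emeasure (\<mu> t) B \<le> (SUP K\<in>{K. compact K \<and> K \<subseteq> B}. emeasure (\<mu> t) K)" by simp
qed

definition \<Phi> :: "('a \<Rightarrow> real) \<Rightarrow> real \<Rightarrow> real" where "\<Phi> f t = (LINT x|m. f x * \<rho> t x)"

lemma integral_mu:
  assumes t: "0 \<le> t" "t \<le> T" and f: "f \<in> borel_measurable m" shows "(LINT x|\<mu> t. f x) = \<Phi> f t"
  unfolding density_curve_def \<Phi>_def
  using rho_measurable[OF t] rho_nonneg[OF t] f by (subst integral_real_density) (auto simp: mult.commute)

lemma integrable_rho:
  assumes t: "0 \<le> t" "t \<le> T" and f: "f \<in> borel_measurable m" "AE x in m. \<bar>f x\<bar> \<le> B"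
  shows "integrable m (\<lambda>x. f x * \<rho> t x)"
proof (rule Bochner_Integration.integrable_bound)
  show "integrable m (\<lambda>x. B * \<rho> t x)" by (intro integrable_mult_right rho_integrable t)
  show "(\<lambda>x. f x * \<rho> t x) \<in> borel_measurable m" by (intro borel_measurable_times f rho_measurable t)
  show "AE x in m. norm (f x * \<rho> t x) \<le> norm (B * \<rho> t x)" using f(2)
    by eventually_elim (auto simp: abs_mult intro!: mult_right_mono)
qed

lemma integrable_rho_Lip:
  assumes "0 \<le> t" "t \<le> T" "f \<in> Lip_b d" shows "integrable m (\<lambda>x. f x * \<rho> t x)"
proof -
  obtain B where "\<And>x. \<bar>f x\<bar> \<le> B" using Lip_b_bounded[OF assms(3)] by (auto simp: bounded_range_real)
  then show ?thesis by (intro integrable_rho[of _ _ B] assms Lip_b_m) auto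
qed

lemma Phi_mono:
  assumes t: "0 \<le> t" "t \<le> T" and f: "integrable m (\<lambda>x. f x * \<rho> t x)" and g: "integrable m (\<lambda>x. g x * \<rho> t x)"
    and le: "AE x in m. f x \<le> g x"
  shows "\<Phi> f t \<le> \<Phi> g t"
  unfolding \<Phi>_def
  by (intro integral_mono_AE f g, use le rho_nonneg[OF t] in eventually_elim) (auto intro: mult_right_mono)

lemma Phi_const: "0 \<le> t \<Longrightarrow> t \<le> T \<Longrightarrow> \<Phi> (\<lambda>_. c) t = c"
  by (simp add: \<Phi>_def rho_integral)

definition Fs :: "('a \<Rightarrow> real) \<Rightarrow> real \<Rightarrow> real" where "Fs f r = sqrt (LINT x|m. (mslope f x)\<^sup>2 * \<rho> r x)"

lemma Fs_nonneg: assumes "0 \<le> r" "r \<le> T" shows "0 \<le> Fs f r"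
  unfolding Fs_def using rho_nonneg[OF assms]
  by (intro real_sqrt_ge_zero Bochner_Integration.integral_nonneg_AE) (auto elim!: eventually_mono)

lemma A_Ch_bound:
  assumes f: "f \<in> A_Ch d m"
  obtains K where "0 \<le> K" "AE x in m. (mslope f x)\<^sup>2 \<le> K\<^sup>2"
proof -
  obtain K where K: "0 \<le> K" "AE x in m. \<bar>mslope f x\<bar> \<le> K" using Linf_D[of "mslope f"] f by (auto simp: A_Ch_def)
  have "AE x in m. (mslope f x)\<^sup>2 \<le> K\<^sup>2" using K(2) by eventually_elim (simp add: abs_le_square_iff[symmetric] K(1))
  then show thesis using that K(1) by blast
qed

lemma A_Ch_measurable: "f \<in> A_Ch d m \<Longrightarrow> mslope f \<in> borel_measurable m"
  by (intro mslope_measurable) (simp add: A_Ch_def)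

lemma Fs_le:
  assumes r: "0 \<le> r" "r \<le> T" and f: "f \<in> A_Ch d m" and G: "G \<in> borel_measurable m" "AE x in m. \<bar>G x\<bar> \<le> B"
    and le: "AE x in m. (mslope f x)\<^sup>2 \<le> G x"
  shows "(Fs f r)\<^sup>2 \<le> \<Phi> G r"
proof -
  obtain K where K: "AE x in m. (mslope f x)\<^sup>2 \<le> K\<^sup>2" using A_Ch_bound[OF f] by blast
  have "(Fs f r)\<^sup>2 = \<Phi> (\<lambda>x. (mslope f x)\<^sup>2) r"
    unfolding Fs_def \<Phi>_def using rho_nonneg[OF r]
    by (intro real_sqrt_pow2 Bochner_Integration.integral_nonneg_AE) (auto elim!: eventually_mono)
  also have "\<dots> \<le> \<Phi> G r"
  proof (rule Phi_mono[OF r _ integrable_rho[OF r G] le])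
    show "integrable m (\<lambda>x. (mslope f x)\<^sup>2 * \<rho> r x)"
      by (rule integrable_rho[OF r, of _ "K\<^sup>2"]) (use K A_Ch_measurable[OF f] in auto)
  qed
  finally show ?thesis .
qed

lemma Fs_le_const:
  assumes r: "0 \<le> r" "r \<le> T" and f: "f \<in> A_Ch d m" and K: "0 \<le> K" "AE x in m. (mslope f x)\<^sup>2 \<le> K\<^sup>2"
  shows "Fs f r \<le> K"
proof -
  have G: "(\<lambda>_. K\<^sup>2) \<in> borel_measurable m" by (rule borel_measurable_const)
  have B: "AE x in m. \<bar>K\<^sup>2\<bar> \<le> K\<^sup>2" by (intro AE_I2) simp
  have 1: "(Fs f r)\<^sup>2 \<le> \<Phi> (\<lambda>_. K\<^sup>2) r" by (rule Fs_le[OF r f G B K(2)])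
  have 2: "(Fs f r)\<^sup>2 \<le> K\<^sup>2" using 1 unfolding Phi_const[OF r] .
  show ?thesis by (rule power2_le_imp_le[OF 2 K(1)])
qed

lemma CE2_boundD:
  assumes "CE2_bound T d m \<rho> c"
  shows "c \<in> L2 (leb_Ioo T)" "AE r in lborel. 0 \<le> ext0 T c r" "integrable lborel (ext0 T c)"
    and "f \<in> A_Ch d m \<Longrightarrow> 0 \<le> s \<Longrightarrow> s \<le> t \<Longrightarrow> t \<le> T \<Longrightarrow> \<bar>\<Phi> f t - \<Phi> f s\<bar> \<le> (LBINT r:{s<..<t}. ext0 T c r * Fs f r)"
proof -
  show c: "c \<in> L2 (leb_Ioo T)" using assms by (simp add: CE2_bound_def)
  show "integrable lborel (ext0 T c)" by (rule ext0_integrable[OF c])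
  have "AE r in leb_Ioo T. 0 \<le> c r" using assms by (simp add: CE2_bound_def)
  then show "AE r in lborel. 0 \<le> ext0 T c r"
    unfolding AE_ext0 by eventually_elim (auto simp: ext0_def indicator_def)
  assume f: "f \<in> A_Ch d m" and st: "0 \<le> s" "s \<le> t" "t \<le> T"
  have "\<bar>\<Phi> f t - \<Phi> f s\<bar> \<le> (LBINT r=s..t. c r * Fs f r)"
    using assms[unfolded CE2_bound_def, THEN conjunct2, THEN conjunct2] f st unfolding \<Phi>_def Fs_def by blast
  then show "\<bar>\<Phi> f t - \<Phi> f s\<bar> \<le> (LBINT r:{s<..<t}. ext0 T c r * Fs f r)"
    by (simp only: interval_integral_ext0[OF st])
qed

lemma CE2_bound_sup:
  assumes c: "CE2_bound T d m \<rho> c" and f: "f \<in> A_Ch d m" and st: "0 \<le> s" "s \<le> t" "t \<le> T" and S: "0 \<le> S"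
    and le: "\<And>r. s < r \<Longrightarrow> r < t \<Longrightarrow> Fs f r \<le> S"
  shows "\<bar>\<Phi> f t - \<Phi> f s\<bar> \<le> S * (LBINT r:{s..t}. \<bar>ext0 T c r\<bar>)"
proof -
  let ?c = "ext0 T c"
  note i = CE2_boundD(3)[OF c]
  have ia: "integrable lborel (\<lambda>r. \<bar>?c r\<bar>)" using i by simp
  have "\<bar>\<Phi> f t - \<Phi> f s\<bar> \<le> (LBINT r:{s<..<t}. ?c r * Fs f r)" by (rule CE2_boundD(4)[OF c f st])
  also have "\<dots> \<le> (LBINT r:{s<..<t}. S * \<bar>?c r\<bar>)"
  proof (cases "set_integrable lborel {s<..<t} (\<lambda>r. ?c r * Fs f r)")
    case True
    show ?thesis
    proof (rule set_integral_mono[OF True])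
      show "set_integrable lborel {s<..<t} (\<lambda>r. S * \<bar>?c r\<bar>)" using ia by (intro set_integrable_lborel integrable_mult_right) auto
      fix r assume r: "r \<in> {s<..<t}"
      then have "0 \<le> Fs f r" "Fs f r \<le> S" using st le by (auto intro: Fs_nonneg)
      then have "?c r * Fs f r \<le> \<bar>?c r\<bar> * S" by (intro mult_mono) auto
      then show "?c r * Fs f r \<le> S * \<bar>?c r\<bar>" by (simp add: mult.commute)
    qed
  next
    \<comment> \<open>Measurability of \<open>Fs f\<close> in time is not established at this point.
      A nonintegrable product has integral 0, and the right-hand side is nonnegative.\<close>
    case False
    then have "(LBINT r:{s<..<t}. ?c r * Fs f r) = 0"
      by (simp add: set_lebesgue_integral_def set_integrable_def not_integrable_integral_eq)
    also have "0 \<le> (LBINT r:{s<..<t}. S * \<bar>?c r\<bar>)"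
      unfolding set_lebesgue_integral_def using S by (intro Bochner_Integration.integral_nonneg) auto
    finally show ?thesis .
  qed
  also have "\<dots> = S * (LBINT r:{s..t}. \<bar>?c r\<bar>)" by (simp add: LBINT_Ioo_eq_Icc[OF ia])
  finally show ?thesis .
qed

text \<open>A change of time \<open>R\<close> makes the bound equal to the constant
  \<open>C0\<close> on the unit interval. In the new time, \<open>w \<sigma> \<tau>\<close>
  integrates \<open>Q \<sigma>\<close> against the curve at time \<open>R \<tau>\<close>. Its
  increments in \<open>\<tau>\<close> are controlled by the slope of \<open>Q \<sigma>\<close>,
  which \<open>Lip_a_Q\<close> bounds by the decrease in \<open>\<sigma>\<close>; so
  \<open>characteristic_estimate\<close> applies with \<open>A = C0\<^sup>2 / 2\<close>. The
  potentials are halved because the Hopf-Lax cost is \<open>(\<delta> x y)\<^sup>2 / 2\<close>, and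
  doubling at the end gives \<open>C0\<^sup>2\<close>.\<close>

lemma dual_inequality:
  assumes c: "CE2_bound T d m \<rho> c" and st: "0 \<le> s" "s < t" "t \<le> T" and e: "0 < e"
    and C0: "C0 = (LBINT r:{s..t}. \<bar>ext0 T c r\<bar>) + e * (t - s)"
    and \<phi>: "\<phi> \<in> Lip_b d" and \<psi>: "\<psi> \<in> Lip_b d" and \<delta>: "\<delta> \<in> bcs d" and le: "\<And>x y. \<phi> x + \<psi> y \<le> (\<delta> x y)\<^sup>2"
  shows "\<Phi> \<phi> s + \<Phi> \<psi> t \<le> C0\<^sup>2"
proof -
  let ?c = "\<lambda>r. \<bar>ext0 T c r\<bar>"
  have ic: "integrable lborel ?c" using CE2_boundD(3)[OF c] by simp
  have nn: "0 \<le> (LBINT r:{a..b}. ?c r)" for a b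
    unfolding set_lebesgue_integral_def by (intro Bochner_Integration.integral_nonneg) auto
  \<comment> \<open>Arc length of the bound. The term with \<open>e\<close> makes it strictly
    increasing even where \<open>c\<close> vanishes, so that it can be inverted.\<close>
  define H where "H r = (LBINT x:{s..r}. ?c x) + e * (r - s)" for r
  have Hd: "H b - H a = (LBINT r:{a..b}. ?c r) + e * (b - a)" if "s \<le> a" "a \<le> b" for a b
    using LBINT_Icc_combine[OF ic that] by (simp add: H_def algebra_simps)
  have Hs: "H s = 0"
  proof -
    have "(LBINT x:{s..s}. ?c x) = (LBINT x:{s<..<s}. ?c x)" by (rule LBINT_Ioo_eq_Icc[OF ic, symmetric])
    then show ?thesis by (simp add: H_def set_lebesgue_integral_def)
  qed
  have Ht: "H t = C0" by (simp add: H_def C0)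
  have Hmono: "H a < H b" if "s \<le> a" "a < b" for a b
  proof -
    have "0 < e * (b - a)" using e that by simp
    then show ?thesis using Hd[of a b] nn[of a b] that by linarith
  qed
  have C0p: "0 < C0" using Hmono[of s t] st Hs Ht by simp
  have Hcont: "continuous_on {s..t} H" unfolding H_def by (intro continuous_intros continuous_on_LBINT_Icc ic)
  \<comment> \<open>\<open>characteristic_estimate\<close> asks for all real times, and its
    averaging windows reach beyond 1; the curve is frozen outside the unit interval.\<close>
  define cl :: "real \<Rightarrow> real" where "cl \<tau> = max 0 (min 1 \<tau>)" for \<tau>
  have cl: "0 \<le> cl \<tau>" "cl \<tau> \<le> 1" for \<tau> by (auto simp: cl_def)
  have cl_mono: "cl \<tau> \<le> cl \<tau>'" "cl \<tau>' - cl \<tau> \<le> \<tau>' - \<tau>" if "\<tau> \<le> \<tau>'" for \<tau> \<tau>' using that by (auto simp: cl_def)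
  have "\<exists>r. s \<le> r \<and> r \<le> t \<and> H r = C0 * cl \<tau>" for \<tau>
    using IVT'[of H s "C0 * cl \<tau>" t] Hcont st cl[of \<tau>] C0p by (auto simp: Hs Ht mult_le_cancel_left1)
  then obtain R where R: "\<And>\<tau>. s \<le> R \<tau>" "\<And>\<tau>. R \<tau> \<le> t" "\<And>\<tau>. H (R \<tau>) = C0 * cl \<tau>" by metis
  have R0T: "0 \<le> R \<tau>" "R \<tau> \<le> T" for \<tau> using R(1,2)[of \<tau>] st by auto
  have Rmono: "R \<tau> \<le> R \<tau>'" if "\<tau> \<le> \<tau>'" for \<tau> \<tau>'
  proof (rule ccontr)
    assume "\<not> ?thesis"
    then have "H (R \<tau>') < H (R \<tau>)" using R by (intro Hmono) auto
    then show False using cl_mono(1)[OF that] C0p by (simp add: R(3))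
  qed
  have Rint: "(LBINT r:{R \<tau>..R \<tau>'}. ?c r) \<le> C0 * (\<tau>' - \<tau>)" if "\<tau> \<le> \<tau>'" for \<tau> \<tau>'
  proof -
    have "(LBINT r:{R \<tau>..R \<tau>'}. ?c r) \<le> H (R \<tau>') - H (R \<tau>)" using Hd[OF R(1) Rmono[OF that]] Rmono[OF that] e by simp
    also have "\<dots> = C0 * (cl \<tau>' - cl \<tau>)" by (simp add: R(3) right_diff_distrib)
    also have "\<dots> \<le> C0 * (\<tau>' - \<tau>)" using cl_mono(2)[OF that] C0p by (intro mult_left_mono) auto
    finally show ?thesis .
  qed
  \<comment> \<open>\<open>CE2_bound_sup\<close> wants a slope bound at every original time between
    \<open>R \<tau>1\<close> and \<open>R \<tau>2\<close>, while the hypothesis on \<open>S\<close>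
    speaks of times of the form \<open>R \<tau>\<close>.\<close>
  have Rsurj: "\<exists>\<tau>. \<tau>1 \<le> \<tau> \<and> \<tau> \<le> \<tau>2 \<and> R \<tau> = r" if r: "R \<tau>1 \<le> r" "r \<le> R \<tau>2" "\<tau>1 \<le> \<tau>2" for r \<tau>1 \<tau>2
  proof -
    have sr: "s \<le> r" using R(1)[of \<tau>1] r by simp
    have "H (R \<tau>1) \<le> H r" "H r \<le> H (R \<tau>2)"
      using Hmono[of "R \<tau>1" r] Hmono[of r "R \<tau>2"] R(1)[of \<tau>1] sr r by (auto simp: le_less)
    then have x: "cl \<tau>1 \<le> H r / C0" "H r / C0 \<le> cl \<tau>2" using C0p by (auto simp: R(3) field_simps)
    define X where "X = H r / C0"
    define \<tau> where "\<tau> = max \<tau>1 (min \<tau>2 X)"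
    have "cl \<tau> = X" using x r(3) unfolding \<tau>_def cl_def X_def[symmetric] by linarith
    then have "cl \<tau> = H r / C0" by (simp only: X_def)
    then have "H (R \<tau>) = H r" using C0p by (simp add: R(3))
    then have "R \<tau> = r" using Hmono[of "R \<tau>" r] Hmono[of r "R \<tau>"] R(1)[of \<tau>] sr by (cases "R \<tau>" r rule: linorder_cases) auto
    then show ?thesis using r(3) by (intro exI[of _ \<tau>]) (auto simp: \<tau>_def)
  qed
  define f where "f x = - (1/2) * \<phi> x" for x
  have f: "f \<in> Lip_b d" unfolding f_def[abs_def] by (rule Lip_b_cmult[OF \<phi>])
  obtain M where M: "0 \<le> M" "\<And>x y. \<delta> x y \<le> M" using bcs_bounded[OF \<delta>] by blast
  obtain Bf where Bf: "\<And>x. \<bar>f x\<bar> \<le> Bf" using Lip_b_bounded[OF f] by (auto simp: bounded_range_real)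
  interpret hopf_lax d \<delta> f M Bf by unfold_locales (use \<delta> M Bf in auto)
  \<comment> \<open>The Lipschitz bounds for \<open>Q\<close> degenerate at
    \<open>\<sigma> = 0\<close>, so the diagonal runs from \<open>\<sigma>0\<close> to
    \<open>\<sigma>0 + 1\<close>; comparing its end with \<open>Q 1\<close> costs
    \<open>M\<^sup>2 / 2 * \<sigma>0\<close>.\<close>
  have main: "\<Phi> (Q 1) t - \<Phi> f s - C0\<^sup>2 / 2 \<le> M\<^sup>2 / 2 * \<sigma>0" if \<sigma>0: "0 < \<sigma>0" "\<sigma>0 \<le> 1" for \<sigma>0
  proof -
    define w where "w \<sigma> \<tau> = \<Phi> (Q \<sigma>) (R \<tau>)" for \<sigma> \<tau>
    have iQ: "integrable m (\<lambda>x. Q \<sigma> x * \<rho> r x)" if "0 < \<sigma>" "0 \<le> r" "r \<le> T" for \<sigma> r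
      by (intro integrable_rho_Lip Q_in_Lip_b that)
    have est: "w (\<sigma>0 + 1) 1 \<le> w \<sigma>0 0 + C0\<^sup>2 / 2"
    proof (rule characteristic_estimate[of \<sigma>0 "C0\<^sup>2 / 2" "M / \<sigma>0 * C0" "M\<^sup>2 / (2 * \<sigma>0\<^sup>2)"])
      show "0 \<le> M / \<sigma>0 * C0" using M \<sigma>0 C0p by simp
      fix \<sigma> :: real assume \<sigma>: "\<sigma>0 \<le> \<sigma>"
      then have \<sigma>p: "0 < \<sigma>" using \<sigma>0 by simp
      note QA = Lip_b_A_Ch[OF Q_in_Lip_b[OF \<sigma>p]] and QD = Lip_b_D_Ch[OF Q_in_Lip_b[OF \<sigma>p]]
      have lip: "\<bar>w \<sigma> \<tau>' - w \<sigma> \<tau>\<bar> \<le> M / \<sigma>0 * C0 * (\<tau>' - \<tau>)" if "\<tau> \<le> \<tau>'" for \<tau> \<tau>'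
      proof -
        have Mp: "0 \<le> M / \<sigma>" using M \<sigma>p by simp
        have "ennreal \<bar>Q \<sigma> x - Q \<sigma> y\<bar> \<le> ennreal (M / \<sigma>) * d x y" for x y
        proof -
          have "ennreal \<bar>Q \<sigma> x - Q \<sigma> y\<bar> \<le> ennreal (M / \<sigma> * \<delta> x y)" by (intro ennreal_leI Q_lipschitz \<sigma>p)
          also have "\<dots> = ennreal (M / \<sigma>) * ennreal (\<delta> x y)" using Mp dnn by (intro ennreal_mult) auto
          also have "\<dots> \<le> ennreal (M / \<sigma>) * d x y" by (intro mult_left_mono bcs_le[OF \<delta>]) auto
          finally show ?thesis .
        qed
        then have "AE x in m. LA (Q \<sigma>) x \<le> M / \<sigma>" by (rule LA_le_const[OF Q_in_Lip_b[OF \<sigma>p] Mp])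
        with mslope_le_LA[OF Q_in_Lip_b[OF \<sigma>p]] mslope_nonneg[OF QD]
        have ms: "AE x in m. (mslope (Q \<sigma>) x)\<^sup>2 \<le> (M / \<sigma>)\<^sup>2" by eventually_elim (auto intro!: power_mono)
        have "\<bar>w \<sigma> \<tau>' - w \<sigma> \<tau>\<bar> \<le> (M / \<sigma>) * (LBINT r:{R \<tau>..R \<tau>'}. ?c r)"
          unfolding w_def
        proof (rule CE2_bound_sup[OF c QA _ Rmono[OF that] _ Mp])
          fix r assume "R \<tau> < r" "r < R \<tau>'"
          then show "Fs (Q \<sigma>) r \<le> M / \<sigma>" using R0T[of \<tau>] R0T[of \<tau>'] by (intro Fs_le_const QA Mp ms) auto
        qed (use R0T in auto)
        also have "\<dots> \<le> (M / \<sigma>) * (C0 * (\<tau>' - \<tau>))" using Rint[OF that] Mp by (intro mult_left_mono)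
        also have "\<dots> \<le> (M / \<sigma>0) * (C0 * (\<tau>' - \<tau>))"
          using M \<sigma> \<sigma>0 C0p that by (intro mult_right_mono divide_left_mono) auto
        finally show ?thesis by (simp add: mult.assoc)
      qed
      show "\<bar>w \<sigma> \<tau> - w \<sigma> \<tau>'\<bar> \<le> M / \<sigma>0 * C0 * \<bar>\<tau> - \<tau>'\<bar>" for \<tau> \<tau>'
        using lip[of \<tau> \<tau>'] lip[of \<tau>' \<tau>] by (cases "\<tau> \<le> \<tau>'") (auto simp: abs_minus_commute)
      show "\<bar>w \<sigma> \<tau> - w \<sigma>' \<tau>\<bar> \<le> M\<^sup>2 / (2 * \<sigma>0\<^sup>2) * \<bar>\<sigma> - \<sigma>'\<bar>" if "\<sigma>0 \<le> \<sigma>'" for \<sigma>' \<tau>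
      proof -
        let ?k = "M\<^sup>2 / (2 * \<sigma>0\<^sup>2) * \<bar>\<sigma> - \<sigma>'\<bar>"
        have \<sigma>': "0 < \<sigma>'" using that \<sigma>0 by simp
        have ik: "integrable m (\<lambda>x. ?k * \<rho> (R \<tau>) x)" by (intro integrable_mult_right rho_integrable R0T)
        have i1: "integrable m (\<lambda>x. (Q \<sigma> x - Q \<sigma>' x) * \<rho> (R \<tau>) x)"
          by (intro integrable_rho_Lip R0T Lip_b_diff Q_in_Lip_b \<sigma>p \<sigma>')
        have "w \<sigma> \<tau> - w \<sigma>' \<tau> = \<Phi> (\<lambda>x. Q \<sigma> x - Q \<sigma>' x) (R \<tau>)"
          unfolding w_def \<Phi>_def by (simp add: left_diff_distrib iQ[OF \<sigma>p R0T] iQ[OF \<sigma>' R0T])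
        moreover have "\<Phi> (\<lambda>x. Q \<sigma> x - Q \<sigma>' x) (R \<tau>) \<le> \<Phi> (\<lambda>_. ?k) (R \<tau>)"
          using Q_lipschitz_time[OF \<sigma>0(1) \<sigma> that] by (intro Phi_mono R0T ik i1 AE_I2) (auto dest: abs_le_D1)
        moreover have "\<Phi> (\<lambda>_. - ?k) (R \<tau>) \<le> \<Phi> (\<lambda>x. Q \<sigma> x - Q \<sigma>' x) (R \<tau>)"
        proof (intro Phi_mono R0T i1 AE_I2)
          show "integrable m (\<lambda>x. - ?k * \<rho> (R \<tau>) x)" by (intro integrable_mult_right rho_integrable R0T)
          show "- ?k \<le> Q \<sigma> x - Q \<sigma>' x" for x using Q_lipschitz_time[OF \<sigma>0(1) \<sigma> that, of x] by (auto dest: abs_le_D2)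
        qed
        ultimately show ?thesis by (simp only: Phi_const[OF R0T] abs_le_iff simp_thms)
      qed
      show "w \<sigma> \<tau>2 - w \<sigma> \<tau>1 \<le> (\<tau>2 - \<tau>1) * (C0\<^sup>2 / 2 + (\<sigma> + \<kappa>) / (\<sigma> * \<kappa>) * S)"
        if \<kappa>: "0 < \<kappa>" and \<tau>: "\<tau>1 \<le> \<tau>2" and S: "\<And>\<tau>. \<tau>1 \<le> \<tau> \<Longrightarrow> \<tau> \<le> \<tau>2 \<Longrightarrow> w \<sigma> \<tau> - w (\<sigma> + \<kappa>) \<tau> \<le> S" for \<kappa> \<tau>1 \<tau>2 S
      proof -
        have \<sigma>k: "0 < \<sigma> + \<kappa>" "\<sigma> < \<sigma> + \<kappa>" using \<sigma>p \<kappa> by auto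
        define q where "q = (\<sigma> + \<kappa>) / (\<sigma> * \<kappa>)"
        have q: "0 < q" using \<sigma>p \<kappa> by (simp add: q_def)
        have Lipd: "(\<lambda>x. (2 * q) * (Q \<sigma> x - Q (\<sigma> + \<kappa>) x)) \<in> Lip_b d" by (intro Lip_b_cmult Lip_b_diff Q_in_Lip_b \<sigma>p \<sigma>k)
        \<comment> \<open>\<open>2 * q\<close> is the factor in \<open>Lip_a_Q\<close> for the pair
          \<open>\<sigma>\<close> and \<open>\<sigma> + \<kappa>\<close>. The resulting majorant of
          \<open>Lip_a\<close> is measurable, hence it dominates \<open>LA\<close> and the minimal
          slope as well.\<close>
        have F2: "(Fs (Q \<sigma>) r)\<^sup>2 \<le> 2 * q * S" if r: "R \<tau>1 < r" "r < R \<tau>2" for r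
        proof -
          have r0: "0 \<le> r" "r \<le> T" using r R0T[of \<tau>1] R0T[of \<tau>2] by auto
          obtain \<tau> where \<tau>': "\<tau>1 \<le> \<tau>" "\<tau> \<le> \<tau>2" "R \<tau> = r" using Rsurj[of \<tau>1 r \<tau>2] r \<tau> by auto
          obtain B where B: "\<And>x. \<bar>(2 * q) * (Q \<sigma> x - Q (\<sigma> + \<kappa>) x)\<bar> \<le> B" using Lip_b_bounded[OF Lipd] by (auto simp: bounded_range_real)
          have "AE x in m. LA (Q \<sigma>) x \<le> sqrt ((2 * q) * (Q \<sigma> x - Q (\<sigma> + \<kappa>) x))"
          proof (rule LA_least[OF Q_in_Lip_b[OF \<sigma>p]])
            show "(\<lambda>x. sqrt ((2 * q) * (Q \<sigma> x - Q (\<sigma> + \<kappa>) x))) \<in> borel_measurable m" using Lip_b_m[OF Lipd] by measurable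
            show "AE x in m. Lip_a d (Q \<sigma>) x \<le> sqrt ((2 * q) * (Q \<sigma> x - Q (\<sigma> + \<kappa>) x))"
            proof (intro AE_I2 real_le_rsqrt)
              fix x
              have "q = (\<sigma> + \<kappa>) / (\<sigma> * (\<sigma> + \<kappa> - \<sigma>))" by (simp add: q_def)
              then show "(Lip_a d (Q \<sigma>) x)\<^sup>2 \<le> (2 * q) * (Q \<sigma> x - Q (\<sigma> + \<kappa>) x)"
                using Lip_a_Q[OF \<sigma>p \<sigma>k(2), of x] by (simp only: mult_ac)
            qed
          qed
          with mslope_le_LA[OF Q_in_Lip_b[OF \<sigma>p]] mslope_nonneg[OF QD]
          have "AE x in m. (mslope (Q \<sigma>) x)\<^sup>2 \<le> (2 * q) * (Q \<sigma> x - Q (\<sigma> + \<kappa>) x)"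
          proof eventually_elim
            case (elim x)
            have n: "0 \<le> (2 * q) * (Q \<sigma> x - Q (\<sigma> + \<kappa>) x)" using q Q_antimono[OF \<sigma>p, of "\<sigma> + \<kappa>" x] \<kappa> by simp
            have "(mslope (Q \<sigma>) x)\<^sup>2 \<le> (sqrt ((2 * q) * (Q \<sigma> x - Q (\<sigma> + \<kappa>) x)))\<^sup>2" using elim by (intro power_mono) auto
            then show ?case using n by simp
          qed
          then have "(Fs (Q \<sigma>) r)\<^sup>2 \<le> \<Phi> (\<lambda>x. (2 * q) * (Q \<sigma> x - Q (\<sigma> + \<kappa>) x)) r"
            by (rule Fs_le[OF r0 QA Lip_b_m[OF Lipd] AE_I2[OF B]])
          also have "\<dots> = (2 * q) * (w \<sigma> \<tau> - w (\<sigma> + \<kappa>) \<tau>)"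
          proof -
            have "(\<lambda>x. (2 * q) * (Q \<sigma> x - Q (\<sigma> + \<kappa>) x) * \<rho> r x) = (\<lambda>x. (2 * q) * (Q \<sigma> x * \<rho> r x - Q (\<sigma> + \<kappa>) x * \<rho> r x))"
              by (auto simp: algebra_simps)
            then show ?thesis unfolding w_def \<Phi>_def \<tau>'(3)
              by (simp only: integral_mult_right_zero Bochner_Integration.integral_diff[OF iQ[OF \<sigma>p r0] iQ[OF \<sigma>k(1) r0]])
          qed
          also have "\<dots> \<le> (2 * q) * S" using q S[OF \<tau>'(1,2)] by (intro mult_left_mono) auto
          finally show ?thesis .
        qed
        have S0: "0 \<le> S"
        proof -
          have "\<Phi> (Q (\<sigma> + \<kappa>)) (R \<tau>1) \<le> \<Phi> (Q \<sigma>) (R \<tau>1)"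
            using Q_antimono[OF \<sigma>p] \<kappa> by (intro Phi_mono R0T iQ \<sigma>p \<sigma>k AE_I2) auto
          then show ?thesis using S[of \<tau>1] \<tau> by (simp add: w_def)
        qed
        have "\<bar>w \<sigma> \<tau>2 - w \<sigma> \<tau>1\<bar> \<le> sqrt (2 * q * S) * (LBINT r:{R \<tau>1..R \<tau>2}. ?c r)"
          unfolding w_def
        proof (rule CE2_bound_sup[OF c QA _ Rmono[OF \<tau>]])
          show "Fs (Q \<sigma>) r \<le> sqrt (2 * q * S)" if "R \<tau>1 < r" "r < R \<tau>2" for r using F2[OF that] by (rule real_le_rsqrt)
        qed (use R0T q S0 in auto)
        also have "\<dots> \<le> sqrt (2 * q * S) * (C0 * (\<tau>2 - \<tau>1))" using Rint[OF \<tau>] q S0 by (intro mult_left_mono) auto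
        also have "\<dots> = (\<tau>2 - \<tau>1) * (sqrt (2 * q * S) * C0)" by simp
        \<comment> \<open>Young's inequality; the 2 in \<open>2 * q * S\<close> leaves
          \<open>S\<close> with coefficient \<open>q\<close>, as the hypothesis of the estimate
          prescribes.\<close>
        also have "\<dots> \<le> (\<tau>2 - \<tau>1) * (C0\<^sup>2 / 2 + q * S)"
        proof (intro mult_left_mono)
          have "0 \<le> (sqrt (2 * q * S) - C0)\<^sup>2" by simp
          then have "2 * (sqrt (2 * q * S) * C0) \<le> (sqrt (2 * q * S))\<^sup>2 + C0\<^sup>2" by (simp add: power2_diff)
          also have "(sqrt (2 * q * S))\<^sup>2 = 2 * q * S" using q S0 by simp
          finally show "sqrt (2 * q * S) * C0 \<le> C0\<^sup>2 / 2 + q * S" by simp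
        qed (use \<tau> in simp)
        finally show ?thesis unfolding q_def by (auto dest: abs_le_D1)
      qed
    qed (use \<sigma>0 in auto)
    have H0: "H (R 0) = 0" "H (R 1) = C0" by (auto simp: R(3) cl_def)
    have "R 0 = s" using Hmono[of s "R 0"] R(1)[of 0] H0 Hs by (cases "s < R 0") auto
    moreover have "R 1 = t" using Hmono[of "R 1" t] R(1)[of 1] R(2)[of 1] H0 Ht by (cases "R 1 < t") auto
    ultimately have "\<Phi> (Q (\<sigma>0 + 1)) t \<le> \<Phi> (Q \<sigma>0) s + C0\<^sup>2 / 2" using est by (simp add: w_def)
    moreover have "\<Phi> (Q \<sigma>0) s \<le> \<Phi> f s"
      using Q_le_f[OF \<sigma>0(1)] st by (intro Phi_mono iQ integrable_rho_Lip f \<sigma>0 AE_I2) auto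
    moreover have "\<Phi> (Q 1) t \<le> \<Phi> (Q (\<sigma>0 + 1)) t + M\<^sup>2 / 2 * \<sigma>0"
    proof -
      have t0: "0 \<le> t" "t \<le> T" using st by auto
      have iQt: "integrable m (\<lambda>x. Q (\<sigma>0 + 1) x * \<rho> t x)" "integrable m (\<lambda>x. (M\<^sup>2 / 2 * \<sigma>0) * \<rho> t x)"
        using \<sigma>0 t0 by (auto intro!: iQ integrable_mult_right rho_integrable)
      have "\<Phi> (Q 1) t \<le> \<Phi> (\<lambda>x. Q (\<sigma>0 + 1) x + M\<^sup>2 / 2 * \<sigma>0) t"
      proof (intro Phi_mono t0 AE_I2)
        show "integrable m (\<lambda>x. Q 1 x * \<rho> t x)" by (intro iQ t0) simp
        show "integrable m (\<lambda>x. (Q (\<sigma>0 + 1) x + M\<^sup>2 / 2 * \<sigma>0) * \<rho> t x)" unfolding distrib_right by (intro Bochner_Integration.integrable_add iQt)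
        show "Q 1 x \<le> Q (\<sigma>0 + 1) x + M\<^sup>2 / 2 * \<sigma>0" for x
          using Q_lipschitz_time[of 1 1 "\<sigma>0 + 1" x] abs_ge_self[of "Q 1 x - Q (\<sigma>0 + 1) x"] \<sigma>0 by simp
      qed
      also have "\<dots> = \<Phi> (Q (\<sigma>0 + 1)) t + M\<^sup>2 / 2 * \<sigma>0"
        unfolding \<Phi>_def distrib_right Bochner_Integration.integral_add[OF iQt] by (simp add: rho_integral[OF t0])
      finally show ?thesis .
    qed
    ultimately show ?thesis by linarith
  qed
  have "\<Phi> (Q 1) t - \<Phi> f s - C0\<^sup>2 / 2 \<le> 0"
  proof (rule field_le_epsilon)
    fix \<epsilon> :: real assume \<epsilon>: "0 < \<epsilon>"
    define \<sigma>0 where "\<sigma>0 = min 1 (\<epsilon> / (M\<^sup>2 / 2 + 1))"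
    have p: "0 < M\<^sup>2 / 2 + 1" by (simp add: add_nonneg_pos)
    have \<sigma>0: "0 < \<sigma>0" "\<sigma>0 \<le> 1" using \<epsilon> p by (auto simp: \<sigma>0_def)
    have "M\<^sup>2 / 2 * \<sigma>0 \<le> (M\<^sup>2 / 2 + 1) * (\<epsilon> / (M\<^sup>2 / 2 + 1))"
      using \<sigma>0 p by (intro mult_mono) (auto simp: \<sigma>0_def)
    also have "\<dots> = \<epsilon>" using p by simp
    finally show "\<Phi> (Q 1) t - \<Phi> f s - C0\<^sup>2 / 2 \<le> 0 + \<epsilon>" using main[OF \<sigma>0] by simp
  qed
  \<comment> \<open>Since \<open>f\<close> is minus half of \<open>\<phi>\<close>, the constraint
    \<open>le\<close> says that half of \<open>\<psi>\<close> lies below every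
    \<open>val 1 x y\<close>.\<close>
  moreover have "(1/2) * \<Phi> \<psi> t \<le> \<Phi> (Q 1) t"
  proof -
    have t0: "0 \<le> t" "t \<le> T" using st by auto
    have "\<Phi> (\<lambda>x. (1/2) * \<psi> x) t \<le> \<Phi> (Q 1) t"
    proof (intro Phi_mono t0 integrable_rho_Lip Lip_b_cmult \<psi> Q_in_Lip_b AE_I2 Q_greatest)
      fix x y
      show "(1/2) * \<psi> x \<le> val 1 x y" using le[of y x] bcs_commute[OF \<delta>, of x y] by (simp add: val_def f_def)
    qed simp
    then show ?thesis by (simp add: \<Phi>_def)
  qed
  moreover have "\<Phi> f s = - (1/2) * \<Phi> \<phi> s" by (simp add: \<Phi>_def f_def)
  ultimately show ?thesis by simp
qed

text \<open>Both orders are recorded because \<open>metric_speed\<close> evaluates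
  \<open>W2 d (\<mu> s) (\<mu> t)\<close> for \<open>s\<close> on either side of \<open>t\<close>.
  They follow from one dual bound, in which the potentials may be exchanged as
  \<open>\<delta>\<close> is symmetric.\<close>

lemma W2_le_CE2:
  assumes c: "CE2_bound T d m \<rho> c" and st: "0 \<le> s" "s \<le> t" "t \<le> T"
  shows "W2 d (\<mu> s) (\<mu> t) \<le> ennreal (LBINT r:{s..t}. \<bar>ext0 T c r\<bar>)"
    and "W2 d (\<mu> t) (\<mu> s) \<le> ennreal (LBINT r:{s..t}. \<bar>ext0 T c r\<bar>)"
proof -
  let ?I = "LBINT r:{s..t}. \<bar>ext0 T c r\<bar>"
  have I0: "0 \<le> ?I" unfolding set_lebesgue_integral_def by (intro Bochner_Integration.integral_nonneg) auto
  have s0: "0 \<le> s" "s \<le> T" and t0: "0 \<le> t" "t \<le> T" using st by auto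
  have "W2 d (\<mu> s) (\<mu> t) \<le> ennreal (?I + e * (t - s)) \<and> W2 d (\<mu> t) (\<mu> s) \<le> ennreal (?I + e * (t - s))" if e: "0 < e" for e
  proof -
    let ?C = "?I + e * (t - s)"
    have C: "0 \<le> ?C" using I0 e st by simp
    have dual: "\<Phi> \<phi> s + \<Phi> \<psi> t \<le> ?C\<^sup>2" if \<phi>: "\<phi> \<in> Lip_b d" and \<psi>: "\<psi> \<in> Lip_b d" and \<delta>: "\<delta> \<in> bcs d" and le: "\<And>x y. \<phi> x + \<psi> y \<le> (\<delta> x y)\<^sup>2" for \<phi> \<psi> \<delta>
    proof (cases "s = t")
      \<comment> \<open>At equal times the diagonal of \<open>le\<close> gives
        \<open>\<phi> \<le> - \<psi>\<close>.\<close>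
      case True
      have "\<Phi> \<phi> t \<le> \<Phi> (\<lambda>x. - \<psi> x) t"
      proof (intro Phi_mono t0 integrable_rho_Lip \<phi> Lip_b_uminus \<psi> AE_I2)
        show "\<phi> x \<le> - \<psi> x" for x using le[of x x] bcs_refl[OF \<delta>, of x] by simp
      qed
      then have "\<Phi> \<phi> s + \<Phi> \<psi> t \<le> 0" using True by (simp add: \<Phi>_def)
      then show ?thesis by (meson order_trans zero_le_power2)
    next
      case False
      then show ?thesis using dual_inequality[OF c st(1) _ st(3) e refl \<phi> \<psi> \<delta> le] st by simp
    qed
    have im: "f \<in> Lip_b d \<Longrightarrow> (LINT x|\<mu> r. f x) = \<Phi> f r" if "0 \<le> r" "r \<le> T" for f r by (intro integral_mu that Lip_b_m)
    interpret A: transport_dual d "\<mu> s" "\<mu> t" "?C\<^sup>2"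
      by unfold_locales (auto intro!: top mu_radon s0 t0 dual simp: im[OF s0] im[OF t0])
    interpret B: transport_dual d "\<mu> t" "\<mu> s" "?C\<^sup>2"
    proof unfold_locales
      fix \<phi> \<psi> \<delta> assume *: "\<phi> \<in> Lip_b d" "\<psi> \<in> Lip_b d" "\<delta> \<in> bcs d" "\<And>x y. \<phi> x + \<psi> y \<le> (\<delta> x y)\<^sup>2"
      have "\<Phi> \<psi> s + \<Phi> \<phi> t \<le> ?C\<^sup>2"
      proof (rule dual[OF *(2,1,3)])
        show "\<psi> x + \<phi> y \<le> (\<delta> x y)\<^sup>2" for x y using *(4)[of y x] bcs_commute[OF *(3), of x y] by simp
      qed
      then show "(LINT x|\<mu> t. \<phi> x) + (LINT x|\<mu> s. \<psi> x) \<le> ?C\<^sup>2" by (simp add: im[OF s0 *(2)] im[OF t0 *(1)])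
    qed (auto intro!: top mu_radon s0 t0)
    show ?thesis using A.W2_le B.W2_le C by simp
  qed
  then have *: "W2 d (\<mu> s) (\<mu> t) \<le> ennreal ?I + ennreal e \<and> W2 d (\<mu> t) (\<mu> s) \<le> ennreal ?I + ennreal e" if "0 < e" for e
  proof -
    have p: "0 < e / (t - s + 1)" using that st by simp
    have "?I + e / (t - s + 1) * (t - s) \<le> ?I + e" using that st by (simp add: field_simps)
    then have "ennreal (?I + e / (t - s + 1) * (t - s)) \<le> ennreal (?I + e)" by (rule ennreal_leI)
    also have "\<dots> = ennreal ?I + ennreal e" using I0 that by simp
    finally show ?thesis using \<open>\<And>e. 0 < e \<Longrightarrow> W2 d (\<mu> s) (\<mu> t) \<le> ennreal (?I + e * (t - s)) \<and> W2 d (\<mu> t) (\<mu> s) \<le> ennreal (?I + e * (t - s))\<close>[OF p]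
      by (auto intro: order_trans)
  qed
  show "W2 d (\<mu> s) (\<mu> t) \<le> ennreal ?I"
    by (rule ennreal_le_epsilon) (rule *[THEN conjunct1])
  show "W2 d (\<mu> t) (\<mu> s) \<le> ennreal ?I"
    by (rule ennreal_le_epsilon) (rule *[THEN conjunct2])
qed

end

section \<open>Measurability in time, pointwise form of the bounds, and the least bound\<close>

lemma LBINT_Icc_cong_AE:
  fixes f g :: "real \<Rightarrow> real"
  assumes f: "integrable lborel f" and g: "integrable lborel g" and fg: "AE x in lborel. f x = g x"
  shows "(LBINT x:{a..b}. f x) = (LBINT x:{a..b}. g x)"
  unfolding set_lebesgue_integral_def
proof (rule integral_cong_AE)
  note [measurable] = borel_measurable_integrable[OF f] borel_measurable_integrable[OF g]
  show "(\<lambda>x. indicator {a..b} x *\<^sub>R f x) \<in> borel_measurable lborel"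
    "(\<lambda>x. indicator {a..b} x *\<^sub>R g x) \<in> borel_measurable lborel" by measurable
  show "AE x in lborel. indicator {a..b} x *\<^sub>R f x = indicator {a..b} x *\<^sub>R g x"
    using fg by eventually_elim simp
qed

lemma abs_LBINT_Icc_le:
  fixes f g :: "real \<Rightarrow> real"
  assumes f: "integrable lborel f" and g: "integrable lborel g" and fg: "AE x in lborel. \<bar>f x\<bar> \<le> g x"
  shows "\<bar>LBINT x:{a..b}. f x\<bar> \<le> (LBINT x:{a..b}. g x)"
proof -
  have i: "integrable lborel (\<lambda>x. indicator {a..b} x *\<^sub>R f x)" "integrable lborel (\<lambda>x. indicator {a..b} x *\<^sub>R g x)"
    using set_integrable_lborel[OF f, of "{a..b}"] set_integrable_lborel[OF g, of "{a..b}"]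
    unfolding set_integrable_def by auto
  have "norm (LBINT x:{a..b}. f x) \<le> (LBINT x:{a..b}. g x)"
    unfolding set_lebesgue_integral_def
  proof (rule order_trans[OF integral_norm_bound])
    show "(LINT x|lborel. norm (indicator {a..b} x *\<^sub>R f x)) \<le> (LINT x|lborel. indicator {a..b} x *\<^sub>R g x)"
      by (intro integral_mono_AE integrable_norm i, use fg in eventually_elim) (auto simp: indicator_def)
  qed
  then show ?thesis by simp
qed

context curve
begin

text \<open>Time frozen at 0 and at \<open>T\<close>, so that results about functions on the whole
  line apply to the curve.\<close>

definition ctime :: "real \<Rightarrow> real" where "ctime r = max 0 (min T r)"

lemma ctime: "0 \<le> ctime r" "ctime r \<le> T" using T by (auto simp: ctime_def)
lemma ctime_mono: "s \<le> t \<Longrightarrow> ctime s \<le> ctime t" by (auto simp: ctime_def)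
lemma ctime_id: "0 \<le> r \<Longrightarrow> r \<le> T \<Longrightarrow> ctime r = r" by (auto simp: ctime_def)

lemma AC_clamp:
  fixes h F :: "real \<Rightarrow> real"
  assumes h: "integrable lborel h" "\<And>r. 0 \<le> h r" "\<And>r. r \<notin> {0<..<T} \<Longrightarrow> h r = 0" and K: "0 \<le> K"
    and F: "\<And>s t. 0 \<le> s \<Longrightarrow> s \<le> t \<Longrightarrow> t \<le> T \<Longrightarrow> \<bar>F t - F s\<bar> \<le> K * (LBINT r:{s..t}. h r)" and st: "s \<le> t"
  shows "\<bar>F (ctime t) - F (ctime s)\<bar> \<le> (LBINT r:{s..t}. K * h r)"
proof -
  have "\<bar>F (ctime t) - F (ctime s)\<bar> \<le> K * (LBINT r:{ctime s..ctime t}. h r)"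
    by (rule F[OF ctime(1) ctime_mono[OF st] ctime(2)])
  also have "(LBINT r:{ctime s..ctime t}. h r) = (LBINT r:{s..t}. h r)"
    unfolding ctime_def by (rule Icc_ext0_clamp[OF h(3) T h(1) st])
  finally show ?thesis by simp
qed

text \<open>Common ground of the two halves: one integrable \<open>h\<close> controls all Lipschitz
  observables, up to a factor depending on the observable. A continuity inequality provides it from
  \<open>c\<close>, absolute continuity in \<open>W2\<close> from \<open>g\<close>; measurability in
  time rests on it.\<close>

definition Lip_regular :: "(real \<Rightarrow> real) \<Rightarrow> bool" where
  "Lip_regular h \<longleftrightarrow> integrable lborel h \<and> (\<forall>r. 0 \<le> h r) \<and> (\<forall>r. r \<notin> {0<..<T} \<longrightarrow> h r = 0) \<and>
    (\<forall>f\<in>Lip_b d. \<exists>K\<ge>0. \<forall>s t. 0 \<le> s \<longrightarrow> s \<le> t \<longrightarrow> t \<le> T \<longrightarrow> \<bar>\<Phi> f t - \<Phi> f s\<bar> \<le> K * (LBINT r:{s..t}. h r))"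

lemma Lip_regularD:
  assumes "Lip_regular h"
  shows "integrable lborel h" "0 \<le> h r" "r \<notin> {0<..<T} \<Longrightarrow> h r = 0"
    "f \<in> Lip_b d \<Longrightarrow> \<exists>K\<ge>0. \<forall>s t. 0 \<le> s \<longrightarrow> s \<le> t \<longrightarrow> t \<le> T \<longrightarrow> \<bar>\<Phi> f t - \<Phi> f s\<bar> \<le> K * (LBINT r:{s..t}. h r)"
  using assms unfolding Lip_regular_def by blast+

lemma Lip_regular_CE2:
  assumes c: "CE2_bound T d m \<rho> c" shows "Lip_regular (\<lambda>r. \<bar>ext0 T c r\<bar>)"
  unfolding Lip_regular_def
proof (intro conjI allI impI ballI)
  show "integrable lborel (\<lambda>r. \<bar>ext0 T c r\<bar>)" using CE2_boundD(3)[OF c] by simp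
  fix f assume "f \<in> Lip_b d"
  then have f: "f \<in> A_Ch d m" by (rule Lip_b_A_Ch)
  obtain K where K: "0 \<le> K" "AE x in m. (mslope f x)\<^sup>2 \<le> K\<^sup>2" using A_Ch_bound[OF f] by blast
  have "\<bar>\<Phi> f t - \<Phi> f s\<bar> \<le> K * (LBINT r:{s..t}. \<bar>ext0 T c r\<bar>)" if st: "0 \<le> s" "s \<le> t" "t \<le> T" for s t
    using st by (intro CE2_bound_sup[OF c f] K(1) Fs_le_const[OF _ _ f K]) auto
  then show "\<exists>K\<ge>0. \<forall>s t. 0 \<le> s \<longrightarrow> s \<le> t \<longrightarrow> t \<le> T \<longrightarrow> \<bar>\<Phi> f t - \<Phi> f s\<bar> \<le> K * (LBINT r:{s..t}. \<bar>ext0 T c r\<bar>)"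
    using K(1) by blast
qed (auto simp: ext0_def)

lemma emeasure_mu:
  assumes t: "0 \<le> t" "t \<le> T" and B: "B \<in> sets borel" shows "emeasure (\<mu> t) B = ennreal (\<Phi> (indicator B) t)"
proof -
  interpret M: prob_space "\<mu> t" by (rule mu_prob[OF t])
  have "emeasure (\<mu> t) B = ennreal (measure (\<mu> t) B)" by (rule M.emeasure_eq_measure)
  also have "measure (\<mu> t) B = (LINT x|\<mu> t. indicator B x)" using B by (simp add: sets_mu)
  also have "\<dots> = \<Phi> (indicator B) t" by (intro integral_mu[OF t] borel_measurable_indicator) (simp add: sets_m B)
  finally show ?thesis .
qed

text \<open>Integrals of Lipschitz functions are Borel in time by \<open>AC_measurable\<close>. An
  indicator is a bounded limit of Lipschitz functions almost everywhere for \<open>m\<close>, so one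
  sequence serves the measures of all times.\<close>

lemma mu_kernel:
  assumes h: "Lip_regular h" shows "(\<lambda>r. \<mu> (ctime r)) \<in> borel \<rightarrow>\<^sub>M subprob_algebra borel"
proof (rule measurable_subprob_algebra)
  show "subprob_space (\<mu> (ctime r))" for r using mu_prob[OF ctime] by (rule prob_space_imp_subprob_space)
  show "sets (\<mu> (ctime r)) = sets borel" for r by (rule sets_mu)
  fix B :: "'a set" assume B: "B \<in> sets borel"
  obtain c where c: "\<And>n. c n \<in> Lip_b d" "\<And>n x. 0 \<le> c n x" "\<And>n x. c n x \<le> 1" "AE x in m. (\<lambda>n. c n x) \<longlonglongrightarrow> indicator B x"
    by (rule indicator_approx[OF B]) blast
  have "(\<lambda>r. \<Phi> (indicator B) (ctime r)) \<in> borel_measurable borel"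
  proof (rule borel_measurable_LIMSEQ_real)
    show "(\<lambda>n. \<Phi> (c n) (ctime r)) \<longlonglongrightarrow> \<Phi> (indicator B) (ctime r)" for r
      unfolding \<Phi>_def
    proof (rule integral_dominated_convergence)
      show "integrable m (\<lambda>x. \<bar>\<rho> (ctime r) x\<bar>)" using rho_integrable[OF ctime] by simp
      show "(\<lambda>x. indicator B x * \<rho> (ctime r) x) \<in> borel_measurable m"
        by (intro borel_measurable_times borel_measurable_indicator rho_measurable ctime) (simp add: sets_m B)
      show "(\<lambda>x. c n x * \<rho> (ctime r) x) \<in> borel_measurable m" for n
        by (intro borel_measurable_times Lip_b_m c rho_measurable ctime)
      show "AE x in m. (\<lambda>n. c n x * \<rho> (ctime r) x) \<longlonglongrightarrow> indicator B x * \<rho> (ctime r) x"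
        using c(4) by eventually_elim (intro tendsto_intros)
      show "AE x in m. norm (c n x * \<rho> (ctime r) x) \<le> \<bar>\<rho> (ctime r) x\<bar>" for n
        using c(2,3) by (auto simp: abs_mult intro!: mult_left_le_one_le)
    qed
    show "(\<lambda>r. \<Phi> (c n) (ctime r)) \<in> borel_measurable borel" for n
    proof -
      obtain K where K: "0 \<le> K" "\<And>s t. 0 \<le> s \<Longrightarrow> s \<le> t \<Longrightarrow> t \<le> T \<Longrightarrow> \<bar>\<Phi> (c n) t - \<Phi> (c n) s\<bar> \<le> K * (LBINT r:{s..t}. h r)"
        using Lip_regularD(4)[OF h c(1)] by blast
      show ?thesis
        by (rule AC_measurable[OF integrable_mult_right[OF Lip_regularD(1)[OF h]]],
            rule AC_clamp[OF Lip_regularD(1,2,3)[OF h] K(1)]) (use K in auto)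
    qed
  qed
  then show "(\<lambda>r. emeasure (\<mu> (ctime r)) B) \<in> borel_measurable borel"
    by (simp add: emeasure_mu[OF ctime B])
qed

lemma Phi_measurable:
  assumes h: "Lip_regular h" and G: "G \<in> borel_measurable m" "\<And>x. 0 \<le> G x"
  shows "(\<lambda>r. \<Phi> G (ctime r)) \<in> borel_measurable borel"
proof -
  have Gb: "G \<in> borel_measurable borel" using G(1) by (simp add: measurable_def sets_m space_m)
  have "(\<lambda>r. \<integral>\<^sup>+ x. ennreal (G x) \<partial>\<mu> (ctime r)) \<in> borel_measurable borel"
    by (rule measurable_compose[OF mu_kernel[OF h] nn_integral_measurable_subprob_algebra]) (use Gb in measurable)
  then have "(\<lambda>r. enn2real (\<integral>\<^sup>+ x. ennreal (G x) \<partial>\<mu> (ctime r))) \<in> borel_measurable borel" by measurable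
  also have "(\<lambda>r. enn2real (\<integral>\<^sup>+ x. ennreal (G x) \<partial>\<mu> (ctime r))) = (\<lambda>r. \<Phi> G (ctime r))"
  proof
    fix r
    have "G \<in> borel_measurable (\<mu> (ctime r))" using Gb by (simp add: measurable_def sets_mu space_mu)
    then show "enn2real (\<integral>\<^sup>+ x. ennreal (G x) \<partial>\<mu> (ctime r)) = \<Phi> G (ctime r)"
      unfolding integral_mu[OF ctime G(1), symmetric] using G(2) by (subst integral_eq_nn_integral) auto
  qed
  finally show ?thesis .
qed

lemma Fs_measurable:
  assumes h: "Lip_regular h" and f: "f \<in> A_Ch d m" shows "(\<lambda>r. Fs f (ctime r)) \<in> borel_measurable borel"
proof -
  have "(\<lambda>r. \<Phi> (\<lambda>x. (mslope f x)\<^sup>2) (ctime r)) \<in> borel_measurable borel"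
    by (intro Phi_measurable[OF h] borel_measurable_power A_Ch_measurable f) simp
  then show ?thesis unfolding Fs_def \<Phi>_def by measurable
qed

lemma ext0_clamp: "ext0 T c r * X (ctime r) = ext0 T c r * X r"
  by (auto simp: ext0_def indicator_def ctime_id)

lemma ext0_Fs_integrable:
  assumes h: "Lip_regular h" and f: "f \<in> A_Ch d m" and c: "c \<in> L2 (leb_Ioo T)"
  shows "integrable lborel (\<lambda>r. ext0 T c r * Fs f r)"
proof -
  obtain K where K: "0 \<le> K" "AE x in m. (mslope f x)\<^sup>2 \<le> K\<^sup>2" using A_Ch_bound[OF f] by blast
  have i: "integrable lborel (ext0 T c)" by (rule ext0_integrable[OF c])
  have "integrable lborel (\<lambda>r. ext0 T c r * Fs f (ctime r))"
  proof (rule Bochner_Integration.integrable_bound)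
    show "integrable lborel (\<lambda>r. K * ext0 T c r)" using i by (rule integrable_mult_right)
    show "(\<lambda>r. ext0 T c r * Fs f (ctime r)) \<in> borel_measurable lborel"
      by (rule borel_measurable_times[OF borel_measurable_integrable[OF i]]) (simp add: Fs_measurable[OF h f])
    have "\<bar>ext0 T c r * Fs f (ctime r)\<bar> \<le> \<bar>K * ext0 T c r\<bar>" for r
      using mult_left_mono[OF Fs_le_const[OF ctime f K], of "\<bar>ext0 T c r\<bar>" r] Fs_nonneg[OF ctime, of f r] K(1)
      by (simp add: abs_mult mult.commute)
    then show "AE r in lborel. norm (ext0 T c r * Fs f (ctime r)) \<le> norm (K * ext0 T c r)" by simp
  qed
  then show ?thesis by (simp only: ext0_clamp)
qed

text \<open>With measurability in time the products are integrable, so the open interval may be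
  replaced by the closed one, for which the comparison results are stated.\<close>

lemma CE2_bound_iff:
  assumes h: "Lip_regular h" and c: "c \<in> L2 (leb_Ioo T)"
  shows "CE2_bound T d m \<rho> c \<longleftrightarrow> (AE r in leb_Ioo T. 0 \<le> c r) \<and> (\<forall>f\<in>A_Ch d m. \<forall>s t. 0 \<le> s \<longrightarrow> s \<le> t \<longrightarrow> t \<le> T \<longrightarrow>
    \<bar>\<Phi> f t - \<Phi> f s\<bar> \<le> (LBINT r:{s..t}. ext0 T c r * Fs f r))"
proof -
  have "(LBINT r=s..t. c r * Fs f r) = (LBINT r:{s..t}. ext0 T c r * Fs f r)"
    if "f \<in> A_Ch d m" "0 \<le> s" "s \<le> t" "t \<le> T" for f s t
    unfolding interval_integral_ext0[OF that(2-4)] by (rule LBINT_Ioo_eq_Icc[OF ext0_Fs_integrable[OF h that(1) c]])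
  then have "(\<forall>f\<in>A_Ch d m. \<forall>s t. 0 \<le> s \<longrightarrow> s \<le> t \<longrightarrow> t \<le> T \<longrightarrow> \<bar>\<Phi> f t - \<Phi> f s\<bar> \<le> (LBINT r=s..t. c r * Fs f r)) \<longleftrightarrow>
    (\<forall>f\<in>A_Ch d m. \<forall>s t. 0 \<le> s \<longrightarrow> s \<le> t \<longrightarrow> t \<le> T \<longrightarrow> \<bar>\<Phi> f t - \<Phi> f s\<bar> \<le> (LBINT r:{s..t}. ext0 T c r * Fs f r))"
    by (intro ball_cong iff_allI imp_cong refl) simp
  then show ?thesis unfolding CE2_bound_def Fs_def \<Phi>_def by (simp only: c simp_thms)
qed

definition time_density :: "(real \<Rightarrow> real) \<Rightarrow> (real \<Rightarrow> real) \<Rightarrow> bool" where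
  "time_density F \<phi> \<longleftrightarrow> integrable lborel \<phi> \<and> (\<forall>r. r \<notin> {0<..<T} \<longrightarrow> \<phi> r = 0) \<and>
    (\<forall>s t. 0 \<le> s \<longrightarrow> s \<le> t \<longrightarrow> t \<le> T \<longrightarrow> F t - F s = (LBINT r:{s..t}. \<phi> r))"

lemma time_density_exists:
  fixes h F :: "real \<Rightarrow> real"
  assumes h: "integrable lborel h" "\<And>r. 0 \<le> h r" "\<And>r. r \<notin> {0<..<T} \<Longrightarrow> h r = 0" and K: "0 \<le> K"
    and F: "\<And>s t. 0 \<le> s \<Longrightarrow> s \<le> t \<Longrightarrow> t \<le> T \<Longrightarrow> \<bar>F t - F s\<bar> \<le> K * (LBINT r:{s..t}. h r)"
  shows "\<exists>\<phi>. time_density F \<phi>"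
proof -
  obtain \<phi>0 where p0: "integrable lborel \<phi>0" "AE r in lborel. \<bar>\<phi>0 r\<bar> \<le> K * h r"
    "\<And>s t. s \<le> t \<Longrightarrow> F (ctime t) - F (ctime s) = (LBINT r:{s..t}. \<phi>0 r)"
    by (rule AC_density[of "\<lambda>r. K * h r" "\<lambda>r. F (ctime r)"])
      (use h K AC_clamp[OF h K F] in auto)
  define \<phi> where "\<phi> = (\<lambda>r. indicator {0<..<T} r * \<phi>0 r)"
  have i: "integrable lborel \<phi>" unfolding \<phi>_def
    using integrable_mult_indicator[of "{0<..<T}" lborel, OF _ p0(1)] by simp
  have z: "\<phi> r = 0" if "r \<notin> {0<..<T}" for r using that by (simp add: \<phi>_def)
  have ae: "AE r in lborel. \<phi>0 r = \<phi> r"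
    using p0(2)
  proof eventually_elim
    case (elim r) then show ?case using h(3)[of r] by (cases "r \<in> {0<..<T}") (auto simp: \<phi>_def)
  qed
  have "F t - F s = (LBINT r:{s..t}. \<phi> r)" if "0 \<le> s" "s \<le> t" "t \<le> T" for s t
    using p0(3)[OF that(2)] LBINT_Icc_cong_AE[OF p0(1) i ae] that by (simp add: ctime_id)
  then show ?thesis using i z unfolding time_density_def by blast
qed

text \<open>Comparing integrals over all subintervals amounts to comparing integrands almost
  everywhere. Everything vanishes outside the open time interval, so clamping reduces intervals of
  the line to subintervals of \<open>{0..T}\<close>.\<close>

lemma time_density_le_iff:
  fixes G :: "real \<Rightarrow> real"
  assumes \<phi>: "time_density F \<phi>" and G: "integrable lborel G" and Gz: "\<And>r. r \<notin> {0<..<T} \<Longrightarrow> G r = 0"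
  shows "(\<forall>s t. 0 \<le> s \<longrightarrow> s \<le> t \<longrightarrow> t \<le> T \<longrightarrow> \<bar>F t - F s\<bar> \<le> (LBINT r:{s..t}. G r)) \<longleftrightarrow> (AE r in lborel. \<bar>\<phi> r\<bar> \<le> G r)"
proof -
  have i: "integrable lborel \<phi>" and z: "\<And>r. r \<notin> {0<..<T} \<Longrightarrow> \<phi> r = 0"
    and e: "\<And>s t. 0 \<le> s \<Longrightarrow> s \<le> t \<Longrightarrow> t \<le> T \<Longrightarrow> F t - F s = (LBINT r:{s..t}. \<phi> r)"
    using \<phi> by (auto simp: time_density_def)
  have c: "F (ctime t) - F (ctime s) = (LBINT r:{s..t}. \<phi> r)" if "s \<le> t" for s t
    using e[OF ctime(1) ctime_mono[OF that] ctime(2)] Icc_ext0_clamp[OF z T i that] by (simp add: ctime_def)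
  show ?thesis
  proof
    assume L: "\<forall>s t. 0 \<le> s \<longrightarrow> s \<le> t \<longrightarrow> t \<le> T \<longrightarrow> \<bar>F t - F s\<bar> \<le> (LBINT r:{s..t}. G r)"
    have b: "\<bar>LBINT r:{a..b}. \<phi> r\<bar> \<le> (LBINT r:{a..b}. G r)" if "a < b" for a b
    proof -
      have ab: "a \<le> b" using that by simp
      have "\<bar>F (ctime b) - F (ctime a)\<bar> \<le> (LBINT r:{ctime a..ctime b}. G r)"
        by (rule L[rule_format, OF ctime(1) ctime_mono[OF ab] ctime(2)])
      also have "\<dots> = (LBINT r:{a..b}. G r)" unfolding ctime_def by (rule Icc_ext0_clamp[OF Gz T G ab])
      finally show ?thesis by (simp only: c[OF ab])
    qed
    have "AE r in lborel. \<phi> r \<le> G r" by (rule AE_le_of_LBINT_Icc_le[OF i G]) (rule b[THEN abs_le_D1])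
    moreover have "AE r in lborel. - \<phi> r \<le> G r"
    proof (intro AE_le_of_LBINT_Icc_le Bochner_Integration.integrable_minus i G)
      show "(LBINT r:{a..b}. - \<phi> r) \<le> (LBINT r:{a..b}. G r)" if "a < b" for a b
        using b[OF that] by (simp only: LBINT_Icc_uminus abs_le_iff)
    qed
    ultimately show "AE r in lborel. \<bar>\<phi> r\<bar> \<le> G r" by eventually_elim simp
  next
    assume "AE r in lborel. \<bar>\<phi> r\<bar> \<le> G r"
    then show "\<forall>s t. 0 \<le> s \<longrightarrow> s \<le> t \<longrightarrow> t \<le> T \<longrightarrow> \<bar>F t - F s\<bar> \<le> (LBINT r:{s..t}. G r)"
      using abs_LBINT_Icc_le[OF i G] by (simp add: e)
  qed
qed

text \<open>\<open>\<phi> f\<close> is the density in time of \<open>\<Phi> f\<close> and is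
  independent of \<open>c\<close>; the given bound \<open>c0\<close> guarantees that it exists.
  Being a bound thus becomes a condition at almost every time, with a null set that depends on
  \<open>f\<close>.\<close>

lemma CE2_bound_pointwise:
  assumes c0: "CE2_bound T d m \<rho> c0"
  obtains \<phi> where "\<And>c. c \<in> L2 (leb_Ioo T) \<Longrightarrow> CE2_bound T d m \<rho> c \<longleftrightarrow> (AE r in leb_Ioo T. 0 \<le> c r) \<and>
    (\<forall>f\<in>A_Ch d m. AE r in leb_Ioo T. \<bar>\<phi> f r\<bar> \<le> c r * Fs f r)"
proof -
  note h = Lip_regular_CE2[OF c0]
  let ?h = "\<lambda>r. \<bar>ext0 T c0 r\<bar>"
  have ex: "\<forall>f\<in>A_Ch d m. \<exists>\<phi>. \<forall>c\<in>L2 (leb_Ioo T). (\<forall>s t. 0 \<le> s \<longrightarrow> s \<le> t \<longrightarrow> t \<le> T \<longrightarrow> \<bar>\<Phi> f t - \<Phi> f s\<bar> \<le> (LBINT r:{s..t}. ext0 T c r * Fs f r))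
      \<longleftrightarrow> (AE r in leb_Ioo T. \<bar>\<phi> r\<bar> \<le> c r * Fs f r)"
  proof
    fix f assume f: "f \<in> A_Ch d m"
    obtain K where K: "0 \<le> K" "AE x in m. (mslope f x)\<^sup>2 \<le> K\<^sup>2" using A_Ch_bound[OF f] by blast
    have F: "\<bar>\<Phi> f t - \<Phi> f s\<bar> \<le> K * (LBINT r:{s..t}. ?h r)" if st: "0 \<le> s" "s \<le> t" "t \<le> T" for s t
      using st by (intro CE2_bound_sup[OF c0 f] K(1) Fs_le_const[OF _ _ f K]) auto
    obtain \<phi> where \<phi>: "time_density (\<Phi> f) \<phi>"
      using time_density_exists[OF Lip_regularD(1,2,3)[OF h] K(1) F] by blast
    then have z: "\<phi> r = 0" if "r \<notin> {0<..<T}" for r using that by (simp add: time_density_def)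
    show "\<exists>\<phi>. \<forall>c\<in>L2 (leb_Ioo T). (\<forall>s t. 0 \<le> s \<longrightarrow> s \<le> t \<longrightarrow> t \<le> T \<longrightarrow> \<bar>\<Phi> f t - \<Phi> f s\<bar> \<le> (LBINT r:{s..t}. ext0 T c r * Fs f r))
      \<longleftrightarrow> (AE r in leb_Ioo T. \<bar>\<phi> r\<bar> \<le> c r * Fs f r)"
    proof (intro exI[of _ \<phi>] ballI)
      fix c assume c: "c \<in> L2 (leb_Ioo T)"
      have "(AE r in lborel. \<bar>\<phi> r\<bar> \<le> ext0 T c r * Fs f r) \<longleftrightarrow> (AE r in leb_Ioo T. \<bar>\<phi> r\<bar> \<le> c r * Fs f r)"
        unfolding AE_ext0
      proof (intro iffI; elim eventually_mono)
        show "r \<in> {0<..<T} \<longrightarrow> \<bar>\<phi> r\<bar> \<le> c r * Fs f r" if "\<bar>\<phi> r\<bar> \<le> ext0 T c r * Fs f r" for r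
          using that by (auto simp: ext0_def indicator_def split: if_splits)
        show "\<bar>\<phi> r\<bar> \<le> ext0 T c r * Fs f r" if "r \<in> {0<..<T} \<longrightarrow> \<bar>\<phi> r\<bar> \<le> c r * Fs f r" for r
          using that z[of r] by (cases "r \<in> {0<..<T}") (auto simp: ext0_def)
      qed
      then show "(\<forall>s t. 0 \<le> s \<longrightarrow> s \<le> t \<longrightarrow> t \<le> T \<longrightarrow> \<bar>\<Phi> f t - \<Phi> f s\<bar> \<le> (LBINT r:{s..t}. ext0 T c r * Fs f r))
        \<longleftrightarrow> (AE r in leb_Ioo T. \<bar>\<phi> r\<bar> \<le> c r * Fs f r)"
        by (subst time_density_le_iff[OF \<phi> ext0_Fs_integrable[OF h f c]]) (auto simp: ext0_def)
    qed
  qed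
  obtain \<phi> where "\<forall>f\<in>A_Ch d m. \<forall>c\<in>L2 (leb_Ioo T).
      (\<forall>s t. 0 \<le> s \<longrightarrow> s \<le> t \<longrightarrow> t \<le> T \<longrightarrow> \<bar>\<Phi> f t - \<Phi> f s\<bar> \<le> (LBINT r:{s..t}. ext0 T c r * Fs f r))
      \<longleftrightarrow> (AE r in leb_Ioo T. \<bar>\<phi> f r\<bar> \<le> c r * Fs f r)"
    using bchoice[OF ex] by (elim exE) (rule that)
  note \<phi> = this[THEN bspec, THEN bspec]
  show thesis
  proof (rule that[of \<phi>])
    fix c assume c: "c \<in> L2 (leb_Ioo T)"
    show "CE2_bound T d m \<rho> c \<longleftrightarrow> (AE r in leb_Ioo T. 0 \<le> c r) \<and> (\<forall>f\<in>A_Ch d m. AE r in leb_Ioo T. \<bar>\<phi> f r\<bar> \<le> c r * Fs f r)"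
      unfolding CE2_bound_iff[OF h c] by (intro conj_cong ball_cong refl) (rule \<phi>[OF _ c])
  qed
qed

lemma Fs_nonneg_AE: "AE r in leb_Ioo T. 0 \<le> Fs f r"
  unfolding AE_ext0 by (intro AE_I2) (auto intro: Fs_nonneg)

lemma CE2_bound_min:
  assumes c: "CE2_bound T d m \<rho> c" and c': "CE2_bound T d m \<rho> c'" shows "CE2_bound T d m \<rho> (\<lambda>r. min (c r) (c' r))"
proof -
  obtain \<phi> where \<phi>: "\<And>c. c \<in> L2 (leb_Ioo T) \<Longrightarrow> CE2_bound T d m \<rho> c \<longleftrightarrow> (AE r in leb_Ioo T. 0 \<le> c r) \<and>
    (\<forall>f\<in>A_Ch d m. AE r in leb_Ioo T. \<bar>\<phi> f r\<bar> \<le> c r * Fs f r)" by (rule CE2_bound_pointwise[OF c]) blast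
  note L = CE2_boundD(1)[OF c] CE2_boundD(1)[OF c']
  have P: "AE r in leb_Ioo T. 0 \<le> c r" "AE r in leb_Ioo T. 0 \<le> c' r" using \<phi> L c c' by auto
  have "(\<lambda>r. min (c r) (c' r)) \<in> L2 (leb_Ioo T)"
  proof (rule L2_I_bound[OF _ L2_integrable[OF L(1)]])
    show "(\<lambda>r. min (c r) (c' r)) \<in> borel_measurable (leb_Ioo T)" by (intro borel_measurable_min L2_measurable L)
    show "AE r in leb_Ioo T. (min (c r) (c' r))\<^sup>2 \<le> (c r)\<^sup>2" using P by eventually_elim (auto intro!: power_mono)
  qed
  moreover have "AE r in leb_Ioo T. 0 \<le> min (c r) (c' r)" using P by eventually_elim simp
  moreover have "AE r in leb_Ioo T. \<bar>\<phi> f r\<bar> \<le> min (c r) (c' r) * Fs f r" if f: "f \<in> A_Ch d m" for f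
  proof -
    have "AE r in leb_Ioo T. \<bar>\<phi> f r\<bar> \<le> c r * Fs f r" "AE r in leb_Ioo T. \<bar>\<phi> f r\<bar> \<le> c' r * Fs f r"
      using \<phi> L c c' f by auto
    then show ?thesis by eventually_elim (simp add: min_def)
  qed
  ultimately show ?thesis using \<phi> by blast
qed

text \<open>A pointwise supremum of quotients over all of \<open>A_Ch\<close> would collect
  uncountably many null sets. The essential infimum over the bounds avoids this: it is reached along
  one sequence, so each \<open>f\<close> contributes only countably many null sets.\<close>

lemma CE2_least:
  assumes c0: "CE2_bound T d m \<rho> c0"
  shows "\<exists>c. CE2_bound T d m \<rho> c \<and> (\<forall>c'. CE2_bound T d m \<rho> c' \<longrightarrow> (AE r in leb_Ioo T. c r \<le> c' r))"
proof -
  obtain \<phi> where \<phi>: "\<And>c. c \<in> L2 (leb_Ioo T) \<Longrightarrow> CE2_bound T d m \<rho> c \<longleftrightarrow> (AE r in leb_Ioo T. 0 \<le> c r) \<and>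
    (\<forall>f\<in>A_Ch d m. AE r in leb_Ioo T. \<bar>\<phi> f r\<bar> \<le> c r * Fs f r)" by (rule CE2_bound_pointwise[OF c0]) blast
  have ex: "\<exists>F :: nat \<Rightarrow> real \<Rightarrow> real. (\<forall>n. F n \<in> Collect (CE2_bound T d m \<rho>)) \<and> (\<forall>n r. F (Suc n) r \<le> F n r) \<and>
    (\<forall>c\<in>Collect (CE2_bound T d m \<rho>). AE r in leb_Ioo T. \<forall>e>0. \<exists>n. F n r < c r + e)"
  proof (rule ess_inf_sequence[OF finite_measure_leb_Ioo])
    show "Collect (CE2_bound T d m \<rho>) \<noteq> {}" using c0 by blast
    show "c \<in> borel_measurable (leb_Ioo T)" if "c \<in> Collect (CE2_bound T d m \<rho>)" for c
      using that CE2_boundD(1) by (auto intro: L2_measurable)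
    show "(\<lambda>r. min (c r) (c' r)) \<in> Collect (CE2_bound T d m \<rho>)"
      if "c \<in> Collect (CE2_bound T d m \<rho>)" "c' \<in> Collect (CE2_bound T d m \<rho>)" for c c'
      using that CE2_bound_min by simp
  qed
  obtain F :: "nat \<Rightarrow> real \<Rightarrow> real" where F: "\<And>n. CE2_bound T d m \<rho> (F n)"
    "\<And>c. CE2_bound T d m \<rho> c \<Longrightarrow> AE r in leb_Ioo T. \<forall>e>0. \<exists>n. F n r < c r + e"
    using ex by auto
  note L = CE2_boundD(1)[OF F(1)]
  \<comment> \<open>The bounds are nonnegative only almost everywhere; the truncation makes the
    infimum well behaved at every \<open>r\<close>.\<close>
  define c where "c r = (INF n. max 0 (F n r))" for r
  have bd: "bdd_below (range (\<lambda>n. max 0 (F n r)))" for r by (rule bdd_belowI[of _ 0]) auto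
  have c0: "0 \<le> c r" for r unfolding c_def by (rule cINF_greatest) auto
  have cF: "c r \<le> max 0 (F n r)" for n r unfolding c_def by (rule cINF_lower[OF bd]) simp
  have cm: "c \<in> borel_measurable (leb_Ioo T)" unfolding c_def[abs_def]
    by (rule borel_measurable_cINF) (auto intro!: borel_measurable_max bd L[THEN L2_measurable])
  have P: "AE r in leb_Ioo T. 0 \<le> F n r" for n using F(1) \<phi>[OF L] by blast
  have cL: "c \<in> L2 (leb_Ioo T)"
  proof (rule L2_I_bound[OF cm L2_integrable[OF L[of 0]]])
    show "AE r in leb_Ioo T. (c r)\<^sup>2 \<le> (F 0 r)\<^sup>2"
      using P[of 0]
    proof eventually_elim
      case (elim r)
      then show ?case using cF[of r 0] c0[of r] by (intro power_mono) auto
    qed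
  qed
  have "CE2_bound T d m \<rho> c"
    unfolding \<phi>[OF cL]
  proof (intro conjI ballI)
    show "AE r in leb_Ioo T. 0 \<le> c r" by (intro AE_I2 c0)
    fix f assume f: "f \<in> A_Ch d m"
    have "AE r in leb_Ioo T. \<bar>\<phi> f r\<bar> \<le> F n r * Fs f r" for n using F(1) \<phi>[OF L] f by blast
    then have "AE r in leb_Ioo T. \<forall>n. \<bar>\<phi> f r\<bar> \<le> F n r * Fs f r" by (simp add: AE_all_countable)
    then show "AE r in leb_Ioo T. \<bar>\<phi> f r\<bar> \<le> c r * Fs f r"
      using Fs_nonneg_AE[of f]
    proof eventually_elim
      case (elim r)
      show ?case
      proof (cases "Fs f r = 0")
        case True then show ?thesis using elim(1) by simp
      next
        case False
        then have p: "0 < Fs f r" using elim(2) by simp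
        have "\<bar>\<phi> f r\<bar> / Fs f r \<le> c r" unfolding c_def
        proof (rule cINF_greatest)
          fix n
          have "\<bar>\<phi> f r\<bar> / Fs f r \<le> F n r" using elim(1) p by (simp add: pos_divide_le_eq)
          then show "\<bar>\<phi> f r\<bar> / Fs f r \<le> max 0 (F n r)" by simp
        qed simp
        then show ?thesis using p by (simp add: pos_divide_le_eq)
      qed
    qed
  qed
  moreover have "AE r in leb_Ioo T. c r \<le> c' r" if c': "CE2_bound T d m \<rho> c'" for c'
  proof -
    have "AE r in leb_Ioo T. 0 \<le> c' r" using c' by (simp add: CE2_bound_def)
    with F(2)[OF c'] show ?thesis
    proof eventually_elim
      case (elim r)
      show "c r \<le> c' r"
      proof (rule field_le_epsilon)
        fix e :: real assume e: "0 < e"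
        then obtain n where "F n r < c' r + e" using elim(1) by blast
        then show "c r \<le> c' r + e" using cF[of r n] elim(2) e by linarith
      qed
    qed
  qed
  ultimately show ?thesis by blast
qed

lemma CE2_speed:
  assumes "CE2_bound T d m \<rho> c"
  shows "CE2_bound T d m \<rho> (CE2_speed T d m \<rho>)" and "AE r in leb_Ioo T. CE2_speed T d m \<rho> r \<le> c r"
  using someI_ex[OF CE2_least[OF assms]] assms unfolding CE2_speed_def by blast+

lemma AC2_CE2:
  assumes c: "CE2_bound T d m \<rho> c" shows "\<mu> \<in> AC2 T radon_prob (W2 d)"
  unfolding AC2_def
proof (intro CollectI conjI bexI ballI allI impI)
  show "\<mu> t \<in> radon_prob" if "t \<in> {0..T}" for t using that by (intro mu_radon) auto
  show "c \<in> L2 (leb_Ioo T)" by (rule CE2_boundD(1)[OF c])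
  fix s t assume st: "0 \<le> s" "s \<le> t" "t \<le> T"
  have i: "integrable lborel (ext0 T c)" by (rule CE2_boundD(3)[OF c])
  have "(LBINT r:{s..t}. \<bar>ext0 T c r\<bar>) = (LBINT r:{s..t}. ext0 T c r)"
    using CE2_boundD(2)[OF c] by (intro LBINT_Icc_cong_AE integrable_abs i) (auto elim!: eventually_mono)
  also have "\<dots> = (LBINT r=s..t. c r)" by (simp only: interval_integral_ext0_1[OF st] LBINT_Ioo_eq_Icc[OF i])
  finally show "W2 d (\<mu> s) (\<mu> t) \<le> ennreal (LBINT r=s..t. c r)" using W2_le_CE2(1)[OF c st] by simp
qed

text \<open>At a Lebesgue point the averages converge along intervals ending at \<open>t\<close> as
  well as along intervals starting there, which covers the quotients from both sides.\<close>

lemma metric_speed_CE2: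
  assumes c: "CE2_bound T d m \<rho> c" shows "AE t in leb_Ioo T. metric_speed T (W2 d) \<mu> t \<le> ennreal (c t)"
proof -
  let ?c = "\<lambda>r. \<bar>ext0 T c r\<bar>"
  have i: "integrable lborel ?c" using CE2_boundD(3)[OF c] by simp
  show ?thesis
    unfolding AE_ext0 using lebesgue_differentiation[OF i] CE2_boundD(2)[OF c]
  proof eventually_elim
    case (elim t)
    show ?case
    proof
      assume t: "t \<in> {0<..<T}"
      then have ct: "?c t = c t" "0 \<le> c t" using elim(2) by (auto simp: ext0_def)
      show "metric_speed T (W2 d) \<mu> t \<le> ennreal (c t)"
      proof (rule ennreal_le_epsilon)
        fix \<epsilon> :: real assume \<epsilon>: "0 < \<epsilon>"
        obtain e where e: "0 < e" "\<And>a b. a \<le> t \<Longrightarrow> t \<le> b \<Longrightarrow> a < b \<Longrightarrow> b - a < e \<Longrightarrow>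
            \<bar>(LBINT x:{a..b}. ?c x) - ?c t * (b - a)\<bar> \<le> \<epsilon> * (b - a)"
          using elim(1) \<epsilon> by blast
        have le: "W2 d (\<mu> s) (\<mu> t) \<le> ennreal ((c t + \<epsilon>) * \<bar>s - t\<bar>)"
          if s: "s \<in> {0..T}" "s \<noteq> t" "\<bar>s - t\<bar> < e" for s
        proof (cases "s < t")
          case True
          have "W2 d (\<mu> s) (\<mu> t) \<le> ennreal (LBINT x:{s..t}. ?c x)" using s t True by (intro W2_le_CE2 c) auto
          also have "\<dots> \<le> ennreal ((c t + \<epsilon>) * \<bar>s - t\<bar>)"
            using e(2)[of s t] True s ct by (intro ennreal_leI) (simp add: distrib_right abs_le_iff)
          finally show ?thesis .
        next
          case False
          then have ts: "t < s" using s by simp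
          have "W2 d (\<mu> s) (\<mu> t) \<le> ennreal (LBINT x:{t..s}. ?c x)" using s t ts by (intro W2_le_CE2 c) auto
          also have "\<dots> \<le> ennreal ((c t + \<epsilon>) * \<bar>s - t\<bar>)"
            using e(2)[of t s] ts s ct by (intro ennreal_leI) (simp add: distrib_right abs_le_iff)
          finally show ?thesis .
        qed
        show "metric_speed T (W2 d) \<mu> t \<le> ennreal (c t) + ennreal \<epsilon>"
          unfolding metric_speed_def
        proof (rule Limsup_bounded)
          show "\<forall>\<^sub>F s in at t within {0..T}. W2 d (\<mu> s) (\<mu> t) / ennreal \<bar>s - t\<bar> \<le> ennreal (c t) + ennreal \<epsilon>"
            unfolding eventually_at
          proof (intro exI[of _ e] conjI ballI impI)
            fix s assume s: "s \<in> {0..T}" "s \<noteq> t \<and> dist s t < e"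
            then have p: "0 < \<bar>s - t\<bar>" by simp
            have "W2 d (\<mu> s) (\<mu> t) / ennreal \<bar>s - t\<bar> \<le> ennreal ((c t + \<epsilon>) * \<bar>s - t\<bar>) / ennreal \<bar>s - t\<bar>"
              using s by (intro divide_right_mono_ennreal le) (auto simp: dist_real_def)
            also have "\<dots> = ennreal (c t) + ennreal \<epsilon>" using p ct \<epsilon> by (subst divide_ennreal) auto
            finally show "W2 d (\<mu> s) (\<mu> t) / ennreal \<bar>s - t\<bar> \<le> ennreal (c t) + ennreal \<epsilon>" .
          qed (use e in auto)
        qed
      qed
    qed
  qed
qed

end

section \<open>Absolutely continuous curves of bounded density\<close>

text \<open>If the fibre \<open>{x} \<times> K\<close> misses \<open>W\<close>, the tube lemma gives
  a neighbourhood of \<open>x\<close> all of whose fibres miss it.\<close>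

lemma closed_compact_projection:
  fixes W :: "('a::topological_space \<times> 'b::topological_space) set"
  assumes W: "closed W" and K: "compact K" shows "closed {x. \<exists>y\<in>K. (x, y) \<in> W}"
  unfolding closed_def
proof (subst open_subopen, intro ballI)
  fix x assume "x \<in> - {x. \<exists>y\<in>K. (x, y) \<in> W}"
  then have "{x} \<times> K \<subseteq> - W" by auto
  moreover have "open (- W)" using W by (rule open_Compl)
  ultimately obtain U U' where U: "open U" "{x} \<subseteq> U" "K \<subseteq> U'" "U \<times> U' \<subseteq> - W"
    using compact_Times_open_tube[of "{x}" K "- W"] K by (metis compact_sing)
  then have "U \<subseteq> - {x. \<exists>y\<in>K. (x, y) \<in> W}" by blast
  then show "\<exists>T. open T \<and> x \<in> T \<and> T \<subseteq> - {x. \<exists>y\<in>K. (x, y) \<in> W}" using U by blast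
qed

lemma esqrt_less_imp: assumes "esqrt a < ennreal w" shows "0 < w" "a < ennreal (w\<^sup>2)"
proof -
  show w: "0 < w" using assms by (cases "0 < w") (auto simp: ennreal_neg not_less)
  show "a < ennreal (w\<^sup>2)"
  proof (cases a)
    case (real r)
    then have "sqrt r < w" using assms w by (simp add: esqrt_def ennreal_less_iff)
    then have "(sqrt r)\<^sup>2 < w\<^sup>2" using real by (intro power_strict_mono) auto
    then show ?thesis using real by (simp add: ennreal_less_iff)
  next
    case top then show ?thesis using assms by (simp add: esqrt_def)
  qed
qed

lemma ennreal_power2_le_imp_le:
  assumes "a\<^sup>2 \<le> ennreal (b\<^sup>2)" "0 \<le> b" shows "a \<le> ennreal b"
proof (cases a)
  case (real r)
  then have "r\<^sup>2 \<le> b\<^sup>2" using assms by (simp add: ennreal_power)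
  then show ?thesis using real assms(2) by (auto intro!: ennreal_leI power2_le_imp_le)
next
  case top then show ?thesis using assms by (simp add: power2_eq_square top_unique)
qed

context curve
begin

text \<open>Measurable substitutes for \<open>Lip_a\<close> at the scale \<open>1 / Suc n\<close>:
  the pairs have one point at the base point and the other in \<open>S\<close>. The last clause says
  that their upper limit is at most \<open>Lip_a\<close>.\<close>

definition local_slopes :: "('a \<Rightarrow> real) \<Rightarrow> real \<Rightarrow> 'a set \<Rightarrow> (nat \<Rightarrow> 'a \<Rightarrow> real) \<Rightarrow> bool" where
  "local_slopes f Lc S l \<longleftrightarrow> S \<in> sets borel \<and> emeasure m (UNIV - S) = 0 \<and>
    (\<forall>n. l n \<in> borel_measurable m) \<and> (\<forall>n x. 0 \<le> l n x \<and> l n x \<le> Lc) \<and>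
    (\<forall>n x. \<forall>y\<in>S. d x y < ennreal (1 / real (Suc n)) \<longrightarrow> ennreal \<bar>f x - f y\<bar> \<le> ennreal (l n x) * d x y) \<and>
    (\<forall>x K. Lip_a d f x < K \<longrightarrow> (\<forall>\<^sub>F n in sequentially. l n x \<le> K))"

text \<open>The slope is taken only over points of a \<open>\<sigma>\<close>-compact set of full measure, which makes its
  superlevel sets countable unions of projections of closed sets along compact ones.\<close>

lemma local_slopes_exist:
  assumes f: "f \<in> Lip_b d" and Lc: "0 \<le> Lc" "\<And>x y. ennreal \<bar>f x - f y\<bar> \<le> ennreal Lc * d x y"
  shows "\<exists>S l. local_slopes f Lc S l"
proof -
  obtain L :: "nat \<Rightarrow> 'a set" where L: "\<And>n. compact (L n)" "emeasure m (UNIV - (\<Union>n. L n)) = 0"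
    by (rule sigma_compact[of UNIV]) (simp, blast)
  define S where "S = (\<Union>n. L n)"
  define good where "good n x K \<longleftrightarrow> (\<forall>y\<in>S. d x y < ennreal (1 / real (Suc n)) \<longrightarrow> ennreal \<bar>f x - f y\<bar> \<le> ennreal K * d x y)" for n x K
  define l where "l n x = Inf {K. 0 \<le> K \<and> good n x K}" for n x
  have bd: "bdd_below {K. 0 \<le> K \<and> good n x K}" for n x by (rule bdd_belowI[of _ 0]) auto
  have gL: "good n x Lc" for n x using Lc by (simp add: good_def)
  have ne: "{K. 0 \<le> K \<and> good n x K} \<noteq> {}" for n x using gL Lc(1) by blast
  have l0: "0 \<le> l n x" for n x unfolding l_def by (rule cInf_greatest[OF ne]) auto
  have lK: "l n x \<le> K" if "0 \<le> K" "good n x K" for n x K unfolding l_def by (rule cInf_lower[OF _ bd]) (use that in auto)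
  have gl: "good n x (l n x)" for n x
    unfolding good_def
  proof (intro ballI impI)
    fix y assume y: "y \<in> S" "d x y < ennreal (1 / real (Suc n))"
    then obtain r where r: "0 \<le> r" "d x y = ennreal r" by (cases "d x y") auto
    have "\<bar>f x - f y\<bar> \<le> l n x * r"
    proof (rule field_le_epsilon)
      fix e :: real assume e: "0 < e"
      have "l n x < l n x + e / (r + 1)" using e r by simp
      then obtain K where K: "0 \<le> K" "good n x K" "K < l n x + e / (r + 1)"
        using cInf_lessD[OF ne, of n x] unfolding l_def by blast
      have "ennreal \<bar>f x - f y\<bar> \<le> ennreal K * d x y" using K(2) y unfolding good_def by blast
      then have "ennreal \<bar>f x - f y\<bar> \<le> ennreal (K * r)" using K(1) r by (simp add: ennreal_mult)
      then have "\<bar>f x - f y\<bar> \<le> K * r" using K r by (simp add: ennreal_le_iff)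
      also have "\<dots> \<le> (l n x + e / (r + 1)) * r" using K r by (intro mult_right_mono) auto
      also have "\<dots> \<le> l n x * r + e" using e r by (simp add: distrib_right field_simps)
      finally show "\<bar>f x - f y\<bar> \<le> l n x * r + e" .
    qed
    then show "ennreal \<bar>f x - f y\<bar> \<le> ennreal (l n x) * d x y" using r l0 by (simp add: ennreal_mult[symmetric])
  qed
  have gK: "good n x K" if "l n x \<le> K" for n x K
    using gl[of n x] mult_right_mono[OF ennreal_leI[OF that]] unfolding good_def by (meson order_trans zero_le)
  have meas: "l n \<in> borel_measurable m" for n
    unfolding borel_measurable_iff_greater
  proof
    fix a :: real
    show "{x \<in> space m. a < l n x} \<in> sets m"
    proof (cases "a < 0")
      case True
      then have "{x \<in> space m. a < l n x} = space m" using l0 by (auto intro: less_le_trans)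
      then show ?thesis by simp
    next
      case False
      then have a: "0 \<le> a" by simp
      define \<epsilon> where "\<epsilon> = 1 / real (Suc n)"
      have \<epsilon>: "0 < \<epsilon>" by (simp add: \<epsilon>_def)
      \<comment> \<open>The rational \<open>b\<close> will lie slightly above the distance, and
        \<open>1 / Suc k\<close> records a strict excess over slope \<open>a\<close>. This replaces
        the strict condition by countably many closed ones, as \<open>d\<close> is lower
        semicontinuous.\<close>
      define W where "W b k = {z. d (fst z) (snd z) \<le> ennreal b} \<inter> {z. a * b + 1 / real (Suc k) \<le> \<bar>f (fst z) - f (snd z)\<bar>}" for b k
      have W: "closed (W b k)" for b k
      proof -
        have "{z. d (fst z) (snd z) \<le> ennreal b} = - {z. ennreal b < d (fst z) (snd z)}" by auto
        then have "closed {z. d (fst z) (snd z) \<le> ennreal b}" using open_less_ext_metric[OF top, of "ennreal b"] by (simp add: closed_Compl)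
        moreover have "closed {z. a * b + 1 / real (Suc k) \<le> \<bar>f (fst z) - f (snd z)\<bar>}"
          by (intro closed_Collect_le continuous_intros continuous_on_compose2[OF Lip_b_continuous[OF f]]) auto
        ultimately show ?thesis unfolding W_def by (rule closed_Int)
      qed
      define P where "P j b k = {x. \<exists>y\<in>L j. (x, y) \<in> W b k}" for j b k
      have P: "P j b k \<in> sets m" for j b k
        unfolding P_def sets_m by (rule borel_closed[OF closed_compact_projection[OF W L(1)]])
      have "{x \<in> space m. a < l n x} = (\<Union>j. \<Union>b\<in>{b\<in>\<rat>. 0 \<le> b \<and> b < \<epsilon>}. \<Union>k. P j b k)"
      proof (intro set_eqI iffI)
        fix x assume "x \<in> {x \<in> space m. a < l n x}"
        then have "\<not> good n x a" using lK[OF a] by (auto simp: not_le[symmetric])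
        then obtain y where y: "y \<in> S" "d x y < ennreal \<epsilon>" "\<not> ennreal \<bar>f x - f y\<bar> \<le> ennreal a * d x y"
          by (auto simp: good_def \<epsilon>_def)
        then obtain r where r: "0 \<le> r" "d x y = ennreal r" by (cases "d x y") auto
        have r1: "r < \<epsilon>" using y(2) r by (simp add: ennreal_less_iff)
        define q where "q = \<bar>f x - f y\<bar>"
        have "\<not> ennreal q \<le> ennreal (a * r)" using y(3) r a by (simp add: q_def ennreal_mult)
        then have q: "a * r < q" using ennreal_leI by (meson not_le)
        \<comment> \<open>Leaves room for a rational \<open>b\<close> above \<open>r\<close> that is
          so close to it that \<open>a * b < q\<close> still holds.\<close>
        have "r < min \<epsilon> (r + (q - a * r) / (a + 1))" using r1 q a by simp
        then obtain b where b: "b \<in> \<rat>" "r < b" "b < min \<epsilon> (r + (q - a * r) / (a + 1))" using Rats_dense_in_real by blast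
        have "(b - r) * (a + 1) < q - a * r" using b a by (simp add: field_simps)
        moreover have "a * (b - r) \<le> (b - r) * (a + 1)" using b a by (simp add: algebra_simps)
        ultimately have "0 < q - a * b" by (simp add: right_diff_distrib)
        then obtain k where k: "1 / real (Suc k) < q - a * b" using nat_approx_posE by blast
        obtain j where j: "y \<in> L j" using y by (auto simp: S_def)
        have "(x, y) \<in> W b k" using r b k by (auto simp: W_def q_def intro!: ennreal_leI)
        then have "x \<in> P j b k" using j by (auto simp: P_def)
        moreover have "b \<in> {b\<in>\<rat>. 0 \<le> b \<and> b < \<epsilon>}" using b r by auto
        ultimately show "x \<in> (\<Union>j. \<Union>b\<in>{b\<in>\<rat>. 0 \<le> b \<and> b < \<epsilon>}. \<Union>k. P j b k)" by blast
      next
        fix x assume "x \<in> (\<Union>j. \<Union>b\<in>{b\<in>\<rat>. 0 \<le> b \<and> b < \<epsilon>}. \<Union>k. P j b k)"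
        then obtain j b k y where b: "0 \<le> b" "b < \<epsilon>" and y: "y \<in> L j" "(x, y) \<in> W b k" by (auto simp: P_def)
        have yS: "y \<in> S" using y by (auto simp: S_def)
        have db: "d x y \<le> ennreal b" and q: "a * b + 1 / real (Suc k) \<le> \<bar>f x - f y\<bar>" using y by (auto simp: W_def)
        have d1: "d x y < ennreal (1 / real (Suc n))" using db b by (auto simp: \<epsilon>_def ennreal_less_iff intro: le_less_trans)
        have "\<not> good n x a"
        proof
          assume "good n x a"
          then have "ennreal \<bar>f x - f y\<bar> \<le> ennreal a * d x y" using yS d1 unfolding good_def by blast
          also have "\<dots> \<le> ennreal a * ennreal b" using db by (intro mult_left_mono) auto
          also have "\<dots> = ennreal (a * b)" using a b by (simp add: ennreal_mult)
          finally have "\<bar>f x - f y\<bar> \<le> a * b" using a b by (simp add: ennreal_le_iff)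
          moreover have "0 < 1 / real (Suc k)" by simp
          ultimately show False using q by linarith
        qed
        then have "a < l n x" using gK by (meson not_le)
        then show "x \<in> {x \<in> space m. a < l n x}" by (simp add: space_m)
      qed
      moreover have "countable {b\<in>\<rat>. 0 \<le> b \<and> b < \<epsilon>}" by (rule countable_subset[OF _ countable_rat]) auto
      ultimately show ?thesis using P by (simp only:) (intro sets.countable_UN'' sets.countable_UN' | simp)+
    qed
  qed
  have lim: "\<forall>\<^sub>F n in sequentially. l n x \<le> K" if K: "Lip_a d f x < K" for x K
  proof -
    have "0 < K - Lip_a d f x" using K by simp
    then obtain r where r: "0 < r" "\<And>y z. d y x < ennreal r \<Longrightarrow> d z x < ennreal r \<Longrightarrow>
        ennreal \<bar>f y - f z\<bar> \<le> ennreal (Lip_a d f x + (K - Lip_a d f x)) * d y z"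
      by (rule Lip_a_approx[OF extm f]) blast
    obtain N where N: "1 / real (Suc N) < r" using r(1) nat_approx_posE by blast
    have dxx: "d x x = 0" and sym: "d x y = d y x" for y using extm by (auto simp: extended_metric_def semidistance_def)
    have "l n x \<le> K" if n: "N \<le> n" for n
    proof (rule lK)
      show "0 \<le> K" using K Lip_a_nonneg[of d f x] by linarith
      show "good n x K" unfolding good_def
      proof (intro ballI impI)
        fix y assume "d x y < ennreal (1 / real (Suc n))"
        also have "ennreal (1 / real (Suc n)) \<le> ennreal r"
        proof (rule ennreal_leI)
          have "1 / real (Suc n) \<le> 1 / real (Suc N)" using n by (simp add: field_simps)
          then show "1 / real (Suc n) \<le> r" using N by linarith
        qed
        finally have "d y x < ennreal r" by (simp add: sym)
        then show "ennreal \<bar>f x - f y\<bar> \<le> ennreal K * d x y" using r(2)[of x y] r(1) by (simp add: dxx)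
      qed
    qed
    then show ?thesis unfolding eventually_sequentially by blast
  qed
  have "S \<in> sets borel" unfolding S_def using L(1) by (auto simp: borel_compact)
  moreover have "emeasure m (UNIV - S) = 0" using L(2) by (simp add: S_def)
  ultimately have "local_slopes f Lc S l"
    unfolding local_slopes_def using meas l0 lK[OF Lc(1) gL] gl lim unfolding good_def by blast
  then show ?thesis by blast
qed

text \<open>The marginals turn the difference of the two integrals into one integral over the plan.
  Cauchy-Schwarz handles the linear term, with the slope read at the second point and hence
  integrated against \<open>\<mu> t\<close>; the quadratic term integrates to the cost.\<close>

lemma plan_estimate:
  assumes \<pi>: "\<pi> \<in> plans (\<mu> s) (\<mu> t)" and s: "0 \<le> s" "s \<le> T" and t: "0 \<le> t" "t \<le> T"
    and w: "0 \<le> w" "(\<integral>\<^sup>+ (x, y). (d x y)\<^sup>2 \<partial>\<pi>) \<le> ennreal (w\<^sup>2)" and f: "f \<in> Lip_b d"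
    and l: "l \<in> borel_measurable m" "\<And>x. 0 \<le> l x" "\<And>x. l x \<le> B" and k: "0 \<le> k"
    and S: "S \<in> sets borel" "emeasure m (UNIV - S) = 0"
    and le: "\<And>x y. x \<in> S \<Longrightarrow> y \<in> S \<Longrightarrow> ennreal \<bar>f x - f y\<bar> \<le> ennreal (l y) * d x y + ennreal k * (d x y)\<^sup>2"
  shows "\<bar>\<Phi> f t - \<Phi> f s\<bar> \<le> sqrt (\<Phi> (\<lambda>x. (l x)\<^sup>2) t) * w + k * w\<^sup>2"
proof -
  have \<pi>r: "\<pi> \<in> radon_prob" and mf: "distr \<pi> borel fst = \<mu> s" and ms: "distr \<pi> borel snd = \<mu> t"
    using \<pi> by (auto simp: plans_def)
  interpret \<pi>: prob_space \<pi> by (rule radon_prob_prob_space[OF \<pi>r])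
  note sp = radon_prob_sets[OF \<pi>r]
  have bm: "X \<in> borel_measurable \<pi>" if "X \<in> borel_measurable borel" for X :: "'a \<times> 'a \<Rightarrow> 'c::topological_space"
    using that by (simp add: measurable_cong_sets[OF sp refl])
  have fm: "fst \<in> \<pi> \<rightarrow>\<^sub>M borel" "snd \<in> \<pi> \<rightarrow>\<^sub>M borel"
    by (auto intro!: bm borel_measurable_continuous_onI continuous_intros)
  have fb: "f \<in> borel_measurable borel" by (rule Lip_b_borel[OF f])
  have lb: "l \<in> borel_measurable borel" using l(1) by (simp add: measurable_cong_sets[OF sets_m refl])
  have dm: "(\<lambda>z. d (fst z) (snd z)) \<in> borel_measurable \<pi>" by (rule bm[OF borel_measurable_ext_metric[OF top]])
  have lm: "(\<lambda>z. ennreal (l (snd z))) \<in> borel_measurable \<pi>" using measurable_compose[OF fm(2) lb] by measurable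
  obtain Bf where Bf: "\<And>x. \<bar>f x\<bar> \<le> Bf" using Lip_b_bounded[OF f] by (auto simp: bounded_range_real)
  have i: "integrable \<pi> (\<lambda>z. f (fst z))" "integrable \<pi> (\<lambda>z. f (snd z))"
    using measurable_compose[OF fm(1) fb] measurable_compose[OF fm(2) fb] Bf
    by (auto intro!: \<pi>.integrable_const_bound[of _ Bf])
  have inS: "AE z in \<pi>. fst z \<in> S" "AE z in \<pi>. snd z \<in> S"
  proof -
    have N: "UNIV - S \<in> null_sets (\<mu> s)" "UNIV - S \<in> null_sets (\<mu> t)"
      using emeasure_mu_null[OF s] emeasure_mu_null[OF t] S by (auto simp: null_sets_def sets_mu)
    have "AE x in distr \<pi> borel fst. x \<in> S" unfolding mf using AE_not_in[OF N(1)] by (auto elim!: eventually_mono)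
    then show "AE z in \<pi>. fst z \<in> S" using S by (subst (asm) AE_distr_iff[OF fm(1)]) auto
    have "AE x in distr \<pi> borel snd. x \<in> S" unfolding ms using AE_not_in[OF N(2)] by (auto elim!: eventually_mono)
    then show "AE z in \<pi>. snd z \<in> S" using S by (subst (asm) AE_distr_iff[OF fm(2)]) auto
  qed
  have "\<Phi> f s = (LINT z|\<pi>. f (fst z))" "\<Phi> f t = (LINT z|\<pi>. f (snd z))"
    using integral_distr[OF fm(1) fb] integral_distr[OF fm(2) fb]
    unfolding mf ms integral_mu[OF s Lip_b_m[OF f]] integral_mu[OF t Lip_b_m[OF f]] by auto
  then have "\<Phi> f t - \<Phi> f s = (LINT z|\<pi>. f (snd z) - f (fst z))" using i by simp
  then have "ennreal \<bar>\<Phi> f t - \<Phi> f s\<bar> \<le> (\<integral>\<^sup>+ z. ennreal \<bar>f (snd z) - f (fst z)\<bar> \<partial>\<pi>)"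
    using integral_norm_bound_ennreal[of \<pi> "\<lambda>z. f (snd z) - f (fst z)"] i by simp
  also have "\<dots> \<le> (\<integral>\<^sup>+ z. ennreal (l (snd z)) * d (fst z) (snd z) + ennreal k * (d (fst z) (snd z))\<^sup>2 \<partial>\<pi>)"
    using inS by (intro nn_integral_mono_AE, eventually_elim) (use le in \<open>auto simp: abs_minus_commute\<close>)
  also have "\<dots> = (\<integral>\<^sup>+ z. ennreal (l (snd z)) * d (fst z) (snd z) \<partial>\<pi>) + ennreal k * (\<integral>\<^sup>+ z. (d (fst z) (snd z))\<^sup>2 \<partial>\<pi>)"
    using dm lm by (simp add: nn_integral_add nn_integral_cmult)
  also have "\<dots> \<le> ennreal (sqrt (\<Phi> (\<lambda>x. (l x)\<^sup>2) t) * w) + ennreal (k * w\<^sup>2)"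
  proof (rule add_mono)
    have d2: "(\<integral>\<^sup>+ z. (d (fst z) (snd z))\<^sup>2 \<partial>\<pi>) \<le> ennreal (w\<^sup>2)" using w(2) by (simp only: case_prod_beta')
    then have "ennreal k * (\<integral>\<^sup>+ z. (d (fst z) (snd z))\<^sup>2 \<partial>\<pi>) \<le> ennreal k * ennreal (w\<^sup>2)" by (intro mult_left_mono) auto
    then show "ennreal k * (\<integral>\<^sup>+ z. (d (fst z) (snd z))\<^sup>2 \<partial>\<pi>) \<le> ennreal (k * w\<^sup>2)" using k by (simp add: ennreal_mult)
    have l2: "(\<lambda>x. (l x)\<^sup>2) \<in> borel_measurable m" "(\<lambda>x. (l x)\<^sup>2) \<in> borel_measurable borel" using l(1) lb by measurable
    have Pn: "0 \<le> \<Phi> (\<lambda>x. (l x)\<^sup>2) t" unfolding integral_mu[OF t l2(1), symmetric] by simp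
    have "(\<integral>\<^sup>+ z. (ennreal (l (snd z)))\<^sup>2 \<partial>\<pi>) = (\<integral>\<^sup>+ z. ennreal ((l (snd z))\<^sup>2) \<partial>\<pi>)" using l(2) by (simp add: ennreal_power)
    also have "\<dots> = (\<integral>\<^sup>+ x. ennreal ((l x)\<^sup>2) \<partial>\<mu> t)" unfolding ms[symmetric] using l2(2) by (subst nn_integral_distr[OF fm(2)]) auto
    also have "\<dots> = ennreal (LINT x|\<mu> t. (l x)\<^sup>2)"
    proof (rule nn_integral_eq_integral)
      interpret M: prob_space "\<mu> t" by (rule mu_prob[OF t])
      show "integrable (\<mu> t) (\<lambda>x. (l x)\<^sup>2)"
      proof (rule M.integrable_const_bound[of _ "B\<^sup>2"])
        show "AE x in \<mu> t. norm ((l x)\<^sup>2) \<le> B\<^sup>2" using l(2,3) by (auto intro!: power_mono)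
        show "(\<lambda>x. (l x)\<^sup>2) \<in> borel_measurable (\<mu> t)" using l2(2) by (simp add: measurable_cong_sets[OF sets_mu refl])
      qed
    qed auto
    finally have l2i: "(\<integral>\<^sup>+ z. (ennreal (l (snd z)))\<^sup>2 \<partial>\<pi>) = ennreal (\<Phi> (\<lambda>x. (l x)\<^sup>2) t)" by (simp only: integral_mu[OF t l2(1)])
    have "(\<integral>\<^sup>+ z. ennreal (l (snd z)) * d (fst z) (snd z) \<partial>\<pi>)\<^sup>2
        \<le> (\<integral>\<^sup>+ z. (ennreal (l (snd z)))\<^sup>2 \<partial>\<pi>) * (\<integral>\<^sup>+ z. (d (fst z) (snd z))\<^sup>2 \<partial>\<pi>)"
      by (rule Cauchy_Schwarz_nn_integral[OF lm dm])
    also have "\<dots> \<le> ennreal (\<Phi> (\<lambda>x. (l x)\<^sup>2) t) * ennreal (w\<^sup>2)" unfolding l2i using d2 by (intro mult_left_mono) auto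
    also have "\<dots> = ennreal ((sqrt (\<Phi> (\<lambda>x. (l x)\<^sup>2) t) * w)\<^sup>2)" using Pn by (simp add: ennreal_mult power_mult_distrib)
    finally show "(\<integral>\<^sup>+ z. ennreal (l (snd z)) * d (fst z) (snd z) \<partial>\<pi>) \<le> ennreal (sqrt (\<Phi> (\<lambda>x. (l x)\<^sup>2) t) * w)"
      by (rule ennreal_power2_le_imp_le) (use Pn w in simp)
  qed
  also have "\<dots> = ennreal (sqrt (\<Phi> (\<lambda>x. (l x)\<^sup>2) t) * w + k * w\<^sup>2)"
  proof (rule ennreal_plus[symmetric])
    have l2: "(\<lambda>x. (l x)\<^sup>2) \<in> borel_measurable m" using l(1) by measurable
    have "0 \<le> \<Phi> (\<lambda>x. (l x)\<^sup>2) t" unfolding integral_mu[OF t l2, symmetric] by simp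
    then show "0 \<le> sqrt (\<Phi> (\<lambda>x. (l x)\<^sup>2) t) * w" using w by simp
  qed (use k in simp)
  finally have *: "ennreal \<bar>\<Phi> f t - \<Phi> f s\<bar> \<le> ennreal (sqrt (\<Phi> (\<lambda>x. (l x)\<^sup>2) t) * w + k * w\<^sup>2)" .
  have l2: "(\<lambda>x. (l x)\<^sup>2) \<in> borel_measurable m" using l(1) by measurable
  have "0 \<le> \<Phi> (\<lambda>x. (l x)\<^sup>2) t" unfolding integral_mu[OF t l2, symmetric] by simp
  then have "0 \<le> sqrt (\<Phi> (\<lambda>x. (l x)\<^sup>2) t) * w + k * w\<^sup>2" using w k by simp
  with * show ?thesis by (simp add: ennreal_le_iff)
qed

text \<open>A strict bound on \<open>W2\<close> lets a plan of cost below \<open>w\<^sup>2\<close>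
  be selected from the infimum.\<close>

lemma W2_estimate:
  assumes W: "W2 d (\<mu> s) (\<mu> t) < ennreal w" and s: "0 \<le> s" "s \<le> T" and t: "0 \<le> t" "t \<le> T"
    and f: "f \<in> Lip_b d" and l: "l \<in> borel_measurable m" "\<And>x. 0 \<le> l x" "\<And>x. l x \<le> B" and k: "0 \<le> k"
    and S: "S \<in> sets borel" "emeasure m (UNIV - S) = 0"
    and le: "\<And>x y. x \<in> S \<Longrightarrow> y \<in> S \<Longrightarrow> ennreal \<bar>f x - f y\<bar> \<le> ennreal (l y) * d x y + ennreal k * (d x y)\<^sup>2"
  shows "\<bar>\<Phi> f t - \<Phi> f s\<bar> \<le> sqrt (\<Phi> (\<lambda>x. (l x)\<^sup>2) t) * w + k * w\<^sup>2"
proof -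
  note w = esqrt_less_imp[OF W[unfolded W2_def]]
  then obtain \<pi> where "\<pi> \<in> plans (\<mu> s) (\<mu> t)" "(\<integral>\<^sup>+ (x, y). (d x y)\<^sup>2 \<partial>\<pi>) < ennreal (w\<^sup>2)" by (auto simp: INF_less_iff)
  then show ?thesis using w(1) by (intro plan_estimate[OF _ s t _ _ f l k S le]) auto
qed

lemma W2_Lipschitz:
  assumes W: "W2 d (\<mu> s) (\<mu> t) \<le> ennreal w" and w: "0 \<le> w" and s: "0 \<le> s" "s \<le> T" and t: "0 \<le> t" "t \<le> T"
    and f: "f \<in> Lip_b d" and Lc: "0 \<le> Lc" "\<And>x y. ennreal \<bar>f x - f y\<bar> \<le> ennreal Lc * d x y"
  shows "\<bar>\<Phi> f t - \<Phi> f s\<bar> \<le> Lc * w"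
proof (rule field_le_epsilon)
  fix e :: real assume e: "0 < e"
  define w' where "w' = w + e / (Lc + 1)"
  have "w < w'" using e Lc by (simp add: w'_def)
  then have W': "W2 d (\<mu> s) (\<mu> t) < ennreal w'" using w by (intro le_less_trans[OF W]) (simp add: ennreal_less_iff)
  have "\<bar>\<Phi> f t - \<Phi> f s\<bar> \<le> sqrt (\<Phi> (\<lambda>x. Lc\<^sup>2) t) * w' + 0 * w'\<^sup>2"
    by (rule W2_estimate[OF W' s t f, of "\<lambda>_. Lc" Lc 0 UNIV]) (use Lc in auto)
  also have "\<dots> = Lc * w'" using Lc by (simp add: Phi_const[OF t])
  also have "\<dots> \<le> Lc * w + e" using e Lc by (simp add: w'_def field_simps)
  finally show "\<bar>\<Phi> f t - \<Phi> f s\<bar> \<le> Lc * w + e" .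
qed

text \<open>Only times before \<open>t\<close> are compared: \<open>W2_g\<close> speaks of
  \<open>W2 d (\<mu> s) (\<mu> t)\<close> for \<open>s \<le> t\<close>, and the fixed measure
  \<open>\<mu> t\<close> is then the second marginal, where the slope is read.\<close>

definition left_speed :: "real \<Rightarrow> real \<Rightarrow> bool" where
  "left_speed t v \<longleftrightarrow> (\<forall>\<epsilon>>0. \<exists>\<delta>>0. \<forall>s. 0 \<le> s \<longrightarrow> s < t \<longrightarrow> t - s < \<delta> \<longrightarrow> W2 d (\<mu> s) (\<mu> t) \<le> ennreal ((v + \<epsilon>) * (t - s)))"

definition As :: "('a \<Rightarrow> real) \<Rightarrow> real \<Rightarrow> real" where "As f t = sqrt (\<Phi> (\<lambda>x. (LA f x)\<^sup>2) t)"

text \<open>At fixed \<open>n\<close>, the slope \<open>l n\<close> bounds increments over short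
  distances, and a multiple of the squared distance bounds the others; the latter contribute a
  higher order in \<open>t - s\<close>. So \<open>s\<close> tends to \<open>t\<close> with
  \<open>n\<close> fixed, and only afterwards \<open>n\<close> grows and the slopes come down to the
  envelope.\<close>

lemma left_speed_density:
  assumes f: "f \<in> Lip_b d" and t: "0 < t" "t \<le> T" and v: "0 \<le> v" "left_speed t v"
    and \<phi>: "\<And>\<epsilon>. 0 < \<epsilon> \<Longrightarrow> \<exists>e>0. \<forall>s. 0 \<le> s \<longrightarrow> s < t \<longrightarrow> t - s < e \<longrightarrow> \<bar>\<Phi> f t - \<Phi> f s - p * (t - s)\<bar> \<le> \<epsilon> * (t - s)"
  shows "\<bar>p\<bar> \<le> v * As f t"
proof -
  have t0: "0 \<le> t" "t \<le> T" using t by auto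
  obtain Lc where Lc: "0 \<le> Lc" "\<And>x y. ennreal \<bar>f x - f y\<bar> \<le> ennreal Lc * d x y" by (rule Lip_bE[OF f]) blast
  obtain S l where sl: "local_slopes f Lc S l" using local_slopes_exist[OF f Lc] by blast
  have S: "S \<in> sets borel" "emeasure m (UNIV - S) = 0" and lm: "\<And>n. l n \<in> borel_measurable m"
    and l0: "\<And>n x. 0 \<le> l n x" and lL: "\<And>n x. l n x \<le> Lc"
    and ld: "\<And>n x y. y \<in> S \<Longrightarrow> d x y < ennreal (1 / real (Suc n)) \<Longrightarrow> ennreal \<bar>f x - f y\<bar> \<le> ennreal (l n x) * d x y"
    and lim: "\<And>x K. Lip_a d f x < K \<Longrightarrow> \<forall>\<^sub>F n in sequentially. l n x \<le> K"
    using sl unfolding local_slopes_def by blast+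
  have sym: "d x y = d y x" for x y using extm by (auto simp: extended_metric_def semidistance_def)
  define a where "a n = sqrt (\<Phi> (\<lambda>x. (l n x)\<^sup>2) t)" for n
  have an: "0 \<le> a n" for n
    unfolding a_def \<Phi>_def using rho_nonneg[OF t0] by (intro real_sqrt_ge_zero Bochner_Integration.integral_nonneg_AE) (auto elim!: eventually_mono)
  have step: "\<bar>p\<bar> \<le> v * a n" for n
  proof (rule field_le_epsilon)
    fix e' :: real assume e': "0 < e'"
    \<comment> \<open>Beyond distance \<open>1 / Suc n\<close> the factor
      \<open>Suc n * d x y\<close> is at least 1, so the Lipschitz bound turns into a quadratic
      one.\<close>
    define k where "k = Lc * real (Suc n)"
    have k: "0 \<le> k" using Lc by (simp add: k_def)
    have le: "ennreal \<bar>f x - f y\<bar> \<le> ennreal (l n y) * d x y + ennreal k * (d x y)\<^sup>2" if "x \<in> S" "y \<in> S" for x y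
    proof (cases "d x y < ennreal (1 / real (Suc n))")
      case True
      then have "ennreal \<bar>f x - f y\<bar> \<le> ennreal (l n y) * d x y" using ld[OF that(1), of y n] by (simp add: sym abs_minus_commute)
      then show ?thesis by (simp add: add_increasing2)
    next
      case False
      have "ennreal 1 = ennreal (real (Suc n)) * ennreal (1 / real (Suc n))" by (subst ennreal_mult[symmetric]) auto
      also have "\<dots> \<le> ennreal (real (Suc n)) * d x y" using False by (intro mult_left_mono) auto
      finally have 1: "1 \<le> ennreal (real (Suc n)) * d x y" by simp
      have "ennreal \<bar>f x - f y\<bar> \<le> ennreal Lc * d x y * 1" using Lc(2)[of x y] by simp
      also have "\<dots> \<le> ennreal Lc * d x y * (ennreal (real (Suc n)) * d x y)" using 1 by (intro mult_left_mono) auto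
      also have "\<dots> = ennreal k * (d x y)\<^sup>2" unfolding k_def using Lc by (subst ennreal_mult) (auto simp: power2_eq_square mult_ac)
      finally show ?thesis by (simp add: add_increasing)
    qed
    \<comment> \<open>Two errors \<open>\<epsilon>\<close>, from differentiation and from the
      quadratic term, and an error \<open>2 * \<epsilon>\<close> in the speed, multiplied by
      \<open>a n\<close>.\<close>
    define \<epsilon> where "\<epsilon> = e' / (2 + 2 * a n)"
    have \<epsilon>: "0 < \<epsilon>" using e' an[of n] by (simp add: \<epsilon>_def add_pos_nonneg)
    obtain \<delta> where \<delta>: "0 < \<delta>" "\<And>s. 0 \<le> s \<Longrightarrow> s < t \<Longrightarrow> t - s < \<delta> \<Longrightarrow> W2 d (\<mu> s) (\<mu> t) \<le> ennreal ((v + \<epsilon>) * (t - s))"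
      using v(2) \<epsilon> unfolding left_speed_def by blast
    obtain e where e: "0 < e" "\<And>s. 0 \<le> s \<Longrightarrow> s < t \<Longrightarrow> t - s < e \<Longrightarrow> \<bar>\<Phi> f t - \<Phi> f s - p * (t - s)\<bar> \<le> \<epsilon> * (t - s)"
      using \<phi>[OF \<epsilon>] by blast
    define K where "K = k * (v + 2 * \<epsilon>)\<^sup>2"
    have K: "0 \<le> K" using k by (simp add: K_def)
    define q where "q = \<epsilon> / (1 + K)"
    have q: "0 < q" using \<epsilon> K by (simp add: q_def)
    define \<eta> where "\<eta> = min (min (e / 2) (\<delta> / 2)) (min t q)"
    have \<eta>: "0 < \<eta>" "\<eta> < e" "\<eta> < \<delta>" "\<eta> \<le> t" "\<eta> \<le> \<epsilon> / (1 + K)"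
      using e(1) \<delta>(1) t q unfolding q_def[symmetric] by (auto simp: \<eta>_def)
    define s where "s = t - \<eta>"
    have s: "0 \<le> s" "s < t" "t - s = \<eta>" "s \<le> T" using \<eta> t by (auto simp: s_def)
    \<comment> \<open>\<open>2 * \<epsilon>\<close> exceeds the \<open>\<epsilon>\<close> in the
      bound on \<open>W2\<close>, which gives the strict inequality that \<open>W2_estimate\<close>
      asks for.\<close>
    define w where "w = (v + 2 * \<epsilon>) * \<eta>"
    have "W2 d (\<mu> s) (\<mu> t) \<le> ennreal ((v + \<epsilon>) * \<eta>)" using \<delta>(2)[OF s(1,2)] \<eta> by (simp add: s(3))
    also have "\<dots> < ennreal w" unfolding w_def using \<epsilon> \<eta> v(1) by (intro ennreal_lessI) auto
    finally have "\<bar>\<Phi> f t - \<Phi> f s\<bar> \<le> a n * w + k * w\<^sup>2"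
      unfolding a_def by (rule W2_estimate[OF _ s(1,4) t0 f lm l0 lL k S le])
    moreover have "\<bar>\<Phi> f t - \<Phi> f s - p * \<eta>\<bar> \<le> \<epsilon> * \<eta>" using e(2)[OF s(1,2)] \<eta> by (simp add: s(3))
    moreover have "\<bar>p\<bar> * \<eta> = \<bar>p * \<eta>\<bar>" using \<eta> by (simp add: abs_mult)
    ultimately have "\<bar>p\<bar> * \<eta> \<le> \<epsilon> * \<eta> + (a n * w + k * w\<^sup>2)" by linarith
    also have "\<dots> = (\<epsilon> + a n * (v + 2 * \<epsilon>) + K * \<eta>) * \<eta>"
      by (simp add: w_def K_def power2_eq_square algebra_simps)
    finally have "\<bar>p\<bar> \<le> \<epsilon> + a n * (v + 2 * \<epsilon>) + K * \<eta>" using \<eta>(1) by simp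
    also have "K * \<eta> \<le> \<epsilon>"
    proof -
      have "K * \<eta> \<le> (1 + K) * (\<epsilon> / (1 + K))" using \<eta> K by (intro mult_mono) auto
      then show ?thesis using K by simp
    qed
    also have "\<epsilon> + a n * (v + 2 * \<epsilon>) + \<epsilon> = v * a n + \<epsilon> * (2 + 2 * a n)" by (simp add: algebra_simps)
    also have "\<epsilon> * (2 + 2 * a n) = e'" using an[of n] by (simp add: \<epsilon>_def)
    finally show "\<bar>p\<bar> \<le> v * a n + e'" by simp
  qed
  \<comment> \<open>\<open>l n x\<close> may stay below \<open>LA f x\<close> and need not converge;
    the maximum converges to \<open>LA f x\<close> wherever the envelope dominates
    \<open>Lip_a\<close>.\<close>
  define M where "M n x = max (l n x) (LA f x)" for n x
  have Mm: "M n \<in> borel_measurable m" for n unfolding M_def using lm LA_measurable[OF f] by measurable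
  have LAL: "AE x in m. 0 \<le> LA f x \<and> LA f x \<le> Lc" using LA_le_const[OF f Lc] LA_nonneg[OF f] by eventually_elim simp
  have Mb: "AE x in m. 0 \<le> M n x \<and> M n x \<le> Lc" for n using LAL by eventually_elim (use lL[of n] l0[of n] in \<open>auto simp: M_def\<close>)
  have "(\<lambda>n. \<Phi> (\<lambda>x. (M n x)\<^sup>2) t) \<longlonglongrightarrow> \<Phi> (\<lambda>x. (LA f x)\<^sup>2) t"
    unfolding \<Phi>_def
  proof (rule integral_dominated_convergence)
    show "integrable m (\<lambda>x. Lc\<^sup>2 * \<bar>\<rho> t x\<bar>)" using rho_integrable[OF t0] by simp
    show "(\<lambda>x. (LA f x)\<^sup>2 * \<rho> t x) \<in> borel_measurable m" "(\<lambda>x. (M n x)\<^sup>2 * \<rho> t x) \<in> borel_measurable m" for n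
      by (intro borel_measurable_times borel_measurable_power LA_measurable f Mm rho_measurable t0)+
    show "AE x in m. norm ((M n x)\<^sup>2 * \<rho> t x) \<le> Lc\<^sup>2 * \<bar>\<rho> t x\<bar>" for n
      using Mb[of n] by eventually_elim (auto simp: abs_mult intro!: mult_right_mono power_mono)
    show "AE x in m. (\<lambda>n. (M n x)\<^sup>2 * \<rho> t x) \<longlonglongrightarrow> (LA f x)\<^sup>2 * \<rho> t x"
      using LA_ge[OF f]
    proof eventually_elim
      case (elim x)
      have "(\<lambda>n. M n x) \<longlonglongrightarrow> LA f x"
      proof (rule order_tendstoI)
        show "\<forall>\<^sub>F n in sequentially. b < M n x" if "b < LA f x" for b using that by (auto simp: M_def less_max_iff_disj)
        fix b assume b: "LA f x < b"
        define K where "K = (LA f x + b) / 2"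
        have K: "LA f x < K" "K < b" using b by (auto simp: K_def)
        have "Lip_a d f x < K" using elim K by simp
        from lim[OF this] show "\<forall>\<^sub>F n in sequentially. M n x < b" by eventually_elim (use b K in \<open>auto simp: M_def\<close>)
      qed
      then show ?case by (intro tendsto_intros)
    qed
  qed
  then have L: "(\<lambda>n. v * sqrt (\<Phi> (\<lambda>x. (M n x)\<^sup>2) t)) \<longlonglongrightarrow> v * As f t" unfolding As_def by (intro tendsto_intros)
  have "\<bar>p\<bar> \<le> v * sqrt (\<Phi> (\<lambda>x. (M n x)\<^sup>2) t)" for n
  proof -
    have "\<Phi> (\<lambda>x. (l n x)\<^sup>2) t \<le> \<Phi> (\<lambda>x. (M n x)\<^sup>2) t"
    proof (rule Phi_mono[OF t0 integrable_rho[OF t0, of _ "Lc\<^sup>2"] integrable_rho[OF t0, of _ "Lc\<^sup>2"]])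
      show "(\<lambda>x. (l n x)\<^sup>2) \<in> borel_measurable m" "(\<lambda>x. (M n x)\<^sup>2) \<in> borel_measurable m" using lm Mm by (auto intro: borel_measurable_power)
      show "AE x in m. \<bar>(l n x)\<^sup>2\<bar> \<le> Lc\<^sup>2" using l0 lL by (auto intro!: power_mono)
      show "AE x in m. \<bar>(M n x)\<^sup>2\<bar> \<le> Lc\<^sup>2" using Mb[of n] by eventually_elim (auto intro!: power_mono)
      show "AE x in m. (l n x)\<^sup>2 \<le> (M n x)\<^sup>2" using l0 by (auto simp: M_def intro!: power_mono)
    qed
    then have "v * a n \<le> v * sqrt (\<Phi> (\<lambda>x. (M n x)\<^sup>2) t)" unfolding a_def using v(1) by (intro mult_left_mono real_sqrt_le_mono)
    with step[of n] show ?thesis by simp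
  qed
  then show ?thesis by (intro LIMSEQ_le_const[OF L]) blast
qed

end

section \<open>Time densities against the metric speed\<close>

locale bounded_AC2 = curve +
  fixes g :: "real \<Rightarrow> real" and C :: real
  assumes g: "g \<in> L2 (leb_Ioo T)"
    and W2_g: "\<And>s t. 0 \<le> s \<Longrightarrow> s \<le> t \<Longrightarrow> t \<le> T \<Longrightarrow> W2 d (\<mu> s) (\<mu> t) \<le> ennreal (LBINT r=s..t. g r)"
    and C: "0 \<le> C" and rho_C: "\<And>t. 0 \<le> t \<Longrightarrow> t \<le> T \<Longrightarrow> AE x in m. \<rho> t x \<le> C"
begin

abbreviation hg :: "real \<Rightarrow> real" where "hg r \<equiv> \<bar>ext0 T g r\<bar>"

lemma hg: "integrable lborel hg" "0 \<le> hg r" "r \<notin> {0<..<T} \<Longrightarrow> hg r = 0"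
  using ext0_integrable[OF g] by (simp_all add: integrable_abs) (simp add: ext0_def)

lemma hg_nonneg_LBINT: "0 \<le> (LBINT r:{s..t}. hg r)"
  unfolding set_lebesgue_integral_def by (intro Bochner_Integration.integral_nonneg) auto

lemma W2_le_hg:
  assumes "0 \<le> s" "s \<le> t" "t \<le> T" shows "W2 d (\<mu> s) (\<mu> t) \<le> ennreal (LBINT r:{s..t}. hg r)"
proof -
  note i = ext0_integrable[OF g]
  have "(LBINT r=s..t. g r) = (LBINT r:{s..t}. ext0 T g r)"
    by (simp only: interval_integral_ext0_1[OF assms] LBINT_Ioo_eq_Icc[OF i])
  also have "\<dots> \<le> (LBINT r:{s..t}. hg r)"
    using abs_LBINT_Icc_le[OF i hg(1), of s t] by (simp add: abs_le_iff)
  finally show ?thesis using W2_g[OF assms] by (meson ennreal_leI order_trans)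
qed

lemma Phi_hg:
  assumes f: "f \<in> Lip_b d" and Lc: "0 \<le> Lc" "\<And>x y. ennreal \<bar>f x - f y\<bar> \<le> ennreal Lc * d x y"
    and st: "0 \<le> s" "s \<le> t" "t \<le> T"
  shows "\<bar>\<Phi> f t - \<Phi> f s\<bar> \<le> Lc * (LBINT r:{s..t}. hg r)"
  by (rule W2_Lipschitz[OF W2_le_hg[OF st] hg_nonneg_LBINT _ _ _ _ f Lc]) (use st in auto)

lemma Lip_regular_hg: "Lip_regular hg"
  unfolding Lip_regular_def
proof (intro conjI allI impI ballI)
  fix f assume f: "f \<in> Lip_b d"
  obtain Lc where Lc: "0 \<le> Lc" "\<And>x y. ennreal \<bar>f x - f y\<bar> \<le> ennreal Lc * d x y" by (rule Lip_bE[OF f]) blast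
  show "\<exists>K\<ge>0. \<forall>s t. 0 \<le> s \<longrightarrow> s \<le> t \<longrightarrow> t \<le> T \<longrightarrow> \<bar>\<Phi> f t - \<Phi> f s\<bar> \<le> K * (LBINT r:{s..t}. hg r)"
    using Phi_hg[OF f Lc] Lc(1) by blast
qed (use hg in auto)

text \<open>Capping the metric speed by \<open>\<bar>g t\<bar>\<close> makes it a finite number with
  a square integrable majorant. A bound by the capped speed is also one by the metric speed.\<close>

definition speed :: "real \<Rightarrow> real" where "speed t = enn2real (min (metric_speed T (W2 d) \<mu> t) (ennreal \<bar>g t\<bar>))"

lemma speed_nonneg: "0 \<le> speed t" by (simp add: speed_def)

lemma ennreal_speed: "ennreal (speed t) = min (metric_speed T (W2 d) \<mu> t) (ennreal \<bar>g t\<bar>)"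
proof -
  have "min (metric_speed T (W2 d) \<mu> t) (ennreal \<bar>g t\<bar>) < \<top>" by (rule le_less_trans[OF min.cobounded2]) simp
  then show ?thesis by (simp add: speed_def)
qed

lemma speed_le: "speed t \<le> \<bar>g t\<bar>" "ennreal (speed t) \<le> metric_speed T (W2 d) \<mu> t"
proof -
  have "ennreal (speed t) \<le> ennreal \<bar>g t\<bar>" unfolding ennreal_speed by simp
  then show "speed t \<le> \<bar>g t\<bar>" by (simp add: ennreal_le_iff)
  show "ennreal (speed t) \<le> metric_speed T (W2 d) \<mu> t" unfolding ennreal_speed by simp
qed

lemma left_speed_metric:
  assumes t: "0 < t" "t \<le> T" and v: "metric_speed T (W2 d) \<mu> t = ennreal v" "0 \<le> v" shows "left_speed t v"
  unfolding left_speed_def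
proof (intro allI impI)
  fix \<epsilon> :: real assume \<epsilon>: "0 < \<epsilon>"
  have "Limsup (at t within {0..T}) (\<lambda>s. W2 d (\<mu> s) (\<mu> t) / ennreal \<bar>s - t\<bar>) < ennreal (v + \<epsilon>)"
    using v \<epsilon> unfolding metric_speed_def by (simp add: ennreal_less_iff)
  then have "\<forall>\<^sub>F s in at t within {0..T}. W2 d (\<mu> s) (\<mu> t) / ennreal \<bar>s - t\<bar> < ennreal (v + \<epsilon>)" by (rule Limsup_lessD)
  then obtain \<delta> where \<delta>: "0 < \<delta>" "\<And>s. s \<in> {0..T} \<Longrightarrow> s \<noteq> t \<Longrightarrow> dist s t < \<delta> \<Longrightarrow> W2 d (\<mu> s) (\<mu> t) / ennreal \<bar>s - t\<bar> < ennreal (v + \<epsilon>)"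
    unfolding eventually_at by blast
  have "W2 d (\<mu> s) (\<mu> t) \<le> ennreal ((v + \<epsilon>) * (t - s))" if s: "0 \<le> s" "s < t" "t - s < \<delta>" for s
  proof -
    have *: "W2 d (\<mu> s) (\<mu> t) / ennreal (t - s) < ennreal (v + \<epsilon>)" using \<delta>(2)[of s] s t by (simp add: dist_real_def)
    show ?thesis
    proof (cases "W2 d (\<mu> s) (\<mu> t)")
      case (real w)
      then have "w / (t - s) < v + \<epsilon>" using * s by (simp add: divide_ennreal ennreal_less_iff)
      then have "w < (v + \<epsilon>) * (t - s)" using s by (simp add: pos_divide_less_eq)
      then show ?thesis using real by (simp add: ennreal_leI)
    next
      case top then show ?thesis using * s by (simp add: ennreal_top_divide)
    qed
  qed
  then show "\<exists>\<delta>>0. \<forall>s. 0 \<le> s \<longrightarrow> s < t \<longrightarrow> t - s < \<delta> \<longrightarrow> W2 d (\<mu> s) (\<mu> t) \<le> ennreal ((v + \<epsilon>) * (t - s))" using \<delta>(1) by blast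
qed

text \<open>Where the cap is active, the estimate comes from Lebesgue points of \<open>hg\<close>;
  elsewhere it is read off from the upper limit defining the metric speed.\<close>

lemma left_speed_AE: "AE t in lborel. t \<in> {0<..<T} \<longrightarrow> left_speed t (speed t)"
  using lebesgue_differentiation[OF hg(1)]
proof eventually_elim
  case (elim t)
  show ?case
  proof
    assume t: "t \<in> {0<..<T}"
    show "left_speed t (speed t)"
    proof (cases "metric_speed T (W2 d) \<mu> t \<le> ennreal \<bar>g t\<bar>")
      case True
      then have "metric_speed T (W2 d) \<mu> t = ennreal (speed t)" unfolding ennreal_speed by (simp add: min_def)
      then show ?thesis using t speed_nonneg by (intro left_speed_metric) auto
    next
      case False
      then have "speed t = \<bar>g t\<bar>" by (simp add: speed_def min_def)
      then have sp: "hg t = speed t" using t by (simp add: ext0_def)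
      show ?thesis unfolding left_speed_def
      proof (intro allI impI)
        fix \<epsilon> :: real assume \<epsilon>: "0 < \<epsilon>"
        then obtain e where e: "0 < e" "\<And>a b. a \<le> t \<Longrightarrow> t \<le> b \<Longrightarrow> a < b \<Longrightarrow> b - a < e \<Longrightarrow>
            \<bar>(LBINT x:{a..b}. hg x) - hg t * (b - a)\<bar> \<le> \<epsilon> * (b - a)"
          using elim by blast
        have "W2 d (\<mu> s) (\<mu> t) \<le> ennreal ((speed t + \<epsilon>) * (t - s))" if s: "0 \<le> s" "s < t" "t - s < e" for s
        proof -
          have "(LBINT x:{s..t}. hg x) \<le> (speed t + \<epsilon>) * (t - s)"
            using e(2)[of s t] s unfolding sp distrib_right by (simp add: abs_le_iff)
          then show ?thesis using W2_le_hg[of s t] s t by (meson ennreal_leI order_trans greaterThanLessThan_iff less_imp_le)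
        qed
        then show "\<exists>\<delta>>0. \<forall>s. 0 \<le> s \<longrightarrow> s < t \<longrightarrow> t - s < \<delta> \<longrightarrow> W2 d (\<mu> s) (\<mu> t) \<le> ennreal ((speed t + \<epsilon>) * (t - s))"
          using e(1) by blast
      qed
    qed
  qed
qed

lemma density_le_speed:
  assumes f: "f \<in> Lip_b d" and \<phi>: "time_density (\<Phi> f) \<phi>"
  shows "AE t in leb_Ioo T. \<bar>\<phi> t\<bar> \<le> speed t * As f t"
proof -
  have i: "integrable lborel \<phi>" and e: "\<And>s t. 0 \<le> s \<Longrightarrow> s \<le> t \<Longrightarrow> t \<le> T \<Longrightarrow> \<Phi> f t - \<Phi> f s = (LBINT r:{s..t}. \<phi> r)"
    using \<phi> by (auto simp: time_density_def)
  show ?thesis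
    unfolding AE_ext0 using lebesgue_differentiation[OF i] left_speed_AE
  proof eventually_elim
    case (elim t)
    show ?case
    proof
      assume t: "t \<in> {0<..<T}"
      show "\<bar>\<phi> t\<bar> \<le> speed t * As f t"
      proof (rule left_speed_density[OF f _ _ speed_nonneg])
        show "left_speed t (speed t)" using elim(2) t by blast
        fix \<epsilon> :: real assume "0 < \<epsilon>"
        then obtain e' where e': "0 < e'" "\<And>a b. a \<le> t \<Longrightarrow> t \<le> b \<Longrightarrow> a < b \<Longrightarrow> b - a < e' \<Longrightarrow>
            \<bar>(LBINT x:{a..b}. \<phi> x) - \<phi> t * (b - a)\<bar> \<le> \<epsilon> * (b - a)"
          using elim(1) by blast
        have "\<bar>\<Phi> f t - \<Phi> f s - \<phi> t * (t - s)\<bar> \<le> \<epsilon> * (t - s)" if "0 \<le> s" "s < t" "t - s < e'" for s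
          using e'(2)[of s t] e[of s t] that t by simp
        then show "\<exists>e>0. \<forall>s. 0 \<le> s \<longrightarrow> s < t \<longrightarrow> t - s < e \<longrightarrow> \<bar>\<Phi> f t - \<Phi> f s - \<phi> t * (t - s)\<bar> \<le> \<epsilon> * (t - s)"
          using e'(1) by blast
      qed (use t in auto)
    qed
  qed
qed

lemma As_nonneg: assumes "0 \<le> t" "t \<le> T" shows "0 \<le> As f t"
  unfolding As_def \<Phi>_def using rho_nonneg[OF assms]
  by (intro real_sqrt_ge_zero Bochner_Integration.integral_nonneg_AE) (auto elim!: eventually_mono)

lemma As_measurable: assumes f: "f \<in> Lip_b d" shows "(\<lambda>r. As f (ctime r)) \<in> borel_measurable borel"
proof -
  have "(\<lambda>r. \<Phi> (\<lambda>x. (LA f x)\<^sup>2) (ctime r)) \<in> borel_measurable borel"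
    by (intro Phi_measurable[OF Lip_regular_hg] borel_measurable_power LA_measurable f) simp
  then show ?thesis unfolding As_def by measurable
qed

text \<open>The metric speed need not be measurable a priori, hence the passage to its largest measurable
  lower bound.\<close>

lemma speed_lower_envelope:
  obtains v where "v \<in> L2 (leb_Ioo T)" "AE t in leb_Ioo T. 0 \<le> v t" "AE t in leb_Ioo T. v t \<le> speed t"
    "\<And>f \<phi>. f \<in> Lip_b d \<Longrightarrow> time_density (\<Phi> f) \<phi> \<Longrightarrow> AE t in leb_Ioo T. \<bar>\<phi> t\<bar> \<le> v t * As f t"
proof -
  \<comment> \<open>\<open>- G\<close> is the essentially largest measurable minorant of
    \<open>speed\<close>.\<close>
  obtain G where "is_ess_envelope (leb_Ioo T) (\<lambda>t. - speed t) G"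
    using ess_envelope_exists[OF finite_measure_leb_Ioo, of "\<lambda>_. 0" T "\<lambda>t. - speed t"] speed_nonneg by auto
  then have Gm: "G \<in> borel_measurable (leb_Ioo T)" and G: "AE t in leb_Ioo T. - speed t \<le> G t"
    and Gl: "\<And>H. H \<in> borel_measurable (leb_Ioo T) \<Longrightarrow> AE t in leb_Ioo T. - speed t \<le> H t \<Longrightarrow> AE t in leb_Ioo T. G t \<le> H t"
    unfolding is_ess_envelope_def by blast+
  define v where "v t = - G t" for t
  have vm: "v \<in> borel_measurable (leb_Ioo T)" unfolding v_def using Gm by measurable
  have vs: "AE t in leb_Ioo T. v t \<le> speed t" using G by eventually_elim (simp add: v_def)
  have vl: "AE t in leb_Ioo T. q t \<le> v t" if q: "q \<in> borel_measurable (leb_Ioo T)" "AE t in leb_Ioo T. q t \<le> speed t" for q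
  proof -
    have "AE t in leb_Ioo T. G t \<le> - q t"
    proof (rule Gl)
      show "(\<lambda>t. - q t) \<in> borel_measurable (leb_Ioo T)" using q(1) by measurable
      show "AE t in leb_Ioo T. - speed t \<le> - q t" using q(2) by eventually_elim simp
    qed
    then show ?thesis by eventually_elim (simp add: v_def)
  qed
  have v0: "AE t in leb_Ioo T. 0 \<le> v t" by (rule vl) (auto simp: speed_nonneg)
  have vL: "v \<in> L2 (leb_Ioo T)"
  proof (rule L2_I_bound[OF vm L2_integrable[OF g]])
    show "AE t in leb_Ioo T. (v t)\<^sup>2 \<le> (g t)\<^sup>2"
      using v0 vs
    proof eventually_elim
      case (elim t)
      then have "\<bar>v t\<bar> \<le> \<bar>g t\<bar>" using speed_le(1)[of t] by linarith
      then show ?case by (simp add: abs_le_square_iff)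
    qed
  qed
  have d: "AE t in leb_Ioo T. \<bar>\<phi> t\<bar> \<le> v t * As f t" if f: "f \<in> Lip_b d" and \<phi>: "time_density (\<Phi> f) \<phi>" for f \<phi>
  proof -
    have pm: "\<phi> \<in> borel_measurable (leb_Ioo T)"
      using \<phi> by (intro measurable_restrict_space1 borel_measurable_integrable) (simp add: time_density_def)
    have Am: "(\<lambda>t. As f (ctime t)) \<in> borel_measurable (leb_Ioo T)"
      by (intro measurable_restrict_space1) (simp add: As_measurable[OF f])
    have A: "AE t in leb_Ioo T. 0 \<le> As f t \<and> As f (ctime t) = As f t"
      unfolding AE_ext0 by (intro AE_I2) (auto intro: As_nonneg simp: ctime_id)
    \<comment> \<open>The quotient is a measurable minorant of \<open>speed\<close>, hence lies
      below \<open>v\<close>. Where \<open>As f\<close> vanishes the quotient is 0 by convention,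
      and \<open>density_le_speed\<close> shows that \<open>\<phi>\<close> vanishes too.\<close>
    have "AE t in leb_Ioo T. \<bar>\<phi> t\<bar> / As f (ctime t) \<le> v t"
    proof (rule vl)
      show "(\<lambda>t. \<bar>\<phi> t\<bar> / As f (ctime t)) \<in> borel_measurable (leb_Ioo T)" using pm Am by measurable
      show "AE t in leb_Ioo T. \<bar>\<phi> t\<bar> / As f (ctime t) \<le> speed t"
        using density_le_speed[OF f \<phi>] A
      proof eventually_elim
        case (elim t)
        then show ?case using speed_nonneg[of t] by (cases "As f t = 0") (auto simp: pos_divide_le_eq)
      qed
    qed
    then show ?thesis using density_le_speed[OF f \<phi>] A
    proof eventually_elim
      case (elim t)
      then show ?case by (cases "As f t = 0") (auto simp: pos_divide_le_eq)
    qed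
  qed
  show thesis by (rule that[OF vL v0 vs d])
qed

text \<open>The common bound \<open>C\<close> on the densities subordinates the \<open>L^2\<close>
  norm of every \<open>\<mu> t\<close> to that of \<open>m\<close>, uniformly in time;
  approximations of functions and slopes with respect to \<open>m\<close> reach the curve in this
  way.\<close>

lemma L2_mu:
  assumes t: "0 \<le> t" "t \<le> T" and h: "h \<in> L2 m"
  shows "h \<in> L2 (\<mu> t)" and "integrable m (\<lambda>x. (h x)\<^sup>2 * \<rho> t x)" and "n2 (\<mu> t) h = \<Phi> (\<lambda>x. (h x)\<^sup>2) t" and "n2 (\<mu> t) h \<le> C * n2 m h"
proof -
  have hm: "h \<in> borel_measurable m" by (rule L2_measurable[OF h])
  have h2: "(\<lambda>x. (h x)\<^sup>2) \<in> borel_measurable m" using hm by measurable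
  have ic: "integrable m (\<lambda>x. C * (h x)\<^sup>2)" using L2_integrable[OF h] by simp
  show i: "integrable m (\<lambda>x. (h x)\<^sup>2 * \<rho> t x)"
  proof (rule Bochner_Integration.integrable_bound[OF ic])
    show "(\<lambda>x. (h x)\<^sup>2 * \<rho> t x) \<in> borel_measurable m" by (intro borel_measurable_times h2 rho_measurable t)
    show "AE x in m. norm ((h x)\<^sup>2 * \<rho> t x) \<le> norm (C * (h x)\<^sup>2)"
      using rho_C[OF t] rho_nonneg[OF t] by eventually_elim (use C in \<open>simp add: abs_mult mult.commute mult_right_mono\<close>)
  qed
  show n: "n2 (\<mu> t) h = \<Phi> (\<lambda>x. (h x)\<^sup>2) t" unfolding n2_def by (rule integral_mu[OF t h2])
  have "integrable (\<mu> t) (\<lambda>x. (h x)\<^sup>2)"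
    unfolding density_curve_def using i by (subst integrable_real_density[OF rho_measurable[OF t] rho_nonneg[OF t] h2]) (simp add: mult.commute)
  then show "h \<in> L2 (\<mu> t)" using hm by (simp add: L2_def measurable_cong_sets[OF sets_mu[of t, folded sets_m] refl])
  have "\<Phi> (\<lambda>x. (h x)\<^sup>2) t \<le> (LINT x|m. C * (h x)\<^sup>2)"
    unfolding \<Phi>_def using rho_C[OF t]
    by (intro integral_mono_AE i ic) (auto elim!: eventually_mono simp: mult.commute intro!: mult_right_mono)
  then show "n2 (\<mu> t) h \<le> C * n2 m h" unfolding n by (simp add: n2_def)
qed

lemma Phi_L2_le:
  assumes t: "0 \<le> t" "t \<le> T" and h: "h \<in> L2 m" shows "\<bar>\<Phi> h t\<bar> \<le> sqrt (C * n2 m h)"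
proof -
  interpret M: prob_space "\<mu> t" by (rule mu_prob[OF t])
  have one: "(\<lambda>_. 1) \<in> L2 (\<mu> t)" by (simp add: L2_def)
  have "\<bar>\<Phi> h t\<bar> \<le> sqrt (n2 (\<mu> t) h) * sqrt (n2 (\<mu> t) (\<lambda>_. 1))"
    using cauchy_schwarz_L2[OF L2_mu(1)[OF t h] one] by (simp add: integral_mu[OF t L2_measurable[OF h]])
  also have "n2 (\<mu> t) (\<lambda>_. 1) = 1" by (simp add: n2_def M.prob_space)
  finally show ?thesis using L2_mu(4)[OF t h] by (auto intro: order_trans)
qed

text \<open>A Lipschitz \<open>u\<close> near \<open>f\<close>, with a majorant \<open>h\<close> of
  its slope near the minimal slope of \<open>f\<close>, has the time density already estimated. The
  errors are uniform in time, so they survive integration and vanish in the limit.\<close>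

theorem CE2_bound_speed:
  obtains v where "CE2_bound T d m \<rho> v" "AE t in leb_Ioo T. v t \<le> speed t"
proof -
  obtain v where v: "v \<in> L2 (leb_Ioo T)" "AE t in leb_Ioo T. 0 \<le> v t" "AE t in leb_Ioo T. v t \<le> speed t"
    "\<And>f \<phi>. f \<in> Lip_b d \<Longrightarrow> time_density (\<Phi> f) \<phi> \<Longrightarrow> AE t in leb_Ioo T. \<bar>\<phi> t\<bar> \<le> v t * As f t"
    by (rule speed_lower_envelope) blast
  have iv: "integrable lborel (ext0 T v)" by (rule ext0_integrable[OF v(1)])
  have "\<bar>\<Phi> f t - \<Phi> f s\<bar> \<le> (LBINT r:{s..t}. ext0 T v r * Fs f r)"
    if f: "f \<in> A_Ch d m" and st: "0 \<le> s" "s \<le> t" "t \<le> T" for f s t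
  proof (rule field_le_epsilon)
    fix e :: real assume e: "0 < e"
    note s0 = st(1) order_trans[OF st(2,3)] and t0 = order_trans[OF st(1,2)] st(3)
    have fD: "f \<in> D_Ch d m" and fL: "f \<in> L2 m" using f by (auto simp: A_Ch_def D_Ch_def)
    define V where "V = (LBINT r:{s..t}. ext0 T v r)"
    \<comment> \<open>Error budget: \<open>\<kappa> * V\<close> from the slopes and
      \<open>\<kappa>\<close> from each of the two endpoints add up to at most
      \<open>e\<close>.\<close>
    define \<kappa> where "\<kappa> = e / (2 + \<bar>V\<bar>)"
    have \<kappa>: "0 < \<kappa>" using e by (simp add: \<kappa>_def)
    \<comment> \<open>Squared closeness with respect to \<open>m\<close> that becomes closeness
      \<open>\<kappa>\<close> with respect to every \<open>\<mu> r\<close>; the denominator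
      \<open>C + 1\<close> stays positive for \<open>C = 0\<close>.\<close>
    define e' where "e' = \<kappa>\<^sup>2 / (C + 1)"
    have e': "0 < e'" using \<kappa> C by (simp add: e'_def)
    have Ce: "sqrt (C * x) \<le> \<kappa>" if x: "x \<le> e'" for x
    proof (rule real_le_lsqrt)
      have "C * x \<le> C * e'" using x C by (intro mult_left_mono)
      also have "\<dots> \<le> (C + 1) * e'" using e' by simp
      also have "\<dots> = \<kappa>\<^sup>2" using C by (simp add: e'_def)
      finally show "C * x \<le> \<kappa>\<^sup>2" .
    qed (use \<kappa> in simp)
    obtain h where "h \<in> Kset f e'" and hG: "n2 m (\<lambda>x. h x - mslope f x) \<le> e'"
      using strong_slopeD[OF mslope_strong[OF fD] e'] by blast
    then obtain u where h: "h \<in> L2 m" and u: "u \<in> Lip_b d" "n2 m (\<lambda>x. u x - f x) \<le> e'" "AE x in m. LA u x \<le> h x"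
      unfolding Kset_def by blast
    have GL: "mslope f \<in> L2 m" by (rule strong_slope_L2[OF mslope_strong[OF fD]])
    have As_le: "As u r \<le> Fs f r + \<kappa>" if r: "0 \<le> r" "r \<le> T" for r
    proof -
      have "\<Phi> (\<lambda>x. (LA u x)\<^sup>2) r \<le> \<Phi> (\<lambda>x. (h x)\<^sup>2) r"
      proof (rule Phi_mono[OF r L2_mu(2)[OF r LA_L2[OF u(1)]] L2_mu(2)[OF r h]])
        show "AE x in m. (LA u x)\<^sup>2 \<le> (h x)\<^sup>2" using u(3) LA_nonneg[OF u(1)] by eventually_elim (rule power_mono)
      qed
      then have "As u r \<le> sqrt (n2 (\<mu> r) h)" unfolding As_def L2_mu(3)[OF r h] by (rule real_sqrt_le_mono)
      also have "\<dots> \<le> sqrt (n2 (\<mu> r) (mslope f)) + sqrt (n2 (\<mu> r) (\<lambda>x. h x - mslope f x))"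
        by (rule sqrt_n2_triangle[OF L2_mu(1)[OF r h] L2_mu(1)[OF r GL]])
      also have "sqrt (n2 (\<mu> r) (mslope f)) = Fs f r" unfolding L2_mu(3)[OF r GL] Fs_def \<Phi>_def ..
      also have "sqrt (n2 (\<mu> r) (\<lambda>x. h x - mslope f x)) \<le> \<kappa>"
        using real_sqrt_le_mono[OF L2_mu(4)[OF r L2_diff[OF h GL]]] Ce[OF hG] by linarith
      finally show ?thesis by simp
    qed
    obtain Lc where Lc: "0 \<le> Lc" "\<And>x y. ennreal \<bar>u x - u y\<bar> \<le> ennreal Lc * d x y" by (rule Lip_bE[OF u(1)]) blast
    obtain \<phi> where \<phi>: "time_density (\<Phi> u) \<phi>"
      using time_density_exists[OF hg Lc(1), of "\<Phi> u"] Phi_hg[OF u(1) Lc] by blast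
    have i: "integrable lborel \<phi>" and z: "\<And>r. r \<notin> {0<..<T} \<Longrightarrow> \<phi> r = 0" and \<phi>e: "\<Phi> u t - \<Phi> u s = (LBINT r:{s..t}. \<phi> r)"
      using \<phi> st by (auto simp: time_density_def)
    have iF: "integrable lborel (\<lambda>r. ext0 T v r * Fs f r)" by (rule ext0_Fs_integrable[OF Lip_regular_hg f v(1)])
    have ik: "integrable lborel (\<lambda>r. \<kappa> * ext0 T v r)" using iv by simp
    have "AE r in lborel. \<bar>\<phi> r\<bar> \<le> ext0 T v r * Fs f r + \<kappa> * ext0 T v r"
      using v(4)[OF u(1) \<phi>] v(2) unfolding AE_ext0
    proof eventually_elim
      case (elim r)
      show ?case
      proof (cases "r \<in> {0<..<T}")
        case True
        then have "\<bar>\<phi> r\<bar> \<le> v r * As u r" "0 \<le> v r" using elim by auto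
        moreover have "v r * As u r \<le> v r * (Fs f r + \<kappa>)" using True elim by (intro mult_left_mono As_le) auto
        ultimately show ?thesis using True by (simp add: ext0_def distrib_left mult.commute)
      qed (simp add: z ext0_def)
    qed
    then have "\<bar>LBINT r:{s..t}. \<phi> r\<bar> \<le> (LBINT r:{s..t}. ext0 T v r * Fs f r + \<kappa> * ext0 T v r)"
      by (intro abs_LBINT_Icc_le i Bochner_Integration.integrable_add iF ik)
    also have "\<dots> = (LBINT r:{s..t}. ext0 T v r * Fs f r) + (LBINT r:{s..t}. \<kappa> * ext0 T v r)"
      by (intro set_integral_add set_integrable_lborel iF ik) auto
    also have "(LBINT r:{s..t}. \<kappa> * ext0 T v r) = \<kappa> * V" by (simp add: V_def)
    finally have 1: "\<bar>\<Phi> u t - \<Phi> u s\<bar> \<le> (LBINT r:{s..t}. ext0 T v r * Fs f r) + \<kappa> * V" by (simp only: \<phi>e)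
    have 2: "\<bar>\<Phi> u r - \<Phi> f r\<bar> \<le> \<kappa>" if r: "0 \<le> r" "r \<le> T" for r
    proof -
      have uL: "u \<in> L2 m" by (rule Lip_b_L2[OF u(1)])
      have if': "integrable m (\<lambda>x. f x * \<rho> r x)"
      proof -
        obtain B where "AE x in m. \<bar>f x\<bar> \<le> B" using Linf_D[of f] f by (auto simp: A_Ch_def)
        then show ?thesis by (rule integrable_rho[OF r L2_measurable[OF fL]])
      qed
      have "\<Phi> u r - \<Phi> f r = \<Phi> (\<lambda>x. u x - f x) r"
        unfolding \<Phi>_def left_diff_distrib using Bochner_Integration.integral_diff[OF integrable_rho_Lip[OF r u(1)] if'] by simp
      then show ?thesis using Phi_L2_le[OF r L2_diff[OF uL fL]] Ce[OF u(2)] by linarith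
    qed
    have "\<kappa> * V \<le> \<kappa> * \<bar>V\<bar>" using \<kappa> by (intro mult_left_mono) auto
    moreover have "\<kappa> * \<bar>V\<bar> + 2 * \<kappa> = e"
    proof -
      have "2 + \<bar>V\<bar> \<noteq> 0" using abs_ge_zero[of V] by linarith
      then have "\<kappa> * (2 + \<bar>V\<bar>) = e" by (simp add: \<kappa>_def)
      then show ?thesis by (simp only: distrib_left mult.commute add.commute)
    qed
    ultimately show "\<bar>\<Phi> f t - \<Phi> f s\<bar> \<le> (LBINT r:{s..t}. ext0 T v r * Fs f r) + e"
      using 1 2[OF s0] 2[OF t0] by linarith
  qed
  then have "CE2_bound T d m \<rho> v" unfolding CE2_bound_iff[OF Lip_regular_hg v(1)] using v(2) by blast
  then show thesis using that v(3) by blast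
qed

end

theorem theorem7p3:
  fixes d :: "'a::t2_space \<Rightarrow> 'a \<Rightarrow> ennreal" and m :: "'a measure" and T :: real
  assumes "ext_metric_measure_space d m" and "0 < T"
  shows "(\<forall>\<rho>\<in>CE2 T d m.
            density_curve m \<rho> \<in> AC2 T radon_prob (W2 d) \<and>
            (AE t in leb_Ioo T.
               metric_speed T (W2 d) (density_curve m \<rho>) t \<le> ennreal (CE2_speed T d m \<rho> t))) \<and>
         (ext_complete d \<longrightarrow>
            (\<forall>\<rho>. (\<forall>t\<in>{0..T}. prob_density m (\<rho> t)) \<longrightarrow>
                 density_curve m \<rho> \<in> AC2 T radon_prob (W2 d) \<longrightarrow>
                 (SUP t\<in>{0..T}. Linf_norm m (\<rho> t)) < \<top> \<longrightarrow>
                 \<rho> \<in> CE2 T d m \<and>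
                 (AE t in leb_Ioo T.
                    ennreal (CE2_speed T d m \<rho> t) \<le> metric_speed T (W2 d) (density_curve m \<rho>) t)))"
proof (intro conjI ballI impI allI)
  fix \<rho> assume \<rho>: "\<rho> \<in> CE2 T d m"
  then obtain c where c: "CE2_bound T d m \<rho> c" by (auto simp: CE2_def)
  interpret curve d m T \<rho> by unfold_locales (use assms \<rho> in \<open>auto simp: CE2_def\<close>)
  show "density_curve m \<rho> \<in> AC2 T radon_prob (W2 d)" by (rule AC2_CE2[OF c])
  show "AE t in leb_Ioo T. metric_speed T (W2 d) (density_curve m \<rho>) t \<le> ennreal (CE2_speed T d m \<rho> t)"
    by (rule metric_speed_CE2[OF CE2_speed(1)[OF c]])
next
  fix \<rho> assume \<rho>: "\<forall>t\<in>{0..T}. prob_density m (\<rho> t)" and AC: "density_curve m \<rho> \<in> AC2 T radon_prob (W2 d)"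
    and sup: "(SUP t\<in>{0..T}. Linf_norm m (\<rho> t)) < \<top>"
  obtain g where g: "g \<in> L2 (leb_Ioo T)" "\<And>s t. 0 \<le> s \<Longrightarrow> s \<le> t \<Longrightarrow> t \<le> T \<Longrightarrow>
      W2 d (density_curve m \<rho> s) (density_curve m \<rho> t) \<le> ennreal (LBINT r=s..t. g r)"
    using AC unfolding AC2_def by blast
  obtain C where C: "0 \<le> C" "(SUP t\<in>{0..T}. Linf_norm m (\<rho> t)) = ennreal C"
    using sup by (cases "SUP t\<in>{0..T}. Linf_norm m (\<rho> t)") auto
  have rho_C: "AE x in m. \<rho> t x \<le> C" if "0 \<le> t" "t \<le> T" for t
  proof -
    have "Linf_norm m (\<rho> t) \<le> ennreal C" unfolding C(2)[symmetric] using that by (intro SUP_upper) auto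
    moreover have "AE x in m. ennreal \<bar>\<rho> t x\<bar> \<le> Linf_norm m (\<rho> t)" unfolding Linf_norm_def by (rule esssup_AE)
    ultimately have "AE x in m. ennreal \<bar>\<rho> t x\<bar> \<le> ennreal C" by (auto elim!: eventually_mono)
    then show ?thesis by eventually_elim (use C(1) in \<open>simp add: ennreal_le_iff\<close>)
  qed
  interpret bounded_AC2 d m T \<rho> g C
    by unfold_locales (use assms \<rho> g C(1) rho_C in auto)
  obtain v where v: "CE2_bound T d m \<rho> v" "AE t in leb_Ioo T. v t \<le> speed t" by (rule CE2_bound_speed)
  show "\<rho> \<in> CE2 T d m" using \<rho> v(1) by (auto simp: CE2_def)
  show "AE t in leb_Ioo T. ennreal (CE2_speed T d m \<rho> t) \<le> metric_speed T (W2 d) (density_curve m \<rho>) t"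
    using CE2_speed(2)[OF v(1)] v(2)
  proof eventually_elim
    case (elim t)
    then have "CE2_speed T d m \<rho> t \<le> speed t" by simp
    then show ?case using speed_le(2)[of t] by (meson ennreal_leI order_trans)
  qed
qed

end
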